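(* Let $p\in\mathbb{C}[z,w]$ be a polynomial without univariate factors (no nonconstant factor depending only on $z$ or only on $w$), such that the zero set of every irreducible factor of $p$ meets $\mathbb{D}^2$. Let $[p]^\perp=H^2(\mathbb{D}^2)\ominus[p]$ and $S_z=P_{[p]^\perp}T_z|_{[p]^\perp}$. Let $\Omega$ be the union of those connected components $\Omega_i$ of $\mathbb{D}\setminus\pi_1\big(Z_p\cap(\mathbb{D}\times\mathbb{T})\big)$ on which the number $\alpha_i$ of zeros of $p(\lambda,\cdot)$ in $\mathbb{D}$ ($\lambda\in\Omega_i$) is positive. Then $S_z^*$ is a generalized Cowen–Douglas operator over $\Omega^*$, i.e. $S_z^*\in\mathfrak{B}_\alpha(\Omega^* )$ with $\alpha=(\alpha_i)$. Moreover, $S_z$ is reducible if and only if $E_{S_z^*}$ is strictly reducible.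
   Context: $H^2(\mathbb{D}^2)$ is the Hardy space over the bidisk, with coordinates $(z,w)$; $[p]$ is the closure of $p\,\mathbb{C}[z,w]$ in $H^2(\mathbb{D}^2)$; $T_z$ is multiplication by $z$; $P_{\mathcal{K}}$ is the orthogonal projection onto $\mathcal{K}$; $Z_p$ is the zero set of $p$ in $\mathbb{C}^2$; $\pi_1(z,w)=z$; $\Omega^*=\{\bar\lambda:\lambda\in\Omega\}$. Zeros are counted with multiplicity. An operator $T$ is reducible if it has a closed subspace $\mathcal{M}$, other than $\{0\}$ and the whole space, with $T\mathcal{M}\subset\mathcal{M}$ and $T^*\mathcal{M}\subset\mathcal{M}$. Generalized Cowen–Douglas class: let $\Omega$ be a bounded open subset of $\mathbb{C}$ (not necessarily connected) with distinct connected components $\Omega_i$, $1\le i\le N$, $N\in\mathbb{Z}_+\cup\{\infty\}$, and let $\alpha=(\alpha_i)_{i=1}^N$ be a sequence of positive integers. $\mathfrak{B}_\alpha(\Omega)$ is the set of bounded operators $T$ on a separable complex Hilbert space $\mathcal{H}$ such that (1) $\mathrm{Ran}(T-w)=\mathcal{H}$ for $w\in\Omega$; (2) $\bigvee_{w\in\Omega}\mathrm{Ker}(T-w)=\mathcal{H}$ (closed linear span); (3) $\dim\mathrm{Ker}(T-w)=\alpha_i$ for all $w\in\Omega_i$ and all $i$. Kernel bundle: for $T\in\mathfrak{B}_\alpha(\Omega)$, $E_T(\Omega_i)=\{(w,x)\in\Omega_i\times\mathcal{H}:x\in\mathrm{Ker}(T-w)\}$ is a Hermitian holomorphic vector bundle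 over $\Omega_i$ of rank $\alpha_i$, and $E_T=\bigsqcup_{i=1}^N E_T(\Omega_i)$. $E_T$ is reducible if there exist $E^1=\bigsqcup_i E^1(\Omega_i)$ and $E^2=\bigsqcup_i E^2(\Omega_i)$, where $E^1(\Omega_i),E^2(\Omega_i)$ are (possibly zero) holomorphic subbundles of $E_T(\Omega_i)$, with $E^1,E^2$ each different from $\{0\}$ and $E_T$, such that (1) $E^1(\Omega_i)\oplus E^2(\Omega_i)=E_T(\Omega_i)$ for all $i$; (2) $E^1(\Omega_i)\perp E^2(\Omega_j)$ for all $i,j$, i.e. $\bigvee_{w\in\Omega_i}E^1(w)\perp\bigvee_{w\in\Omega_j}E^2(w)$. Then one writes $E_T=E^1\oplus E^2$ (a reducible decomposition). $E_T$ is strictly reducible if $E_T$ is reducible and, for each reducible decomposition $E_T=E^1\oplus E^2$ and each $i$, $E^1(\Omega_i)$ is neither $\{0\}$ nor $E_T(\Omega_i)$. *)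

theory Defs
  imports "HOL-Complex_Analysis.Complex_Analysis"
begin

class complex_hilbert = real_inner + complete_space +
  fixes scaleC :: "complex \<Rightarrow> 'a \<Rightarrow> 'a"  (infixr \<open>*\<^sub>C\<close> 75)
    and cinner :: "'a \<Rightarrow> 'a \<Rightarrow> complex"
  assumes scaleC_add_right: "a *\<^sub>C (x + y) = a *\<^sub>C x + a *\<^sub>C y"
    and scaleC_add_left: "(a + b) *\<^sub>C x = a *\<^sub>C x + b *\<^sub>C x"
    and scaleC_scaleC: "a *\<^sub>C b *\<^sub>C x = (a * b) *\<^sub>C x"
    and scaleR_scaleC: "r *\<^sub>R x = complex_of_real r *\<^sub>C x"
    and cinner_commute: "cinner x y = cnj (cinner y x)"
    and cinner_add_left: "cinner (x + y) z = cinner x z + cinner y z"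
    and cinner_scaleC_left: "cinner (a *\<^sub>C x) y = a * cinner x y"
    and Re_cinner: "Re (cinner x y) = inner x y"

global_interpretation complex_vector: vector_space "scaleC :: complex \<Rightarrow> 'a \<Rightarrow> 'a::complex_hilbert"
  defines csubspace = complex_vector.subspace
    and cspan = complex_vector.span
    and cdependent = complex_vector.dependent
    and cdim = complex_vector.dim
proof
  fix x :: 'a
  show "1 *\<^sub>C x = x" using scaleR_scaleC[of 1 x] by simp
qed (auto simp: scaleC_add_right scaleC_add_left scaleC_scaleC)

abbreviation bidisk :: "(complex \<times> complex) set"
  where "bidisk \<equiv> ball 0 1 \<times> ball 0 1"

definition square_summable :: "('k \<Rightarrow> complex) \<Rightarrow> bool"
  where "square_summable a \<longleftrightarrow> (\<lambda>k. (cmod (a k))\<^sup>2) summable_on UNIV"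

definition dpowser :: "(nat \<times> nat \<Rightarrow> complex) \<Rightarrow> complex \<times> complex \<Rightarrow> complex"
  where "dpowser a = (\<lambda>(z, w). \<Sum>\<^sub>\<infinity>(m, n). a (m, n) * z ^ m * w ^ n)"

lemma square_summable_zero: "square_summable (\<lambda>k. 0)"
  by (simp add: square_summable_def)

lemma square_summable_scale: "square_summable a \<Longrightarrow> square_summable (\<lambda>k. c * a k)"
  unfolding square_summable_def norm_mult power_mult_distrib
  by (rule summable_on_cmult_right)

lemma square_summable_add:
  assumes "square_summable a" "square_summable b"
  shows "square_summable (\<lambda>k. a k + b k)"
proof -
  have s: "(\<lambda>k. 2 * (cmod (a k))\<^sup>2 + 2 * (cmod (b k))\<^sup>2) summable_on UNIV"
    using assms unfolding square_summable_def
    by (intro summable_on_add summable_on_cmult_right)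
  show ?thesis
    unfolding square_summable_def
  proof (rule summable_on_comparison_test[OF s])
    fix k
    have "(cmod (a k + b k))\<^sup>2 \<le> (cmod (a k) + cmod (b k))\<^sup>2"
      by (intro power_mono norm_triangle_ineq) auto
    also have "\<dots> \<le> 2 * (cmod (a k))\<^sup>2 + 2 * (cmod (b k))\<^sup>2"
      using sum_squares_bound[of "cmod (a k)" "cmod (b k)"] by (simp add: power2_sum)
    finally show "(cmod (a k + b k))\<^sup>2 \<le> 2 * (cmod (a k))\<^sup>2 + 2 * (cmod (b k))\<^sup>2" .
  qed auto
qed

lemma square_summable_mult:
  assumes "square_summable a" "square_summable b"
  shows "(\<lambda>k. cmod (a k * b k)) summable_on UNIV"
proof (rule abs_summable_product)
  have eq: "cmod (c * c) = (cmod c)\<^sup>2" for c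
    by (simp only: norm_mult power2_eq_square)
  show "(\<lambda>k. cmod (a k * a k)) summable_on UNIV" "(\<lambda>k. cmod (b k * b k)) summable_on UNIV"
    using assms by (simp_all only: eq square_summable_def)
qed

lemma square_summable_cinner:
  assumes "square_summable a" "square_summable b"
  shows "(\<lambda>k. a k * cnj (b k)) summable_on UNIV"
proof -
  have "square_summable (\<lambda>k. cnj (b k))"
    using assms(2) by (simp add: square_summable_def)
  from square_summable_mult[OF assms(1) this] show ?thesis
    by (rule abs_summable_summable)
qed

lemma geometric_has_sum:
  fixes r :: real
  assumes "0 \<le> r" "r < 1"
  shows "((\<lambda>n. r ^ n) has_sum (1 / (1 - r))) UNIV"
proof (rule norm_summable_imp_has_sum)
  show "summable (\<lambda>n. norm (r ^ n))"
    using assms by (simp add: norm_power summable_geometric)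
  show "(\<lambda>n. r ^ n) sums (1 / (1 - r))"
    using assms geometric_sums[of r] by simp
qed

lemma square_summable_monomials:
  assumes "cmod z < 1" "cmod w < 1"
  shows "square_summable (\<lambda>(m, n). z ^ m * w ^ n)"
proof -
  define r s where "r = (cmod z)\<^sup>2" and "s = (cmod w)\<^sup>2"
  have r: "0 \<le> r" "r < 1" and s: "0 \<le> s" "s < 1"
    using assms by (auto simp: r_def s_def abs_square_less_1)
  have "(\<lambda>k. r ^ fst k * s ^ snd k) summable_on (UNIV \<times> UNIV)"
  proof (rule summable_on_SigmaI)
    show "((\<lambda>y. r ^ fst (x, y) * s ^ snd (x, y)) has_sum (r ^ x * (1 / (1 - s)))) UNIV" for x :: nat
      using has_sum_cmult_right[OF geometric_has_sum[OF s], of "r ^ x"] by simp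
    show "(\<lambda>x::nat. r ^ x * (1 / (1 - s))) summable_on UNIV"
      using has_sum_cmult_left[OF geometric_has_sum[OF r]] summable_on_def by blast
  qed (use r s in auto)
  then show ?thesis
    unfolding square_summable_def
    by (simp add: r_def s_def case_prod_unfold norm_mult norm_power power_mult_distrib
        flip: power_mult) (simp add: mult.commute)
qed

lemma dpowser_summable:
  assumes "square_summable a" "cmod z < 1" "cmod w < 1"
  shows "(\<lambda>(m, n). a (m, n) * z ^ m * w ^ n) summable_on UNIV"
  using abs_summable_summable[OF square_summable_mult[OF assms(1) square_summable_monomials[OF assms(2,3)]]]
  by (simp add: case_prod_unfold mult.assoc)

lemma powser_eq_0_imp_coeff_eq_0:
  fixes c :: "nat \<Rightarrow> complex"
  assumes "\<And>z. cmod z < 1 \<Longrightarrow> (\<lambda>n. c n * z ^ n) sums 0"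
  shows "c n = 0"
proof (cases n)
  case 0
  have "(\<lambda>n. c n * 0 ^ n) sums 0" by (rule assms) simp
  then show ?thesis using 0 powser_sums_zero_iff[of c 0] by simp
next
  case (Suc m)
  show ?thesis
  proof (rule ccontr)
    assume nz: "c n \<noteq> 0"
    obtain s where "s > 0" and s: "\<And>z::complex. z \<in> cball 0 s - {0} \<Longrightarrow> (0::complex) \<noteq> 0"
      by (rule powser_0_nonzero[of 1 0 c "\<lambda>_. 0" n]) (use assms nz Suc in auto)
    then have "complex_of_real s \<in> cball 0 s - {0}" by simp
    then show False using s by blast
  qed
qed

lemma dpowser_eq_0_imp:
  assumes a: "square_summable a"
    and z: "\<And>z w. cmod z < 1 \<Longrightarrow> cmod w < 1 \<Longrightarrow> dpowser a (z, w) = 0"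
  shows "a = (\<lambda>_. 0)"
proof -
  define g where "g w m = (\<Sum>\<^sub>\<infinity>n. a (m, n) * w ^ n)" for w :: complex and m
  have row: "(\<lambda>n. a (m, n) * w ^ n) summable_on UNIV" if "cmod w < 1" for w m
  proof -
    have "(\<lambda>k. cmod (a k * (case k of (m, n) \<Rightarrow> (1/2) ^ m * w ^ n))) summable_on UNIV"
      by (rule square_summable_mult[OF a square_summable_monomials]) (use that in auto)
    then have "(\<lambda>k. a k * (case k of (m, n) \<Rightarrow> (1/2) ^ m * w ^ n)) summable_on range (Pair m)"
      by (rule summable_on_subset_banach[OF abs_summable_summable]) simp
    then have "(\<lambda>n. a (m, n) * ((1/2) ^ m * w ^ n)) summable_on UNIV"
      by (subst (asm) summable_on_reindex) (auto simp: inj_on_def o_def)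
    then have "(\<lambda>n. 2 ^ m * (a (m, n) * ((1/2) ^ m * w ^ n))) summable_on UNIV"
      by (rule summable_on_cmult_right)
    then show ?thesis by (simp add: power_divide field_simps)
  qed
  have g0: "g w m = 0" if w: "cmod w < 1" for w m
  proof (rule powser_eq_0_imp_coeff_eq_0)
    fix z :: complex assume zz: "cmod z < 1"
    have sm: "(\<lambda>(m, n). a (m, n) * z ^ m * w ^ n) summable_on UNIV \<times> UNIV"
      using dpowser_summable[OF a zz w] by simp
    have inner_eq: "(\<Sum>\<^sub>\<infinity>n. a (m, n) * z ^ m * w ^ n) = g w m * z ^ m" for m
    proof -
      have "(\<Sum>\<^sub>\<infinity>n. a (m, n) * z ^ m * w ^ n) = (\<Sum>\<^sub>\<infinity>n. z ^ m * (a (m, n) * w ^ n))"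
        by (simp add: mult_ac)
      also have "\<dots> = z ^ m * g w m"
        unfolding g_def using row[OF w] by (rule infsum_cmult_right)
      finally show ?thesis by simp
    qed
    have "(\<lambda>m. g w m * z ^ m) summable_on UNIV"
      using summable_on_Sigma_banach[OF sm] by (simp add: inner_eq)
    moreover have "(\<Sum>\<^sub>\<infinity>m. g w m * z ^ m) = 0"
      using infsum_Sigma'_banach[OF sm] z[OF zz w] by (simp add: inner_eq dpowser_def)
    ultimately have "((\<lambda>m. g w m * z ^ m) has_sum 0) UNIV"
      using has_sum_infsum by force
    then show "(\<lambda>m. g w m * z ^ m) sums 0" by (rule has_sum_imp_sums)
  qed
  have "a (m, n) = 0" for m n
  proof (rule powser_eq_0_imp_coeff_eq_0[of "\<lambda>n. a (m, n)"])
    fix w :: complex assume w: "cmod w < 1"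
    have "((\<lambda>n. a (m, n) * w ^ n) has_sum 0) UNIV"
      using has_sum_infsum[OF row[OF w, of m]] g0[OF w, of m] by (simp add: g_def)
    then show "(\<lambda>n. a (m, n) * w ^ n) sums 0" by (rule has_sum_imp_sums)
  qed
  then show ?thesis by auto
qed

lemma dpowser_add:
  assumes "square_summable a" "square_summable b" "cmod z < 1" "cmod w < 1"
  shows "dpowser (\<lambda>k. a k + b k) (z, w) = dpowser a (z, w) + dpowser b (z, w)"
proof -
  have "dpowser (\<lambda>k. a k + b k) (z, w)
      = (\<Sum>\<^sub>\<infinity>k. (case k of (m, n) \<Rightarrow> a (m, n) * z ^ m * w ^ n)
             + (case k of (m, n) \<Rightarrow> b (m, n) * z ^ m * w ^ n))"
    by (simp add: dpowser_def case_prod_unfold distrib_right)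
  also have "\<dots> = dpowser a (z, w) + dpowser b (z, w)"
    using infsum_add[OF dpowser_summable[OF assms(1,3,4)] dpowser_summable[OF assms(2-4)]]
    by (simp add: dpowser_def)
  finally show ?thesis .
qed

lemma dpowser_scale:
  assumes "square_summable a" "cmod z < 1" "cmod w < 1"
  shows "dpowser (\<lambda>k. c * a k) (z, w) = c * dpowser a (z, w)"
proof -
  have "dpowser (\<lambda>k. c * a k) (z, w) = (\<Sum>\<^sub>\<infinity>k. c * (case k of (m, n) \<Rightarrow> a (m, n) * z ^ m * w ^ n))"
    by (simp add: dpowser_def case_prod_unfold mult.assoc)
  also have "\<dots> = c * dpowser a (z, w)"
    using infsum_cmult_right[OF dpowser_summable[OF assms]] by (simp add: dpowser_def)
  finally show ?thesis .
qed

text \<open>Elements are the functions on the bidisk with square-summable Taylor coefficients,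
  extended by \<open>0\<close> to \<open>\<complex>\<^sup>2\<close> so that equality of functions is equality on the bidisk.\<close>

typedef hardy2 =
  "{f :: complex \<times> complex \<Rightarrow> complex.
      \<exists>a. square_summable a \<and> (\<forall>x. f x = (if x \<in> bidisk then dpowser a x else 0))}"
  morphisms hardy_fun Abs_hardy2
  by (rule exI[of _ "\<lambda>x. if x \<in> bidisk then dpowser (\<lambda>k. 0) x else 0"])
     (use square_summable_zero in blast)

setup_lifting type_definition_hardy2

definition hcoeff :: "hardy2 \<Rightarrow> nat \<times> nat \<Rightarrow> complex"
  where "hcoeff f = (THE a. square_summable a \<and> (\<forall>x\<in>bidisk. hardy_fun f x = dpowser a x))"

lemma dpowser_unique:
  assumes "square_summable a" "square_summable b" "\<forall>x\<in>bidisk. dpowser a x = dpowser b x"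
  shows "a = b"
proof -
  have sb: "square_summable (\<lambda>k. (-1) * b k)" using assms(2) by (rule square_summable_scale)
  have "(\<lambda>k. a k + (-1) * b k) = (\<lambda>_. 0)"
  proof (rule dpowser_eq_0_imp)
    show "square_summable (\<lambda>k. a k + (-1) * b k)" by (rule square_summable_add[OF assms(1) sb])
    fix z w :: complex assume zw: "cmod z < 1" "cmod w < 1"
    have "dpowser (\<lambda>k. a k + (-1) * b k) (z, w) = dpowser a (z, w) + (-1) * dpowser b (z, w)"
      by (simp only: dpowser_add[OF assms(1) sb zw] dpowser_scale[OF assms(2) zw])
    then show "dpowser (\<lambda>k. a k + (-1) * b k) (z, w) = 0" using assms(3) zw by simp
  qed
  then have "a k + (-1) * b k = 0" for k by (rule fun_cong)
  then show ?thesis by (intro ext) (simp add: add_eq_0_iff)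
qed

lemma hcoeffI:
  assumes "square_summable a" "\<And>x. x \<in> bidisk \<Longrightarrow> hardy_fun f x = dpowser a x"
  shows "hcoeff f = a"
  unfolding hcoeff_def
proof (rule the_equality)
  show "square_summable a \<and> (\<forall>x\<in>bidisk. hardy_fun f x = dpowser a x)" using assms by blast
  fix b assume "square_summable b \<and> (\<forall>x\<in>bidisk. hardy_fun f x = dpowser b x)"
  then show "b = a" using dpowser_unique[of b a] assms by simp
qed

lemma hcoeff: "square_summable (hcoeff f)"
  and hardy_fun_eq: "hardy_fun f x = (if x \<in> bidisk then dpowser (hcoeff f) x else 0)"
proof -
  obtain a where a: "square_summable a" "\<And>x. hardy_fun f x = (if x \<in> bidisk then dpowser a x else 0)"
    using hardy_fun[of f] by auto
  then have "hcoeff f = a" by (intro hcoeffI) auto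
  then show "square_summable (hcoeff f)"
    "hardy_fun f x = (if x \<in> bidisk then dpowser (hcoeff f) x else 0)" using a by auto
qed

lemma hcoeff_inject: "hcoeff f = hcoeff g \<longleftrightarrow> f = g"
proof
  assume eq: "hcoeff f = hcoeff g"
  have "hardy_fun f = hardy_fun g" by (rule ext) (simp only: hardy_fun_eq eq)
  then show "f = g" by (simp only: hardy_fun_inject)
qed simp

lemma hcoeff_surj:
  assumes "square_summable a"
  obtains f where "hcoeff f = a"
proof -
  have "(\<lambda>x. if x \<in> bidisk then dpowser a x else 0) \<in>
    {f. \<exists>a. square_summable a \<and> (\<forall>x. f x = (if x \<in> bidisk then dpowser a x else 0))}"
    using assms by blast
  from Abs_hardy2_inverse[OF this]
  have "hcoeff (Abs_hardy2 (\<lambda>x. if x \<in> bidisk then dpowser a x else 0)) = a"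
    using assms by (intro hcoeffI) auto
  then show thesis by (rule that)
qed

lift_definition hardy_scale :: "complex \<Rightarrow> hardy2 \<Rightarrow> hardy2" is "\<lambda>c f x. c * f x"
proof -
  fix c and f :: "complex \<times> complex \<Rightarrow> complex"
  assume "\<exists>a. square_summable a \<and> (\<forall>x. f x = (if x \<in> bidisk then dpowser a x else 0))"
  then obtain a where a: "square_summable a" "\<forall>x. f x = (if x \<in> bidisk then dpowser a x else 0)"
    by blast
  show "\<exists>a. square_summable a \<and> (\<forall>x. c * f x = (if x \<in> bidisk then dpowser a x else 0))"
    by (rule exI[of _ "\<lambda>k. c * a k"])
       (use a in \<open>auto simp: square_summable_scale dpowser_scale\<close>)
qed

definition hardy_cinner :: "hardy2 \<Rightarrow> hardy2 \<Rightarrow> complex"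
  where "hardy_cinner f g = (\<Sum>\<^sub>\<infinity>k. hcoeff f k * cnj (hcoeff g k))"

instantiation hardy2 :: real_inner
begin

lift_definition zero_hardy2 :: hardy2 is "\<lambda>x. 0"
proof -
  have "\<forall>x. (0::complex) = (if x \<in> bidisk then dpowser (\<lambda>k. 0) x else 0)"
    by (simp add: dpowser_def case_prod_unfold)
  then show "\<exists>a. square_summable a \<and> (\<forall>x. (0::complex) = (if x \<in> bidisk then dpowser a x else 0))"
    using square_summable_zero by blast
qed

lift_definition plus_hardy2 :: "hardy2 \<Rightarrow> hardy2 \<Rightarrow> hardy2" is "\<lambda>f g x. f x + g x"
proof -
  fix f g :: "complex \<times> complex \<Rightarrow> complex"
  assume "\<exists>a. square_summable a \<and> (\<forall>x. f x = (if x \<in> bidisk then dpowser a x else 0))"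
    and "\<exists>a. square_summable a \<and> (\<forall>x. g x = (if x \<in> bidisk then dpowser a x else 0))"
  then obtain a b where ab: "square_summable a" "\<forall>x. f x = (if x \<in> bidisk then dpowser a x else 0)"
    "square_summable b" "\<forall>x. g x = (if x \<in> bidisk then dpowser b x else 0)" by blast
  show "\<exists>a. square_summable a \<and> (\<forall>x. f x + g x = (if x \<in> bidisk then dpowser a x else 0))"
    by (rule exI[of _ "\<lambda>k. a k + b k"])
       (use ab in \<open>auto simp: square_summable_add dpowser_add\<close>)
qed

definition uminus_hardy2 :: "hardy2 \<Rightarrow> hardy2" where "uminus_hardy2 f = hardy_scale (-1) f"
definition minus_hardy2 :: "hardy2 \<Rightarrow> hardy2 \<Rightarrow> hardy2" where "minus_hardy2 f g = f + - g"
definition scaleR_hardy2 :: "real \<Rightarrow> hardy2 \<Rightarrow> hardy2" where "scaleR_hardy2 r f = hardy_scale (complex_of_real r) f"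

definition inner_hardy2 :: "hardy2 \<Rightarrow> hardy2 \<Rightarrow> real"
  where "inner_hardy2 f g = Re (hardy_cinner f g)"
definition norm_hardy2 :: "hardy2 \<Rightarrow> real"
  where "norm_hardy2 f = sqrt (inner f f)"
definition sgn_hardy2 :: "hardy2 \<Rightarrow> hardy2"
  where "sgn_hardy2 f = inverse (norm f) *\<^sub>R f"
definition dist_hardy2 :: "hardy2 \<Rightarrow> hardy2 \<Rightarrow> real"
  where "dist_hardy2 f g = norm (f - g)"
definition uniformity_hardy2 :: "(hardy2 \<times> hardy2) filter"
  where "uniformity_hardy2 = (INF e\<in>{0<..}. principal {(x, y). dist x y < e})"
definition open_hardy2 :: "hardy2 set \<Rightarrow> bool"
  where "open_hardy2 U \<longleftrightarrow> (\<forall>x\<in>U. eventually (\<lambda>(x', y). x' = x \<longrightarrow> y \<in> U) uniformity)"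

lemma hcoeff_add: "hcoeff (f + g) = (\<lambda>k. hcoeff f k + hcoeff g k)"
  by (rule hcoeffI) (auto simp: square_summable_add hcoeff plus_hardy2.rep_eq hardy_fun_eq dpowser_add)

lemma hcoeff_scale: "hcoeff (hardy_scale c f) = (\<lambda>k. c * hcoeff f k)"
  by (rule hcoeffI) (auto simp: square_summable_scale hcoeff hardy_scale.rep_eq hardy_fun_eq dpowser_scale)

lemma hcoeff_zero: "hcoeff 0 = (\<lambda>k. 0)"
  by (rule hcoeffI) (auto simp: square_summable_zero zero_hardy2.rep_eq dpowser_def case_prod_unfold)

lemma hcoeff_diff: "hcoeff (f - g) = (\<lambda>k. hcoeff f k - hcoeff g k)"
  by (simp add: minus_hardy2_def uminus_hardy2_def hcoeff_add hcoeff_scale)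

lemma hardy_cinner_commute: "hardy_cinner x y = cnj (hardy_cinner y x)"
  by (simp add: hardy_cinner_def mult.commute flip: infsum_cnj)

lemma hardy_cinner_add: "hardy_cinner (x + y) z = hardy_cinner x z + hardy_cinner y z"
  by (simp add: hardy_cinner_def hcoeff_add distrib_right infsum_add square_summable_cinner hcoeff)

lemma hardy_cinner_scale: "hardy_cinner (hardy_scale c x) y = c * hardy_cinner x y"
  by (simp add: hardy_cinner_def hcoeff_scale mult.assoc infsum_cmult_right square_summable_cinner hcoeff)

lemma inner_self_hardy2: "inner f f = (\<Sum>\<^sub>\<infinity>k. (cmod (hcoeff f k))\<^sup>2)"
proof -
  have "hardy_cinner f f = (\<Sum>\<^sub>\<infinity>k. complex_of_real ((cmod (hcoeff f k))\<^sup>2))"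
    unfolding hardy_cinner_def complex_norm_square ..
  also have "\<dots> = complex_of_real (\<Sum>\<^sub>\<infinity>k. (cmod (hcoeff f k))\<^sup>2)"
    using hcoeff[of f] unfolding square_summable_def
    by (intro infsumI has_sum_of_real has_sum_infsum)
  finally show ?thesis by (simp add: inner_hardy2_def)
qed

lemma sum_le_norm_hardy2:
  assumes "finite F"
  shows "(\<Sum>k\<in>F. (cmod (hcoeff f k))\<^sup>2) \<le> (norm f)\<^sup>2"
proof -
  have "(\<Sum>k\<in>F. (cmod (hcoeff f k))\<^sup>2) \<le> (\<Sum>\<^sub>\<infinity>k. (cmod (hcoeff f k))\<^sup>2)"
    using hcoeff[of f] assms unfolding square_summable_def by (intro finite_sum_le_infsum) auto
  moreover have "0 \<le> inner f f"
    unfolding inner_self_hardy2 by (rule infsum_nonneg) auto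
  ultimately show ?thesis by (simp add: norm_hardy2_def inner_self_hardy2)
qed

lemma norm_le_hardy2:
  assumes "\<And>F. finite F \<Longrightarrow> (\<Sum>k\<in>F. (cmod (hcoeff f k))\<^sup>2) \<le> e\<^sup>2" "0 \<le> e"
  shows "norm f \<le> e"
proof -
  have "inner f f \<le> e\<^sup>2"
    unfolding inner_self_hardy2
    using hcoeff[of f] assms(1) unfolding square_summable_def by (intro infsum_le_finite_sums) auto
  then have "sqrt (inner f f) \<le> sqrt (e\<^sup>2)" by (rule real_sqrt_le_mono)
  then show ?thesis using assms(2) by (simp add: norm_hardy2_def)
qed

lemma hcoeff_le_norm: "cmod (hcoeff f k) \<le> norm f"
proof (rule power2_le_imp_le)
  show "(cmod (hcoeff f k))\<^sup>2 \<le> (norm f)\<^sup>2" using sum_le_norm_hardy2[of "{k}" f] by simp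
  show "0 \<le> norm f"
    unfolding norm_hardy2_def inner_self_hardy2 by (intro real_sqrt_ge_zero infsum_nonneg) auto
qed

lemma hardy2_cauchy_converges:
  fixes X :: "nat \<Rightarrow> hardy2"
  assumes cau: "\<And>e. e > 0 \<Longrightarrow> \<exists>M. \<forall>m\<ge>M. \<forall>n\<ge>M. norm (X m - X n) < e"
  shows "\<exists>L. \<forall>e>0. \<exists>M. \<forall>n\<ge>M. norm (X n - L) \<le> e"
proof -
  have "Cauchy (\<lambda>n. hcoeff (X n) k)" for k
  proof (rule metric_CauchyI)
    fix e :: real assume "e > 0"
    then obtain M where M: "\<forall>m\<ge>M. \<forall>n\<ge>M. norm (X m - X n) < e" using cau by blast
    have "dist (hcoeff (X m) k) (hcoeff (X n) k) < e" if "m \<ge> M" "n \<ge> M" for m n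
      using hcoeff_le_norm[of "X m - X n" k] M that by (force simp: dist_norm hcoeff_diff)
    then show "\<exists>M. \<forall>m\<ge>M. \<forall>n\<ge>M. dist (hcoeff (X m) k) (hcoeff (X n) k) < e" by blast
  qed
  then have "\<exists>l. (\<lambda>n. hcoeff (X n) k) \<longlonglongrightarrow> l" for k
    using Cauchy_convergent convergent_def by blast
  then obtain a where a: "\<And>k. (\<lambda>n. hcoeff (X n) k) \<longlonglongrightarrow> a k" by metis
  have bound: "(\<Sum>k\<in>F. (cmod (hcoeff (X m) k - a k))\<^sup>2) \<le> e\<^sup>2"
    if F: "finite F" and M: "\<forall>n\<ge>M. norm (X m - X n) < e" for F e m M
  proof (rule LIMSEQ_le_const2)
    show "(\<lambda>n. \<Sum>k\<in>F. (cmod (hcoeff (X m) k - hcoeff (X n) k))\<^sup>2)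
        \<longlonglongrightarrow> (\<Sum>k\<in>F. (cmod (hcoeff (X m) k - a k))\<^sup>2)"
      by (intro tendsto_intros a)
    have "(\<Sum>k\<in>F. (cmod (hcoeff (X m) k - hcoeff (X n) k))\<^sup>2) \<le> e\<^sup>2" if "n \<ge> M" for n
    proof -
      have "(\<Sum>k\<in>F. (cmod (hcoeff (X m) k - hcoeff (X n) k))\<^sup>2) \<le> (norm (X m - X n))\<^sup>2"
        using sum_le_norm_hardy2[OF F, of "X m - X n"] by (simp add: hcoeff_diff)
      also have "\<dots> \<le> e\<^sup>2"
      proof (rule power_mono)
        show "norm (X m - X n) \<le> e" using M that by force
        show "0 \<le> norm (X m - X n)" using hcoeff_le_norm norm_ge_zero order_trans by blast
      qed
      finally show ?thesis .
    qed
    then show "\<exists>N. \<forall>n\<ge>N. (\<Sum>k\<in>F. (cmod (hcoeff (X m) k - hcoeff (X n) k))\<^sup>2) \<le> e\<^sup>2" by blast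
  qed
  obtain M where M: "\<forall>m\<ge>M. \<forall>n\<ge>M. norm (X m - X n) < 1" using cau[of 1] by auto
  have "square_summable (\<lambda>k. hcoeff (X M) k - a k)"
    unfolding square_summable_def
  proof (rule nonneg_bdd_above_summable_on)
    show "bdd_above (sum (\<lambda>k. (cmod (hcoeff (X M) k - a k))\<^sup>2) ` {F. F \<subseteq> UNIV \<and> finite F})"
      by (rule bdd_aboveI2[where M = "1\<^sup>2"]) (use bound[of _ M M 1] M in auto)
  qed auto
  from square_summable_add[OF hcoeff[of "X M"] square_summable_scale[OF this, of "-1"]]
  have "square_summable a" by simp
  then obtain L where L: "hcoeff L = a" by (rule hcoeff_surj)
  have "\<exists>M. \<forall>n\<ge>M. norm (X n - L) \<le> e" if e: "e > 0" for e
  proof -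
    obtain M where M: "\<forall>m\<ge>M. \<forall>n\<ge>M. norm (X m - X n) < e" using cau[OF e] by auto
    have "norm (X m - L) \<le> e" if m: "m \<ge> M" for m
      by (rule norm_le_hardy2) (use bound[of _ M m e] M m e L in \<open>auto simp: hcoeff_diff\<close>)
    then show ?thesis by blast
  qed
  then show ?thesis by blast
qed

instance
proof
  fix f g h :: hardy2 and r s :: real
  note co = hcoeff_inject[symmetric] hcoeff_add hcoeff_scale hcoeff_zero fun_eq_iff
  show "f + g + h = f + (g + h)" "f + g = g + f" "0 + f = f"
    "- f + f = 0" "f - g = f + - g"
    by (simp_all add: co minus_hardy2_def uminus_hardy2_def algebra_simps)
  show "r *\<^sub>R (f + g) = r *\<^sub>R f + r *\<^sub>R g" "(r + s) *\<^sub>R f = r *\<^sub>R f + s *\<^sub>R f"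
    "r *\<^sub>R s *\<^sub>R f = (r * s) *\<^sub>R f" "1 *\<^sub>R f = f"
    by (simp_all add: co scaleR_hardy2_def algebra_simps)
  show "sgn f = inverse (norm f) *\<^sub>R f" by (rule sgn_hardy2_def)
  show "dist f g = norm (f - g)" by (rule dist_hardy2_def)
  show "(uniformity :: (hardy2 \<times> hardy2) filter) = (INF e\<in>{0<..}. principal {(x, y). dist x y < e})"
    by (rule uniformity_hardy2_def)
  show "open U \<longleftrightarrow> (\<forall>x\<in>U. eventually (\<lambda>(x', y). x' = x \<longrightarrow> y \<in> U) uniformity)" for U :: "hardy2 set"
    by (rule open_hardy2_def)
  show "inner f g = inner g f"
    using arg_cong[OF hardy_cinner_commute[of f g], of Re] by (simp add: inner_hardy2_def)
  show "inner (f + g) h = inner f h + inner g h"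
    by (simp add: inner_hardy2_def hardy_cinner_add)
  show "inner (r *\<^sub>R f) g = r * inner f g"
    by (simp add: inner_hardy2_def hardy_cinner_scale scaleR_hardy2_def)
  show "0 \<le> inner f f" unfolding inner_self_hardy2 by (rule infsum_nonneg) auto
  show "norm f = sqrt (inner f f)" by (rule norm_hardy2_def)
  show "inner f f = 0 \<longleftrightarrow> f = 0"
  proof
    assume "inner f f = 0"
    then have "norm f = 0" by (simp add: norm_hardy2_def)
    then show "f = 0" using hcoeff_le_norm[of f] by (simp add: co)
  next
    show "f = 0 \<Longrightarrow> inner f f = 0" by (simp add: inner_self_hardy2 hcoeff_zero)
  qed
qed

end

instance hardy2 :: complete_space
proof
  fix X :: "nat \<Rightarrow> hardy2"
  assume X: "Cauchy X"
  obtain L where L: "\<forall>e>0. \<exists>M. \<forall>n\<ge>M. norm (X n - L) \<le> e"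
    using hardy2_cauchy_converges[of X] CauchyD[OF X] by blast
  have "X \<longlonglongrightarrow> L"
  proof (rule LIMSEQ_I)
    fix e :: real assume "0 < e"
    then obtain M where "\<forall>n\<ge>M. norm (X n - L) \<le> e / 2" using L half_gt_zero by blast
    then have "\<forall>n\<ge>M. norm (X n - L) < e" using \<open>0 < e\<close> by force
    then show "\<exists>no. \<forall>n\<ge>no. norm (X n - L) < e" by blast
  qed
  then show "convergent X" by (auto simp: convergent_def)
qed

instantiation hardy2 :: complex_hilbert
begin

definition scaleC_hardy2 :: "complex \<Rightarrow> hardy2 \<Rightarrow> hardy2" where "scaleC_hardy2 = hardy_scale"
definition cinner_hardy2 :: "hardy2 \<Rightarrow> hardy2 \<Rightarrow> complex" where "cinner_hardy2 = hardy_cinner"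

instance
proof
  fix f g h :: hardy2 and a b :: complex and r :: real
  note co = hcoeff_inject[symmetric] hcoeff_add hcoeff_scale fun_eq_iff scaleC_hardy2_def
  show "a *\<^sub>C (f + g) = a *\<^sub>C f + a *\<^sub>C g" "(a + b) *\<^sub>C f = a *\<^sub>C f + b *\<^sub>C f"
    "a *\<^sub>C b *\<^sub>C f = (a * b) *\<^sub>C f"
    by (simp_all add: co algebra_simps)
  show "r *\<^sub>R f = complex_of_real r *\<^sub>C f" by (simp add: scaleR_hardy2_def scaleC_hardy2_def)
  show "cinner f g = cnj (cinner g f)" unfolding cinner_hardy2_def by (rule hardy_cinner_commute)
  show "cinner (f + g) h = cinner f h + cinner g h" by (simp add: cinner_hardy2_def hardy_cinner_add)
  show "cinner (a *\<^sub>C f) g = a * cinner f g"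
    by (simp add: cinner_hardy2_def scaleC_hardy2_def hardy_cinner_scale)
  show "Re (cinner f g) = inner f g" by (simp add: inner_hardy2_def cinner_hardy2_def)
qed

end

lemma dpowser_shift:
  assumes "square_summable a"
  defines "b \<equiv> \<lambda>(m, n). if m = 0 then 0 else a (m - 1, n)"
  shows "square_summable b" "cmod z < 1 \<Longrightarrow> cmod w < 1 \<Longrightarrow> dpowser b (z, w) = z * dpowser a (z, w)"
proof -
  define h :: "nat \<times> nat \<Rightarrow> nat \<times> nat" where "h = (\<lambda>(m, n). (Suc m, n))"
  have inj: "inj h" by (auto simp: h_def inj_on_def)
  have off: "b k = 0" if "k \<notin> range h" for k
  proof (cases k)
    case (Pair m n)
    then show ?thesis using that by (cases m) (auto simp: b_def h_def image_iff)
  qed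
  have on: "b (h k) = a k" for k by (auto simp: b_def h_def split: prod.splits)
  have "(\<lambda>k. (cmod (b k))\<^sup>2) \<circ> h = (\<lambda>k. (cmod (a k))\<^sup>2)" by (simp add: on o_def)
  then have "(\<lambda>k. (cmod (b k))\<^sup>2) summable_on range h"
    using assms(1) by (simp add: summable_on_reindex[OF inj] square_summable_def)
  then show "square_summable b"
    unfolding square_summable_def
    by (subst summable_on_cong_neutral[where T = "range h" and g = "\<lambda>k. (cmod (b k))\<^sup>2"])
       (auto simp: off)
  assume zw: "cmod z < 1" "cmod w < 1"
  have "dpowser b (z, w) = (\<Sum>\<^sub>\<infinity>k. b k * z ^ fst k * w ^ snd k)"
    by (simp add: dpowser_def case_prod_unfold)
  also have "\<dots> = (\<Sum>\<^sub>\<infinity>k\<in>range h. b k * z ^ fst k * w ^ snd k)"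
    by (rule infsum_cong_neutral) (auto simp: off)
  also have "\<dots> = (\<Sum>\<^sub>\<infinity>k. z * (case k of (m, n) \<Rightarrow> a (m, n) * z ^ m * w ^ n))"
    unfolding infsum_reindex[OF inj]
    by (rule infsum_cong) (simp add: on o_def, simp add: h_def case_prod_unfold)
  also have "\<dots> = z * dpowser a (z, w)"
    using infsum_cmult_right[OF dpowser_summable[OF assms(1) zw]] by (simp add: dpowser_def)
  finally show "dpowser b (z, w) = z * dpowser a (z, w)" .
qed

lift_definition mult_z :: "hardy2 \<Rightarrow> hardy2" is "\<lambda>f (z, w). z * f (z, w)"
proof -
  fix f :: "complex \<times> complex \<Rightarrow> complex"
  assume "\<exists>a. square_summable a \<and> (\<forall>x. f x = (if x \<in> bidisk then dpowser a x else 0))"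
  then obtain a where a: "square_summable a" "\<forall>x. f x = (if x \<in> bidisk then dpowser a x else 0)"
    by blast
  show "\<exists>a. square_summable a \<and>
    (\<forall>x. (case x of (z, w) \<Rightarrow> z * f (z, w)) = (if x \<in> bidisk then dpowser a x else 0))"
    by (rule exI[of _ "\<lambda>(m, n). if m = 0 then 0 else a (m - 1, n)"])
       (use a dpowser_shift[OF a(1)] in auto)
qed

text \<open>\<open>\<complex>[z, w]\<close> is \<open>\<complex>[z][w]\<close>: the coefficients of a \<^typ>\<open>complex poly poly\<close> are polynomials
  in \<open>z\<close>, and its indeterminate is \<open>w\<close>.\<close>

definition slice :: "complex poly poly \<Rightarrow> complex \<Rightarrow> complex poly"
  where "slice p z = map_poly (\<lambda>c. poly c z) p"

definition poly2 :: "complex poly poly \<Rightarrow> complex \<times> complex \<Rightarrow> complex"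
  where "poly2 p = (\<lambda>(z, w). poly (slice p z) w)"

definition zero_set :: "complex poly poly \<Rightarrow> (complex \<times> complex) set"
  where "zero_set p = {x. poly2 p x = 0}"

definition no_univariate_factors :: "complex poly poly \<Rightarrow> bool"
  where "no_univariate_factors p \<longleftrightarrow>
    (\<forall>q :: complex poly. degree q > 0 \<longrightarrow>
      \<not> [:q:] dvd p \<and> \<not> map_poly (\<lambda>c. [:c:]) q dvd p)"

definition disk_zeros :: "complex poly \<Rightarrow> nat"
  where "disk_zeros q = (\<Sum>w | w \<in> ball 0 1 \<and> poly q w = 0. order w q)"

lemma poly_eq_sum_le:
  fixes q :: "complex poly"
  assumes "degree q \<le> N"
  shows "poly q x = (\<Sum>i\<le>N. coeff q i * x ^ i)"
  unfolding poly_altdef using assms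
  by (intro sum.mono_neutral_left) (auto simp: coeff_eq_0)

lemma poly2_dpowser:
  defines "a \<equiv> \<lambda>p (m, n). coeff (coeff p n) m"
  shows "square_summable (a p)" "poly2 p x = dpowser (a p) x"
proof -
  define d where "d = (MAX n\<in>{..degree p}. degree (coeff p n))"
  define S where "S = {..d} \<times> {..degree p}"
  have fin: "finite S" by (simp add: S_def)
  have deg: "degree (coeff p n) \<le> d" if "n \<le> degree p" for n
    unfolding d_def using that by (intro Max_ge) auto
  have off: "a p k = 0" if k: "k \<notin> S" for k
  proof (cases k)
    case (Pair m n)
    show ?thesis
    proof (cases "n \<le> degree p")
      case True
      then have "degree (coeff p n) < m" using k Pair deg[of n] by (auto simp: S_def)
      then show ?thesis by (simp add: a_def Pair coeff_eq_0)
    next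
      case False
      then show ?thesis by (simp add: a_def Pair coeff_eq_0)
    qed
  qed
  have "(\<lambda>k. (cmod (a p k))\<^sup>2) summable_on S" using fin by (rule summable_on_finite)
  then show "square_summable (a p)"
    unfolding square_summable_def
    by (subst summable_on_cong_neutral[where T = S and g = "\<lambda>k. (cmod (a p k))\<^sup>2"]) (auto simp: off)
  obtain z w where x: "x = (z, w)" by (cases x)
  have dp: "degree (slice p z) \<le> degree p" unfolding slice_def by (rule map_poly_degree_leq)
  have "poly2 p x = (\<Sum>n\<le>degree p. coeff (slice p z) n * w ^ n)"
    unfolding x poly2_def prod.case by (rule poly_eq_sum_le[OF dp])
  also have "\<dots> = (\<Sum>n\<le>degree p. poly (coeff p n) z * w ^ n)"
    by (simp add: slice_def coeff_map_poly)
  also have "\<dots> = (\<Sum>n\<le>degree p. \<Sum>m\<le>d. coeff (coeff p n) m * z ^ m * w ^ n)"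
    by (intro sum.cong refl) (simp add: poly_eq_sum_le[OF deg] sum_distrib_right)
  also have "\<dots> = (\<Sum>m\<le>d. \<Sum>n\<le>degree p. coeff (coeff p n) m * z ^ m * w ^ n)"
    by (rule sum.swap)
  also have "\<dots> = (\<Sum>k\<in>S. a p k * z ^ fst k * w ^ snd k)"
    by (simp add: S_def sum.cartesian_product a_def case_prod_unfold)
  also have "\<dots> = (\<Sum>\<^sub>\<infinity>k\<in>S. a p k * z ^ fst k * w ^ snd k)"
    using fin by simp
  also have "\<dots> = (\<Sum>\<^sub>\<infinity>k. a p k * z ^ fst k * w ^ snd k)"
    by (rule infsum_cong_neutral) (auto simp: off)
  also have "\<dots> = dpowser (a p) x" by (simp add: x dpowser_def case_prod_unfold)
  finally show "poly2 p x = dpowser (a p) x" .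
qed

lift_definition hardy_of_poly :: "complex poly poly \<Rightarrow> hardy2"
  is "\<lambda>p x. if x \<in> bidisk then poly2 p x else 0"
  using poly2_dpowser by fastforce

text \<open>A Hilbert space that is not a whole type is a closed subspace \<open>K\<close> of a
  \<^class>\<open>complex_hilbert\<close> type; operators on \<open>K\<close> are functions on the type of which only the
  restriction to \<open>K\<close> matters.\<close>

definition closed_csubspace :: "'a::complex_hilbert set \<Rightarrow> bool"
  where "closed_csubspace M \<longleftrightarrow> csubspace M \<and> closed M"

definition closed_cspan :: "'a::complex_hilbert set \<Rightarrow> 'a set"
  where "closed_cspan S = closure (cspan S)"

definition orth_compl :: "'a::complex_hilbert set \<Rightarrow> 'a set"
  where "orth_compl S = {x. \<forall>y\<in>S. cinner x y = 0}"

definition orth_proj :: "'a::complex_hilbert set \<Rightarrow> 'a \<Rightarrow> 'a"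
  where "orth_proj K x = (THE y. y \<in> K \<and> x - y \<in> orth_compl K)"

definition bounded_op_on :: "'a::complex_hilbert set \<Rightarrow> ('a \<Rightarrow> 'a) \<Rightarrow> bool"
  where "bounded_op_on K T \<longleftrightarrow> T ` K \<subseteq> K \<and>
    (\<forall>x\<in>K. \<forall>y\<in>K. T (x + y) = T x + T y) \<and> (\<forall>c. \<forall>x\<in>K. T (c *\<^sub>C x) = c *\<^sub>C T x) \<and>
    (\<exists>B. \<forall>x\<in>K. norm (T x) \<le> B * norm x)"

definition adjoint_on :: "'a::complex_hilbert set \<Rightarrow> ('a \<Rightarrow> 'a) \<Rightarrow> 'a \<Rightarrow> 'a"
  where "adjoint_on K T y = (THE y'. y' \<in> K \<and> (\<forall>x\<in>K. cinner (T x) y = cinner x y'))"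

definition reducible_op :: "'a::complex_hilbert set \<Rightarrow> ('a \<Rightarrow> 'a) \<Rightarrow> bool"
  where "reducible_op K T \<longleftrightarrow> (\<exists>M. closed_csubspace M \<and> M \<subseteq> K \<and> M \<noteq> {0} \<and> M \<noteq> K \<and>
    T ` M \<subseteq> M \<and> adjoint_on K T ` M \<subseteq> M)"

definition eigenspace :: "'a::complex_hilbert set \<Rightarrow> ('a \<Rightarrow> 'a) \<Rightarrow> complex \<Rightarrow> 'a set"
  where "eigenspace K T w = {x \<in> K. T x - w *\<^sub>C x = 0}"

text \<open>The components \<open>\<Omega>\<^sub>i\<close> index themselves, so the multi-index \<open>\<alpha>\<close> is a function of the
  component. As \<open>\<alpha>\<close> is positive, the convention that \<^const>\<open>cdim\<close> is \<open>0\<close> on infinite-dimensional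
  spaces does no harm. The empty \<open>\<Omega>\<close> is allowed; it forces \<open>K = {0}\<close>.\<close>

definition cowen_douglas ::
    "'a::complex_hilbert set \<Rightarrow> complex set \<Rightarrow> (complex set \<Rightarrow> nat) \<Rightarrow> ('a \<Rightarrow> 'a) \<Rightarrow> bool"
  where "cowen_douglas K \<Omega> \<alpha> T \<longleftrightarrow>
    closed_csubspace K \<and> separable_space (top_of_set K) \<and> bounded_op_on K T \<and>
    open \<Omega> \<and> bounded \<Omega> \<and> (\<forall>C\<in>components \<Omega>. \<alpha> C > 0) \<and>
    (\<forall>w\<in>\<Omega>. (\<lambda>x. T x - w *\<^sub>C x) ` K = K) \<and>
    closed_cspan (\<Union>w\<in>\<Omega>. eigenspace K T w) = K \<and>
    (\<forall>C\<in>components \<Omega>. \<forall>w\<in>C. cdim (eigenspace K T w) = \<alpha> C)"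

definition kernel_bundle ::
    "'a::complex_hilbert set \<Rightarrow> ('a \<Rightarrow> 'a) \<Rightarrow> complex set \<Rightarrow> (complex \<times> 'a) set"
  where "kernel_bundle K T C = (SIGMA w:C. eigenspace K T w)"

abbreviation fibre :: "(complex \<times> 'a) set \<Rightarrow> complex \<Rightarrow> 'a set"
  where "fibre E w \<equiv> E `` {w}"

definition vholomorphic_on :: "(complex \<Rightarrow> 'a::complex_hilbert) \<Rightarrow> complex set \<Rightarrow> bool"
  where "vholomorphic_on s U \<longleftrightarrow>
    (\<forall>w\<in>U. \<exists>d. (s has_derivative (\<lambda>h. h *\<^sub>C d)) (at w within U))"

text \<open>\<open>F\<close> has a constant rank \<open>r\<close> over \<open>C\<close> and, near every point of \<open>C\<close>, a holomorphic frame
  \<open>s\<^sub>0, \<dots>, s\<^sub>r\<^sub>-\<^sub>1\<close>. Holomorphy is that of Hilbert-space-valued functions, since the holomorphic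
  structure of a kernel bundle is inherited from the trivial bundle.\<close>

definition holomorphic_subbundle ::
    "complex set \<Rightarrow> (complex \<times> 'a::complex_hilbert) set \<Rightarrow> (complex \<times> 'a) set \<Rightarrow> bool"
  where "holomorphic_subbundle C F E \<longleftrightarrow> F \<subseteq> E \<and>
    (\<exists>r :: nat. \<forall>w\<^sub>0\<in>C. \<exists>U s. open U \<and> w\<^sub>0 \<in> U \<and> U \<subseteq> C \<and>
      (\<forall>i<r. vholomorphic_on (s i) U) \<and>
      (\<forall>w\<in>U. inj_on (\<lambda>i. s i w) {..<r} \<and> \<not> cdependent ((\<lambda>i. s i w) ` {..<r}) \<and>
        cspan ((\<lambda>i. s i w) ` {..<r}) = fibre F w))"

text \<open>\<open>E1 C\<close> and \<open>E2 C\<close> are the parts of the two bundles over the component \<open>C\<close>.\<close>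

definition bundle_decomposition ::
    "'a::complex_hilbert set \<Rightarrow> ('a \<Rightarrow> 'a) \<Rightarrow> complex set \<Rightarrow>
      (complex set \<Rightarrow> (complex \<times> 'a) set) \<Rightarrow> (complex set \<Rightarrow> (complex \<times> 'a) set) \<Rightarrow> bool"
  where "bundle_decomposition K T \<Omega> E1 E2 \<longleftrightarrow>
    (\<forall>E\<in>{E1, E2}.
      (\<forall>C\<in>components \<Omega>. holomorphic_subbundle C (E C) (kernel_bundle K T C)) \<and>
      (\<exists>C\<in>components \<Omega>. E C \<noteq> C \<times> {0}) \<and>
      (\<exists>C\<in>components \<Omega>. E C \<noteq> kernel_bundle K T C)) \<and>
    (\<forall>C\<in>components \<Omega>. \<forall>w\<in>C.
      fibre (E1 C) w \<inter> fibre (E2 C) w = {0} \<and>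
      {x + y | x y. x \<in> fibre (E1 C) w \<and> y \<in> fibre (E2 C) w} = fibre (kernel_bundle K T C) w) \<and>
    (\<forall>C\<in>components \<Omega>. \<forall>C'\<in>components \<Omega>.
      \<forall>x\<in>closed_cspan (\<Union>w\<in>C. fibre (E1 C) w). \<forall>y\<in>closed_cspan (\<Union>w\<in>C'. fibre (E2 C') w).
        cinner x y = 0)"

definition reducible_bundle :: "'a::complex_hilbert set \<Rightarrow> ('a \<Rightarrow> 'a) \<Rightarrow> complex set \<Rightarrow> bool"
  where "reducible_bundle K T \<Omega> \<longleftrightarrow> (\<exists>E1 E2. bundle_decomposition K T \<Omega> E1 E2)"

definition strictly_reducible_bundle :: "'a::complex_hilbert set \<Rightarrow> ('a \<Rightarrow> 'a) \<Rightarrow> complex set \<Rightarrow> bool"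
  where "strictly_reducible_bundle K T \<Omega> \<longleftrightarrow> reducible_bundle K T \<Omega> \<and>
    (\<forall>E1 E2. bundle_decomposition K T \<Omega> E1 E2 \<longrightarrow>
      (\<forall>C\<in>components \<Omega>. E1 C \<noteq> C \<times> {0} \<and> E1 C \<noteq> kernel_bundle K T C))"

definition submodule_of :: "complex poly poly \<Rightarrow> hardy2 set"
  where "submodule_of p = closure (range (\<lambda>q. hardy_of_poly (p * q)))"

definition quotient_module :: "complex poly poly \<Rightarrow> hardy2 set"
  where "quotient_module p = orth_compl (submodule_of p)"

definition S_z :: "complex poly poly \<Rightarrow> hardy2 \<Rightarrow> hardy2"
  where "S_z p f = orth_proj (quotient_module p) (mult_z f)"

definition Omega :: "complex poly poly \<Rightarrow> complex set"
  where "Omega p = \<Union>{C \<in> components (ball 0 1 - fst ` (zero_set p \<inter> ball 0 1 \<times> sphere 0 1)).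
    \<forall>z\<in>C. disk_zeros (slice p z) > 0}"

end

(* The eigenvectors of the adjoint of S_z at conj(z) correspond to the geometric sequences that solve the
   recurrence of the slice p(z,.), so their dimension is the number of zeros of p(z,.) in the disk. A
   vector of the quotient module orthogonal to all of them over Omega is divisible by p in every slice;
   contour integrals glue the slicewise quotients to one holomorphic quotient on the bidisk, and a
   dilation argument in w approximates the vector by polynomial multiples of p, so it is 0.

   A reducing subspace M splits every eigenspace orthogonally, and power series in a bounded right inverse
   give holomorphic frames of both parts. Conversely the closed span of the fibres of E^1 reduces S_z
   because the eigenvectors are total. The splitting is automatically strict: a subspace invariant under
   the adjoint of S_z and orthogonal to all eigenspaces over a nonempty open set is 0. *)

theory Submission
  imports Defs
begin

section \<open>Complex Hilbert spaces\<close>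

text \<open>Totality of the eigenvectors is the hard step. The quotient g = f / p is only known to
  be holomorphic on the bidisk, and p may vanish on the torus, so g need not have a finite Hardy
  norm. The dilates \<open>g_r(z, w) = g(r z, r w)\<close> have absolutely summable coefficients, so
  p g_r is orthogonal to the quotient module; but a bound on the norm of p g_r that is uniform in r
  < 1 has to come from f = p g alone. In one variable such a bound holds for q h with a constant
  that depends only on the degree of q, not on the position of its roots. Restricting to the lines
  \<open>(s t, s u t)\<close> with |u| = 1 and averaging over u carries it over to two variables.
  Slices with zeros on the unit circle lie outside Omega. There f / p is expanded on a smaller
  circle free of zeros. The Laurent coefficients are holomorphic in z, and the negative ones vanish
  by the identity theorem, because Omega accumulates wherever p has a zero in the bidisk.\<close>

instance complex_hilbert \<subseteq> banach by standard

lemma cinner_zero_left [simp]: "cinner 0 (y::'a::complex_hilbert) = 0"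
  using cinner_add_left[of 0 0 y] by simp

lemma cinner_zero_right [simp]: "cinner (y::'a::complex_hilbert) 0 = 0"
  using cinner_commute[of y 0] by simp

lemma cinner_add_right: "cinner (x::'a::complex_hilbert) (y + z) = cinner x y + cinner x z"
  using cinner_commute[of x "y + z"] cinner_commute[of x y] cinner_commute[of x z]
  by (simp add: cinner_add_left)

lemma cinner_scaleC_right: "cinner (x::'a::complex_hilbert) (c *\<^sub>C y) = cnj c * cinner x y"
  using cinner_commute[of x "c *\<^sub>C y"] cinner_commute[of x y] by (simp add: cinner_scaleC_left)

lemma cinner_minus_left: "cinner (- x) (y::'a::complex_hilbert) = - cinner x y"
  using cinner_add_left[of "-x" x y] by (simp add: eq_neg_iff_add_eq_0)

lemma cinner_diff_left: "cinner (x - y) (z::'a::complex_hilbert) = cinner x z - cinner y z"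
  using cinner_add_left[of x "-y" z] by (simp add: cinner_minus_left)

lemma cinner_minus_right: "cinner x (- (y::'a::complex_hilbert)) = - cinner x y"
  using cinner_add_right[of x "-y" y] by (simp add: eq_neg_iff_add_eq_0)

lemma cinner_diff_right: "cinner x (y - (z::'a::complex_hilbert)) = cinner x y - cinner x z"
  using cinner_add_right[of x y "-z"] by (simp add: cinner_minus_right)

lemma cinner_sum_left: "cinner (sum f S) (z::'a::complex_hilbert) = (\<Sum>i\<in>S. cinner (f i) z)"
  by (induct S rule: infinite_finite_induct) (auto simp: cinner_add_left)

lemma cinner_self: "cinner x (x::'a::complex_hilbert) = complex_of_real ((norm x)\<^sup>2)"
proof (rule complex_eqI)
  show "Re (cinner x x) = Re (complex_of_real ((norm x)\<^sup>2))"
    by (simp add: Re_cinner power2_norm_eq_inner)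
  show "Im (cinner x x) = Im (complex_of_real ((norm x)\<^sup>2))"
    using arg_cong[OF cinner_commute[of x x], of Im] by simp
qed

lemma cinner_self_eq_0 [simp]: "cinner x x = 0 \<longleftrightarrow> (x::'a::complex_hilbert) = 0"
  by (simp add: cinner_self)

lemma cinner_eq_0_commute: "cinner x (y::'a::complex_hilbert) = 0 \<longleftrightarrow> cinner y x = 0"
  by (metis cinner_commute complex_cnj_zero_iff)

lemma norm_scaleC: "norm (c *\<^sub>C (x::'a::complex_hilbert)) = cmod c * norm x"
proof (rule power2_eq_imp_eq)
  have "complex_of_real ((norm (c *\<^sub>C x))\<^sup>2) = complex_of_real ((cmod c * norm x)\<^sup>2)"
    unfolding cinner_self[symmetric] cinner_scaleC_left cinner_scaleC_right
    by (simp add: cinner_self power_mult_distrib mult.commute[of "cnj c"] flip: mult.assoc complex_norm_square)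
  then show "(norm (c *\<^sub>C x))\<^sup>2 = (cmod c * norm x)\<^sup>2" by (simp only: of_real_eq_iff)
qed auto

lemma norm_cinner_le: "cmod (cinner x (y::'a::complex_hilbert)) \<le> norm x * norm y"
proof (cases "cinner x y = 0")
  case False
  \<comment> \<open>The unimodular factor that makes \<open>cinner (c *\<^sub>C x) y\<close> real
    and nonnegative, so that the real Cauchy-Schwarz inequality applies.\<close>
  define c where "c = cnj (cinner x y) / cmod (cinner x y)"
  have c: "cmod c = 1" using False by (simp add: c_def norm_divide)
  have "complex_of_real (cmod (cinner x y)) = c * cinner x y"
    using False by (simp add: c_def mult.commute[of "cnj _"] complex_norm_square[symmetric] power2_eq_square)
  then have "cmod (cinner x y) = Re (cinner (c *\<^sub>C x) y)"
    by (metis cinner_scaleC_left Re_complex_of_real)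
  also have "\<dots> \<le> norm (c *\<^sub>C x) * norm y" by (simp add: Re_cinner norm_cauchy_schwarz)
  finally show ?thesis by (simp add: norm_scaleC c)
qed simp

lemma scaleC_scaleR_right: "c *\<^sub>C (r *\<^sub>R x) = r *\<^sub>R (c *\<^sub>C (x::'a::complex_hilbert))"
  by (simp add: scaleR_scaleC scaleC_scaleC mult.commute)

lemma bounded_bilinear_scaleC:
  "bounded_bilinear (scaleC :: complex \<Rightarrow> 'a \<Rightarrow> 'a::complex_hilbert)"
  by (intro bounded_bilinear.intro exI[of _ 1])
     (auto simp: scaleC_add_left scaleC_add_right scaleC_scaleR_right norm_scaleC scaleR_scaleC[where 'a = 'a]
        scaleC_scaleC scaleR_conv_of_real)

lemma bounded_bilinear_cinner:
  "bounded_bilinear (cinner :: 'a \<Rightarrow> 'a::complex_hilbert \<Rightarrow> complex)"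
  by (intro bounded_bilinear.intro exI[of _ 1])
     (auto simp: cinner_add_left cinner_add_right norm_cinner_le scaleR_scaleC cinner_scaleC_left
        cinner_scaleC_right scaleR_conv_of_real)

lemmas tendsto_scaleC [tendsto_intros] = bounded_bilinear.tendsto[OF bounded_bilinear_scaleC]
lemmas tendsto_cinner [tendsto_intros] = bounded_bilinear.tendsto[OF bounded_bilinear_cinner]
lemmas continuous_on_scaleC [continuous_intros] =
  bounded_bilinear.continuous_on[OF bounded_bilinear_scaleC]
lemmas continuous_on_cinner [continuous_intros] =
  bounded_bilinear.continuous_on[OF bounded_bilinear_cinner]

section \<open>Closed subspaces and orthogonal complements\<close>

lemma csubspaceI:
  assumes "0 \<in> M" "\<And>x y. x \<in> M \<Longrightarrow> y \<in> M \<Longrightarrow> x + y \<in> M" "\<And>c x. x \<in> M \<Longrightarrow> c *\<^sub>C x \<in> M"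
  shows "csubspace (M :: 'a::complex_hilbert set)"
  using assms by (simp add: complex_vector.subspace_def)

lemma csubspaceD:
  assumes "csubspace (M :: 'a::complex_hilbert set)"
  shows csubspace_0: "0 \<in> M" and csubspace_add: "x \<in> M \<Longrightarrow> y \<in> M \<Longrightarrow> x + y \<in> M"
    and csubspace_scale: "x \<in> M \<Longrightarrow> c *\<^sub>C x \<in> M"
    and csubspace_diff: "x \<in> M \<Longrightarrow> y \<in> M \<Longrightarrow> x - y \<in> M"
    and csubspace_scaleR: "x \<in> M \<Longrightarrow> r *\<^sub>R x \<in> M"
  using assms by (auto simp: complex_vector.subspace_diff scaleR_scaleC complex_vector.subspace_0
      complex_vector.subspace_add complex_vector.subspace_scale)

lemma closed_csubspace_orth_compl: "closed_csubspace (orth_compl (S :: 'a::complex_hilbert set))"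
proof -
  have "orth_compl S = (\<Inter>y\<in>S. {x. cinner x y = 0})" by (auto simp: orth_compl_def)
  moreover have "closed {x. cinner x y = 0}" for y :: 'a
    by (intro closed_Collect_eq continuous_intros)
  ultimately show ?thesis
    unfolding closed_csubspace_def
    by (auto intro!: csubspaceI simp: orth_compl_def cinner_add_left cinner_scaleC_left)
qed

lemma csubspace_closure:
  assumes M: "csubspace (M :: 'a::complex_hilbert set)"
  shows "csubspace (closure M)"
proof (rule csubspaceI)
  show "0 \<in> closure M" using csubspace_0[OF M] closure_subset by blast
next
  fix x y assume "x \<in> closure M" "y \<in> closure M"
  then obtain f g where "\<And>n. f n \<in> M" "f \<longlonglongrightarrow> x" "\<And>n. g n \<in> M" "g \<longlonglongrightarrow> y"
    unfolding closure_sequential by auto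
  then show "x + y \<in> closure M"
    unfolding closure_sequential
    by (intro exI[of _ "\<lambda>n. f n + g n"]) (auto intro!: tendsto_intros csubspace_add[OF M])
next
  fix x c assume "x \<in> closure M"
  then obtain f where "\<And>n. f n \<in> M" "f \<longlonglongrightarrow> x"
    unfolding closure_sequential by auto
  then show "c *\<^sub>C x \<in> closure M"
    unfolding closure_sequential
    by (intro exI[of _ "\<lambda>n. c *\<^sub>C f n"]) (auto intro!: tendsto_intros csubspace_scale[OF M])
qed

lemma closed_csubspace_closed_cspan: "closed_csubspace (closed_cspan (S :: 'a::complex_hilbert set))"
  unfolding closed_csubspace_def closed_cspan_def
  by (simp add: csubspace_closure complex_vector.subspace_span)

lemma closed_cspan_superset: "(S :: 'a::complex_hilbert set) \<subseteq> closed_cspan S"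
  unfolding closed_cspan_def
  using closure_subset[of "cspan S"] complex_vector.span_superset[of S] by blast

lemma closed_cspan_minimal:
  assumes "closed_csubspace M" "(S :: 'a::complex_hilbert set) \<subseteq> M"
  shows "closed_cspan S \<subseteq> M"
  using assms unfolding closed_cspan_def closed_csubspace_def
  by (intro closure_minimal complex_vector.span_minimal) auto

lemma orth_compl_antimono: "S \<subseteq> T \<Longrightarrow> orth_compl T \<subseteq> orth_compl (S :: 'a::complex_hilbert set)"
  by (auto simp: orth_compl_def)

lemma subset_orth_compl_commute:
  "S \<subseteq> orth_compl T \<longleftrightarrow> (T :: 'a::complex_hilbert set) \<subseteq> orth_compl S"
  unfolding orth_compl_def subset_iff mem_Collect_eq
  by (meson cinner_eq_0_commute)

lemma orth_compl_closed_cspan: "orth_compl (closed_cspan S) = orth_compl (S :: 'a::complex_hilbert set)"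
proof
  show "orth_compl (closed_cspan S) \<subseteq> orth_compl S"
    by (intro orth_compl_antimono closed_cspan_superset)
  have "closed_cspan S \<subseteq> orth_compl (orth_compl S)"
    by (intro closed_cspan_minimal closed_csubspace_orth_compl)
       (use subset_orth_compl_commute[of S "orth_compl S"] in blast)
  then show "orth_compl S \<subseteq> orth_compl (closed_cspan S)" by (simp add: subset_orth_compl_commute)
qed

section \<open>Nearest points and orthogonal projections\<close>

lemma parallelogram:
  "(norm (x + y))\<^sup>2 + (norm (x - y))\<^sup>2 = 2 * (norm x)\<^sup>2 + 2 * (norm (y::'a::real_inner))\<^sup>2"
  unfolding power2_norm_eq_inner by (simp add: inner_add inner_diff inner_commute algebra_simps)

text \<open>The midpoint of two near-minimisers lies in \<open>M\<close> and is no closer to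
  \<open>x\<close> than the infimum, so the parallelogram law forces near-minimisers to be close to
  each other: a minimising sequence is Cauchy. The infimum is that of squared distances, as the law
  is about squares.\<close>

lemma closed_csubspace_nearest:
  assumes M: "closed_csubspace (M :: 'a::complex_hilbert set)"
  obtains y where "y \<in> M" "\<And>z. z \<in> M \<Longrightarrow> norm (x - y) \<le> norm (x - z)"
proof -
  have sub: "csubspace M" and cl: "closed M" using M by (auto simp: closed_csubspace_def)
  have ne: "M \<noteq> {}" using csubspace_0[OF sub] by auto
  define d where "d = (INF z\<in>M. (norm (x - z))\<^sup>2)"
  have bdd: "bdd_below ((\<lambda>z. (norm (x - z))\<^sup>2) ` M)" by (rule bdd_belowI2[of _ 0]) auto
  have d_le: "d \<le> (norm (x - z))\<^sup>2" if "z \<in> M" for z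
    unfolding d_def by (rule cINF_lower[OF bdd that])
  have "\<exists>z\<in>M. (norm (x - z))\<^sup>2 < d + 1 / Suc n" for n
  proof (rule ccontr)
    assume "\<not> (\<exists>z\<in>M. (norm (x - z))\<^sup>2 < d + 1 / Suc n)"
    then have "d + 1 / Suc n \<le> d"
      unfolding d_def[of] by (intro cINF_greatest[OF ne]) (auto simp: not_less d_def)
    then show False by (simp add: field_simps)
  qed
  then obtain f where fM: "\<And>n. f n \<in> M" and f: "\<And>n. (norm (x - f n))\<^sup>2 < d + 1 / Suc n" by metis
  have par: "(norm (f m - f n))\<^sup>2 \<le> 2 / Suc m + 2 / Suc n" for m n
  proof -
    have "d \<le> (norm (x - (1/2) *\<^sub>R (f m + f n)))\<^sup>2"
      by (intro d_le csubspace_scaleR[OF sub] csubspace_add[OF sub] fM)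
    moreover have "(x - f m) + (x - f n) = 2 *\<^sub>R (x - (1/2) *\<^sub>R (f m + f n))"
      by (simp add: algebra_simps scaleR_2)
    then have "(norm ((x - f m) + (x - f n)))\<^sup>2 = 4 * (norm (x - (1/2) *\<^sub>R (f m + f n)))\<^sup>2"
      by (simp add: power_mult_distrib)
    moreover have "(x - f m) - (x - f n) = f n - f m" by simp
    ultimately show ?thesis
      using parallelogram[of "x - f m" "x - f n"] f[of m] f[of n] by (simp add: norm_minus_commute)
  qed
  have "Cauchy f"
  proof (rule metric_CauchyI)
    fix e :: real assume "e > 0"
    then obtain N where N: "inverse (real (Suc N)) < e\<^sup>2 / 4"
      using reals_Archimedean[of "e\<^sup>2 / 4"] by auto
    have "dist (f m) (f n) < e" if "m \<ge> N" "n \<ge> N" for m n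
    proof -
      have le: "2 / real (Suc k) \<le> 2 * inverse (real (Suc N))" if "k \<ge> N" for k
        using that by (simp add: field_simps)
      have "(norm (f m - f n))\<^sup>2 < e\<^sup>2"
        using par[of m n] N le[OF that(1)] le[OF that(2)] by linarith
      then show ?thesis using \<open>e > 0\<close> by (simp add: dist_norm power_less_imp_less_base)
    qed
    then show "\<exists>M. \<forall>m\<ge>M. \<forall>n\<ge>M. dist (f m) (f n) < e" by blast
  qed
  then obtain y where y: "f \<longlonglongrightarrow> y" using Cauchy_convergent convergent_def by blast
  have yM: "y \<in> M" using closed_sequentially[OF cl _ y] fM by blast
  have "(norm (x - y))\<^sup>2 \<le> d"
  proof (rule LIMSEQ_le)
    show "(\<lambda>n. (norm (x - f n))\<^sup>2) \<longlonglongrightarrow> (norm (x - y))\<^sup>2" by (intro tendsto_intros y)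
    show "(\<lambda>n. d + 1 / Suc n) \<longlonglongrightarrow> d"
      using tendsto_add[OF tendsto_const[of d] LIMSEQ_inverse_real_of_nat] by (simp add: inverse_eq_divide)
    show "\<exists>N. \<forall>n\<ge>N. (norm (x - f n))\<^sup>2 \<le> d + 1 / real (Suc n)" using f less_imp_le by blast
  qed
  then have "(norm (x - y))\<^sup>2 \<le> (norm (x - z))\<^sup>2" if "z \<in> M" for z
    using d_le[OF that] by linarith
  then have "norm (x - y) \<le> norm (x - z)" if "z \<in> M" for z
    using that by (intro power2_le_imp_le[OF _ norm_ge_zero])
  with yM show thesis by (rule that)
qed

lemma orth_decomp:
  assumes M: "closed_csubspace (M :: 'a::complex_hilbert set)"
  shows "\<exists>y\<in>M. x - y \<in> orth_compl M"
proof -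
  have sub: "csubspace M" using M by (auto simp: closed_csubspace_def)
  obtain y where y: "y \<in> M" "\<And>z. z \<in> M \<Longrightarrow> norm (x - y) \<le> norm (x - z)"
    using closed_csubspace_nearest[OF M] by blast
  have "cinner (x - y) z = 0" if z: "z \<in> M" for z
  proof (cases "z = 0")
    case False
    \<comment> \<open>The coefficient of \<open>x - y\<close> along \<open>z\<close>. Moving
      \<open>y\<close> by \<open>c *\<^sub>C z\<close> lowers the squared distance by |c|^2 |z|^2,
      which minimality forbids unless \<open>c = 0\<close>.\<close>
    define c where "c = cinner (x - y) z / (norm z)\<^sup>2"
    have "norm (x - y) \<le> norm (x - (y + c *\<^sub>C z))"
      by (intro y csubspace_add[OF sub] csubspace_scale[OF sub] z)
    then have le: "(norm (x - y))\<^sup>2 \<le> (norm (x - y - c *\<^sub>C z))\<^sup>2" by (simp add: algebra_simps)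
    have "complex_of_real ((norm (x - y - c *\<^sub>C z))\<^sup>2)
        = complex_of_real ((norm (x - y))\<^sup>2) - cnj c * cinner (x - y) z
        - c * cinner z (x - y) + c * cnj c * complex_of_real ((norm z)\<^sup>2)"
      unfolding cinner_self[symmetric]
      unfolding cinner_diff_left[of "x - y" "c *\<^sub>C z"] cinner_diff_right[of _ "x - y" "c *\<^sub>C z"]
        cinner_scaleC_left cinner_scaleC_right by (simp add: ring_distribs)
    also have "cinner z (x - y) = cnj (cinner (x - y) z)" by (rule cinner_commute)
    also have "cinner (x - y) z = c * complex_of_real ((norm z)\<^sup>2)" using False by (simp add: c_def)
    finally have "complex_of_real ((norm (x - y - c *\<^sub>C z))\<^sup>2)
        = complex_of_real ((norm (x - y))\<^sup>2) - c * cnj c * complex_of_real ((norm z)\<^sup>2)"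
      by (simp add: algebra_simps)
    also have "\<dots> = complex_of_real ((norm (x - y))\<^sup>2 - (cmod c)\<^sup>2 * (norm z)\<^sup>2)"
      by (simp add: complex_norm_square del: of_real_power)
    finally have "(norm (x - y - c *\<^sub>C z))\<^sup>2 = (norm (x - y))\<^sup>2 - (cmod c)\<^sup>2 * (norm z)\<^sup>2"
      by (simp only: of_real_eq_iff)
    with le have "(cmod c)\<^sup>2 * (norm z)\<^sup>2 \<le> 0" by linarith
    then have "c = 0" using False by (simp add: mult_le_0_iff)
    then show ?thesis using False by (simp add: c_def)
  qed simp
  then show ?thesis using y(1) by (auto simp: orth_compl_def)
qed

lemma orth_compl_Int:
  assumes "x \<in> M" "x \<in> orth_compl M"
  shows "x = (0::'a::complex_hilbert)"
  using assms by (auto simp: orth_compl_def)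

lemma orth_proj_eqI:
  assumes M: "csubspace (M :: 'a::complex_hilbert set)" and y: "y \<in> M" "x - y \<in> orth_compl M"
  shows "orth_proj M x = y"
  unfolding orth_proj_def
proof (rule the_equality)
  fix y' assume y': "y' \<in> M \<and> x - y' \<in> orth_compl M"
  have "(x - y) - (x - y') \<in> orth_compl M"
    using closed_csubspace_orth_compl[of M] y(2) y' csubspace_diff unfolding closed_csubspace_def by blast
  then have "y' - y \<in> orth_compl M" by simp
  moreover have "y' - y \<in> M" using y y' csubspace_diff[OF M] by auto
  ultimately have "y' - y = 0" by (rule orth_compl_Int[rotated])
  then show "y' = y" by simp
qed (use y in auto)

lemma orth_proj:
  assumes M: "closed_csubspace (M :: 'a::complex_hilbert set)"
  shows orth_proj_mem: "orth_proj M x \<in> M" and orth_proj_diff: "x - orth_proj M x \<in> orth_compl M"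
proof -
  have sub: "csubspace M" using M by (auto simp: closed_csubspace_def)
  obtain y where y: "y \<in> M" "x - y \<in> orth_compl M" using orth_decomp[OF M, of x] by blast
  from orth_proj_eqI[OF sub this] y show "orth_proj M x \<in> M" "x - orth_proj M x \<in> orth_compl M" by auto
qed

lemma orth_proj_id:
  assumes "csubspace (M :: 'a::complex_hilbert set)" "x \<in> M"
  shows "orth_proj M x = x"
  by (rule orth_proj_eqI[OF assms]) (auto simp: orth_compl_def)

lemma orth_proj_add:
  assumes M: "closed_csubspace (M :: 'a::complex_hilbert set)"
  shows "orth_proj M (x + y) = orth_proj M x + orth_proj M y"
proof (rule orth_proj_eqI)
  show "csubspace M" using M by (auto simp: closed_csubspace_def)
  then show "orth_proj M x + orth_proj M y \<in> M" by (intro csubspace_add orth_proj_mem[OF M])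
  have "csubspace (orth_compl M)" using closed_csubspace_orth_compl by (auto simp: closed_csubspace_def)
  from csubspace_add[OF this orth_proj_diff[OF M, of x] orth_proj_diff[OF M, of y]]
  show "x + y - (orth_proj M x + orth_proj M y) \<in> orth_compl M" by (simp add: algebra_simps)
qed

lemma orth_proj_scaleC:
  assumes M: "closed_csubspace (M :: 'a::complex_hilbert set)"
  shows "orth_proj M (c *\<^sub>C x) = c *\<^sub>C orth_proj M x"
proof (rule orth_proj_eqI)
  show "csubspace M" using M by (auto simp: closed_csubspace_def)
  then show "c *\<^sub>C orth_proj M x \<in> M" by (intro csubspace_scale orth_proj_mem[OF M])
  have "csubspace (orth_compl M)" using closed_csubspace_orth_compl by (auto simp: closed_csubspace_def)
  from csubspace_scale[OF this orth_proj_diff[OF M, of x], of c]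
  show "c *\<^sub>C x - c *\<^sub>C orth_proj M x \<in> orth_compl M"
    by (simp add: complex_vector.scale_right_diff_distrib)
qed

lemma norm_orth_proj_le:
  assumes M: "closed_csubspace (M :: 'a::complex_hilbert set)"
  shows "norm (orth_proj M x) \<le> norm x"
proof -
  have "cinner (x - orth_proj M x) (orth_proj M x) = 0"
    using orth_proj[OF M, of x] by (auto simp: orth_compl_def)
  then have "complex_of_real ((norm (orth_proj M x))\<^sup>2) = cinner x (orth_proj M x)"
    by (simp add: cinner_diff_left cinner_self)
  then have "(norm (orth_proj M x))\<^sup>2 = cmod (cinner x (orth_proj M x))"
    by (metis norm_of_real abs_of_nonneg zero_le_power2)
  also have "\<dots> \<le> norm x * norm (orth_proj M x)" by (rule norm_cinner_le)
  finally show ?thesis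
    by (cases "orth_proj M x = 0") (auto simp: power2_eq_square)
qed

lemma cinner_orth_proj:
  assumes M: "closed_csubspace (M :: 'a::complex_hilbert set)" and y: "y \<in> M"
  shows "cinner (orth_proj M x) y = cinner x y"
  using orth_proj_diff[OF M, of x] y by (auto simp: orth_compl_def cinner_diff_left)

text \<open>Reduces density of a span to the absence of nonzero orthogonal vectors: the difference
  of \<open>x\<close> and its projection stays in \<open>K\<close> and is orthogonal to
  \<open>S\<close>.\<close>

lemma closed_cspan_eqI:
  assumes K: "closed_csubspace K" and S: "S \<subseteq> K"
    and tot: "\<And>x. x \<in> K \<Longrightarrow> x \<in> orth_compl S \<Longrightarrow> x = (0::'a::complex_hilbert)"
  shows "closed_cspan S = K"
proof
  show "closed_cspan S \<subseteq> K" by (rule closed_cspan_minimal[OF K S])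
  show "K \<subseteq> closed_cspan S"
  proof
    fix x assume x: "x \<in> K"
    let ?y = "orth_proj (closed_cspan S) x"
    have y: "?y \<in> closed_cspan S" by (rule orth_proj_mem[OF closed_csubspace_closed_cspan])
    have "x - ?y \<in> K"
      using x y \<open>closed_cspan S \<subseteq> K\<close> K csubspace_diff[of K x ?y] by (auto simp: closed_csubspace_def)
    moreover have "x - ?y \<in> orth_compl S"
      using orth_proj_diff[OF closed_csubspace_closed_cspan, of x S] orth_compl_closed_cspan by blast
    ultimately have "x - ?y = 0" by (rule tot)
    with y show "x \<in> closed_cspan S" by simp
  qed
qed

section \<open>Orthonormal and nearly orthonormal families\<close>

lemma orthonormal_independent:
  fixes S :: "'a::complex_hilbert set"
  assumes "\<And>x y. x \<in> S \<Longrightarrow> y \<in> S \<Longrightarrow> cinner x y = (if x = y then 1 else 0)"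
  shows "\<not> cdependent S"
proof
  assume "cdependent S"
  then obtain t u where t: "finite t" "t \<subseteq> S" "(\<Sum>v\<in>t. u v *\<^sub>C v) = 0" and "\<exists>v\<in>t. u v \<noteq> 0"
    unfolding complex_vector.dependent_explicit by auto
  then obtain v where v: "v \<in> t" "u v \<noteq> 0" by blast
  have "0 = cinner (\<Sum>v\<in>t. u v *\<^sub>C v) v" using t by simp
  also have "\<dots> = (\<Sum>w\<in>t. if w = v then u w else 0)"
    unfolding cinner_sum_left cinner_scaleC_left using t(2) v(1) by (intro sum.cong) (auto simp: assms subset_iff)
  also have "\<dots> = u v" using t v by simp
  finally show False using v by simp
qed

text \<open>Maximality replaces the Gram-Schmidt recursion: an orthonormal set of largest
  cardinality must span, since a vector outside its span, stripped of its components and normalised,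
  would enlarge it. Finite dimension enters as the bound \<open>N\<close> on independent
  sets.\<close>

lemma orthonormal_basis_exists:
  assumes V: "csubspace (V :: 'a::complex_hilbert set)"
    and bound: "\<And>S. S \<subseteq> V \<Longrightarrow> finite S \<Longrightarrow> \<not> cdependent S \<Longrightarrow> card S \<le> N"
  obtains r :: nat and e where "\<And>i j. i < r \<Longrightarrow> j < r \<Longrightarrow> cinner (e i) (e j) = (if i = j then 1 else 0)"
    "cspan (e ` {..<r}) = V"
proof -
  define P where "P S \<longleftrightarrow> S \<subseteq> V \<and> finite S \<and>
    (\<forall>x\<in>S. \<forall>y\<in>S. cinner x y = (if x = y then 1 else 0))" for S
  have "P {}" by (simp add: P_def)
  moreover have "card S \<le> N" if "P S" for S
    using that bound[of S] orthonormal_independent[of S] by (auto simp: P_def)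
  ultimately obtain S where S: "P S" and max: "\<And>S'. P S' \<Longrightarrow> card S' \<le> card S"
    using ex_has_greatest_nat[of P "{}" card "Suc N"] by (metis less_Suc_eq_le)
  have fin: "finite S" and SV: "S \<subseteq> V"
    and on: "\<And>x y. x \<in> S \<Longrightarrow> y \<in> S \<Longrightarrow> cinner x y = (if x = y then 1 else 0)"
    using S by (auto simp: P_def)
  have "v \<in> cspan S" if v: "v \<in> V" for v
  proof (rule ccontr)
    assume nin: "v \<notin> cspan S"
    define u where "u = v - (\<Sum>x\<in>S. cinner v x *\<^sub>C x)"
    have sp: "(\<Sum>x\<in>S. cinner v x *\<^sub>C x) \<in> cspan S"
      by (intro complex_vector.span_sum complex_vector.span_scale complex_vector.span_base)
    then have u0: "u \<noteq> 0" using nin by (auto simp: u_def)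
    have "(\<Sum>x\<in>S. cinner v x *\<^sub>C x) \<in> V"
      using sp complex_vector.span_minimal[OF SV V] by blast
    then have uV: "u \<in> V" unfolding u_def by (intro csubspace_diff[OF V] v)
    have uo: "cinner u y = 0" if "y \<in> S" for y
    proof -
      have "cinner (\<Sum>x\<in>S. cinner v x *\<^sub>C x) y = (\<Sum>x\<in>S. if x = y then cinner v x else 0)"
        unfolding cinner_sum_left cinner_scaleC_left using that by (intro sum.cong) (auto simp: on)
      also have "\<dots> = cinner v y" using fin that by simp
      finally show ?thesis by (simp add: u_def cinner_diff_left)
    qed
    define w where "w = (1 / norm u) *\<^sub>R u"
    have nw: "norm w = 1" using u0 by (simp add: w_def)
    have wo: "cinner w y = 0" if "y \<in> S" for y
      using uo[OF that] by (simp add: w_def scaleR_scaleC cinner_scaleC_left)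
    have ww: "cinner w w = 1" using nw by (simp add: cinner_self)
    have nS: "w \<notin> S" using wo[of w] ww by auto
    have "w \<in> V" unfolding w_def by (rule csubspace_scaleR[OF V uV])
    moreover have "cinner y w = 0" if "y \<in> S" for y
      using wo[OF that] by (subst cinner_eq_0_commute)
    ultimately have "P (insert w S)"
      using fin SV on wo ww nS unfolding P_def by (intro conjI ballI) auto
    then show False using max[of "insert w S"] fin nS by simp
  qed
  then have span: "cspan S = V" using complex_vector.span_minimal[OF SV V] by auto
  obtain e where e: "bij_betw e {..<card S} S"
    using ex_bij_betw_nat_finite[OF fin] atLeast0LessThan by metis
  show thesis
  proof (rule that[of "card S" e])
    show "cinner (e i) (e j) = (if i = j then 1 else 0)" if "i < card S" "j < card S" for i j
    proof -
      have "e i \<in> S" "e j \<in> S" "e i = e j \<longleftrightarrow> i = j"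
        using that e by (auto simp: bij_betw_def inj_on_eq_iff)
      then show ?thesis by (simp add: on)
    qed
    show "cspan (e ` {..<card S}) = V" using e span by (simp add: bij_betw_def)
  qed
qed

text \<open>The two conclusions are what a frame in \<open>holomorphic_subbundle\<close> has to
  satisfy. A repeated member would be the relation \<open>s i - s j = 0\<close>, so both follow from
  the absence of relations among the indexed vectors.\<close>

lemma independent_familyI:
  fixes s :: "nat \<Rightarrow> 'a::complex_hilbert"
  assumes zero: "\<And>c i. (\<Sum>i<r. c i *\<^sub>C s i) = 0 \<Longrightarrow> i < r \<Longrightarrow> c i = 0"
  shows "inj_on s {..<r} \<and> \<not> cdependent (s ` {..<r})"
proof -
  have inj: "inj_on s {..<r}"
  proof (rule inj_onI)
    fix i j assume ij: "i \<in> {..<r}" "j \<in> {..<r}" "s i = s j"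
    show "i = j"
    proof (rule ccontr)
      assume ne: "i \<noteq> j"
      let ?c = "\<lambda>k. if k = i then 1 else if k = j then -1 else (0::complex)"
      have "(\<Sum>k<r. ?c k *\<^sub>C s k) = (\<Sum>k\<in>{i,j}. ?c k *\<^sub>C s k)"
        using ij by (intro sum.mono_neutral_right) auto
      also have "\<dots> = 0" using ne ij(3) by (simp add: complex_vector.scale_minus_left)
      finally show False using zero[of ?c i] ij by auto
    qed
  qed
  moreover have "\<not> cdependent (s ` {..<r})"
  proof
    assume "cdependent (s ` {..<r})"
    then obtain u where u: "(\<Sum>v\<in>s ` {..<r}. u v *\<^sub>C v) = 0" "\<exists>v\<in>s ` {..<r}. u v \<noteq> 0"
      unfolding complex_vector.dependent_finite[OF finite_imageI[OF finite_lessThan]] by auto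
    then have "(\<Sum>i<r. u (s i) *\<^sub>C s i) = 0" by (simp add: sum.reindex[OF inj])
    from zero[OF this] u(2) show False by auto
  qed
  ultimately show ?thesis ..
qed


text \<open>Pairing a relation with \<open>e j\<close> gives |c j| \<le> A m, where A is the sum of
  all |c i| and m the largest deviation. Summing over j yields A \<le> r m A with r m < 1, so A = 0.
  This keeps holomorphic sections independent near a point where they are orthonormal.\<close>

lemma near_orthonormal_independent:
  fixes s e :: "nat \<Rightarrow> 'a::complex_hilbert"
  assumes on: "\<And>i j. i < r \<Longrightarrow> j < r \<Longrightarrow> cinner (e i) (e j) = (if i = j then 1 else 0)"
    and near: "\<And>i. i < r \<Longrightarrow> norm (s i - e i) * r < 1"
  shows "inj_on s {..<r} \<and> \<not> cdependent (s ` {..<r})"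
proof (rule independent_familyI)
  show "c i = 0" if c: "(\<Sum>i<r. c i *\<^sub>C s i) = 0" and i: "i < r" for c i
  proof -
    define A where "A = (\<Sum>i<r. cmod (c i))"
    define m where "m = Max ((\<lambda>i. norm (s i - e i)) ` {..<r})"
    have r: "r > 0" using i by auto
    have m_ge: "norm (s i - e i) \<le> m" if "i < r" for i unfolding m_def using that by (intro Max_ge) auto
    have m: "m * r < 1"
    proof -
      have "m \<in> (\<lambda>i. norm (s i - e i)) ` {..<r}" unfolding m_def using r by (intro Max_in) auto
      then obtain k where "k < r" "m = norm (s k - e k)" by auto
      then show ?thesis using near[of k] by simp
    qed
    have m0: "0 \<le> m" using m_ge[OF i] norm_ge_zero order_trans by blast
    have "cmod (c j) \<le> A * m" if j: "j < r" for j
    proof -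
      have "(norm (e j))\<^sup>2 = 1"
        using on[OF j j] cinner_self[of "e j"] of_real_eq_1_iff[of "(norm (e j))\<^sup>2"]
        by (simp del: of_real_power)
      then have nj: "norm (e j) = 1" by (metis abs_norm_cancel abs_1 abs_minus_cancel power2_eq_1_iff)
      have "(\<Sum>i<r. c i * cinner (s i - e i) (e j)) + (\<Sum>i<r. c i * cinner (e i) (e j)) = 0"
        using arg_cong[OF c, of "\<lambda>x. cinner x (e j)"]
        unfolding cinner_sum_left cinner_scaleC_left cinner_diff_left right_diff_distrib sum_subtractf
        by simp
      moreover have "(\<Sum>i<r. c i * cinner (e i) (e j)) = (\<Sum>i<r. if i = j then c i else 0)"
        using j by (intro sum.cong) (auto simp: on)
      moreover have "\<dots> = c j" using j by simp
      ultimately have "c j = - (\<Sum>i<r. c i * cinner (s i - e i) (e j))"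
        by (simp add: add_eq_0_iff)
      then have "cmod (c j) = cmod (\<Sum>i<r. c i * cinner (s i - e i) (e j))"
        by (simp only: norm_minus_cancel)
      also have "\<dots> \<le> (\<Sum>i<r. cmod (c i) * m)"
      proof (rule sum_norm_le)
        fix i assume "i \<in> {..<r}"
        then have "cmod (cinner (s i - e i) (e j)) \<le> m"
          using norm_cinner_le[of "s i - e i" "e j"] m_ge[of i] nj by simp
        then show "cmod (c i * cinner (s i - e i) (e j)) \<le> cmod (c i) * m"
          by (simp add: norm_mult mult_left_mono)
      qed
      finally show ?thesis by (simp add: A_def sum_distrib_right)
    qed
    then have "(\<Sum>j<r. cmod (c j)) \<le> (\<Sum>j<r. A * m)" by (intro sum_mono) simp
    then have "A \<le> r * (A * m)" by (simp add: A_def[symmetric])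
    then have "A * (1 - m * r) \<le> 0" by (simp add: algebra_simps)
    then have "A \<le> 0" using m by (simp add: mult_le_0_iff)
    moreover have "cmod (c i) \<le> A" unfolding A_def using i by (intro member_le_sum) auto
    ultimately have "cmod (c i) \<le> 0" by linarith
    then show ?thesis by simp
  qed
qed

section \<open>Kernels of polynomials in the backward shift\<close>

text \<open>Linear factors have to stay visible as products \<open>[:- a, 1:] * q\<close>; these
  simplification rules would expand them.\<close>

declare mult_pCons_left [simp del] mult_pCons_right [simp del]

section \<open>Square sums of sequences through their truncations\<close>

definition l2n :: "(nat \<Rightarrow> complex) \<Rightarrow> nat \<Rightarrow> real"
  where "l2n a N = L2_set (\<lambda>n. cmod (a n)) {..<N}"

text \<open>A bound on the l2 norm stated for truncations only. Summability is then a conclusion and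
  not a side condition, and terms can be absorbed in inequalities because every truncation is
  finite.\<close>

definition l2b :: "(nat \<Rightarrow> complex) \<Rightarrow> real \<Rightarrow> bool"
  where "l2b a B \<longleftrightarrow> (\<forall>N. l2n a N \<le> B)"

lemma l2n_nonneg [simp]: "0 \<le> l2n a N"
  by (simp add: l2n_def)

lemma l2n_power2: "(l2n a N)\<^sup>2 = (\<Sum>n<N. (cmod (a n))\<^sup>2)"
  by (simp add: l2n_def L2_set_def sum_nonneg)

lemma l2n_add: "l2n (\<lambda>n. a n + b n) N \<le> l2n a N + l2n b N"
  unfolding l2n_def
  by (rule order_trans[OF L2_set_mono L2_set_triangle_ineq]) (auto intro: norm_triangle_ineq)

lemma l2n_cmult: "l2n (\<lambda>n. c * a n) N = cmod c * l2n a N"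
  by (simp add: l2n_def norm_mult L2_set_right_distrib)

lemma l2n_uminus [simp]: "l2n (\<lambda>n. - a n) N = l2n a N"
  by (simp add: l2n_def)

lemma l2n_diff: "l2n (\<lambda>n. a n - b n) N \<le> l2n a N + l2n b N"
  using l2n_add[of a "\<lambda>n. - b n" N] by simp

lemma l2n_mono: "N \<le> M \<Longrightarrow> l2n a N \<le> l2n a M"
  by (rule power2_le_imp_le) (auto simp: l2n_power2 intro!: sum_mono2)

lemma l2n_le: "(\<And>n. n < N \<Longrightarrow> cmod (a n) \<le> cmod (b n)) \<Longrightarrow> l2n a N \<le> l2n b N"
  unfolding l2n_def by (rule L2_set_mono) auto

lemma norm_le_l2n: "n < N \<Longrightarrow> cmod (a n) \<le> l2n a N"
  unfolding l2n_def using member_le_L2_set[of "{..<N}" n "\<lambda>n. cmod (a n)"] by simp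

lemma l2n_Suc: "l2n a (Suc N) \<le> l2n a N + cmod (a N)"
proof (rule power2_le_imp_le)
  show "(l2n a (Suc N))\<^sup>2 \<le> (l2n a N + cmod (a N))\<^sup>2"
    by (simp add: power2_sum) (simp add: l2n_power2)
qed simp

lemma l2n_Suc_shift: "l2n a (Suc N) \<le> cmod (a 0) + l2n (\<lambda>n. a (Suc n)) N"
proof (rule power2_le_imp_le)
  show "(l2n a (Suc N))\<^sup>2 \<le> (cmod (a 0) + l2n (\<lambda>n. a (Suc n)) N)\<^sup>2"
    by (simp add: power2_sum) (simp add: l2n_power2 sum.lessThan_Suc_shift del: sum.lessThan_Suc)
qed simp

lemma l2n_shift_le: "l2n (\<lambda>n. a (Suc n)) N \<le> l2n a (Suc N)"
  by (rule power2_le_imp_le) (auto simp: l2n_power2 sum.lessThan_Suc_shift simp del: sum.lessThan_Suc)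

lemma l2bD: "l2b a B \<Longrightarrow> l2n a N \<le> B"
  by (simp add: l2b_def)

lemma l2b_nonneg: "l2b a B \<Longrightarrow> 0 \<le> B"
  using l2bD[of a B 0] l2n_nonneg order_trans by blast

lemma l2b_norm_le: "l2b a B \<Longrightarrow> cmod (a n) \<le> B"
  using l2bD[of a B "Suc n"] norm_le_l2n[of n "Suc n" a] by simp

lemma l2b_mono: "l2b a B \<Longrightarrow> B \<le> C \<Longrightarrow> l2b a C"
  unfolding l2b_def using order_trans by blast

lemma l2b_add: "l2b a A \<Longrightarrow> l2b b B \<Longrightarrow> l2b (\<lambda>n. a n + b n) (A + B)"
  unfolding l2b_def by (blast intro: order_trans[OF l2n_add add_mono])

lemma l2b_diff: "l2b a A \<Longrightarrow> l2b b B \<Longrightarrow> l2b (\<lambda>n. a n - b n) (A + B)"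
  unfolding l2b_def by (blast intro: order_trans[OF l2n_diff add_mono])

lemma l2b_cmult: "l2b a B \<Longrightarrow> l2b (\<lambda>n. c * a n) (cmod c * B)"
  unfolding l2b_def by (simp add: l2n_cmult mult_left_mono)

lemma l2b_Suc: "l2b a B \<Longrightarrow> l2b (\<lambda>n. a (Suc n)) B"
  unfolding l2b_def using l2n_shift_le order_trans by blast

lemma l2b_shift: "l2b a B \<Longrightarrow> l2b (\<lambda>n. a (k + n)) B"
  by (induct k) (auto dest: l2b_Suc)

lemma l2b_sum:
  assumes "finite I" "\<And>i. i \<in> I \<Longrightarrow> l2b (f i) (B i)"
  shows "l2b (\<lambda>n. \<Sum>i\<in>I. f i n) (\<Sum>i\<in>I. B i)"
  using assms
proof (induct I rule: finite_induct)
  case empty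
  show ?case by (simp add: l2b_def l2n_def L2_set_def)
next
  case (insert i I)
  then show ?case using l2b_add[of "f i" "B i" "\<lambda>n. \<Sum>i\<in>I. f i n" "\<Sum>i\<in>I. B i"] by simp
qed

lemma square_summable_iff_l2b: "square_summable a \<longleftrightarrow> (\<exists>B. l2b a B)"
proof
  assume a: "square_summable a"
  have "l2n a N \<le> sqrt (\<Sum>\<^sub>\<infinity>n. (cmod (a n))\<^sup>2)" for N
  proof (rule real_le_rsqrt)
    show "(l2n a N)\<^sup>2 \<le> (\<Sum>\<^sub>\<infinity>n. (cmod (a n))\<^sup>2)"
      unfolding l2n_power2 using a by (intro finite_sum_le_infsum) (auto simp: square_summable_def)
  qed
  then show "\<exists>B. l2b a B" unfolding l2b_def by blast
next
  assume "\<exists>B. l2b a B"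
  then obtain B where B: "l2b a B" by blast
  show "square_summable a"
    unfolding square_summable_def
  proof (rule nonneg_bdd_above_summable_on)
    show "bdd_above (sum (\<lambda>n. (cmod (a n))\<^sup>2) ` {F. F \<subseteq> UNIV \<and> finite F})"
    proof (rule bdd_aboveI2[where M = "B\<^sup>2"])
      fix F :: "nat set" assume "F \<in> {F. F \<subseteq> UNIV \<and> finite F}"
      then obtain N where N: "F \<subseteq> {..<N}" using finite_nat_bounded[of F] by auto
      have "(\<Sum>n\<in>F. (cmod (a n))\<^sup>2) \<le> (\<Sum>n<N. (cmod (a n))\<^sup>2)" using N by (intro sum_mono2) auto
      also have "\<dots> = (l2n a N)\<^sup>2" by (simp add: l2n_power2)
      also have "\<dots> \<le> B\<^sup>2" by (intro power_mono l2bD[OF B]) simp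
      finally show "(\<Sum>n\<in>F. (cmod (a n))\<^sup>2) \<le> B\<^sup>2" .
    qed
  qed auto
qed

lemma square_summableI: "l2b a B \<Longrightarrow> square_summable a"
  using square_summable_iff_l2b by blast

lemma summable_mult_square_summable:
  fixes a b :: "nat \<Rightarrow> complex"
  assumes "square_summable a" "square_summable b"
  shows "summable (\<lambda>n. a n * b n)"
  using square_summable_mult[OF assms] by (simp add: summable_norm_cancel summable_on_UNIV_nonneg_real_iff)

text \<open>The truncated norm X satisfies X \<le> |u 0| + |a| X + B; as X is finite, the middle
  term moves to the left. So first-order recursion with |a| < 1 preserves square
  summability.\<close>

lemma l2b_forward:
  assumes v: "l2b v B" and a: "cmod a < 1" and u: "\<And>n. u (Suc n) = a * u n + v n"
  shows "l2b u ((cmod (u 0) + B) / (1 - cmod a))"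
  unfolding l2b_def
proof
  fix N
  have "l2n u (Suc N) \<le> cmod (u 0) + l2n (\<lambda>n. a * u n + v n) N"
    using l2n_Suc_shift[of u N] by (simp add: u)
  also have "l2n (\<lambda>n. a * u n + v n) N \<le> cmod a * l2n u N + B"
    using l2n_add[of "\<lambda>n. a * u n" v N] l2bD[OF v, of N] by (simp add: l2n_cmult)
  finally have "l2n u (Suc N) \<le> cmod (u 0) + cmod a * l2n u N + B" by simp
  then have "l2n u N \<le> cmod (u 0) + cmod a * l2n u N + B"
    using l2n_mono[of N "Suc N" u] by simp
  then have "l2n u N * (1 - cmod a) \<le> cmod (u 0) + B" by (simp add: algebra_simps)
  then show "l2n u N \<le> (cmod (u 0) + B) / (1 - cmod a)" using a by (simp add: field_simps)
qed

text \<open>The solution of \<open>u n = v n + c * u (Suc n)\<close> obtained from infinity. With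
  \<open>c = 1 / a\<close> it inverts the backward shift minus a for |a| > 1, where forward
  recursion would explode; with \<open>c = a\<close> it gives the coefficients of a series divided
  by w - a for |a| < 1.\<close>

definition backward_sum :: "complex \<Rightarrow> (nat \<Rightarrow> complex) \<Rightarrow> nat \<Rightarrow> complex"
  where "backward_sum c v n = (\<Sum>k. c ^ k * v (n + k))"

lemma backward_sum:
  assumes v: "l2b v B" and c: "cmod c < 1"
  shows backward_sum_rec: "backward_sum c v n = v n + c * backward_sum c v (Suc n)"
    and l2b_backward_sum: "l2b (backward_sum c v) (B / (1 - cmod c)\<^sup>2)"
proof -
  have le: "norm (c ^ k * v (n + k)) \<le> cmod c ^ k * B" for n k
    using l2b_norm_le[OF v, of "n + k"] by (simp add: norm_mult norm_power mult_left_mono)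
  have gs: "(\<lambda>k. cmod c ^ k * B) sums (1 / (1 - cmod c) * B)"
    using c by (intro sums_mult2 geometric_sums) simp
  have sm: "summable (\<lambda>k. c ^ k * v (n + k))" for n
    by (rule summable_comparison_test'[of "\<lambda>k. cmod c ^ k * B"]) (use gs le in \<open>auto simp: sums_iff\<close>)
  show rec: "backward_sum c v n = v n + c * backward_sum c v (Suc n)" for n
  proof -
    have "backward_sum c v n = c ^ 0 * v (n + 0) + (\<Sum>k. c ^ Suc k * v (n + Suc k))"
      unfolding backward_sum_def using suminf_split_head[OF sm[of n]] by simp
    also have "(\<Sum>k. c ^ Suc k * v (n + Suc k)) = c * backward_sum c v (Suc n)"
      unfolding backward_sum_def suminf_mult[OF sm, symmetric] by (simp add: mult.assoc)
    finally show ?thesis by simp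
  qed
  \<comment> \<open>The truncation of the shifted sequence contains the extra entry
    \<open>u N\<close>, which this sup bound controls. It also causes the second factor 1 / (1 -
    |c|) in the final bound.\<close>
  have bd: "cmod (backward_sum c v n) \<le> B / (1 - cmod c)" for n
    unfolding backward_sum_def
    using norm_suminf_le[of "\<lambda>k. c ^ k * v (n + k)", OF le] gs by (simp add: sums_iff)
  show "l2b (backward_sum c v) (B / (1 - cmod c)\<^sup>2)"
    unfolding l2b_def
  proof
    fix N
    let ?u = "backward_sum c v"
    have "l2n ?u N = l2n (\<lambda>n. v n + c * ?u (Suc n)) N" using rec by metis
    also have "\<dots> \<le> B + cmod c * l2n (\<lambda>n. ?u (Suc n)) N"
      using l2n_add[of v "\<lambda>n. c * ?u (Suc n)" N] l2bD[OF v, of N] by (simp add: l2n_cmult)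
    also have "\<dots> \<le> B + cmod c * (l2n ?u N + B / (1 - cmod c))"
      using l2n_shift_le[of ?u N] l2n_Suc[of ?u N] bd[of N] by (intro add_left_mono mult_left_mono) auto
    finally have "l2n ?u N * (1 - cmod c) \<le> B + cmod c * (B / (1 - cmod c))" by (simp add: algebra_simps)
    also have "\<dots> = B / (1 - cmod c)" using c by (simp add: field_simps)
    finally have "l2n ?u N \<le> B / (1 - cmod c) / (1 - cmod c)" using c by (simp add: pos_le_divide_eq)
    then show "l2n ?u N \<le> B / (1 - cmod c)\<^sup>2" by (simp add: power2_eq_square)
  qed
qed

section \<open>Polynomials in the backward shift\<close>

definition pact :: "complex poly \<Rightarrow> (nat \<Rightarrow> complex) \<Rightarrow> nat \<Rightarrow> complex"
  where "pact q g j = (\<Sum>i\<le>degree q. coeff q i * g (i + j))"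

lemma pact_altdef: "degree q \<le> N \<Longrightarrow> pact q g j = (\<Sum>i\<le>N. coeff q i * g (i + j))"
  unfolding pact_def by (rule sum.mono_neutral_left) (auto simp: coeff_eq_0)

lemma pact_0 [simp]: "pact 0 g j = 0"
  by (simp add: pact_def)

lemma pact_pCons: "pact (pCons a q) g j = a * g j + pact q g (Suc j)"
proof -
  have "pact (pCons a q) g j = (\<Sum>i\<le>Suc (degree q). coeff (pCons a q) i * g (i + j))"
    by (rule pact_altdef) (rule degree_pCons_le)
  also have "\<dots> = a * g j + pact q g (Suc j)"
    unfolding sum.atMost_Suc_shift by (simp add: pact_def)
  finally show ?thesis .
qed

lemma pact_add: "pact (p + q) g j = pact p g j + pact q g j"
  using pact_altdef[of p "max (degree p) (degree q)" g j] pact_altdef[of q "max (degree p) (degree q)" g j]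
    pact_altdef[of "p + q" "max (degree p) (degree q)" g j] degree_add_le_max[of p q]
  by (simp add: sum.distrib distrib_right)

lemma pact_smult: "pact (smult c q) g j = c * pact q g j"
  using pact_altdef[OF degree_smult_le, of c q g j] by (simp add: pact_def sum_distrib_left mult.assoc)

text \<open>\<open>pact q\<close> is q evaluated at the backward shift, so products become
  compositions. Its kernel consists of the solutions of the linear recurrence with characteristic
  polynomial q, and it can be analysed one root at a time.\<close>

lemma pact_mult: "pact (p * q) g = pact p (pact q g)"
proof (induct p)
  case 0
  show ?case by (rule ext) simp
next
  case (pCons a p)
  then show ?case by (auto simp: fun_eq_iff pact_add pact_smult pact_pCons mult_pCons_left)
qed

lemma pact_linear_factor: "pact [:- a, 1:] g = (\<lambda>j. g (Suc j) - a * g j)"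
  by (rule ext) (simp add: pact_pCons)

lemma pact_zero_right [simp]: "pact q (\<lambda>_. 0) = (\<lambda>_. 0)"
  by (rule ext) (simp add: pact_def)

lemma pact_sum_right: "pact q (\<lambda>n. \<Sum>i\<in>I. c i * f i n) j = (\<Sum>i\<in>I. c i * pact q (f i) j)"
  unfolding pact_def sum_distrib_left by (subst sum.swap) (simp add: mult_ac)

lemma l2b_pact: "l2b g B \<Longrightarrow> l2b (pact q g) (\<Sum>i\<le>degree q. cmod (coeff q i) * B)"
  unfolding pact_def[abs_def] by (intro l2b_sum l2b_cmult l2b_shift) auto

lemma square_summable_pact: "square_summable g \<Longrightarrow> square_summable (pact q g)"
  using l2b_pact unfolding square_summable_iff_l2b by blast

section \<open>Square summable solutions and the number of zeros\<close>

definition ker2 :: "complex poly \<Rightarrow> (nat \<Rightarrow> complex) set"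
  where "ker2 q = {g. square_summable g \<and> pact q g = (\<lambda>_. 0)}"

text \<open>The radius is kept variable: near a slice with zeros on the unit circle only the count
  inside a smaller, zero-free circle is locally constant.\<close>

definition zcount :: "real \<Rightarrow> complex poly \<Rightarrow> nat"
  where "zcount r q = (\<Sum>w | w \<in> ball 0 r \<and> poly q w = 0. order w q)"

lemma disk_zeros_eq_zcount: "disk_zeros q = zcount 1 q"
  by (simp add: disk_zeros_def zcount_def)

lemma order_linear_factor: "order w [:- a, 1:] = (if w = a then 1 else 0)" for a :: complex
  using order_power_n_n[of a 1] by (auto simp: order_0I)

lemma zcount_linear_factor:
  assumes q: "q \<noteq> 0"
  shows "zcount r ([:- a, 1:] * q) = (if cmod a < r then 1 else 0) + zcount r q"
proof -
  let ?p = "[:- a, 1:] * q"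
  define R where "R = {w \<in> ball 0 r. poly ?p w = 0}"
  have p: "?p \<noteq> 0" using q by (simp del: mult_pCons_left)
  have fin: "finite R" unfolding R_def by (rule finite_subset[OF _ poly_roots_finite[OF p]]) auto
  have "zcount r ?p = (\<Sum>w\<in>R. order w ?p)" by (simp add: zcount_def R_def)
  also have "\<dots> = (\<Sum>w\<in>R. (if w = a then 1 else 0)) + (\<Sum>w\<in>R. order w q)"
    using order_mult[OF p] by (simp add: order_linear_factor sum.distrib)
  also have "(\<Sum>w\<in>R. (if w = a then 1 else 0)) = (if cmod a < r then 1 else 0)"
    using fin by (simp add: R_def)
  also have "(\<Sum>w\<in>R. order w q) = zcount r q"
    unfolding zcount_def
    by (rule sum.mono_neutral_right[OF fin]) (auto simp: R_def order_0I)
  finally show ?thesis .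
qed

lemma zcount_const: "c \<noteq> 0 \<Longrightarrow> zcount r [:c:] = 0"
  by (simp add: zcount_def)

text \<open>Splitting off roots over the complex numbers turns each later statement about
  recurrences into one about a single linear factor, with nonzero constants as the base
  case.\<close>

lemma poly_linear_induct [consumes 1, case_names const linear]:
  fixes q :: "complex poly"
  assumes "q \<noteq> 0" and "\<And>c. c \<noteq> 0 \<Longrightarrow> P [:c:]"
    and "\<And>a q. q \<noteq> 0 \<Longrightarrow> P q \<Longrightarrow> P ([:- a, 1:] * q)"
  shows "P q"
  using assms(1)
proof (induct "degree q" arbitrary: q)
  case 0
  then obtain c where "q = [:c:]" by (metis degree_eq_zeroE)
  then show ?case using 0 assms(2) by auto
next
  case (Suc n)
  have "\<exists>i\<in>{1..degree q}. coeff q i \<noteq> 0"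
    using Suc(2,3) by (intro bexI[of _ "degree q"]) auto
  then obtain a where "poly q a = 0"
    using fundamental_theorem_of_algebra[of "coeff q" "degree q"] by (auto simp: poly_altdef)
  then obtain q' where q': "q = [:- a, 1:] * q'" using poly_eq_0_iff_dvd by (metis dvdE)
  with Suc have "q' \<noteq> 0" by auto
  with Suc(2) q' have "degree q' = n" by (simp add: degree_mult_eq)
  then show ?case using Suc.hyps(1)[of q'] assms(3) q' \<open>q' \<noteq> 0\<close> by auto
qed

text \<open>For |a| < 1 forward recursion preserves square summability, so \<open>u\<close> is
  square summable as soon as its image under the factor is. Commutativity of the product lets the
  factor act first.\<close>

lemma ker2_linear_factor_inside:
  assumes "cmod a < 1"
  shows "u \<in> ker2 ([:- a, 1:] * q) \<longleftrightarrow> (\<lambda>j. u (Suc j) - a * u j) \<in> ker2 q"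
proof -
  let ?u' = "\<lambda>j. u (Suc j) - a * u j"
  have eq: "pact ([:- a, 1:] * q) u = pact q ?u'"
    using pact_mult[of q "[:- a, 1:]" u] by (simp only: mult.commute[of q] pact_linear_factor)
  have "square_summable u \<longleftrightarrow> square_summable ?u'"
  proof
    assume "square_summable u"
    from square_summable_pact[OF this, of "[:- a, 1:]"] show "square_summable ?u'"
      by (simp only: pact_linear_factor)
  next
    assume "square_summable ?u'"
    then obtain B where B: "l2b ?u' B" by (auto simp: square_summable_iff_l2b)
    show "square_summable u" by (rule square_summableI[OF l2b_forward[OF B assms]]) simp
  qed
  with eq show ?thesis by (simp add: ker2_def)
qed

text \<open>\<open>x = pact q u\<close> satisfies \<open>x (Suc n) = a * x n\<close>, so its moduli
  do not decrease; being square summable it tends to 0 and hence vanishes. Roots on the unit circle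
  are covered.\<close>

lemma ker2_linear_factor_outside:
  assumes a: "cmod a \<ge> 1"
  shows "ker2 ([:- a, 1:] * q) = ker2 q"
proof
  show "ker2 q \<subseteq> ker2 ([:- a, 1:] * q)" unfolding ker2_def pact_mult by auto
  show "ker2 ([:- a, 1:] * q) \<subseteq> ker2 q"
  proof
    fix u assume u: "u \<in> ker2 ([:- a, 1:] * q)"
    define x where "x = pact q u"
    have "square_summable x" unfolding x_def using u square_summable_pact by (auto simp: ker2_def)
    have "pact [:- a, 1:] x = (\<lambda>_. 0)"
      using u by (simp add: ker2_def pact_mult x_def del: mult_pCons_left)
    then have rec: "x (Suc n) = a * x n" for n by (auto simp: pact_linear_factor fun_eq_iff)
    have "summable (\<lambda>n. cmod (x n) * cmod (x n))"
      using \<open>square_summable x\<close>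
      by (simp add: square_summable_def power2_eq_square summable_on_UNIV_nonneg_real_iff)
    then have "(\<lambda>n. cmod (x n) * cmod (x n)) \<longlonglongrightarrow> 0" by (rule summable_LIMSEQ_zero)
    then have lim: "(\<lambda>n. cmod (x n)) \<longlonglongrightarrow> 0"
      using tendsto_real_sqrt[of "\<lambda>n. cmod (x n) * cmod (x n)" 0] by simp
    have "x n = 0" for n
    proof -
      have "cmod (x n) \<le> cmod (x (n + k))" for k
      proof (induct k)
        case (Suc k)
        have "1 * cmod (x (n + k)) \<le> cmod a * cmod (x (n + k))" using a by (intro mult_right_mono) auto
        then show ?case using Suc by (simp add: rec norm_mult)
      qed simp
      moreover have "(\<lambda>k. cmod (x (k + n))) \<longlonglongrightarrow> 0" using lim by (rule LIMSEQ_ignore_initial_segment)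
      ultimately have "cmod (x n) \<le> 0"
        by (intro LIMSEQ_le_const[of "\<lambda>k. cmod (x (k + n))"]) (auto simp: add.commute)
      then show ?thesis by simp
    qed
    then have "pact q u = (\<lambda>_. 0)" by (simp add: x_def fun_eq_iff)
    with u show "u \<in> ker2 q" by (simp add: ker2_def)
  qed
qed

lemma ker2_const: "c \<noteq> 0 \<Longrightarrow> ker2 [:c:] = {\<lambda>_. 0}"
  by (auto simp: ker2_def pact_def fun_eq_iff square_summable_zero)

text \<open>So \<open>ker2 q\<close> has dimension \<open>zcount 1 q\<close>: its elements are parametrised by their
  first \<open>zcount 1 q\<close> entries.\<close>

lemma ker2_initial_values:
  assumes "q \<noteq> 0"
  shows "(\<exists>u\<in>ker2 q. \<forall>j<zcount 1 q. u j = v j) \<and>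
    (\<forall>u\<in>ker2 q. (\<forall>j<zcount 1 q. u j = 0) \<longrightarrow> u = (\<lambda>_. 0))"
  using assms
proof (induct q arbitrary: v rule: poly_linear_induct)
  case (const c)
  then show ?case by (simp add: ker2_const zcount_const)
next
  case (linear a q)
  show ?case
  proof (cases "cmod a < 1")
    case True
    obtain u' where u': "u' \<in> ker2 q" "\<And>j. j < zcount 1 q \<Longrightarrow> u' j = v (Suc j) - a * v j"
      using linear(2)[of "\<lambda>j. v (Suc j) - a * v j"] by blast
    \<comment> \<open>Undoes the factor \<open>[:- a, 1:]\<close>. The free value \<open>v 0\<close>
      is the one extra parameter that a root inside the disk contributes.\<close>
    define u where "u = rec_nat (v 0) (\<lambda>n x. a * x + u' n)"
    have u: "u 0 = v 0" "\<And>n. u (Suc n) = a * u n + u' n" by (simp_all add: u_def)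
    have uv: "u j = v j" if "j < Suc (zcount 1 q)" for j
      using that by (induct j) (auto simp: u u'(2))
    have uk: "u \<in> ker2 ([:- a, 1:] * q)"
      unfolding ker2_linear_factor_inside[OF True] by (simp add: u u'(1))
    have "x = (\<lambda>_. 0)" if x: "x \<in> ker2 ([:- a, 1:] * q)" "\<forall>j<Suc (zcount 1 q). x j = 0" for x
    proof -
      have "(\<lambda>j. x (Suc j) - a * x j) = (\<lambda>_. 0)"
        using linear(2)[of v] x unfolding ker2_linear_factor_inside[OF True] by auto
      then have "x (Suc j) = a * x j" for j by (auto simp: fun_eq_iff)
      then have "x j = 0" for j using x(2) by (induct j) auto
      then show ?thesis by auto
    qed
    with uv uk show ?thesis
      using True zcount_linear_factor[OF linear(1), of 1 a] by (auto simp del: mult_pCons_left)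
  next
    case False
    then show ?thesis using linear(2)[of v] zcount_linear_factor[OF linear(1), of 1 a]
      by (simp add: ker2_linear_factor_outside del: mult_pCons_left)
  qed
qed

text \<open>One root at a time, with constants multiplying: forward recursion from 0 for a root
  inside the disk, the backward sum with 1 / a for a root outside. Both constants blow up as |a|
  tends to 1, which is why roots on the circle are excluded. The uniform constant later becomes the
  norm bound of a right inverse.\<close>

lemma pact_surj:
  assumes "q \<noteq> 0" "\<And>w. cmod w = 1 \<Longrightarrow> poly q w \<noteq> 0"
  shows "\<exists>C\<ge>0. \<forall>v B. l2b v B \<longrightarrow> (\<exists>u. l2b u (C * B) \<and> pact q u = v)"
  using assms
proof (induct q rule: poly_linear_induct)
  case (const c)
  show ?case
  proof (intro exI[of _ "cmod (1 / c)"] conjI allI impI)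
    fix v B assume "l2b v B"
    then show "\<exists>u. l2b u (cmod (1 / c) * B) \<and> pact [:c:] u = v"
      using const by (intro exI[of _ "\<lambda>n. 1 / c * v n"] conjI l2b_cmult) (auto simp: pact_def)
  qed simp
next
  case (linear a q)
  have "\<forall>w. cmod w = 1 \<longrightarrow> poly q w \<noteq> 0" and a1: "cmod a \<noteq> 1"
    using linear.prems by (auto simp del: mult_pCons_left)
  then obtain C where C: "C \<ge> 0" "\<And>v B. l2b v B \<Longrightarrow> \<exists>u. l2b u (C * B) \<and> pact q u = v"
    using linear.hyps(2) by blast
  have "\<exists>D\<ge>0. \<forall>v B. l2b v B \<longrightarrow> (\<exists>u. l2b u (D * B) \<and> pact [:- a, 1:] u = v)"
  proof (cases "cmod a < 1")
    case True
    show ?thesis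
    proof (intro exI[of _ "1 / (1 - cmod a)"] conjI allI impI)
      fix v B assume v: "l2b v B"
      define u where "u = rec_nat 0 (\<lambda>n x. a * x + v n)"
      have u: "u 0 = 0" "\<And>n. u (Suc n) = a * u n + v n" by (simp_all add: u_def)
      have "l2b u ((cmod (u 0) + B) / (1 - cmod a))" using v True u(2) by (rule l2b_forward)
      then show "\<exists>u. l2b u (1 / (1 - cmod a) * B) \<and> pact [:- a, 1:] u = v"
        by (intro exI[of _ u]) (simp add: u pact_linear_factor)
    qed (use True in simp)
  next
    case False
    let ?c = "1 / a"
    have c: "cmod ?c < 1" using False a1 by (simp add: norm_divide divide_less_eq_1)
    show ?thesis
    proof (intro exI[of _ "cmod (- ?c) * (1 / (1 - cmod ?c)\<^sup>2)"] conjI allI impI)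
      fix v B assume v: "l2b v B"
      have "a \<noteq> 0" using False by auto
      have "(- ?c * backward_sum ?c v (Suc j)) - a * (- ?c * backward_sum ?c v j) = v j" for j
        using backward_sum_rec[OF v c, of j] \<open>a \<noteq> 0\<close> by (simp add: field_simps)
      moreover have "l2b (\<lambda>j. - ?c * backward_sum ?c v j) (cmod (- ?c) * (B / (1 - cmod ?c)\<^sup>2))"
        by (rule l2b_cmult[OF l2b_backward_sum[OF v c]])
      ultimately show "\<exists>u. l2b u (cmod (- ?c) * (1 / (1 - cmod ?c)\<^sup>2) * B) \<and> pact [:- a, 1:] u = v"
        by (intro exI[of _ "\<lambda>j. - ?c * backward_sum ?c v j"]) (auto simp: pact_linear_factor)
    qed simp
  qed
  then obtain D where D: "D \<ge> 0" "\<And>v B. l2b v B \<Longrightarrow> \<exists>u. l2b u (D * B) \<and> pact [:- a, 1:] u = v"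
    by blast
  show ?case
  proof (intro exI[of _ "C * D"] conjI allI impI)
    fix v B assume "l2b v B"
    with D(2) obtain u where u: "l2b u (D * B)" "pact [:- a, 1:] u = v" by blast
    with C(2) obtain u' where "l2b u' (C * (D * B))" "pact q u' = u" by blast
    with u show "\<exists>u. l2b u (C * D * B) \<and> pact ([:- a, 1:] * q) u = v"
      by (auto simp: pact_mult mult.assoc simp del: mult_pCons_left)
  qed (use C D in simp)
qed

text \<open>The coefficients of functions holomorphic on the open unit disk. This growth condition
  is weaker than square summability but survives division by w - a for |a| \<ge> 1, including |a| =
  1.\<close>

definition subexp :: "(nat \<Rightarrow> complex) \<Rightarrow> bool"
  where "subexp G \<longleftrightarrow> (\<forall>\<rho>. 0 \<le> \<rho> \<and> \<rho> < 1 \<longrightarrow> (\<exists>C. \<forall>n. cmod (G n) * \<rho> ^ n \<le> C))"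

lemma fps_linear_factor_nth:
  "fps_nth (fps_of_poly [:- a, 1:] * Abs_fps G) n = (if n = 0 then 0 else G (n - 1)) - a * G n"
  for a :: complex
proof -
  have "fps_of_poly [:- a, 1:] = fps_X - fps_const a"
    by (intro fps_ext) (auto simp: coeff_pCons split: nat.split)
  then show ?thesis by (simp only: left_diff_distrib fps_sub_nth fps_X_mult_nth fps_mult_left_const_nth) simp
qed

lemma l2b_subexp: "l2b F B \<Longrightarrow> subexp F"
  unfolding subexp_def
proof (intro allI impI exI[of _ B])
  fix \<rho> :: real and n assume F: "l2b F B" and \<rho>: "0 \<le> \<rho> \<and> \<rho> < 1"
  have "cmod (F n) * \<rho> ^ n \<le> B * 1"
    by (intro mult_mono l2b_norm_le[OF F] power_le_one) (use \<rho> l2b_nonneg[OF F] in auto)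
  then show "cmod (F n) * \<rho> ^ n \<le> B" by simp
qed

text \<open>For a root with |a| < 1, orthogonality to the powers of a says F(a) = 0, so F / (w - a)
  is again square summable and inherits the orthogonality to \<open>ker2 q\<close>. For |a| \<ge> 1
  the kernel does not see the root; division is then done last and only subexponential growth is
  claimed. The pairing has no conjugate because eigenvectors carry one.\<close>

lemma orth_ker2_imp_dvd:
  assumes "q \<noteq> 0" "square_summable F" "\<And>h. h \<in> ker2 q \<Longrightarrow> (\<Sum>n. F n * h n) = 0"
  shows "\<exists>G. subexp G \<and> Abs_fps F = fps_of_poly q * Abs_fps G"
  using assms
proof (induct q arbitrary: F rule: poly_linear_induct)
  case (const c)
  obtain B where "l2b F B" using const(2) by (auto simp: square_summable_iff_l2b)
  then have "subexp (\<lambda>n. 1 / c * F n)" using l2b_cmult l2b_subexp by blast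
  moreover have "Abs_fps F = fps_of_poly [:c:] * Abs_fps (\<lambda>n. 1 / c * F n)"
    using const(1) by (intro fps_ext) (simp add: fps_of_poly_const)
  ultimately show ?case by blast
next
  case (linear a q)
  obtain B where B: "l2b F B" using linear.prems(1) by (auto simp: square_summable_iff_l2b)
  show ?case
  proof (cases "cmod a < 1")
    case True
    define F' where "F' = backward_sum a (\<lambda>n. F (Suc n))"
    have F'2: "l2b F' (B / (1 - cmod a)\<^sup>2)" and F'rec: "F' n = F (Suc n) + a * F' (Suc n)" for n
      unfolding F'_def using l2b_Suc[OF B] True by (rule l2b_backward_sum backward_sum_rec)+
    have pow: "l2b (\<lambda>n. a ^ n) ((cmod (a ^ 0) + 0) / (1 - cmod a))"
      by (rule l2b_forward[OF _ True, of "\<lambda>_. 0"]) (auto simp: l2b_def l2n_def L2_set_def)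
    have "(\<lambda>n. a ^ n) \<in> ker2 ([:- a, 1:] * q)"
      unfolding ker2_linear_factor_inside[OF True] by (simp add: ker2_def square_summable_zero)
    then have "(\<Sum>n. F n * a ^ n) = 0" by (rule linear.prems(2))
    moreover have sm: "summable (\<lambda>n. F n * a ^ n)"
      by (rule summable_mult_square_summable[OF linear.prems(1) square_summableI[OF pow]])
    ultimately have "0 = F 0 + (\<Sum>n. F (Suc n) * a ^ Suc n)" using suminf_split_head[OF sm] by simp
    also have "(\<Sum>n. F (Suc n) * a ^ Suc n) = a * F' 0"
    proof -
      have "summable (\<lambda>n. F (Suc n) * a ^ n)"
        by (rule summable_mult_square_summable[OF square_summableI[OF l2b_Suc[OF B]] square_summableI[OF pow]])
      then have "a * (\<Sum>n. F (Suc n) * a ^ n) = (\<Sum>n. a * (F (Suc n) * a ^ n))" by (rule suminf_mult[symmetric])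
      then show ?thesis by (simp add: F'_def backward_sum_def mult_ac)
    qed
    \<comment> \<open>F(a) = 0, written so that the formula for the coefficients of (w - a) F' holds
      at index 0 as well.\<close>
    finally have F0: "F 0 = - a * F' 0" by (simp add: eq_neg_iff_add_eq_0)
    have Feq: "F n = (if n = 0 then 0 else F' (n - 1)) - a * F' n" for n
      using F0 F'rec[of "n - 1"] by (cases n) auto
    have "(\<Sum>n. F' n * h' n) = 0" if h': "h' \<in> ker2 q" for h'
    proof -
      \<comment> \<open>A preimage of \<open>h'\<close> under the linear factor. Shifting the index
        moves the factor from \<open>h\<close> to \<open>F'\<close>, so the pairing of
        \<open>F'\<close> with \<open>h'\<close> equals that of \<open>F\<close> with
        \<open>h\<close>, which vanishes.\<close>
      define h where "h = rec_nat 0 (\<lambda>n x. a * x + h' n)"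
      have h: "h 0 = 0" "\<And>n. h (Suc n) = a * h n + h' n" by (simp_all add: h_def)
      have hk: "h \<in> ker2 ([:- a, 1:] * q)"
        unfolding ker2_linear_factor_inside[OF True] by (simp add: h h')
      then have h2: "square_summable h" by (simp add: ker2_def)
      then obtain D where D: "l2b h D" by (auto simp: square_summable_iff_l2b)
      define A where "A n = (if n = 0 then 0 else F' (n - 1)) * h n" for n
      have s1: "summable (\<lambda>n. F' n * h (Suc n))"
        by (rule summable_mult_square_summable[OF square_summableI[OF F'2] square_summableI[OF l2b_Suc[OF D]]])
      have s2: "summable (\<lambda>n. F' n * h n)"
        by (rule summable_mult_square_summable[OF square_summableI[OF F'2] h2])
      have sA: "summable A" using s1 summable_Suc_iff[of A] by (simp add: A_def)
      have "suminf A = (\<Sum>n. F' n * h (Suc n))"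
        using suminf_split_head[OF sA] by (simp add: A_def)
      moreover have "0 = (\<Sum>n. A n - a * (F' n * h n))"
        using linear.prems(2)[OF hk] by (simp add: Feq A_def left_diff_distrib mult.assoc)
      ultimately have "0 = (\<Sum>n. F' n * h (Suc n)) - a * (\<Sum>n. F' n * h n)"
        using suminf_diff[OF sA summable_mult[OF s2, of a]] suminf_mult[OF s2, of a] by simp
      also have "\<dots> = (\<Sum>n. F' n * h (Suc n) - a * (F' n * h n))"
        using suminf_diff[OF s1 summable_mult[OF s2, of a]] suminf_mult[OF s2, of a] by simp
      also have "\<dots> = (\<Sum>n. F' n * h' n)" by (simp add: h algebra_simps)
      finally show ?thesis by simp
    qed
    then obtain G where G: "subexp G" "Abs_fps F' = fps_of_poly q * Abs_fps G"
      using linear.hyps(2)[OF square_summableI[OF F'2]] by blast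
    have "Abs_fps F = fps_of_poly [:- a, 1:] * Abs_fps F'"
      by (intro fps_ext) (simp only: fps_linear_factor_nth, simp add: Feq[symmetric])
    also have "\<dots> = fps_of_poly ([:- a, 1:] * q) * Abs_fps G"
      by (simp only: G(2) fps_of_poly_mult mult.assoc)
    finally show ?thesis using G(1) by blast
  next
    case False
    then have a: "cmod a \<ge> 1" "a \<noteq> 0" by auto
    obtain G' where G': "subexp G'" "Abs_fps F = fps_of_poly q * Abs_fps G'"
      using linear.hyps(2)[OF linear.prems(1)] linear.prems(2) ker2_linear_factor_outside[OF a(1)] by blast
    \<comment> \<open>Formal division of G' by w - a. As |a| \<ge> 1, dividing by a does not
      increase moduli, so with weights \<rho>^n the recursion contracts by \<rho> and the bound is C
      / (1 - \<rho>).\<close>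
    define G where "G = rec_nat (- G' 0 / a) (\<lambda>n x. (x - G' (Suc n)) / a)"
    have G: "G 0 = - G' 0 / a" "\<And>n. G (Suc n) = (G n - G' (Suc n)) / a" by (simp_all add: G_def)
    have "fps_of_poly [:- a, 1:] * Abs_fps G = Abs_fps G'"
    proof (intro fps_ext)
      fix n show "fps_nth (fps_of_poly [:- a, 1:] * Abs_fps G) n = fps_nth (Abs_fps G') n"
        unfolding fps_linear_factor_nth using a by (cases n) (auto simp: G)
    qed
    then have "Abs_fps F = fps_of_poly ([:- a, 1:] * q) * Abs_fps G"
      unfolding fps_of_poly_mult G'(2) by (simp only: mult.assoc mult.left_commute)
    moreover have "subexp G"
      unfolding subexp_def
    proof (intro allI impI)
      fix \<rho> :: real assume \<rho>: "0 \<le> \<rho> \<and> \<rho> < 1"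
      then obtain C where C: "\<And>n. cmod (G' n) * \<rho> ^ n \<le> C" using G'(1) unfolding subexp_def by blast
      have div: "cmod (x / a) \<le> cmod x" for x
        using a divide_left_mono[of 1 "cmod a" "cmod x"] by (simp add: norm_divide)
      have C0: "0 \<le> C" using C[of 0] norm_ge_zero[of "G' 0"] by (simp del: norm_ge_zero)
      have "cmod (G n) * \<rho> ^ n \<le> C / (1 - \<rho>)" for n
      proof (induct n)
        case 0
        have "cmod (G 0) \<le> C" using div[of "- G' 0"] C[of 0] by (simp add: G)
        also have "C \<le> C / (1 - \<rho>)" using \<rho> C0 by (simp add: field_simps)
        finally show ?case by simp
      next
        case (Suc n)
        have "cmod (G (Suc n)) * \<rho> ^ Suc n \<le> (cmod (G n) + cmod (G' (Suc n))) * \<rho> ^ Suc n"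
          unfolding G by (intro mult_right_mono order_trans[OF div] norm_triangle_ineq4) (use \<rho> in auto)
        also have "\<dots> = \<rho> * (cmod (G n) * \<rho> ^ n) + cmod (G' (Suc n)) * \<rho> ^ Suc n" by (simp add: algebra_simps)
        also have "\<dots> \<le> \<rho> * (C / (1 - \<rho>)) + C"
          using Suc \<rho> C[of "Suc n"] by (intro add_mono mult_left_mono) auto
        also have "\<dots> = C / (1 - \<rho>)" using \<rho> by (simp add: field_simps)
        finally show ?case .
      qed
      then show "\<exists>C. \<forall>n. cmod (G n) * \<rho> ^ n \<le> C" by blast
    qed
    ultimately show ?thesis by blast
  qed
qed

section \<open>The quotient module\<close>

lemma hcoeff_hardy_of_poly: "hcoeff (hardy_of_poly p) = (\<lambda>(m, n). coeff (coeff p n) m)"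
  by (rule hcoeffI) (auto simp: poly2_dpowser hardy_of_poly.rep_eq)

lemma hcoeff_mult_z: "hcoeff (mult_z f) = (\<lambda>(m, n). if m = 0 then 0 else hcoeff f (m - 1, n))"
  by (rule hcoeffI) (use dpowser_shift[OF hcoeff[of f]] in \<open>auto simp: mult_z.rep_eq hardy_fun_eq\<close>)

lemma hcoeff_scaleC: "hcoeff (c *\<^sub>C f) = (\<lambda>k. c * hcoeff f k)"
  by (simp add: scaleC_hardy2_def hcoeff_scale)

lemma hcoeff_scaleR: "hcoeff (c *\<^sub>R f) = (\<lambda>k. complex_of_real c * hcoeff f k)"
  by (simp add: scaleR_hardy2_def hcoeff_scale)

lemma hcoeff_sum: "hcoeff (sum f I) k = (\<Sum>i\<in>I. hcoeff (f i) k)"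
  by (induct I rule: infinite_finite_induct) (auto simp: hcoeff_zero hcoeff_add)

lemma hardy2_eqI: "(\<And>m n. hcoeff f (m, n) = hcoeff g (m, n)) \<Longrightarrow> f = g"
  unfolding hcoeff_inject[symmetric] by auto

lemma cinner_hardy2: "cinner f g = (\<Sum>\<^sub>\<infinity>k. hcoeff f k * cnj (hcoeff g k))"
  by (simp add: cinner_hardy2_def hardy_cinner_def)

lemma bounded_linear_hcoeff: "bounded_linear (\<lambda>f. hcoeff f k)"
  by (rule bounded_linear_intro[of _ 1])
     (auto simp: hcoeff_add hcoeff_scaleR hcoeff_le_norm scaleR_conv_of_real)

definition hardy_of :: "(nat \<times> nat \<Rightarrow> complex) \<Rightarrow> hardy2"
  where "hardy_of a = (SOME f. hcoeff f = a)"

lemma hcoeff_hardy_of: "square_summable a \<Longrightarrow> hcoeff (hardy_of a) = a"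
  unfolding hardy_of_def by (rule someI_ex) (metis hcoeff_surj)

lemma square_summable_comp_inj:
  assumes "inj h" "square_summable a"
  shows "square_summable (\<lambda>k. a (h k))"
  using summable_on_subset_banach[of "\<lambda>k. (cmod (a k))\<^sup>2" UNIV "range h"] assms
  by (simp add: square_summable_def summable_on_reindex o_def)

text \<open>The adjoint of multiplication by z^i w^j; \<open>zshift\<close> is the adjoint of
  \<open>mult_z\<close>.\<close>

definition hshift :: "nat \<Rightarrow> nat \<Rightarrow> hardy2 \<Rightarrow> hardy2"
  where "hshift i j f = hardy_of (\<lambda>(m, n). hcoeff f (m + i, n + j))"

lemma hcoeff_hshift: "hcoeff (hshift i j f) (m, n) = hcoeff f (m + i, n + j)"
proof -
  have "square_summable (\<lambda>k. hcoeff f ((\<lambda>(m, n). (m + i, n + j)) k))"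
    by (rule square_summable_comp_inj[OF _ hcoeff]) (auto simp: inj_def)
  then have "square_summable (\<lambda>(m, n). hcoeff f (m + i, n + j))" by (simp add: case_prod_unfold)
  then show ?thesis by (simp add: hshift_def hcoeff_hardy_of)
qed

abbreviation zshift :: "hardy2 \<Rightarrow> hardy2" where "zshift \<equiv> hshift (Suc 0) 0"

text \<open>The hypotheses say that f is z^i w^j f'. Stated on coefficients, it serves both
  \<open>mult_z\<close> and monomial multiples of polynomials.\<close>

lemma cinner_reindex_shift:
  assumes "\<And>m n. hcoeff f (m + i, n + j) = hcoeff f' (m, n)"
    and "\<And>m n. m < i \<or> n < j \<Longrightarrow> hcoeff f (m, n) = 0"
  shows "cinner f g = cinner f' (hshift i j g)"
proof -
  define h where "h = (\<lambda>(m, n). (m + i, n + j))"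
  have inj: "inj h" by (auto simp: h_def inj_def)
  have off: "hcoeff f k = 0" if "k \<notin> range h" for k
  proof (cases k)
    case (Pair m n)
    have "m < i \<or> n < j"
    proof (rule ccontr)
      assume "\<not> (m < i \<or> n < j)"
      then have "h (m - i, n - j) = k" by (simp add: h_def Pair)
      then show False using that by blast
    qed
    then show ?thesis using assms(2) Pair by simp
  qed
  have "cinner f g = (\<Sum>\<^sub>\<infinity>k\<in>range h. hcoeff f k * cnj (hcoeff g k))"
    unfolding cinner_hardy2 by (rule infsum_cong_neutral) (auto simp: off)
  also have "\<dots> = (\<Sum>\<^sub>\<infinity>k. hcoeff f (h k) * cnj (hcoeff g (h k)))"
    by (simp add: infsum_reindex[OF inj] o_def)
  also have "\<dots> = cinner f' (hshift i j g)"
    unfolding cinner_hardy2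
    by (rule infsum_cong) (auto simp: h_def hcoeff_hshift assms(1))
  finally show ?thesis .
qed

lemma cinner_mult_z: "cinner (mult_z f) g = cinner f (zshift g)"
  by (rule cinner_reindex_shift) (auto simp: hcoeff_mult_z)

lemma zshift_mult_z [simp]: "zshift (mult_z f) = f"
  by (rule hardy2_eqI) (simp add: hcoeff_hshift hcoeff_mult_z)

lemma norm_mult_z [simp]: "norm (mult_z f) = norm f"
proof -
  have "complex_of_real ((norm (mult_z f))\<^sup>2) = complex_of_real ((norm f)\<^sup>2)"
    unfolding cinner_self[symmetric] by (simp add: cinner_mult_z)
  then show ?thesis by (simp del: of_real_power)
qed

lemma norm_zshift_le: "norm (zshift f) \<le> norm f"
proof -
  have "complex_of_real ((norm (zshift f))\<^sup>2) = cinner (mult_z (zshift f)) f"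
    unfolding cinner_self[symmetric] by (simp add: cinner_mult_z)
  then have "(norm (zshift f))\<^sup>2 = cmod (cinner (mult_z (zshift f)) f)"
    by (metis norm_of_real abs_of_nonneg zero_le_power2)
  also have "\<dots> \<le> norm (zshift f) * norm f"
    using norm_cinner_le[of "mult_z (zshift f)" f] by simp
  finally show ?thesis by (cases "zshift f = 0") (auto simp: power2_eq_square)
qed

lemma zshift_add: "zshift (f + g) = zshift f + zshift g"
  by (rule hardy2_eqI) (simp add: hcoeff_hshift hcoeff_add)

lemma zshift_diff: "zshift (f - g) = zshift f - zshift g"
  by (rule hardy2_eqI) (simp add: hcoeff_hshift hcoeff_diff)

lemma zshift_scaleC: "zshift (c *\<^sub>C f) = c *\<^sub>C zshift f"
  by (rule hardy2_eqI) (simp add: hcoeff_hshift hcoeff_scaleC)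

lemma bounded_linear_zshift: "bounded_linear zshift"
  by (rule bounded_linear_intro[of _ 1])
     (auto simp: zshift_add norm_zshift_le zshift_scaleC scaleR_scaleC)

lemma continuous_on_zshift: "continuous_on S zshift"
  using bounded_linear.continuous_on[OF bounded_linear_zshift continuous_on_id] .

section \<open>Pairings with polynomial multiples of p\<close>

definition psum :: "complex poly poly \<Rightarrow> (nat \<Rightarrow> nat \<Rightarrow> complex) \<Rightarrow> complex"
  where "psum p a = (\<Sum>n\<le>degree p. \<Sum>m\<le>degree (coeff p n). coeff (coeff p n) m * a m n)"

lemma cinner_hardy_of_poly: "cinner (hardy_of_poly p) g = psum p (\<lambda>m n. cnj (hcoeff g (m, n)))"
proof -
  let ?t = "\<lambda>(m, n). coeff (coeff p n) m * cnj (hcoeff g (m, n))"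
  let ?S = "prod.swap ` (SIGMA n:{..degree p}. {..degree (coeff p n)})"
  have "cinner (hardy_of_poly p) g = infsum ?t UNIV"
    by (simp add: cinner_hardy2 hcoeff_hardy_of_poly case_prod_unfold)
  also have "\<dots> = infsum ?t ?S"
  proof (rule infsum_cong_neutral)
    fix k assume k: "k \<in> UNIV - ?S"
    obtain m n where mn: "k = (m, n)" by (cases k)
    have "coeff (coeff p n) m = 0"
    proof (rule ccontr)
      assume nz: "coeff (coeff p n) m \<noteq> 0"
      then have "n \<le> degree p" by (metis coeff_0 le_degree)
      moreover have "m \<le> degree (coeff p n)" using nz by (rule le_degree)
      ultimately have "k \<in> ?S" unfolding mn by (auto intro!: rev_image_eqI[of "(n, m)"])
      then show False using k by blast
    qed
    then show "?t k = 0" by (simp add: mn)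
  qed auto
  also have "\<dots> = sum ?t ?S" by (intro infsum_finite finite_imageI finite_SigmaI) auto
  also have "\<dots> = (\<Sum>(n, m)\<in>(SIGMA n:{..degree p}. {..degree (coeff p n)}). ?t (m, n))"
    by (subst sum.reindex) (auto simp: inj_on_def case_prod_unfold prod.swap_def)
  also have "\<dots> = psum p (\<lambda>m n. cnj (hcoeff g (m, n)))"
    unfolding psum_def by (subst sum.Sigma) (auto simp: case_prod_unfold)
  finally show ?thesis .
qed

lemma hardy_of_poly_add: "hardy_of_poly (p + q) = hardy_of_poly p + hardy_of_poly q"
  by (rule hardy2_eqI) (simp add: hcoeff_hardy_of_poly hcoeff_add)

lemma hardy_of_poly_0: "hardy_of_poly 0 = 0"
  by (rule hardy2_eqI) (simp add: hcoeff_hardy_of_poly hcoeff_zero)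

lemma hardy_of_poly_smult: "hardy_of_poly (smult [:c:] p) = c *\<^sub>C hardy_of_poly p"
  by (rule hardy2_eqI) (simp add: hcoeff_hardy_of_poly hcoeff_scaleC mult_pCons_left)

lemma hardy_of_poly_sum: "hardy_of_poly (sum p I) = (\<Sum>i\<in>I. hardy_of_poly (p i))"
  by (induct I rule: infinite_finite_induct) (auto simp: hardy_of_poly_0 hardy_of_poly_add)

lemma cinner_hardy_of_poly_monom:
  "cinner (hardy_of_poly (monom (monom 1 i) j * p)) g = cinner (hardy_of_poly p) (hshift i j g)"
  by (rule cinner_reindex_shift) (auto simp: hcoeff_hardy_of_poly coeff_monom_mult)

text \<open>\<open>pcorr p f i j = \<langle>z\<^sup>i w\<^sup>j p, f\<rangle>\<close>\<close>

definition pcorr :: "complex poly poly \<Rightarrow> hardy2 \<Rightarrow> nat \<Rightarrow> nat \<Rightarrow> complex"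
  where "pcorr p f i j = psum p (\<lambda>m n. cnj (hcoeff f (m + i, n + j)))"

lemma pcorr_eq_cinner: "pcorr p f i j = cinner (hardy_of_poly (monom (monom 1 i) j * p)) f"
  unfolding pcorr_def cinner_hardy_of_poly_monom by (simp add: cinner_hardy_of_poly hcoeff_hshift)

lemma pcorr_add: "pcorr p (f + g) i j = pcorr p f i j + pcorr p g i j"
  by (simp add: pcorr_eq_cinner cinner_add_right)

lemma pcorr_scaleC: "pcorr p (c *\<^sub>C f) i j = cnj c * pcorr p f i j"
  by (simp add: pcorr_eq_cinner cinner_scaleC_right)

lemma pcorr_zshift: "pcorr p (zshift f) i j = pcorr p f (Suc i) j"
  by (simp add: pcorr_def hcoeff_hshift)

lemma closed_csubspace_quotient: "closed_csubspace (quotient_module p)"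
  unfolding quotient_module_def by (rule closed_csubspace_orth_compl)

lemma csubspace_quotient: "csubspace (quotient_module p)"
  using closed_csubspace_quotient by (simp add: closed_csubspace_def)

text \<open>A set and its closed linear span have the same orthogonal complement, and the monomials
  span all polynomials. Membership becomes a family of finite linear relations between coefficients,
  on which \<open>zshift\<close> acts by raising the first index.\<close>

lemma mem_quotient_iff: "f \<in> quotient_module p \<longleftrightarrow> (\<forall>i j. pcorr p f i j = 0)"
proof -
  let ?R = "range (\<lambda>q. hardy_of_poly (p * q))"
  have "submodule_of p \<subseteq> closed_cspan ?R"
    unfolding submodule_of_def closed_cspan_def by (intro closure_mono complex_vector.span_superset)
  then have "orth_compl ?R \<subseteq> quotient_module p"
    unfolding quotient_module_def by (metis orth_compl_antimono orth_compl_closed_cspan)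
  moreover have "quotient_module p \<subseteq> orth_compl ?R"
    unfolding quotient_module_def submodule_of_def by (intro orth_compl_antimono closure_subset)
  ultimately have eq: "quotient_module p = orth_compl ?R" by blast
  show ?thesis
  proof
    assume "f \<in> quotient_module p"
    then have "cinner (hardy_of_poly (p * q)) f = 0" for q
      unfolding eq orth_compl_def using cinner_eq_0_commute by blast
    then show "\<forall>i j. pcorr p f i j = 0" by (simp add: pcorr_eq_cinner mult.commute[of _ p])
  next
    assume z: "\<forall>i j. pcorr p f i j = 0"
    have "cinner (hardy_of_poly (p * q)) f = 0" for q
    proof -
      have mono: "monom c j = (\<Sum>i\<le>degree c. smult [:coeff c i:] (monom (monom 1 i) j))"
        for c :: "complex poly" and j
      proof (intro poly_eqI)
        fix n m
        have "coeff (coeff (\<Sum>i\<le>degree c. smult [:coeff c i:] (monom (monom 1 i) j)) n) m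
          = (if n = j then coeff c m else 0)"
          by (auto simp: coeff_sum mult_pCons_left if_distrib[where f = "\<lambda>x. _ * x"] coeff_eq_0 cong: if_cong)
        then show "coeff (coeff (monom c j) n) m =
            coeff (coeff (\<Sum>i\<le>degree c. smult [:coeff c i:] (monom (monom 1 i) j)) n) m"
          by simp
      qed
      define S where "S = (\<Sum>j\<le>degree q. \<Sum>i\<le>degree (coeff q j).
          smult [:coeff (coeff q j) i:] (monom (monom 1 i) j))"
      have "q = S"
        unfolding S_def mono[symmetric] by (simp add: poly_as_sum_of_monoms)
      then have "p * q = S * p" by (simp only: mult.commute)
      also have "\<dots> = (\<Sum>j\<le>degree q. \<Sum>i\<le>degree (coeff q j).
          smult [:coeff (coeff q j) i:] (monom (monom 1 i) j * p))"
        unfolding S_def by (simp only: sum_distrib_right mult_smult_left)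
      finally have "cinner (hardy_of_poly (p * q)) f = (\<Sum>j\<le>degree q. \<Sum>i\<le>degree (coeff q j).
          coeff (coeff q j) i * pcorr p f i j)"
        by (simp add: hardy_of_poly_sum hardy_of_poly_smult cinner_sum_left cinner_scaleC_left pcorr_eq_cinner)
      then show ?thesis using z by simp
    qed
    then show "f \<in> quotient_module p"
      unfolding eq orth_compl_def using cinner_eq_0_commute by blast
  qed
qed

lemma zshift_quotient: "f \<in> quotient_module p \<Longrightarrow> zshift f \<in> quotient_module p"
  by (simp add: mem_quotient_iff pcorr_zshift)

lemma S_z_mem: "S_z p f \<in> quotient_module p"
  unfolding S_z_def by (rule orth_proj_mem[OF closed_csubspace_quotient])

lemma cinner_S_z: "y \<in> quotient_module p \<Longrightarrow> cinner (S_z p x) y = cinner x (zshift y)"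
  by (simp add: S_z_def cinner_orth_proj closed_csubspace_quotient cinner_mult_z)

text \<open>The quotient module is invariant under \<open>zshift\<close>, so the adjoint of the
  compression is simply a restriction and the projection disappears from all later
  arguments.\<close>

lemma adjoint_S_z:
  assumes y: "y \<in> quotient_module p"
  shows "adjoint_on (quotient_module p) (S_z p) y = zshift y"
  unfolding adjoint_on_def
proof (rule the_equality)
  show "zshift y \<in> quotient_module p \<and>
      (\<forall>x\<in>quotient_module p. cinner (S_z p x) y = cinner x (zshift y))"
    using y by (simp add: zshift_quotient cinner_S_z)
  fix y' assume y': "y' \<in> quotient_module p \<and> (\<forall>x\<in>quotient_module p. cinner (S_z p x) y = cinner x y')"
  then have "y' - zshift y \<in> quotient_module p"
    using y by (intro csubspace_diff[OF csubspace_quotient] zshift_quotient) auto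
  then have "cinner (y' - zshift y) (y' - zshift y) = 0"
    using y y' by (subst cinner_diff_right) (simp flip: cinner_S_z)
  then show "y' = zshift y" by simp
qed

lemma eigenspace_adjoint_S_z:
  "eigenspace (quotient_module p) (adjoint_on (quotient_module p) (S_z p)) w
    = {x \<in> quotient_module p. zshift x = w *\<^sub>C x}"
  unfolding eigenspace_def by (auto simp: adjoint_S_z)

section \<open>Slices of p and eigenvectors of the adjoint\<close>

lemma poly_slice: "poly (slice p z) w = poly2 p (z, w)"
  by (simp add: poly2_def)

lemma coeff_slice: "coeff (slice p z) n = poly (coeff p n) z"
  by (simp add: slice_def coeff_map_poly)

lemma degree_slice_le: "degree (slice p z) \<le> degree p"
  unfolding slice_def by (rule map_poly_degree_leq)

lemma psum_slice: "psum p (\<lambda>m n. z ^ m * a n) = (\<Sum>n\<le>degree p. coeff (slice p z) n * a n)"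
  unfolding psum_def coeff_slice poly_altdef by (simp add: sum_distrib_right mult.assoc)

lemma pact_slice: "pact (slice p z) h j = psum p (\<lambda>m n. z ^ m * h (n + j))"
  unfolding psum_slice by (rule pact_altdef[OF degree_slice_le])

text \<open>A vanishing slice would make the linear polynomial with root z divide every coefficient
  of p: a factor in z alone.\<close>

lemma slice_nonzero:
  assumes "no_univariate_factors p"
  shows "slice p z \<noteq> 0"
proof
  assume "slice p z = 0"
  then have "[:- z, 1:] dvd coeff p n" for n
    using coeff_slice[of p z n] by (simp flip: poly_eq_0_iff_dvd)
  then have "[:[:- z, 1:]:] dvd p" by (simp add: const_poly_dvd_iff)
  then show False using assms unfolding no_univariate_factors_def
    by (metis degree_pCons_eq_if degree_1 one_neq_zero one_pCons pCons_eq_0_iff zero_less_Suc)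
qed

lemma hardy2_bound:
  assumes bound: "\<And>N. (\<Sum>m<N. \<Sum>n<N. (cmod (a (m, n)))\<^sup>2) \<le> e\<^sup>2" and e: "0 \<le> e"
  shows "square_summable a" "norm (hardy_of a) \<le> e"
proof -
  have F: "(\<Sum>k\<in>F. (cmod (a k))\<^sup>2) \<le> e\<^sup>2" if fin: "finite F" for F
  proof -
    obtain N1 where N1: "fst ` F \<subseteq> {..<N1}" using finite_nat_bounded[OF finite_imageI[OF fin]] by blast
    obtain N2 where N2: "snd ` F \<subseteq> {..<N2}" using finite_nat_bounded[OF finite_imageI[OF fin]] by blast
    let ?N = "max N1 N2"
    have "F \<subseteq> {..<?N} \<times> {..<?N}" using N1 N2 by fastforce
    then have "(\<Sum>k\<in>F. (cmod (a k))\<^sup>2) \<le> (\<Sum>k\<in>{..<?N} \<times> {..<?N}. (cmod (a k))\<^sup>2)"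
      by (intro sum_mono2) auto
    also have "\<dots> = (\<Sum>m<?N. \<Sum>n<?N. (cmod (a (m, n)))\<^sup>2)"
      by (simp add: sum.cartesian_product case_prod_unfold)
    also have "\<dots> \<le> e\<^sup>2" by (rule bound)
    finally show ?thesis .
  qed
  show *: "square_summable a"
    unfolding square_summable_def
  proof (rule nonneg_bdd_above_summable_on)
    show "bdd_above (sum (\<lambda>k. (cmod (a k))\<^sup>2) ` {F. F \<subseteq> UNIV \<and> finite F})"
      by (rule bdd_aboveI2[where M = "e\<^sup>2"]) (use F in auto)
  qed auto
  show "norm (hardy_of a) \<le> e"
    by (rule norm_le_hardy2) (use F e in \<open>auto simp: hcoeff_hardy_of[OF *]\<close>)
qed

text \<open>A kernel function in z times a series in the second variable. The conjugate on
  \<open>h\<close> compensates the antilinear second argument of \<open>cinner\<close>, so that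
  \<open>h\<close> itself solves the recurrence of the slice at \<open>cnj w\<close>.\<close>

definition eigvec :: "complex \<Rightarrow> (nat \<Rightarrow> complex) \<Rightarrow> hardy2"
  where "eigvec w h = hardy_of (\<lambda>(m, n). w ^ m * cnj (h n))"

lemma eigvec:
  assumes w: "cmod w < 1" and h: "l2b h B"
  shows hcoeff_eigvec: "hcoeff (eigvec w h) (m, n) = w ^ m * cnj (h n)"
    and norm_eigvec_le: "norm (eigvec w h) \<le> B / (1 - cmod w)"
proof -
  let ?a = "\<lambda>(m, n). w ^ m * cnj (h n)"
  have "(\<Sum>m<N. \<Sum>n<N. (cmod (?a (m, n)))\<^sup>2) \<le> (B / (1 - cmod w))\<^sup>2" for N
  proof -
    have "(\<Sum>m<N. \<Sum>n<N. (cmod (?a (m, n)))\<^sup>2) = (\<Sum>m<N. (cmod w ^ m)\<^sup>2 * (l2n h N)\<^sup>2)"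
      by (simp add: norm_mult norm_power power_mult_distrib l2n_power2 sum_distrib_left)
    also have "\<dots> = (\<Sum>m<N. (cmod w ^ m)\<^sup>2) * (l2n h N)\<^sup>2" by (simp add: sum_distrib_right)
    also have "\<dots> \<le> (\<Sum>m<N. cmod w ^ m)\<^sup>2 * B\<^sup>2"
    proof (intro mult_mono power_mono l2bD[OF h])
      \<comment> \<open>The l2 norm of the geometric sequence is estimated by its l1 norm, which
        gives the simple constant 1 / (1 - |w|).\<close>
      show "(\<Sum>m<N. (cmod w ^ m)\<^sup>2) \<le> (\<Sum>m<N. cmod w ^ m)\<^sup>2"
        using L2_set_le_sum[of "{..<N}" "\<lambda>m. cmod w ^ m"]
        by (simp add: L2_set_def real_sqrt_le_iff flip: real_sqrt_le_iff[of _ "(\<Sum>m<N. cmod w ^ m)\<^sup>2"])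
    qed auto
    also have "(\<Sum>m<N. cmod w ^ m) \<le> 1 / (1 - cmod w)"
    proof -
      have "summable (\<lambda>m. cmod w ^ m)" using w by simp
      then have "(\<Sum>m<N. cmod w ^ m) \<le> (\<Sum>m. cmod w ^ m)" by (intro sum_le_suminf) auto
      then show ?thesis using w by (simp add: suminf_geometric)
    qed
    then have "(\<Sum>m<N. cmod w ^ m)\<^sup>2 * B\<^sup>2 \<le> (1 / (1 - cmod w))\<^sup>2 * B\<^sup>2"
      by (intro mult_right_mono power_mono) (auto intro: sum_nonneg)
    finally show ?thesis by (simp add: power_divide)
  qed
  from hardy2_bound[of ?a, OF this] l2b_nonneg[OF h] w
  show "hcoeff (eigvec w h) (m, n) = w ^ m * cnj (h n)" "norm (eigvec w h) \<le> B / (1 - cmod w)"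
    unfolding eigvec_def by (simp_all add: hcoeff_hardy_of)
qed

lemma hcoeff_eigvec':
  "cmod w < 1 \<Longrightarrow> square_summable h \<Longrightarrow> hcoeff (eigvec w h) (m, n) = w ^ m * cnj (h n)"
  by (auto simp: square_summable_iff_l2b hcoeff_eigvec)

lemma l2b_row: "l2b (\<lambda>n. hcoeff f (m, n)) (norm f)"
  unfolding l2b_def
proof
  fix N
  have "(l2n (\<lambda>n. hcoeff f (m, n)) N)\<^sup>2 = (\<Sum>k\<in>Pair m ` {..<N}. (cmod (hcoeff f k))\<^sup>2)"
    by (simp add: l2n_power2 sum.reindex inj_on_def)
  also have "\<dots> \<le> (norm f)\<^sup>2" by (rule sum_le_norm_hardy2) simp
  finally show "l2n (\<lambda>n. hcoeff f (m, n)) N \<le> norm f" by (rule power2_le_imp_le) simp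
qed

lemma l2b_cnj: "l2b (\<lambda>n. cnj (f n)) B \<longleftrightarrow> l2b f B"
  by (simp add: l2b_def l2n_def)

text \<open>The eigenvalue equation makes the coefficients geometric in m. The pairing with z^i w^j
  p is then a power of \<open>cnj w\<close> times the recurrence at j, so the relations with i = 0
  imply all others, even for w = 0.\<close>

lemma eigenspace_S_z:
  assumes w: "cmod w < 1"
  shows "eigenspace (quotient_module p) (adjoint_on (quotient_module p) (S_z p)) w
    = eigvec w ` ker2 (slice p (cnj w))"
proof -
  have corr: "pcorr p (eigvec w h) i j = cnj w ^ i * pact (slice p (cnj w)) h j"
    if h: "square_summable h" for h i j
  proof -
    have "pcorr p (eigvec w h) i j = psum p (\<lambda>m n. cnj w ^ m * (cnj w ^ i * h (n + j)))"
      by (simp add: pcorr_def hcoeff_eigvec'[OF w h] power_add mult_ac)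
    also have "\<dots> = cnj w ^ i * psum p (\<lambda>m n. cnj w ^ m * h (n + j))"
      unfolding psum_def sum_distrib_left by (simp add: mult_ac)
    finally show ?thesis by (simp add: pact_slice)
  qed
  show ?thesis
  proof (intro equalityI subsetI)
    fix x assume "x \<in> eigenspace (quotient_module p) (adjoint_on (quotient_module p) (S_z p)) w"
    then have x: "x \<in> quotient_module p" "zshift x = w *\<^sub>C x" by (auto simp: eigenspace_adjoint_S_z)
    have "hcoeff x (Suc m, n) = w * hcoeff x (m, n)" for m n
      using arg_cong[OF x(2), of "\<lambda>f. hcoeff f (m, n)"] by (simp add: hcoeff_hshift hcoeff_scaleC)
    then have xm: "hcoeff x (m, n) = w ^ m * hcoeff x (0, n)" for m n by (induct m) simp_all
    define h where "h n = cnj (hcoeff x (0, n))" for n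
    have h2: "square_summable h"
      unfolding h_def using l2b_row[of x 0] l2b_cnj square_summableI by blast
    have xh: "x = eigvec w h"
    proof (rule hardy2_eqI)
      show "hcoeff x (m, n) = hcoeff (eigvec w h) (m, n)" for m n
        unfolding hcoeff_eigvec'[OF w h2] using xm[of m n] by (simp add: h_def)
    qed
    have "pact (slice p (cnj w)) h j = 0" for j
      using x(1) corr[OF h2, of 0 j] by (simp add: mem_quotient_iff xh[symmetric])
    then have "h \<in> ker2 (slice p (cnj w))" using h2 by (auto simp: ker2_def)
    then show "x \<in> eigvec w ` ker2 (slice p (cnj w))" using xh by blast
  next
    fix x assume "x \<in> eigvec w ` ker2 (slice p (cnj w))"
    then obtain h where h: "x = eigvec w h" "square_summable h" "pact (slice p (cnj w)) h = (\<lambda>_. 0)"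
      by (auto simp: ker2_def)
    have "zshift x = w *\<^sub>C x"
      by (rule hardy2_eqI) (simp add: h(1) hcoeff_hshift hcoeff_scaleC hcoeff_eigvec'[OF w h(2)])
    moreover have "x \<in> quotient_module p"
      unfolding mem_quotient_iff by (simp add: h(1) corr[OF h(2)] h(3))
    ultimately show "x \<in> eigenspace (quotient_module p) (adjoint_on (quotient_module p) (S_z p)) w"
      by (simp add: eigenspace_adjoint_S_z)
  qed
qed

lemma basis_eigvec_ker2:
  assumes w: "cmod w < 1" and q: "q \<noteq> 0"
  shows "\<exists>B. finite B \<and> card B = zcount 1 q \<and> \<not> cdependent B \<and> cspan B = eigvec w ` ker2 q"
proof -
  let ?d = "zcount 1 q"
  \<comment> \<open>Solutions whose first \<open>?d\<close> entries are unit vectors. These entries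
    are coordinates on the kernel, so independence can be read off from them.\<close>
  have "\<exists>u\<in>ker2 q. \<forall>j<?d. u j = (if i = j then 1 else 0)" for i
    using ker2_initial_values[OF q, of "\<lambda>j. if i = j then 1 else 0"] by blast
  then obtain u where uk: "\<And>i. u i \<in> ker2 q" and u: "\<And>i j. j < ?d \<Longrightarrow> u i j = (if i = j then 1 else 0)"
    by metis
  have u2: "square_summable (u i)" for i using uk[of i] by (simp add: ker2_def)
  let ?s = "\<lambda>i. eigvec w (u i)"
  have ind: "inj_on ?s {..<?d} \<and> \<not> cdependent (?s ` {..<?d})"
  proof (rule independent_familyI)
    fix c i assume c: "(\<Sum>i<?d. c i *\<^sub>C eigvec w (u i)) = 0" and i: "i < ?d"
    have "0 = hcoeff (\<Sum>j<?d. c j *\<^sub>C eigvec w (u j)) (0, i)" by (simp add: c hcoeff_zero)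
    also have "\<dots> = (\<Sum>j<?d. if j = i then c j else 0)"
      unfolding hcoeff_sum using i by (intro sum.cong) (auto simp: hcoeff_scaleC hcoeff_eigvec'[OF w u2] u)
    also have "\<dots> = c i" using i by simp
    finally show "c i = 0" by simp
  qed
  have lin: "eigvec w h = (\<Sum>i<?d. cnj (h i) *\<^sub>C ?s i)" if h: "h \<in> ker2 q" for h
  proof -
    have h2: "square_summable h" using h by (simp add: ker2_def)
    \<comment> \<open>The difference solves the recurrence with zero initial values, hence
      vanishes.\<close>
    define g where "g n = h n - (\<Sum>i<?d. h i * u i n)" for n
    obtain B where B: "l2b h B" using h2 by (auto simp: square_summable_iff_l2b)
    have "\<forall>i. \<exists>C. l2b (u i) C" using u2 by (auto simp: square_summable_iff_l2b)
    then obtain C where C: "\<And>i. l2b (u i) (C i)" by metis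
    have "l2b g (B + (\<Sum>i<?d. cmod (h i) * C i))"
      unfolding g_def[abs_def] by (intro l2b_diff B l2b_sum l2b_cmult C) simp
    moreover have "pact q g j = 0" for j
    proof -
      have "pact q g j = pact q h j - pact q (\<lambda>n. \<Sum>i<?d. h i * u i n) j"
        by (simp add: pact_def g_def right_diff_distrib sum_subtractf)
      then show ?thesis
        using h uk by (simp add: pact_sum_right ker2_def)
    qed
    ultimately have "g \<in> ker2 q" by (auto simp: ker2_def intro: square_summableI)
    moreover have "g j = 0" if "j < ?d" for j
    proof -
      have "(\<Sum>i<?d. h i * u i j) = (\<Sum>i<?d. if i = j then h i else 0)"
        using that by (intro sum.cong) (auto simp: u)
      then show ?thesis using that by (simp add: g_def)
    qed
    ultimately have "g = (\<lambda>_. 0)" using ker2_initial_values[OF q] by blast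
    then have "g n = 0" for n by simp
    then have hn: "h n = (\<Sum>i<?d. h i * u i n)" for n
      unfolding g_def by (rule eq_iff_diff_eq_0[THEN iffD2])
    show ?thesis
    proof (rule hardy2_eqI)
      fix m n
      have "hcoeff (eigvec w h) (m, n) = w ^ m * cnj (\<Sum>i<?d. h i * u i n)"
        by (subst hcoeff_eigvec'[OF w h2], subst hn) (rule refl)
      also have "\<dots> = hcoeff (\<Sum>i<?d. cnj (h i) *\<^sub>C ?s i) (m, n)"
        by (simp add: hcoeff_sum hcoeff_scaleC hcoeff_eigvec'[OF w u2] sum_distrib_left mult_ac)
      finally show "hcoeff (eigvec w h) (m, n) = hcoeff (\<Sum>i<?d. cnj (h i) *\<^sub>C ?s i) (m, n)" .
    qed
  qed
  have sub: "csubspace (eigvec w ` ker2 q)"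
  proof (rule csubspaceI)
    have "(\<lambda>_. 0) \<in> ker2 q" by (simp add: ker2_def square_summable_zero)
    moreover have "eigvec w (\<lambda>_. 0) = 0"
      by (rule hardy2_eqI) (simp add: hcoeff_eigvec'[OF w square_summable_zero] hcoeff_zero)
    ultimately show "0 \<in> eigvec w ` ker2 q" by force
  next
    fix x y assume "x \<in> eigvec w ` ker2 q" "y \<in> eigvec w ` ker2 q"
    then obtain g h where gh: "x = eigvec w g" "y = eigvec w h" "g \<in> ker2 q" "h \<in> ker2 q" by auto
    then have s: "square_summable g" "square_summable h" by (auto simp: ker2_def)
    have "(\<lambda>n. g n + h n) \<in> ker2 q"
      using gh square_summable_add[OF s]
      by (auto simp: ker2_def pact_def fun_eq_iff distrib_left sum.distrib)
    moreover have "x + y = eigvec w (\<lambda>n. g n + h n)"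
      by (rule hardy2_eqI)
        (simp add: gh hcoeff_add hcoeff_eigvec'[OF w] s square_summable_add[OF s] distrib_left)
    ultimately show "x + y \<in> eigvec w ` ker2 q" by blast
  next
    fix c x assume "x \<in> eigvec w ` ker2 q"
    then obtain g where g: "x = eigvec w g" "g \<in> ker2 q" by auto
    then have s: "square_summable g" by (auto simp: ker2_def)
    have "(\<lambda>n. cnj c * g n) \<in> ker2 q"
      using g square_summable_scale[OF s]
      by (auto simp: ker2_def pact_def fun_eq_iff mult.left_commute[of _ "cnj c"] simp flip: sum_distrib_left)
    moreover have "c *\<^sub>C x = eigvec w (\<lambda>n. cnj c * g n)"
      by (rule hardy2_eqI)
        (simp add: g hcoeff_scaleC hcoeff_eigvec'[OF w] s square_summable_scale[OF s] mult_ac)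
    ultimately show "c *\<^sub>C x \<in> eigvec w ` ker2 q" by blast
  qed
  have "cspan (?s ` {..<?d}) = eigvec w ` ker2 q"
  proof
    show "cspan (?s ` {..<?d}) \<subseteq> eigvec w ` ker2 q"
      by (intro complex_vector.span_minimal sub) (use uk in auto)
    show "eigvec w ` ker2 q \<subseteq> cspan (?s ` {..<?d})"
    proof (rule image_subsetI)
      fix h assume "h \<in> ker2 q"
      have "(\<Sum>i<?d. cnj (h i) *\<^sub>C ?s i) \<in> cspan (?s ` {..<?d})"
        by (rule complex_vector.span_sum, rule complex_vector.span_scale, rule complex_vector.span_base) simp
      then show "eigvec w h \<in> cspan (?s ` {..<?d})" by (simp only: lin[OF \<open>h \<in> ker2 q\<close>])
    qed
  qed
  with ind show ?thesis
    by (intro exI[of _ "?s ` {..<?d}"]) (auto simp: card_image)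
qed

section \<open>Surjectivity of the adjoint minus w, with bounds\<close>

lemma l2b_pcorr: "\<exists>C\<ge>0. \<forall>f. l2b (\<lambda>j. pcorr p f 0 j) (C * norm f)"
proof -
  let ?C = "\<Sum>n\<le>degree p. \<Sum>m\<le>degree (coeff p n). cmod (coeff (coeff p n) m)"
  have "l2b (\<lambda>j. pcorr p f 0 j) (\<Sum>n\<le>degree p. \<Sum>m\<le>degree (coeff p n). cmod (coeff (coeff p n) m) * norm f)" for f
    unfolding pcorr_def psum_def
    by (intro l2b_sum l2b_cmult) (auto simp: l2b_cnj intro: l2b_shift l2b_row)
  then show ?thesis by (intro exI[of _ ?C]) (auto simp: sum_distrib_right intro!: sum_nonneg)
qed

text \<open>The equation is first solved in the whole Hardy space by the series \<open>x0\<close> of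
  w^k times the (k+1)-st power of \<open>mult_z\<close> applied to y. Adding an
  \<open>eigvec w h\<close> does not disturb it, and h is chosen to cancel the pairings of
  \<open>x0\<close> with w^j p. This is a recurrence for h, solvable with bounds because the slice
  has no zero on the circle.\<close>

lemma zshift_lift:
  assumes w: "cmod w < 1" and q0: "slice p (cnj w) \<noteq> 0"
    and q: "\<And>v. cmod v = 1 \<Longrightarrow> poly (slice p (cnj w)) v \<noteq> 0"
  shows "\<exists>C. \<forall>y\<in>quotient_module p. \<exists>x\<in>quotient_module p. zshift x - w *\<^sub>C x = y \<and> norm x \<le> C * norm y"
proof -
  obtain C1 where C1: "C1 \<ge> 0" "\<And>f. l2b (\<lambda>j. pcorr p f 0 j) (C1 * norm f)" using l2b_pcorr by blast
  obtain C2 where C2: "C2 \<ge> 0"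
    "\<And>v B. l2b v B \<Longrightarrow> \<exists>u. l2b u (C2 * B) \<and> pact (slice p (cnj w)) u = v"
    using pact_surj[OF q0 q] by blast
  define D where "D = 1 / (1 - cmod w)"
  have D: "D \<ge> 0" using w by (simp add: D_def)
  have "\<exists>x\<in>quotient_module p. zshift x - w *\<^sub>C x = y \<and> norm x \<le> (D + C2 * C1 * D * D) * norm y"
    if y: "y \<in> quotient_module p" for y
  proof -
    define Z where "Z k = (mult_z ^^ k) y" for k
    have nZ: "norm (Z k) = norm y" for k by (induct k) (simp_all add: Z_def)
    have BZ: "zshift (Z (Suc k)) = Z k" for k by (simp add: Z_def)
    have sm: "summable (\<lambda>k. norm (w ^ k *\<^sub>C Z (k + i)))" for i
      using w by (simp add: norm_scaleC nZ norm_power summable_mult2 summable_geometric)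
    define x0 where "x0 = (\<Sum>k. w ^ k *\<^sub>C Z (Suc k))"
    have sm0: "summable (\<lambda>k. w ^ k *\<^sub>C Z k)" and sm1: "summable (\<lambda>k. w ^ k *\<^sub>C Z (Suc k))"
      using summable_norm_cancel[OF sm[of 0]] summable_norm_cancel[OF sm[of 1]] by simp_all
    have "zshift x0 = (\<Sum>k. w ^ k *\<^sub>C Z k)"
      unfolding x0_def bounded_linear.suminf[OF bounded_linear_zshift sm1] by (simp add: zshift_scaleC BZ)
    also have "\<dots> = y + (\<Sum>k. w ^ Suc k *\<^sub>C Z (Suc k))"
      using suminf_split_head[OF sm0] by (simp add: Z_def)
    also have "(\<Sum>k. w ^ Suc k *\<^sub>C Z (Suc k)) = w *\<^sub>C x0"
      unfolding x0_def
      using bounded_linear.suminf[OF bounded_bilinear.bounded_linear_right[OF bounded_bilinear_scaleC] sm1, of w]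
      by (simp add: scaleC_scaleC)
    finally have x0: "zshift x0 = y + w *\<^sub>C x0" .
    have nx0: "norm x0 \<le> D * norm y"
    proof -
      have "norm x0 \<le> (\<Sum>k. norm (w ^ k *\<^sub>C Z (Suc k)))"
        unfolding x0_def using sm[of 1] by (intro summable_norm) simp
      also have "\<dots> = D * norm y"
        using w by (simp add: norm_scaleC nZ norm_power suminf_mult2[symmetric] summable_geometric suminf_geometric D_def)
      finally show ?thesis .
    qed
    have "l2b (\<lambda>j. - 1 * pcorr p x0 0 j) (cmod (- 1) * (C1 * norm x0))" by (intro l2b_cmult C1)
    then have "l2b (\<lambda>j. - pcorr p x0 0 j) (C1 * norm x0)" by simp
    from C2(2)[OF this] obtain h where h: "l2b h (C2 * (C1 * norm x0))"
      and ph: "pact (slice p (cnj w)) h = (\<lambda>j. - pcorr p x0 0 j)" by blast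
    define x where "x = x0 + eigvec w h"
    have "zshift (eigvec w h) = w *\<^sub>C eigvec w h"
      by (rule hardy2_eqI) (simp add: hcoeff_hshift hcoeff_scaleC hcoeff_eigvec[OF w h])
    then have x: "zshift x = y + w *\<^sub>C x" by (simp add: x_def zshift_add x0 scaleC_add_right)
    \<comment> \<open>The choice of \<open>h\<close> settles i = 0; the equation for x passes from i
      to i + 1 because y lies in the quotient module.\<close>
    have "pcorr p x i j = 0" for i j
    proof (induct i)
      case 0
      have "pcorr p (eigvec w h) 0 j = pact (slice p (cnj w)) h j"
        by (simp add: pcorr_def hcoeff_eigvec[OF w h] pact_slice)
      then show ?case by (simp add: x_def pcorr_add ph)
    next
      case (Suc i)
      have "pcorr p x (Suc i) j = pcorr p y i j + cnj w * pcorr p x i j"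
        by (simp add: x pcorr_add pcorr_scaleC flip: pcorr_zshift)
      then show ?case using y Suc by (simp add: mem_quotient_iff)
    qed
    then have "x \<in> quotient_module p" by (simp add: mem_quotient_iff)
    moreover have "norm x \<le> (D + C2 * C1 * D * D) * norm y"
    proof -
      have "norm (eigvec w h) \<le> (C2 * (C1 * norm x0)) * D"
        using norm_eigvec_le[OF w h] by (simp add: D_def)
      also have "\<dots> \<le> (C2 * (C1 * (D * norm y))) * D"
        using nx0 C1 C2 D by (intro mult_right_mono mult_left_mono) auto
      finally show ?thesis
        using norm_triangle_ineq[of x0 "eigvec w h"] nx0 by (simp add: x_def algebra_simps)
    qed
    moreover have "zshift x - w *\<^sub>C x = y" using x by simp
    ultimately show ?thesis by blast
  qed
  then show ?thesis by blast
qed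

section \<open>Zeros of the slices\<close>

lemma zorder_poly:
  assumes "q \<noteq> 0"
  shows "zorder (poly q) w = int (order w q)"
proof -
  obtain r where r: "q = [:- w, 1:] ^ order w q * r" "\<not> [:- w, 1:] dvd r"
    using order_decomp[OF assms] by blast
  have ev: "poly q v = poly r v * (v - w) ^ order w q" for v
    by (subst r(1)) (simp add: mult.commute)
  show ?thesis
    by (rule zorder_eqI[of UNIV _ "poly r"]) (use r(2) ev in \<open>auto simp: poly_eq_0_iff_dvd intro!: holomorphic_intros\<close>)
qed

text \<open>Rouche's theorem weights zeros by winding numbers. The strict inequality keeps zeros of
  both polynomials off the circle, so the weights are 1 inside and 0 outside and the weighted sum is
  \<open>zcount\<close>.\<close>

lemma zcount_rouche:
  assumes q: "q1 \<noteq> 0" "q2 \<noteq> 0" and r: "0 < r"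
    and less: "\<And>w. cmod w = r \<Longrightarrow> cmod (poly q2 w - poly q1 w) < cmod (poly q1 w)"
  shows "zcount r q2 = zcount r q1"
proof -
  have key: "(\<Sum>w | poly q w = 0. winding_number (circlepath 0 r) w * of_int (zorder (poly q) w)) = of_nat (zcount r q)"
    if "q \<noteq> 0" "\<And>w. cmod w = r \<Longrightarrow> poly q w \<noteq> 0" for q
  proof -
    have "(\<Sum>w | poly q w = 0. winding_number (circlepath 0 r) w * of_int (zorder (poly q) w))
      = (\<Sum>w | w \<in> ball 0 r \<and> poly q w = 0. of_nat (order w q))"
    proof (rule sum.mono_neutral_cong_right)
      show "finite {w. poly q w = 0}" using that by (simp add: poly_roots_finite)
      show "\<forall>w\<in>{w. poly q w = 0} - {w. w \<in> ball 0 r \<and> poly q w = 0}.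
          winding_number (circlepath 0 r) w * of_int (zorder (poly q) w) = 0"
      proof
        fix w assume w: "w \<in> {w. poly q w = 0} - {w. w \<in> ball 0 r \<and> poly q w = 0}"
        then have "cmod w > r" using that(2)[of w] by (auto simp: not_less less_le)
        then have "w \<notin> cball 0 r" by simp
        then have "winding_number (circlepath 0 r) w = 0"
          using r by (intro winding_number_zero_outside[of _ "cball 0 r"]) auto
        then show "winding_number (circlepath 0 r) w * of_int (zorder (poly q) w) = 0" by simp
      qed
      show "winding_number (circlepath 0 r) w * of_int (zorder (poly q) w) = of_nat (order w q)"
        if "w \<in> {w. w \<in> ball 0 r \<and> poly q w = 0}" for w
        using that \<open>q \<noteq> 0\<close> by (simp add: winding_number_circlepath zorder_poly)
    qed auto
    then show ?thesis by (simp add: zcount_def)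
  qed
  have nz1: "poly q1 w \<noteq> 0" if "cmod w = r" for w using less[OF that] by auto
  have nz2: "poly q2 w \<noteq> 0" if "cmod w = r" for w using less[OF that] by auto
  have eq: "(\<lambda>w. poly q1 w + (poly q2 w - poly q1 w)) = poly q2" by auto
  have "(\<Sum>w | poly q2 w = 0. winding_number (circlepath 0 r) w * of_int (zorder (poly q2) w))
    = (\<Sum>w | poly q1 w = 0. winding_number (circlepath 0 r) w * of_int (zorder (poly q1) w))"
  proof -
    have hol: "poly q1 holomorphic_on UNIV" "(\<lambda>w. poly q2 w - poly q1 w) holomorphic_on UNIV"
      by (intro holomorphic_intros)+
    show ?thesis
      using Rouche_theorem[of UNIV "poly q1" "\<lambda>w. poly q2 w - poly q1 w" "circlepath 0 r"] hol q r less
      unfolding eq by (simp add: poly_roots_finite connected_UNIV)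
  qed
  then have "(of_nat (zcount r q2) :: complex) = of_nat (zcount r q1)"
    using key[OF q(1) nz1] key[OF q(2) nz2] by simp
  then show ?thesis by simp
qed

lemma poly2_eq: "poly2 p (z, w) = (\<Sum>n\<le>degree p. poly (coeff p n) z * w ^ n)"
  unfolding poly2_def prod.case by (simp add: poly_eq_sum_le[OF degree_slice_le] coeff_slice)

lemma continuous_on_poly2 [continuous_intros]:
  assumes "continuous_on S f" "continuous_on S g"
  shows "continuous_on S (\<lambda>x. poly2 p (f x, g x))"
  unfolding poly2_eq by (intro continuous_intros assms)

text \<open>The minimum modulus on the compact circle is positive, and uniform continuity preserves
  half of it for nearby slices. The lower bound serves the Laurent estimates, the strict inequality
  Rouche's theorem.\<close>

lemma poly2_near_circle:
  assumes nz: "\<And>w. cmod w = r \<Longrightarrow> poly2 p (z0, w) \<noteq> 0"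
  shows "\<exists>\<delta>>0. \<exists>\<kappa>>0. \<forall>z w. cmod (z - z0) < \<delta> \<longrightarrow> cmod w = r \<longrightarrow>
    \<kappa> \<le> cmod (poly2 p (z, w)) \<and> cmod (poly2 p (z, w) - poly2 p (z0, w)) < cmod (poly2 p (z0, w))"
proof (cases "r \<ge> 0")
  case True
  have "continuous_on (sphere 0 r) (\<lambda>w. cmod (poly2 p (z0, w)))"
    by (intro continuous_intros)
  moreover have "of_real r \<in> sphere (0::complex) r" using True by simp
  ultimately obtain w0 where w0: "w0 \<in> sphere 0 r" "\<And>w. w \<in> sphere 0 r \<Longrightarrow> cmod (poly2 p (z0, w0)) \<le> cmod (poly2 p (z0, w))"
    using continuous_attains_inf[of "sphere 0 r"] by (metis compact_sphere empty_iff)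
  define m where "m = cmod (poly2 p (z0, w0))"
  have m: "m > 0" using nz[of w0] w0(1) by (simp add: m_def)
  have "continuous_on (cball z0 1 \<times> sphere 0 r) (\<lambda>x. poly2 p (fst x, snd x))"
    by (intro continuous_intros)
  then have "uniformly_continuous_on (cball z0 1 \<times> sphere 0 r) (\<lambda>x. poly2 p (fst x, snd x))"
    by (intro compact_uniformly_continuous compact_Times) auto
  then obtain d where d: "d > 0" "\<And>x x'. x \<in> cball z0 1 \<times> sphere 0 r \<Longrightarrow> x' \<in> cball z0 1 \<times> sphere 0 r \<Longrightarrow>
      dist x' x < d \<Longrightarrow> dist (poly2 p (fst x', snd x')) (poly2 p (fst x, snd x)) < m / 2"
    unfolding uniformly_continuous_on_def using m by (metis half_gt_zero)
  have "m / 2 \<le> cmod (poly2 p (z, w)) \<and> cmod (poly2 p (z, w) - poly2 p (z0, w)) < cmod (poly2 p (z0, w))"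
    if "cmod (z - z0) < min d 1" "cmod w = r" for z w
  proof -
    have "dist (poly2 p (z, w)) (poly2 p (z0, w)) < m / 2"
      using d(2)[of "(z0, w)" "(z, w)"] that by (simp add: dist_Pair_Pair dist_norm norm_minus_commute)
    moreover have "m \<le> cmod (poly2 p (z0, w))" using w0(2)[of w] that by (simp add: m_def)
    moreover have "cmod (poly2 p (z0, w)) \<le> cmod (poly2 p (z, w)) + cmod (poly2 p (z, w) - poly2 p (z0, w))"
      using norm_triangle_ineq4[of "poly2 p (z, w)" "poly2 p (z, w) - poly2 p (z0, w)"] by simp
    ultimately show ?thesis using m by (simp add: dist_norm)
  qed
  then show ?thesis using d(1) m by (intro exI[of _ "min d 1"] exI[of _ "m / 2"] conjI allI impI) auto
next
  case False
  \<comment> \<open>For negative r no point has modulus r, and the claim is vacuous.\<close>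
  then show ?thesis using norm_ge_zero by (intro exI[of _ 1]) (auto, smt (verit) norm_ge_zero)
qed

lemma zcount_locally_constant:
  assumes p: "no_univariate_factors p" and r: "0 < r"
    and nz: "\<And>w. cmod w = r \<Longrightarrow> poly2 p (z0, w) \<noteq> 0"
  shows "\<exists>\<delta>>0. \<forall>z\<in>ball z0 \<delta>. zcount r (slice p z) = zcount r (slice p z0)"
proof -
  obtain \<delta> where "\<delta> > 0" and \<delta>: "\<And>z w. cmod (z - z0) < \<delta> \<Longrightarrow> cmod w = r \<Longrightarrow>
      cmod (poly2 p (z, w) - poly2 p (z0, w)) < cmod (poly2 p (z0, w))"
    using poly2_near_circle[of r p z0, OF nz] by blast
  have "zcount r (slice p z) = zcount r (slice p z0)" if "z \<in> ball z0 \<delta>" for z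
    using slice_nonzero[OF p] r \<delta>[of z] that
    by (intro zcount_rouche) (auto simp: poly_slice dist_norm norm_minus_commute)
  then show ?thesis using \<open>\<delta> > 0\<close> by blast
qed

lemma zcount_le_degree: "q \<noteq> 0 \<Longrightarrow> zcount r q \<le> degree q"
  by (induct q rule: poly_linear_induct) (auto simp: zcount_const zcount_linear_factor degree_mult_eq)

lemma zcount_eq_0_iff: "q \<noteq> 0 \<Longrightarrow> zcount r q = 0 \<longleftrightarrow> (\<forall>w\<in>ball 0 r. poly q w \<noteq> 0)"
  unfolding zcount_def
  by (subst sum_eq_0_iff) (auto simp: order_root poly_roots_finite intro: finite_subset[OF _ poly_roots_finite[of q]])

lemma zcount_mono_strict:
  assumes q: "q \<noteq> 0" and rs: "r \<le> cmod w" "cmod w < s" and w: "poly q w = 0"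
  shows "zcount r q < zcount s q"
proof -
  let ?A = "{w. w \<in> ball 0 r \<and> poly q w = 0}" and ?B = "{w. w \<in> ball 0 s \<and> poly q w = 0}"
  have fin: "finite ?B" by (rule finite_subset[OF _ poly_roots_finite[OF q]]) auto
  have "(\<Sum>w\<in>?A. order w q) < (\<Sum>w\<in>?A. order w q) + order w q"
    using q w by (simp add: order_root)
  also have "\<dots> = (\<Sum>w\<in>insert w ?A. order w q)"
    using rs finite_subset[OF _ fin, of ?A] by (subst sum.insert) (auto intro: rev_finite_subset[OF fin])
  also have "\<dots> \<le> (\<Sum>w\<in>?B. order w q)" using rs w by (intro sum_mono2 fin) auto
  finally show ?thesis by (simp add: zcount_def)
qed

text \<open>There are finitely many roots, so those in the open disk keep a distance from the
  boundary. The annulus does not contain the unit circle, on which roots may remain.\<close>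

lemma root_free_annulus:
  fixes q :: "complex poly"
  assumes q: "q \<noteq> 0" and "r0 < 1"
  obtains r where "r0 < r" "0 < r" "r < 1" "\<And>w. r \<le> cmod w \<Longrightarrow> cmod w < 1 \<Longrightarrow> poly q w \<noteq> 0"
proof -
  let ?A = "insert (max 0 r0) {cmod w | w. poly q w = 0 \<and> cmod w < 1}"
  have fin: "finite ?A" using poly_roots_finite[OF q] by auto
  have "Max ?A < 1" using fin assms(2) by (subst Max_less_iff) auto
  then obtain r where r: "Max ?A < r" "r < 1" using dense by blast
  then have "\<forall>x\<in>?A. x < r" using fin by (subst (asm) Max_less_iff) auto
  then show thesis using r(2) by (intro that[of r]) force+
qed

lemma zcount_eq_of_annulus:
  assumes "r \<le> 1" and "\<And>w. r \<le> cmod w \<Longrightarrow> cmod w < 1 \<Longrightarrow> poly q w \<noteq> 0"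
  shows "zcount r q = zcount 1 q"
proof -
  have "{w. w \<in> ball 0 r \<and> poly q w = 0} = {w. w \<in> ball 0 1 \<and> poly q w = 0}"
    using assms by (auto simp: not_less) (metis not_le)
  then show ?thesis by (simp add: zcount_def)
qed

text \<open>Substituting the constant polynomial \<open>[:w:]\<close> for the outer indeterminate
  leaves a polynomial in z: the slice of p in the other direction.\<close>

lemma poly_poly_const: "poly (poly p [:w:]) z = poly2 p (z, w)"
  unfolding poly2_eq poly_altdef[of p] by (simp add: poly_sum)

text \<open>The counterpart of \<open>slice_nonzero\<close>: here the absence of factors in w alone
  is used.\<close>

lemma poly_const_nonzero:
  assumes "no_univariate_factors p"
  shows "poly p [:w:] \<noteq> 0"
proof
  assume "poly p [:w:] = 0"
  then have "[:- [:w:], 1:] dvd p" by (simp add: poly_eq_0_iff_dvd)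
  moreover have "map_poly (\<lambda>c. [:c:]) [:- w, 1:] = [:- [:w:], 1:]"
    by (simp add: map_poly_pCons)
  moreover have "degree [:- w, 1:] > 0" by simp
  ultimately show False using assms unfolding no_univariate_factors_def by metis
qed

text \<open>If p(., w) had no zero near z1, the maximum principle for its reciprocal would bound
  |p(z1, w)| below by the values on a small circle around z1. These are at least m / 2, while p(z1,
  w) is close to p(z1, w1) = 0.\<close>

lemma root_continuity:
  assumes p: "no_univariate_factors p" and root: "poly2 p (z1, w1) = 0" and e: "e > 0"
  shows "\<exists>\<eta>>0. \<forall>w. cmod (w - w1) < \<eta> \<longrightarrow> (\<exists>z. cmod (z - z1) < e \<and> poly2 p (z, w) = 0)"
proof -
  let ?R = "{z. poly2 p (z, w1) = 0}"
  have fin: "finite ?R"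
    using poly_roots_finite[OF poly_const_nonzero[OF p, of w1]] by (simp add: poly_poly_const)
  \<comment> \<open>Finitely many radii are excluded by the zeros of p(., w1), so some radius below
    \<open>e\<close> gives a circle without zeros.\<close>
  obtain r where r: "0 < r" "r < e" "\<And>z. cmod (z - z1) = r \<Longrightarrow> poly2 p (z, w1) \<noteq> 0"
  proof -
    have "infinite {0<..<e}" using e by simp
    moreover have "finite ((\<lambda>z. cmod (z - z1)) ` ?R)" using fin by simp
    ultimately obtain r where "r \<in> {0<..<e}" "r \<notin> (\<lambda>z. cmod (z - z1)) ` ?R"
      by (meson finite_subset subsetI)
    then show thesis by (intro that[of r]) auto
  qed
  have "continuous_on (sphere z1 r) (\<lambda>z. cmod (poly2 p (z, w1)))" by (intro continuous_intros)
  moreover have "z1 + of_real r \<in> sphere z1 r" using r(1) by (simp add: dist_norm)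
  ultimately obtain z0 where z0: "z0 \<in> sphere z1 r"
      "\<And>z. z \<in> sphere z1 r \<Longrightarrow> cmod (poly2 p (z0, w1)) \<le> cmod (poly2 p (z, w1))"
    using continuous_attains_inf[of "sphere z1 r"] by (metis compact_sphere empty_iff)
  define m where "m = cmod (poly2 p (z0, w1))"
  have m: "m > 0" using r(3)[of z0] z0(1) by (simp add: m_def dist_norm norm_minus_commute)
  have "continuous_on (cball z1 r \<times> cball w1 1) (\<lambda>x. poly2 p (fst x, snd x))"
    by (intro continuous_intros)
  then have "uniformly_continuous_on (cball z1 r \<times> cball w1 1) (\<lambda>x. poly2 p (fst x, snd x))"
    by (intro compact_uniformly_continuous compact_Times) auto
  then obtain d where d: "d > 0" "\<And>x x'. x \<in> cball z1 r \<times> cball w1 1 \<Longrightarrow> x' \<in> cball z1 r \<times> cball w1 1 \<Longrightarrow>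
      dist x' x < d \<Longrightarrow> dist (poly2 p (fst x', snd x')) (poly2 p (fst x, snd x)) < m / 2"
    unfolding uniformly_continuous_on_def using m by (metis half_gt_zero)
  have "\<exists>z. cmod (z - z1) < e \<and> poly2 p (z, w) = 0" if w: "cmod (w - w1) < min d 1" for w
  proof (rule ccontr)
    assume "\<not> (\<exists>z. cmod (z - z1) < e \<and> poly2 p (z, w) = 0)"
    then have nz: "poly2 p (z, w) \<noteq> 0" if "z \<in> cball z1 r" for z
      using that r(2) by (auto simp: dist_norm norm_minus_commute)
    have close: "cmod (poly2 p (z, w) - poly2 p (z, w1)) < m / 2" if "z \<in> cball z1 r" for z
      using d(2)[of "(z, w1)" "(z, w)"] that w by (simp add: dist_Pair_Pair dist_norm norm_minus_commute)
    let ?f = "\<lambda>z. 1 / poly (poly p [:w:]) z"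
    have "cmod (?f z1) \<le> 1 / (m / 2)"
    proof (rule maximum_modulus_frontier[of ?f "ball z1 r"])
      have nz': "poly (poly p [:w:]) z \<noteq> 0" if "z \<in> cball z1 r" for z
        using nz[OF that] by (simp add: poly_poly_const)
      then show "?f holomorphic_on interior (ball z1 r)"
        by (intro holomorphic_intros) auto
      show "continuous_on (closure (ball z1 r)) ?f"
        using nz' r(1) by (intro continuous_intros) auto
      fix z assume "z \<in> frontier (ball z1 r)"
      then have z: "z \<in> sphere z1 r" using r(1) by simp
      have "m \<le> cmod (poly2 p (z, w1))" using z0(2)[OF z] by (simp add: m_def)
      also have "\<dots> \<le> cmod (poly2 p (z, w)) + cmod (poly2 p (z, w) - poly2 p (z, w1))"
        using norm_triangle_ineq4[of "poly2 p (z, w)" "poly2 p (z, w) - poly2 p (z, w1)"] by simp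
      finally have "m / 2 \<le> cmod (poly2 p (z, w))" using close[of z] z by simp
      then show "cmod (?f z) \<le> 1 / (m / 2)"
        using m frac_le[of 1 1 "m / 2" "cmod (poly2 p (z, w))"]
        unfolding poly_poly_const norm_divide norm_one by linarith
    qed (use r in auto)
    then have "m / 2 \<le> cmod (poly2 p (z1, w))"
      using m nz[of z1] r(1) by (simp add: poly_poly_const norm_divide field_simps)
    then show False using close[of z1] r(1) root by simp
  qed
  then show ?thesis using d(1) by (intro exI[of _ "min d 1"]) auto
qed

section \<open>The set Omega and its accumulation at zeros of p\<close>

lemma mem_Omega_base:
  "z \<in> ball 0 1 - fst ` (zero_set p \<inter> ball 0 1 \<times> sphere 0 1) \<longleftrightarrow>
    cmod z < 1 \<and> (\<forall>w. cmod w = 1 \<longrightarrow> poly2 p (z, w) \<noteq> 0)"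
  by (force simp: zero_set_def)

lemma Omega_base_locally_constant:
  assumes p: "no_univariate_factors p"
    and z: "z \<in> ball 0 1 - fst ` (zero_set p \<inter> ball 0 1 \<times> sphere 0 1)" (is "z \<in> ?V")
  shows "\<exists>\<delta>>0. ball z \<delta> \<subseteq> ?V \<and> (\<forall>v\<in>ball z \<delta>. disk_zeros (slice p v) = disk_zeros (slice p z))"
proof -
  have nz: "poly2 p (z, w) \<noteq> 0" if "cmod w = 1" for w
    using z that unfolding mem_Omega_base by blast
  obtain d1 where d1: "d1 > 0" "\<And>v. v \<in> ball z d1 \<Longrightarrow> zcount 1 (slice p v) = zcount 1 (slice p z)"
    using zcount_locally_constant[OF p _ nz] by (metis zero_less_one)
  obtain d2 \<kappa> where d2: "d2 > 0" "\<kappa> > 0" "\<And>v w. cmod (v - z) < d2 \<Longrightarrow> cmod w = 1 \<Longrightarrow> \<kappa> \<le> cmod (poly2 p (v, w))"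
    using poly2_near_circle[of 1 p z, OF nz] by blast
  have z1: "cmod z < 1" using z unfolding mem_Omega_base by blast
  let ?d = "min (min d1 d2) (1 - cmod z)"
  have "ball z ?d \<subseteq> ?V"
  proof
    fix v assume v: "v \<in> ball z ?d"
    have "cmod v \<le> cmod z + cmod (v - z)" using norm_triangle_ineq[of z "v - z"] by simp
    then have "cmod v < 1" using v by (simp add: dist_norm norm_minus_commute)
    moreover have "poly2 p (v, w) \<noteq> 0" if "cmod w = 1" for w
      using d2(3)[of v w] d2(2) v that by (auto simp: dist_norm norm_minus_commute)
    ultimately show "v \<in> ?V" unfolding mem_Omega_base by blast
  qed
  moreover have "\<forall>v\<in>ball z ?d. disk_zeros (slice p v) = disk_zeros (slice p z)"
    using d1(2) by (simp add: disk_zeros_eq_zcount)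
  moreover have "?d > 0" using d1 d2 z1 by simp
  ultimately show ?thesis by blast
qed

text \<open>The zero count is locally constant, hence constant on components, so selecting
  components by the count is the same as selecting points.\<close>

lemma Omega_eq:
  assumes p: "no_univariate_factors p"
  shows "Omega p = {z \<in> ball 0 1 - fst ` (zero_set p \<inter> ball 0 1 \<times> sphere 0 1). disk_zeros (slice p z) > 0}"
    (is "_ = {z \<in> ?V. _}")
proof (intro equalityI subsetI)
  fix z assume "z \<in> Omega p"
  then show "z \<in> {z \<in> ?V. disk_zeros (slice p z) > 0}"
    unfolding Omega_def using in_components_subset by fastforce
next
  fix z assume z: "z \<in> {z \<in> ?V. disk_zeros (slice p z) > 0}"
  let ?C = "connected_component_set ?V z"
  have C: "?C \<in> components ?V" using z by (simp add: componentsI)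
  have "disk_zeros (slice p v) > 0" if v: "v \<in> ?C" for v
  proof -
    have "disk_zeros (slice p z) = disk_zeros (slice p v)"
    proof (rule connected_local_const[of ?C])
      show "z \<in> ?C" using z by simp
      show "\<forall>a\<in>?C. eventually (\<lambda>b. disk_zeros (slice p a) = disk_zeros (slice p b)) (at a within ?C)"
      proof
        fix a assume "a \<in> ?C"
        then have "a \<in> ?V" using connected_component_subset by blast
        then obtain d where d: "d > 0" "\<And>v. v \<in> ball a d \<Longrightarrow> disk_zeros (slice p v) = disk_zeros (slice p a)"
          using Omega_base_locally_constant[OF p] by meson
        have "disk_zeros (slice p a) = disk_zeros (slice p b)" if "dist b a < d" for b
          using d(2)[of b] that by (simp add: dist_commute)
        then show "eventually (\<lambda>b. disk_zeros (slice p a) = disk_zeros (slice p b)) (at a within ?C)"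
          unfolding eventually_at using d(1) by blast
      qed
    qed (use v in auto)
    then show ?thesis using z by simp
  qed
  then show "z \<in> Omega p" unfolding Omega_def using C z by (intro UnionI[of ?C]) auto
qed

lemma Omega_locally_constant:
  assumes p: "no_univariate_factors p" and z: "z \<in> Omega p"
  shows "\<exists>\<delta>>0. ball z \<delta> \<subseteq> Omega p \<and> (\<forall>v\<in>ball z \<delta>. disk_zeros (slice p v) = disk_zeros (slice p z))"
proof -
  let ?V = "ball 0 1 - fst ` (zero_set p \<inter> ball 0 1 \<times> sphere 0 1)"
  have z: "z \<in> ?V" "disk_zeros (slice p z) > 0" using z unfolding Omega_eq[OF p] by blast+
  obtain d where d: "d > 0" "ball z d \<subseteq> ?V"
    "\<And>v. v \<in> ball z d \<Longrightarrow> disk_zeros (slice p v) = disk_zeros (slice p z)"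
    using Omega_base_locally_constant[OF p z(1)] by blast
  have "ball z d \<subseteq> Omega p"
    unfolding Omega_eq[OF p] using d(2,3) z(2) by (metis (no_types, lifting) mem_Collect_eq subset_iff)
  with d show ?thesis by blast
qed

lemma open_Omega: "no_univariate_factors p \<Longrightarrow> open (Omega p)"
  unfolding open_contains_ball using Omega_locally_constant by blast

lemma Omega_subset: "Omega p \<subseteq> ball 0 1"
  unfolding Omega_def using in_components_subset by blast

lemma Omega_nonzero: "no_univariate_factors p \<Longrightarrow> z \<in> Omega p \<Longrightarrow> cmod w = 1 \<Longrightarrow> poly2 p (z, w) \<noteq> 0"
  using mem_Omega_base[of z p] by (simp add: Omega_eq)

lemma Omega_root:
  assumes "no_univariate_factors p" "z \<in> Omega p"
  shows "\<exists>w. cmod w < 1 \<and> poly2 p (z, w) = 0"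
  using assms zcount_eq_0_iff[OF slice_nonzero[OF assms(1)], of 1 z]
  by (auto simp: Omega_eq disk_zeros_eq_zcount poly_slice)

text \<open>The zero set over a neighbourhood of any of its points in the bidisk meets the part over
  \<open>\<Omega>\<close>: maximise the number of zeros in the disk among the nearby slices. A zero on the circle of
  the maximising slice could be moved into the disk by perturbing \<open>z\<close>.\<close>

lemma Omega_accumulates:
  assumes p: "no_univariate_factors p" and z0: "cmod z0 < 1" and w0: "cmod w0 < 1" "poly2 p (z0, w0) = 0"
    and d: "d > 0"
  shows "\<exists>z\<in>Omega p. cmod (z - z0) < d"
proof -
  note nz = slice_nonzero[OF p]
  define d' where "d' = min d (1 - cmod z0)"
  have d': "d' > 0" using d z0 by (simp add: d'_def)
  have "zcount 1 (slice p z) < Suc (degree p)" for z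
    using zcount_le_degree[OF nz, of 1 z] degree_slice_le[of p z] by simp
  then obtain z1 where z1: "z1 \<in> ball z0 d'"
    and max: "\<And>z. z \<in> ball z0 d' \<Longrightarrow> zcount 1 (slice p z) \<le> zcount 1 (slice p z1)"
    using ex_has_greatest_nat[of "\<lambda>z. z \<in> ball z0 d'" z0 "\<lambda>z. zcount 1 (slice p z)" "Suc (degree p)"] d'
    by auto
  have "cmod z1 \<le> cmod z0 + cmod (z1 - z0)" using norm_triangle_ineq[of z0 "z1 - z0"] by simp
  then have z11: "cmod z1 < 1" using z1 by (simp add: d'_def dist_norm norm_minus_commute)
  have "zcount 1 (slice p z0) \<noteq> 0" using zcount_eq_0_iff[OF nz] w0 by (auto simp: poly_slice)
  then have pos: "zcount 1 (slice p z1) > 0" using max[of z0] d' by simp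
  have "poly2 p (z1, w1) \<noteq> 0" if w1: "cmod w1 = 1" for w1
  proof
    assume root: "poly2 p (z1, w1) = 0"
    \<comment> \<open>All zeros of the maximising slice in the open disk lie inside radius r, and
      nearby slices keep the same number there.\<close>
    obtain r where r: "0 < r" "r < 1" "\<And>w. r \<le> cmod w \<Longrightarrow> cmod w < 1 \<Longrightarrow> poly (slice p z1) w \<noteq> 0"
      using root_free_annulus[OF nz, of 0] by (metis zero_less_one)
    have r1: "zcount r (slice p z1) = zcount 1 (slice p z1)"
      using r by (intro zcount_eq_of_annulus) auto
    obtain d1 where d1: "d1 > 0" "\<And>v. v \<in> ball z1 d1 \<Longrightarrow> zcount r (slice p v) = zcount r (slice p z1)"
      using zcount_locally_constant[OF p r(1), of z1] r by (metis order_refl poly_slice)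
    define e where "e = min d1 (d' - dist z0 z1)"
    have e: "e > 0" using d1 z1 by (simp add: e_def)
    obtain \<eta> where \<eta>: "\<eta> > 0" "\<And>w. cmod (w - w1) < \<eta> \<Longrightarrow> \<exists>z. cmod (z - z1) < e \<and> poly2 p (z, w) = 0"
      using root_continuity[OF p root e] by blast
    \<comment> \<open>The point \<open>t * w1\<close> is inside the disk but beyond radius r. A
      slice through a zero there has one zero more than the maximum allows.\<close>
    obtain t where t: "max r (1 - \<eta>) < t" "t < 1" using dense[of "max r (1 - \<eta>)" 1] r \<eta>(1) by auto
    have "of_real t * w1 - w1 = of_real (t - 1) * w1" by (simp add: algebra_simps)
    then have "cmod (of_real t * w1 - w1) = 1 - t" using w1 t by (simp add: norm_mult flip: of_real_diff)
    then have "cmod (of_real t * w1 - w1) < \<eta>" using t by simp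
    from \<eta>(2)[OF this] obtain z where z: "cmod (z - z1) < e" "poly2 p (z, of_real t * w1) = 0" by blast
    have tw: "cmod (of_real t * w1) = t" using w1 t r by (simp add: norm_mult)
    have "zcount r (slice p z) < zcount 1 (slice p z)"
      by (rule zcount_mono_strict[OF nz, of _ "of_real t * w1"]) (use tw t z in \<open>auto simp: poly_slice\<close>)
    moreover have "zcount r (slice p z) = zcount 1 (slice p z1)"
      using d1(2)[of z] z r1 by (simp add: e_def dist_norm norm_minus_commute)
    moreover have "z \<in> ball z0 d'"
      using dist_triangle[of z0 z z1] z(1) by (simp add: e_def dist_norm norm_minus_commute)
    ultimately show False using max[of z] by simp
  qed
  then have "z1 \<in> Omega p"
    unfolding Omega_eq[OF p] mem_Collect_eq mem_Omega_base using z11 pos by (simp add: disk_zeros_eq_zcount)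
  then show ?thesis using z1 by (intro bexI[of _ z1]) (auto simp: d'_def dist_norm norm_minus_commute)
qed

section \<open>Laurent coefficients of a quotient\<close>

definition frow :: "hardy2 \<Rightarrow> complex \<Rightarrow> nat \<Rightarrow> complex"
  where "frow f z n = (\<Sum>m. hcoeff f (m, n) * z ^ m)"

lemma frow_sums:
  assumes "cmod z < 1"
  shows "(\<lambda>m. hcoeff f (m, n) * z ^ m) sums frow f z n"
proof -
  have "summable (\<lambda>m. hcoeff f (m, n) * z ^ m)"
  proof (rule summable_comparison_test'[of "\<lambda>m. norm f * cmod z ^ m"])
    show "summable (\<lambda>m. norm f * cmod z ^ m)" using assms by (intro summable_mult summable_geometric) simp
    show "norm (hcoeff f (m, n) * z ^ m) \<le> norm f * cmod z ^ m" for m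
      unfolding norm_mult norm_power by (intro mult_right_mono hcoeff_le_norm) simp
  qed
  then show ?thesis by (simp add: frow_def summable_sums)
qed

lemma frow_holomorphic: "(\<lambda>z. frow f z n) holomorphic_on ball 0 1"
  by (rule power_series_holomorphic[of _ _ "\<lambda>m. hcoeff f (m, n)"]) (use frow_sums in auto)

lemma l2b_frow:
  assumes z: "cmod z < 1"
  shows "l2b (frow f z) (norm f / (1 - cmod z))"
  unfolding l2b_def
proof
  fix N
  have "l2n (\<lambda>n. \<Sum>m<M. z ^ m * hcoeff f (m, n)) N \<le> norm f / (1 - cmod z)" for M
  proof -
    have b: "l2b (\<lambda>n. \<Sum>m<M. z ^ m * hcoeff f (m, n)) (\<Sum>m<M. cmod (z ^ m) * norm f)"
      by (intro l2b_sum l2b_cmult l2b_row) simp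
    have eq: "(\<Sum>m<M. cmod (z ^ m) * norm f) = (\<Sum>m<M. cmod z ^ m) * norm f"
      by (simp add: norm_power sum_distrib_right)
    have "(\<Sum>m<M. cmod z ^ m) \<le> 1 / (1 - cmod z)"
      using z sum_le_suminf[of "\<lambda>m. cmod z ^ m" "{..<M}"] by (simp add: suminf_geometric)
    then have "(\<Sum>m<M. cmod z ^ m) * norm f \<le> 1 / (1 - cmod z) * norm f"
      by (intro mult_right_mono) auto
    from l2bD[OF l2b_mono[OF b[unfolded eq] this]] show ?thesis by simp
  qed
  moreover have "(\<lambda>M. l2n (\<lambda>n. \<Sum>m<M. z ^ m * hcoeff f (m, n)) N) \<longlonglongrightarrow> l2n (frow f z) N"
    unfolding l2n_def L2_set_def
    using frow_sums[OF z, of f] by (intro tendsto_intros) (simp add: sums_def mult.commute)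
  ultimately show "l2n (frow f z) N \<le> norm f / (1 - cmod z)"
    by (intro LIMSEQ_le_const2) auto
qed

lemma suminf_eq_infsum:
  fixes g :: "nat \<Rightarrow> complex"
  assumes "g summable_on UNIV"
  shows "infsum g UNIV = suminf g"
  using has_sum_imp_sums[OF has_sum_infsum[OF assms]] by (simp add: sums_unique)

text \<open>Orthogonality to the eigenvectors at \<open>cnj z\<close> becomes a bilinear pairing of
  the slice f(z, .) with the kernel sequences of p(z, .).\<close>

lemma cinner_eigvec:
  assumes w: "cmod w < 1" and h: "square_summable h"
  shows "cinner f (eigvec w h) = (\<Sum>n. frow f (cnj w) n * h n)"
proof -
  let ?t = "\<lambda>m n. hcoeff f (m, n) * (cnj w ^ m * h n)"
  have eq: "(\<lambda>k. hcoeff f k * cnj (hcoeff (eigvec w h) k)) = (\<lambda>(m, n). ?t m n)"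
    by (auto simp: fun_eq_iff hcoeff_eigvec'[OF w h])
  have sm: "(\<lambda>(m, n). ?t m n) summable_on UNIV \<times> UNIV"
    using square_summable_cinner[OF hcoeff[of f] hcoeff[of "eigvec w h"]] by (simp add: eq)
  then have sm': "(\<lambda>(n, m). ?t m n) summable_on UNIV \<times> UNIV"
    using summable_on_reindex_bij_betw[OF bij_swap, of "\<lambda>(m, n). ?t m n"]
    by (simp add: case_prod_unfold prod.swap_def)
  have row: "infsum (\<lambda>m. ?t m n) UNIV = frow f (cnj w) n * h n" for n
  proof -
    have "(\<lambda>m. ?t m n) summable_on UNIV"
      using summable_on_SigmaD1[OF sm', of n] by simp
    then have "infsum (\<lambda>m. ?t m n) UNIV = (\<Sum>m. ?t m n)" by (rule suminf_eq_infsum)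
    also have "\<dots> = frow f (cnj w) n * h n"
      using frow_sums[of "cnj w" f n] w suminf_mult2[of "\<lambda>m. hcoeff f (m, n) * cnj w ^ m" "h n"]
      by (simp add: sums_iff mult_ac)
    finally show ?thesis .
  qed
  have "cinner f (eigvec w h) = infsum (\<lambda>(m, n). ?t m n) (UNIV \<times> UNIV)"
    by (simp add: cinner_hardy2 eq)
  also have "\<dots> = infsum (\<lambda>n. infsum (\<lambda>m. ?t m n) UNIV) UNIV"
    using infsum_Sigma'_banach[OF sm] infsum_swap_banach[OF sm] by simp
  also have "\<dots> = (\<Sum>n. frow f (cnj w) n * h n)"
    unfolding row
    using summable_on_Sigma_banach[OF sm'] by (intro suminf_eq_infsum) (simp add: row)
  finally show ?thesis .
qed

section \<open>Fourier integrals of 1 / p(z, .) over circles\<close>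

definition circ :: "real \<Rightarrow> real \<Rightarrow> complex"
  where "circ r t = of_real r * exp (2 * of_real pi * \<i> * of_real t)"

lemma norm_circ: "r > 0 \<Longrightarrow> cmod (circ r t) = r"
  by (simp add: circ_def norm_mult norm_exp_eq_Re)

lemma continuous_on_circ [continuous_intros]: "continuous_on S f \<Longrightarrow> continuous_on S (\<lambda>x. circ r (f x))"
  unfolding circ_def by (intro continuous_intros)

lemma integral_circ_powi:
  assumes "r > 0"
  shows "integral {0..1} (\<lambda>t. circ r t powi k) = (if k = 0 then 1 else 0)"
proof (cases "k = 0")
  case False
  have eq: "circ r t powi k = of_real r powi k * exp (2 * of_real pi * \<i> * of_int k * of_real t)" for t
    by (simp add: circ_def power_int_mult_distrib exp_power_int mult_ac)
  define c where "c = 2 * of_real pi * \<i> * of_int k"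
  have c: "c \<noteq> 0" using False by (simp add: c_def)
  have "((\<lambda>t. circ r t powi k) has_integral
      of_real r powi k * exp (c * of_real 1) / c - of_real r powi k * exp (c * of_real 0) / c) {0..1}"
  proof (rule fundamental_theorem_of_calculus)
    fix t :: real assume "t \<in> {0..1}"
    have "((\<lambda>x. of_real r powi k * exp (c * x) / c) has_field_derivative
        of_real r powi k * exp (c * of_real t)) (at (of_real t))"
      using c by (auto intro!: derivative_eq_intros)
    then have "((\<lambda>t. of_real r powi k * exp (c * of_real t) / c) has_vector_derivative
        of_real r powi k * exp (c * of_real t)) (at t within {0..1})"
      by (rule has_vector_derivative_real_field)
    then show "((\<lambda>t. of_real r powi k * exp (c * of_real t) / c) has_vector_derivative circ r t powi k) (at t within {0..1})"
      by (simp add: eq c_def)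
  qed simp
  moreover have "exp c = 1"
  proof -
    have "c = 2 * of_int k * of_real pi * \<i>" by (simp add: c_def)
    then show ?thesis using exp_eq_1[of c] by auto
  qed
  ultimately have "((\<lambda>t. circ r t powi k) has_integral 0) {0..1}" by simp
  then show ?thesis using False by (simp add: integral_unique)
qed simp

text \<open>\<open>inv_laurent p r z k\<close> is the \<open>k\<close>-th Laurent coefficient of \<open>1 / p(z, \<cdot>)\<close> on the circle of
  radius \<open>r\<close>.\<close>

definition inv_laurent :: "complex poly poly \<Rightarrow> real \<Rightarrow> complex \<Rightarrow> int \<Rightarrow> complex"
  where "inv_laurent p r z k = integral {0..1} (\<lambda>t. circ r t powi (- k) / poly2 p (z, circ r t))"

lemma inv_laurent_integrable:
  assumes "r > 0" "\<And>w. cmod w = r \<Longrightarrow> poly2 p (z, w) \<noteq> 0"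
  shows "(\<lambda>t. circ r t powi j / poly2 p (z, circ r t)) integrable_on {0..1}"
proof (rule integrable_continuous_real)
  have "circ r t \<noteq> 0" for t using norm_circ[OF assms(1), of t] assms(1) by auto
  then show "continuous_on {0..1} (\<lambda>t. circ r t powi j / poly2 p (z, circ r t))"
    using assms(2) norm_circ[OF assms(1)] by (intro continuous_intros) auto
qed

text \<open>The identity p(z, .) times 1 / p(z, .) = 1 on the circle, read off
  coefficientwise.\<close>

lemma inv_laurent_conv:
  assumes r: "r > 0" and nz: "\<And>w. cmod w = r \<Longrightarrow> poly2 p (z, w) \<noteq> 0"
  shows "(\<Sum>j\<le>degree p. poly (coeff p j) z * inv_laurent p r z (k - int j)) = (if k = 0 then 1 else 0)"
proof -
  have c0: "circ r t \<noteq> 0" for t using norm_circ[OF r, of t] r by auto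
  have int: "(\<lambda>t. poly (coeff p j) z * (circ r t powi (- (k - int j)) / poly2 p (z, circ r t))) integrable_on {0..1}" for j
    by (intro integrable_on_mult_right inv_laurent_integrable r nz)
  have "(\<Sum>j\<le>degree p. poly (coeff p j) z * inv_laurent p r z (k - int j))
      = integral {0..1} (\<lambda>t. \<Sum>j\<le>degree p. poly (coeff p j) z * (circ r t powi (- (k - int j)) / poly2 p (z, circ r t)))"
    unfolding inv_laurent_def integral_sum[OF finite_atMost int] by (simp only: integral_mult_right)
  also have "(\<lambda>t. \<Sum>j\<le>degree p. poly (coeff p j) z * (circ r t powi (- (k - int j)) / poly2 p (z, circ r t)))
      = (\<lambda>t. circ r t powi (- k))"
  proof
    fix t
    have "circ r t powi (- (k - int j)) = circ r t powi (- k) * circ r t ^ j" for j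
      using c0[of t] by (simp add: power_int_add[symmetric] flip: power_int_of_nat)
    then have "(\<Sum>j\<le>degree p. poly (coeff p j) z * (circ r t powi (- (k - int j)) / poly2 p (z, circ r t)))
        = circ r t powi (- k) / poly2 p (z, circ r t) * (\<Sum>j\<le>degree p. poly (coeff p j) z * circ r t ^ j)"
      by (simp add: sum_distrib_left mult_ac)
    also have "\<dots> = circ r t powi (- k)"
      using nz[OF norm_circ[OF r], of t] by (simp flip: poly2_eq)
    finally show "(\<Sum>j\<le>degree p. poly (coeff p j) z * (circ r t powi (- (k - int j)) / poly2 p (z, circ r t)))
        = circ r t powi (- k)" .
  qed
  also have "integral {0..1} (\<lambda>t. circ r t powi (- k)) = (if k = 0 then 1 else 0)"
    using integral_circ_powi[OF r, of "- k"] by simp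
  finally show ?thesis .
qed

lemma norm_inv_laurent_le:
  assumes r: "r > 0" and \<kappa>: "\<kappa> > 0" and low: "\<And>w. cmod w = r \<Longrightarrow> \<kappa> \<le> cmod (poly2 p (z, w))"
  shows "cmod (inv_laurent p r z k) \<le> r powi (- k) / \<kappa>"
proof -
  have nz: "poly2 p (z, w) \<noteq> 0" if "cmod w = r" for w using low[OF that] \<kappa> by auto
  have "norm (integral {0..1} (\<lambda>t. circ r t powi (- k) / poly2 p (z, circ r t)))
      \<le> integral {0..1} (\<lambda>t::real. r powi (- k) / \<kappa>)"
  proof (rule integral_norm_bound_integral)
    show "norm (circ r t powi (- k) / poly2 p (z, circ r t)) \<le> r powi (- k) / \<kappa>" for t
      using low[OF norm_circ[OF r], of t] r \<kappa>
      by (auto simp: norm_divide norm_power_int norm_circ intro!: frac_le)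
  qed (use inv_laurent_integrable[OF r nz] in auto)
  then show ?thesis by (simp add: inv_laurent_def)
qed

lemma inv_laurent_holomorphic:
  assumes r: "r > 0" and nz: "\<And>z w. z \<in> ball z0 d \<Longrightarrow> cmod w = r \<Longrightarrow> poly2 p (z, w) \<noteq> 0"
  shows "(\<lambda>z. inv_laurent p r z k) holomorphic_on ball z0 d"
proof -
  define dp where "dp z w = (\<Sum>n\<le>degree p. poly (pderiv (coeff p n)) z * w ^ n)" for z w
  have der: "((\<lambda>z. poly2 p (z, w)) has_field_derivative dp z w) (at z within S)" for z w S
    unfolding poly2_eq dp_def by (auto intro!: derivative_eq_intros sum.cong)
  have c0: "circ r t \<noteq> 0" for t using norm_circ[OF r, of t] r by auto
  have "(\<lambda>z. integral (cbox 0 1) (\<lambda>t. circ r t powi (- k) / poly2 p (z, circ r t))) holomorphic_on ball z0 d"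
  proof (rule leibniz_rule_holomorphic)
    show "((\<lambda>z. circ r t powi (- k) / poly2 p (z, circ r t)) has_field_derivative
        - (circ r t powi (- k) * dp z (circ r t)) / (poly2 p (z, circ r t))\<^sup>2) (at z within ball z0 d)"
      if "z \<in> ball z0 d" for z t
      using nz[OF that norm_circ[OF r], of t]
      by (auto intro!: derivative_eq_intros der simp: power2_eq_square)
    show "(\<lambda>t. circ r t powi (- k) / poly2 p (z, circ r t)) integrable_on cbox 0 1" if "z \<in> ball z0 d" for z
      using inv_laurent_integrable[OF r nz[OF that]] by simp
    show "continuous_on (ball z0 d \<times> cbox 0 1)
        (\<lambda>(z, t). - (circ r t powi (- k) * dp z (circ r t)) / (poly2 p (z, circ r t))\<^sup>2)"
      unfolding case_prod_unfold dp_def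
      using nz norm_circ[OF r] c0 by (intro continuous_intros) auto
  qed simp
  then show ?thesis by (simp add: inv_laurent_def)
qed

text \<open>Without zeros in the closed disk, 1 / p(z, .) is holomorphic there, and Cauchy's theorem
  kills the coefficients of negative index.\<close>

lemma inv_laurent_eq_0:
  assumes r: "r > 0" and k: "k < 0" and nz: "\<And>w. cmod w \<le> r \<Longrightarrow> poly2 p (z, w) \<noteq> 0"
  shows "inv_laurent p r z k = 0"
proof -
  \<comment> \<open>One power less than -k: the line element of the circle is 2 \<pi> i w dt and
    supplies the missing factor w.\<close>
  define m where "m = nat (- k - 1)"
  have m: "- k = int (Suc m)" using k by (simp add: m_def)
  let ?g = "\<lambda>w. w ^ m / poly2 p (z, w)"
  have diff: "?g field_differentiable at w" if "w \<in> cball 0 r" for w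
  proof -
    have "poly (slice p z) holomorphic_on UNIV" by (intro holomorphic_intros)
    then have "poly (slice p z) field_differentiable at w" by (rule holomorphic_on_imp_differentiable_at) auto
    then show ?thesis
      using nz[of w] that unfolding poly_slice[symmetric]
      by (intro field_differentiable_divide field_differentiable_power field_differentiable_ident) auto
  qed
  have ci: "(?g has_contour_integral 0) (circlepath 0 r)"
  proof (rule Cauchy_theorem_convex[of "cball 0 r" _ "{}"])
    show "continuous_on (cball 0 r) ?g"
      using nz by (intro continuous_intros) auto
    show "?g field_differentiable at w" if "w \<in> interior (cball 0 r) - {}" for w
      by (rule diff) (use that interior_subset in blast)
  qed (use r in auto)
  have "0 = integral {0..1} (\<lambda>t. ?g (circlepath 0 r t) * vector_derivative (circlepath 0 r) (at t))"
    using contour_integral_unique[OF ci] contour_integral_integral[of "circlepath 0 r" ?g] by simp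
  also have "\<dots> = integral {0..1} (\<lambda>t. (2 * of_real pi * \<i>) * (circ r t powi (- k) / poly2 p (z, circ r t)))"
  proof (rule integral_cong)
    fix t :: real
    have "circlepath 0 r t = circ r t" by (simp add: circlepath circ_def)
    moreover have "vector_derivative (circlepath 0 r) (at t) = 2 * of_real pi * \<i> * circ r t"
      by (simp add: vector_derivative_circlepath circ_def)
    ultimately show "?g (circlepath 0 r t) * vector_derivative (circlepath 0 r) (at t)
        = (2 * of_real pi * \<i>) * (circ r t powi (- k) / poly2 p (z, circ r t))"
      unfolding m power_int_of_nat by simp
  qed
  also have "\<dots> = (2 * of_real pi * \<i>) * inv_laurent p r z k"
    unfolding inv_laurent_def by (rule integral_mult_right)
  finally show ?thesis by simp
qed

text \<open>The Laurent coefficients of \<open>f(z, \<cdot>) / p(z, \<cdot>)\<close> on the circle of radius \<open>r\<close>.\<close>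

definition quot_laurent :: "complex poly poly \<Rightarrow> real \<Rightarrow> hardy2 \<Rightarrow> complex \<Rightarrow> int \<Rightarrow> complex"
  where "quot_laurent p r f z k = (\<Sum>n. frow f z n * inv_laurent p r z (k - int n))"

section \<open>Laurent coefficients of f / p near a fixed slice, with bounds uniform in z\<close>

context
  fixes p :: "complex poly poly" and f :: hardy2 and r :: real and z0 :: complex and d \<kappa> s :: real
  assumes r: "0 < r" "r < 1" and \<kappa>: "\<kappa> > 0"
    and ball: "ball z0 d \<subseteq> ball 0 s" and s: "s < 1"
    and low: "\<And>z w. z \<in> ball z0 d \<Longrightarrow> cmod w = r \<Longrightarrow> \<kappa> \<le> cmod (poly2 p (z, w))"
begin

private lemma nz: "z \<in> ball z0 d \<Longrightarrow> cmod w = r \<Longrightarrow> poly2 p (z, w) \<noteq> 0"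
  using low[of z w] \<kappa> by auto

private lemma z_less: "z \<in> ball z0 d \<Longrightarrow> cmod z < s" "z \<in> ball z0 d \<Longrightarrow> cmod z < 1"
  using ball s by (auto simp: subset_iff)

private lemma term_le:
  assumes z: "z \<in> ball z0 d"
  shows "cmod (frow f z n * inv_laurent p r z (k - int n)) \<le> norm f / (1 - s) * (r powi (- k) / \<kappa>) * r ^ n"
proof -
  have "cmod (frow f z n) \<le> norm f / (1 - cmod z)" by (rule l2b_norm_le[OF l2b_frow[OF z_less(2)[OF z]]])
  also have "\<dots> \<le> norm f / (1 - s)" using z_less[OF z] s by (intro divide_left_mono mult_pos_pos) auto
  finally have 1: "cmod (frow f z n) \<le> norm f / (1 - s)" .
  have "cmod (inv_laurent p r z (k - int n)) \<le> r powi (- (k - int n)) / \<kappa>"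
    by (rule norm_inv_laurent_le[OF r(1) \<kappa> low[OF z]])
  also have "r powi (- (k - int n)) = r powi (- k) * r ^ n"
    using r by (simp add: power_int_add[symmetric] flip: power_int_of_nat)
  finally have 2: "cmod (inv_laurent p r z (k - int n)) \<le> r powi (- k) * r ^ n / \<kappa>" .
  have "cmod (frow f z n) * cmod (inv_laurent p r z (k - int n)) \<le> norm f / (1 - s) * (r powi (- k) * r ^ n / \<kappa>)"
    using 1 2 s by (intro mult_mono) auto
  then show ?thesis by (simp add: norm_mult mult_ac)
qed

private lemma bound_sums:
  "(\<lambda>n. norm f / (1 - s) * (r powi (- k) / \<kappa>) * r ^ n) sums (norm f / (1 - s) * (r powi (- k) / \<kappa>) * (1 / (1 - r)))"
  using r by (intro sums_mult geometric_sums) simp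

private lemma summable_terms:
  "z \<in> ball z0 d \<Longrightarrow> summable (\<lambda>n. frow f z n * inv_laurent p r z (k - int n))"
  by (rule summable_comparison_test'[OF sums_summable[OF bound_sums[of k]] term_le])

lemma norm_quot_laurent_le:
  "z \<in> ball z0 d \<Longrightarrow> cmod (quot_laurent p r f z k) \<le> norm f / (1 - s) * (r powi (- k) / \<kappa>) * (1 / (1 - r))"
  unfolding quot_laurent_def sums_unique[OF bound_sums[of k]]
  by (rule norm_suminf_le[OF term_le sums_summable[OF bound_sums]])

lemma quot_laurent_holomorphic: "(\<lambda>z. quot_laurent p r f z k) holomorphic_on ball z0 d"
proof (rule holomorphic_uniform_sequence)
  let ?F = "\<lambda>N z. \<Sum>n<N. frow f z n * inv_laurent p r z (k - int n)"
  have sub: "ball z0 d \<subseteq> ball 0 1" using z_less by auto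
  show "?F N holomorphic_on ball z0 d" for N
    by (intro holomorphic_intros holomorphic_on_subset[OF frow_holomorphic sub]
        inv_laurent_holomorphic[OF r(1)]) (use nz in auto)
  show "\<exists>e>0. cball x e \<subseteq> ball z0 d \<and> uniform_limit (cball x e) ?F (\<lambda>z. quot_laurent p r f z k) sequentially"
    if "x \<in> ball z0 d" for x
  proof -
    obtain e where e: "e > 0" "cball x e \<subseteq> ball z0 d" using \<open>x \<in> ball z0 d\<close> open_ball open_contains_cball by blast
    have "uniform_limit (cball x e) ?F (\<lambda>z. quot_laurent p r f z k) sequentially"
      unfolding quot_laurent_def
      by (rule Weierstrass_m_test[OF term_le sums_summable[OF bound_sums]]) (use e in auto)
    with e show ?thesis by blast
  qed
qed simp

text \<open>Multiplying the expansion of f / p by p recovers the Taylor series of f(z, .), whose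
  coefficients of negative index are 0.\<close>

lemma quot_laurent_conv:
  assumes z: "z \<in> ball z0 d"
  shows "(\<Sum>j\<le>degree p. poly (coeff p j) z * quot_laurent p r f z (k - int j)) = (if k \<ge> 0 then frow f z (nat k) else 0)"
proof -
  have "(\<Sum>j\<le>degree p. poly (coeff p j) z * quot_laurent p r f z (k - int j))
      = (\<Sum>j\<le>degree p. \<Sum>n. poly (coeff p j) z * (frow f z n * inv_laurent p r z (k - int j - int n)))"
    unfolding quot_laurent_def by (intro sum.cong refl suminf_mult[symmetric] summable_terms z)
  also have "\<dots> = (\<Sum>n. \<Sum>j\<le>degree p. poly (coeff p j) z * (frow f z n * inv_laurent p r z (k - int j - int n)))"
    by (rule suminf_sum[symmetric]) (intro summable_mult summable_terms z)
  also have "\<dots> = (\<Sum>n. if int n = k then frow f z n else 0)"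
  proof (rule suminf_cong)
    fix n
    have "(\<Sum>j\<le>degree p. poly (coeff p j) z * (frow f z n * inv_laurent p r z (k - int j - int n)))
        = frow f z n * (\<Sum>j\<le>degree p. poly (coeff p j) z * inv_laurent p r z ((k - int n) - int j))"
      by (simp add: sum_distrib_left mult_ac algebra_simps)
    then show "(\<Sum>j\<le>degree p. poly (coeff p j) z * (frow f z n * inv_laurent p r z (k - int j - int n)))
        = (if int n = k then frow f z n else 0)"
      using inv_laurent_conv[OF r(1) nz[OF z], where k = "k - int n"] by auto
  qed
  also have "\<dots> = (if k \<ge> 0 then frow f z (nat k) else 0)"
  proof (cases "k \<ge> 0")
    case True
    then have "(\<lambda>n. if int n = k then frow f z n else 0) = (\<lambda>n. if n = nat k then frow f z n else 0)"
      by (intro ext) auto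
    then show ?thesis using True sums_single[of "nat k" "frow f z"] by (simp add: sums_iff)
  next
    case False
    then have "(\<lambda>n. if int n = k then frow f z n else 0) = (\<lambda>n. 0)" by auto
    then show ?thesis using False by simp
  qed
  finally show ?thesis .
qed

text \<open>If f(z, .) is p(z, .) times a function G holomorphic in the disk, then f / p is G on the
  circle. In coefficients: f is written as the convolution of p and G, the sums are exchanged, and
  the convolution of p with 1 / p collapses to the index k = l, which never occurs for negative
  k.\<close>

lemma quot_laurent_eq_0:
  assumes z: "z \<in> ball z0 d" and k: "k < 0"
    and G: "subexp G" "Abs_fps (frow f z) = fps_of_poly (slice p z) * Abs_fps G"
  shows "quot_laurent p r f z k = 0"
proof -
  define b where "b j = poly (coeff p j) z" for j
  have b0: "b j = 0" if "j > degree p" for j using that by (simp add: b_def coeff_eq_0)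
  have fn: "frow f z n = (\<Sum>j\<le>degree p. if j \<le> n then b j * G (n - j) else 0)" for n
  proof -
    have "frow f z n = (\<Sum>j=0..n. b j * G (n - j))"
      using arg_cong[OF G(2), of "\<lambda>F. fps_nth F n"] by (simp add: fps_mult_nth coeff_slice b_def)
    also have "\<dots> = (\<Sum>j\<le>max n (degree p). if j \<le> n then b j * G (n - j) else 0)"
      by (rule sum.mono_neutral_cong_left) auto
    also have "\<dots> = (\<Sum>j\<le>degree p. if j \<le> n then b j * G (n - j) else 0)"
      by (rule sum.mono_neutral_right) (auto simp: b0)
    finally show ?thesis .
  qed
  let ?D = "\<lambda>k. inv_laurent p r z k"
  have smG: "summable (\<lambda>l. G l * ?D (i - int l))" for i
  proof -
    \<comment> \<open>A radius between r and 1: subexponential growth bounds G against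
      \<open>r'\<close>, and the ratio r / r' makes the series converge geometrically.\<close>
    define r' where "r' = (1 + r) / 2"
    have r': "r < r'" "r' < 1" "0 < r'" using r by (auto simp: r'_def)
    obtain C where C: "\<And>n. cmod (G n) * r' ^ n \<le> C" using G(1) r' unfolding subexp_def by (metis less_imp_le)
    show ?thesis
    proof (rule summable_comparison_test'[of "\<lambda>l. C * (r powi (- i) / \<kappa>) * (r / r') ^ l"])
      show "summable (\<lambda>l. C * (r powi (- i) / \<kappa>) * (r / r') ^ l)"
        using r r' by (intro summable_mult summable_geometric) simp
      fix l
      have "cmod (?D (i - int l)) \<le> r powi (- (i - int l)) / \<kappa>"
        by (rule norm_inv_laurent_le[OF r(1) \<kappa> low[OF z]])
      also have "r powi (- (i - int l)) = r powi (- i) * r ^ l"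
        using r by (simp add: power_int_add[symmetric] flip: power_int_of_nat)
      finally have "cmod (?D (i - int l)) \<le> r powi (- i) * r ^ l / \<kappa>" .
      moreover have "cmod (G l) \<le> C / r' ^ l" using C[of l] r' by (simp add: field_simps)
      ultimately have "cmod (G l) * cmod (?D (i - int l)) \<le> (C / r' ^ l) * (r powi (- i) * r ^ l / \<kappa>)"
        by (intro mult_mono) (auto intro: order_trans[OF norm_ge_zero])
      then show "norm (G l * ?D (i - int l)) \<le> C * (r powi (- i) / \<kappa>) * (r / r') ^ l"
        by (simp add: norm_mult power_divide mult_ac)
    qed
  qed
  have shift: "(\<lambda>n. (if j \<le> n then G (n - j) else 0) * ?D (k - int n)) sums (\<Sum>l. G l * ?D (k - int j - int l))" for j
  proof -
    have "(\<lambda>l. G l * ?D (k - int j - int l)) sums (\<Sum>l. G l * ?D (k - int j - int l))"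
      using smG[of "k - int j"] by (rule summable_sums)
    then have "(\<lambda>l. (if j \<le> l + j then G (l + j - j) else 0) * ?D (k - int (l + j))) sums (\<Sum>l. G l * ?D (k - int j - int l))"
      by (simp add: algebra_simps)
    from sums_iff_shift[of "\<lambda>n. (if j \<le> n then G (n - j) else 0) * ?D (k - int n)" j] this
    show ?thesis by (simp add: sum.neutral)
  qed
  have "(\<lambda>n. \<Sum>j\<le>degree p. b j * ((if j \<le> n then G (n - j) else 0) * ?D (k - int n))) sums
      (\<Sum>j\<le>degree p. b j * (\<Sum>l. G l * ?D (k - int j - int l)))"
    by (intro sums_sum sums_mult shift)
  moreover have "(\<Sum>j\<le>degree p. b j * ((if j \<le> n then G (n - j) else 0) * ?D (k - int n)))
      = frow f z n * ?D (k - int n)" for n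
    unfolding fn sum_distrib_right by (intro sum.cong) auto
  ultimately have "quot_laurent p r f z k = (\<Sum>j\<le>degree p. b j * (\<Sum>l. G l * ?D (k - int j - int l)))"
    unfolding quot_laurent_def by (simp add: sums_iff)
  also have "\<dots> = (\<Sum>j\<le>degree p. \<Sum>l. b j * (G l * ?D (k - int j - int l)))"
    by (intro sum.cong refl suminf_mult[symmetric] smG)
  also have "\<dots> = (\<Sum>l. \<Sum>j\<le>degree p. b j * (G l * ?D (k - int j - int l)))"
    by (rule suminf_sum[symmetric]) (intro summable_mult smG)
  also have "\<dots> = (\<Sum>l. 0)"
  proof (rule suminf_cong)
    fix l
    have "(\<Sum>j\<le>degree p. b j * (G l * ?D (k - int j - int l))) = G l * (\<Sum>j\<le>degree p. b j * ?D ((k - int l) - int j))"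
      by (simp add: sum_distrib_left mult_ac algebra_simps)
    also have "\<dots> = 0"
      using inv_laurent_conv[OF r(1) nz[OF z], where k = "k - int l"] k by (simp add: b_def)
    finally show "(\<Sum>j\<le>degree p. b j * (G l * ?D (k - int j - int l))) = 0" .
  qed
  finally show ?thesis by simp
qed

end

text \<open>Zeros of p(z0, .) on the unit circle do no harm, because the expansion is made on a
  circle of radius r with s < r < 1 and no zeros in r \<le> |w| < 1. Cauchy estimates on this circle
  give the bound against s^n.\<close>

lemma local_quotient:
  assumes p: "no_univariate_factors p"
    and div: "\<And>z. z \<in> Omega p \<Longrightarrow> \<exists>G. subexp G \<and> Abs_fps (frow f z) = fps_of_poly (slice p z) * Abs_fps G"
    and z0: "cmod z0 < 1" and s: "0 < s" "s < 1"
  shows "\<exists>d>0. \<exists>c C. ball z0 d \<subseteq> ball 0 1 \<and> (\<forall>n. c n holomorphic_on ball z0 d) \<and>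
    (\<forall>z\<in>ball z0 d. Abs_fps (frow f z) = fps_of_poly (slice p z) * Abs_fps (\<lambda>n. c n z)) \<and>
    (\<forall>z\<in>ball z0 d. \<forall>n. cmod (c n z) * s ^ n \<le> C)"
proof -
  obtain r where r: "s < r" "0 < r" "r < 1" and ann: "\<And>w. r \<le> cmod w \<Longrightarrow> cmod w < 1 \<Longrightarrow> poly (slice p z0) w \<noteq> 0"
    using root_free_annulus[OF slice_nonzero[OF p] s(2)] by metis
  have nz0: "poly2 p (z0, w) \<noteq> 0" if "cmod w = r" for w
    using ann[of w] that r by (simp add: poly_slice)
  obtain d1 \<kappa> where d1: "d1 > 0" "\<kappa> > 0" "\<And>z w. cmod (z - z0) < d1 \<Longrightarrow> cmod w = r \<Longrightarrow> \<kappa> \<le> cmod (poly2 p (z, w))"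
    using poly2_near_circle[of r p z0, OF nz0] by blast
  obtain d2 where d2: "d2 > 0" "\<And>v. v \<in> ball z0 d2 \<Longrightarrow> zcount r (slice p v) = zcount r (slice p z0)"
    using zcount_locally_constant[OF p r(2) nz0] by blast
  define s1 where "s1 = (1 + cmod z0) / 2"
  have s1: "cmod z0 < s1" "s1 < 1" using z0 by (auto simp: s1_def)
  define d where "d = min (min d1 d2) (s1 - cmod z0)"
  have d: "d > 0" using d1 d2 s1 by (simp add: d_def)
  have ball: "ball z0 d \<subseteq> ball 0 s1"
  proof
    fix v assume "v \<in> ball z0 d"
    moreover have "cmod v \<le> cmod z0 + cmod (v - z0)" using norm_triangle_ineq[of z0 "v - z0"] by simp
    ultimately show "v \<in> ball 0 s1" by (simp add: d_def dist_norm norm_minus_commute)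
  qed
  have low: "\<kappa> \<le> cmod (poly2 p (z, w))" if "z \<in> ball z0 d" "cmod w = r" for z w
    using d1(3)[of z w] that by (simp add: d_def dist_norm norm_minus_commute)
  let ?c = "\<lambda>k z. quot_laurent p r f z k"
  note hyps = r(2,3) d1(2) ball s1(2) low
  have hol: "?c k holomorphic_on ball z0 d" for k
    by (rule quot_laurent_holomorphic[OF hyps])
  have neg: "?c k z = 0" if k: "k < 0" and z: "z \<in> ball z0 d" for k z
  \<comment> \<open>A zero inside radius r makes Omega accumulate at z0, and the identity theorem
    spreads the vanishing from Omega over the ball. Without one, nearby slices have no zero inside
    either, and 1 / p has no negative coefficients.\<close>
  proof (cases "\<exists>w. cmod w < r \<and> poly2 p (z0, w) = 0")
    case True
    then obtain v where v: "v \<in> Omega p" "cmod (v - z0) < d"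
      using Omega_accumulates[OF p z0 _ _ d] r by (metis less_trans)
    define U where "U = Omega p \<inter> ball z0 d"
    have U: "open U" "v \<in> U" using v open_Omega[OF p] by (auto simp: U_def dist_norm norm_minus_commute)
    then have "v islimpt U" by (metis interior_limit_point interior_open)
    moreover have "?c k x = 0" if "x \<in> U" for x
      using div[of x] quot_laurent_eq_0[OF hyps _ k] that unfolding U_def by blast
    moreover have "U \<subseteq> ball z0 d" "v \<in> ball z0 d" using U(2) by (auto simp: U_def)
    ultimately show ?thesis
      using analytic_continuation[OF hol open_ball connected_ball, of U v k z] z by blast
  next
    case False
    then have "zcount r (slice p z0) = 0" using zcount_eq_0_iff[OF slice_nonzero[OF p]] by (auto simp: poly_slice)
    then have "zcount r (slice p z) = 0" using d2(2)[of z] z by (simp add: d_def)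
    then have nzz: "poly2 p (z, w) \<noteq> 0" if "cmod w \<le> r" for w
      using zcount_eq_0_iff[OF slice_nonzero[OF p], of r z] low[OF z, of w] d1(2) that
      by (cases "cmod w = r") (auto simp: poly_slice)
    have "inv_laurent p r z (k - int n) = 0" for n
      by (rule inv_laurent_eq_0[OF r(2) _ nzz]) (use k in auto)
    then show ?thesis by (simp add: quot_laurent_def)
  qed
  have eq: "Abs_fps (frow f z) = fps_of_poly (slice p z) * Abs_fps (\<lambda>n. ?c (int n) z)" if z: "z \<in> ball z0 d" for z
  proof (rule fps_ext)
    fix n
    have "frow f z n = (\<Sum>j\<le>degree p. poly (coeff p j) z * ?c (int n - int j) z)"
      using quot_laurent_conv[OF hyps z, where k = "int n" and f = f] by simp
    also have "\<dots> = (\<Sum>j\<le>max n (degree p). poly (coeff p j) z * ?c (int n - int j) z)"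
      by (rule sum.mono_neutral_left) (auto simp: coeff_eq_0)
    also have "\<dots> = (\<Sum>j=0..n. poly (coeff p j) z * ?c (int (n - j)) z)"
      by (rule sum.mono_neutral_cong_right) (auto simp: neg[OF _ z] of_nat_diff)
    finally show "fps_nth (Abs_fps (frow f z)) n = fps_nth (fps_of_poly (slice p z) * Abs_fps (\<lambda>n. ?c (int n) z)) n"
      by (simp add: fps_mult_nth coeff_slice)
  qed
  define C where "C = norm f / (1 - s1) * (1 / \<kappa>) * (1 / (1 - r))"
  have C0: "C \<ge> 0" using s1 r d1 by (simp add: C_def)
  have "cmod (?c (int n) z) * s ^ n \<le> C" if z: "z \<in> ball z0 d" for z n
  proof -
    have "cmod (?c (int n) z) \<le> norm f / (1 - s1) * (r powi (- int n) / \<kappa>) * (1 / (1 - r))"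
      by (rule norm_quot_laurent_le[OF hyps z])
    also have "\<dots> = C / r ^ n" by (simp add: C_def power_int_minus divide_simps)
    finally have "cmod (?c (int n) z) * r ^ n \<le> C" using r by (simp add: field_simps)
    moreover have "cmod (?c (int n) z) * s ^ n \<le> cmod (?c (int n) z) * r ^ n"
      using r s by (intro mult_left_mono power_mono) auto
    ultimately show ?thesis by linarith
  qed
  moreover have "ball z0 d \<subseteq> ball 0 1" using ball s1 by (auto simp: subset_iff)
  ultimately have "ball z0 d \<subseteq> ball 0 1 \<and> (\<forall>n. ?c (int n) holomorphic_on ball z0 d) \<and>
    (\<forall>z\<in>ball z0 d. Abs_fps (frow f z) = fps_of_poly (slice p z) * Abs_fps (\<lambda>n. ?c (int n) z)) \<and>
    (\<forall>z\<in>ball z0 d. \<forall>n. cmod (?c (int n) z) * s ^ n \<le> C)"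
    using hol eq by blast
  then show ?thesis
    by - (rule exI[of _ d], rule conjI[OF d], rule exI[of _ "\<lambda>n z. ?c (int n) z"], rule exI[of _ C])
qed

section \<open>The quotient on the whole bidisk\<close>

lemma poly_fps_expansion: "poly q has_fps_expansion fps_of_poly q" for q :: "complex poly"
proof (rule has_fps_expansionI)
  have "(\<lambda>n. fps_nth (fps_of_poly q) n * u ^ n) sums eval_fps (fps_of_poly q) u" for u
    by (rule sums_eval_fps) simp
  then show "eventually (\<lambda>u. (\<lambda>n. fps_nth (fps_of_poly q) n * u ^ n) sums poly q u) (nhds 0)"
    by (simp add: eval_fps_of_poly)
qed

text \<open>\<open>f = p g\<close> for a holomorphic function \<open>g = \<Sum> b\<^sub>m\<^sub>n z\<^sup>m w\<^sup>n\<close> on the bidisk.\<close>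

lemma global_quotient:
  assumes p: "no_univariate_factors p"
    and div: "\<And>z. z \<in> Omega p \<Longrightarrow> \<exists>G. subexp G \<and> Abs_fps (frow f z) = fps_of_poly (slice p z) * Abs_fps G"
  obtains b :: "nat \<Rightarrow> nat \<Rightarrow> complex"
  where "\<And>m n. hcoeff f (m, n) = (\<Sum>j\<le>n. \<Sum>i\<le>m. coeff (coeff p j) i * b (m - i) (n - j))"
    and "\<And>s. 0 < s \<Longrightarrow> s < 1 \<Longrightarrow> \<exists>C. \<forall>m n. cmod (b m n) * s ^ (m + n) \<le> C"
proof -
  \<comment> \<open>Division of formal power series depends on neither the radius nor the centre, so
    the local quotients agree with \<open>g\<close> and with each other.\<close>
  define g where "g n z = fps_nth (Abs_fps (frow f z) div fps_of_poly (slice p z)) n" for n z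
  have g_eq: "g n z = G n" if "Abs_fps (frow f z) = fps_of_poly (slice p z) * Abs_fps G" for n z G
  proof -
    have "fps_of_poly (slice p z) \<noteq> 0"
      using slice_nonzero[OF p, of z] fps_of_poly_eq_iff[of "slice p z" 0] by simp
    then show ?thesis unfolding g_def that by simp
  qed
  have loc: "\<exists>d>0. \<exists>c C. ball z0 d \<subseteq> ball 0 1 \<and> (\<forall>n. c n holomorphic_on ball z0 d) \<and>
    (\<forall>z\<in>ball z0 d. Abs_fps (frow f z) = fps_of_poly (slice p z) * Abs_fps (\<lambda>n. c n z)) \<and>
    (\<forall>z\<in>ball z0 d. \<forall>n. cmod (c n z) * s ^ n \<le> C)" if "cmod z0 < 1" "0 < s" "s < 1" for z0 s
    by (rule local_quotient[OF p _ that]) (rule div)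
  have g_fps: "Abs_fps (frow f z) = fps_of_poly (slice p z) * Abs_fps (\<lambda>n. g n z)" if z: "cmod z < 1" for z
  proof -
    have half: "0 < (1/2::real)" "(1/2::real) < 1" by simp_all
    obtain d c where d: "d > 0" and c: "\<And>x. x \<in> ball z d \<Longrightarrow> Abs_fps (frow f x) = fps_of_poly (slice p x) * Abs_fps (\<lambda>n. c n x)"
      using loc[OF z half] by blast
    have "Abs_fps (frow f z) = fps_of_poly (slice p z) * Abs_fps (\<lambda>n. c n z)" using c d by simp
    with g_eq[OF this] show ?thesis by simp
  qed
  have hol: "g n holomorphic_on ball 0 1" for n
    unfolding holomorphic_on_open[OF open_ball]
  proof
    fix z :: complex assume "z \<in> ball 0 1"
    then have z: "cmod z < 1" by simp
    have half: "0 < (1/2::real)" "(1/2::real) < 1" by simp_all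
    have half: "0 < (1/2::real)" "(1/2::real) < 1" by simp_all
    obtain d c where d: "d > 0" and hc: "\<And>n. c n holomorphic_on ball z d"
      and c: "\<And>x. x \<in> ball z d \<Longrightarrow> Abs_fps (frow f x) = fps_of_poly (slice p x) * Abs_fps (\<lambda>n. c n x)"
      using loc[OF z half] by blast
    have "g n holomorphic_on ball z d"
      using hc[of n] by (rule holomorphic_transform) (use g_eq[OF c] in auto)
    then show "\<exists>f'. (g n has_field_derivative f') (at z)"
      unfolding holomorphic_on_open[OF open_ball] using d by simp
  qed
  \<comment> \<open>A finite subcover of the compact disk turns the local bounds into one that is
    uniform in z and n.\<close>
  have bound: "\<exists>C. \<forall>z\<in>cball 0 s. \<forall>n. cmod (g n z) * s ^ n \<le> C" if s: "0 < s" "s < 1" for s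
  proof -
    have "\<exists>d C. d > 0 \<and> (\<forall>x\<in>ball z d. \<forall>n. cmod (g n x) * s ^ n \<le> C)" if "z \<in> cball 0 s" for z
    proof -
      have z: "cmod z < 1" using that s by simp
      obtain d c C where d: "d > 0"
        and c: "\<And>x. x \<in> ball z d \<Longrightarrow> Abs_fps (frow f x) = fps_of_poly (slice p x) * Abs_fps (\<lambda>n. c n x)"
        and C: "\<And>x n. x \<in> ball z d \<Longrightarrow> cmod (c n x) * s ^ n \<le> C"
        using loc[OF z s] by blast
      then show ?thesis using g_eq[OF c] by (intro exI[of _ d] exI[of _ C]) auto
    qed
    then obtain d C where dC: "\<And>z. z \<in> cball 0 s \<Longrightarrow> d z > 0"
      "\<And>z x n. z \<in> cball 0 s \<Longrightarrow> x \<in> ball z (d z) \<Longrightarrow> cmod (g n x) * s ^ n \<le> C z" by metis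
    have "cball 0 s \<subseteq> (\<Union>z\<in>cball 0 s. ball z (d z))" using dC(1) by force
    then obtain F where F: "F \<subseteq> cball 0 s" "finite F" "cball 0 s \<subseteq> (\<Union>z\<in>F. ball z (d z))"
      using compactE_image[of "cball 0 s" "cball 0 s" "\<lambda>z. ball z (d z)"] by (metis compact_cball open_ball)
    have "cmod (g n x) * s ^ n \<le> (\<Sum>z\<in>F. \<bar>C z\<bar>)" if "x \<in> cball 0 s" for x n
    proof -
      obtain z where z: "z \<in> F" "x \<in> ball z (d z)" using F(3) \<open>x \<in> cball 0 s\<close> by blast
      then have "cmod (g n x) * s ^ n \<le> C z" using dC(2) F(1) by blast
      also have "\<dots> \<le> \<bar>C z\<bar>" by simp
      also have "\<dots> \<le> (\<Sum>z\<in>F. \<bar>C z\<bar>)" using z(1) F(2) by (intro member_le_sum) auto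
      finally show ?thesis .
    qed
    then show ?thesis by blast
  qed
  define b where "b m n = fps_nth (fps_expansion (g n) 0) m" for m n
  have bexp: "g n has_fps_expansion Abs_fps (\<lambda>m. b m n)" for n
    using has_fps_expansion_fps_expansion[OF open_ball _ hol, of n] by (simp add: b_def fps_nth_inverse)
  show thesis
  proof (rule that[of b])
    fix s :: real assume s: "0 < s" "s < 1"
    obtain C where C: "\<And>z n. z \<in> cball 0 s \<Longrightarrow> cmod (g n z) * s ^ n \<le> C" using bound[OF s] by blast
    have "cmod (b m n) * s ^ (m + n) \<le> C" for m n
    proof -
      \<comment> \<open>The Cauchy inequality on radius s converts the bound on the functions
        \<open>g n\<close> into one on the double coefficients.\<close>
      have "norm ((deriv ^^ m) (g n) 0) \<le> fact m * (C / s ^ n) / s ^ m"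
      proof (rule Cauchy_inequality)
        show "g n holomorphic_on ball 0 s" by (rule holomorphic_on_subset[OF hol]) (use s in auto)
        show "continuous_on (cball 0 s) (g n)"
          by (rule holomorphic_on_imp_continuous_on[OF holomorphic_on_subset[OF hol]]) (use s in auto)
        show "norm (g n x) \<le> C / s ^ n" if "norm (0 - x) = s" for x
          using C[of x n] that s by (simp add: field_simps)
      qed (use s in auto)
      then have "cmod (b m n) \<le> (C / s ^ n) / s ^ m"
        by (simp add: b_def fps_expansion_def norm_divide field_simps)
      then show ?thesis using s by (simp add: field_simps power_add)
    qed
    then show "\<exists>C. \<forall>m n. cmod (b m n) * s ^ (m + n) \<le> C" by blast
  next
    fix m n
    have "(\<lambda>z. \<Sum>j\<le>n. poly (coeff p j) z * g (n - j) z) has_fps_expansion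
        (\<Sum>j\<le>n. fps_of_poly (coeff p j) * Abs_fps (\<lambda>m. b m (n - j)))"
      by (intro has_fps_expansion_sum has_fps_expansion_mult poly_fps_expansion bexp)
    moreover have "(\<lambda>z. \<Sum>j\<le>n. poly (coeff p j) z * g (n - j) z) has_fps_expansion Abs_fps (\<lambda>m. hcoeff f (m, n))"
    proof (rule has_fps_expansionI)
      have "eventually (\<lambda>u::complex. u \<in> ball 0 1) (nhds 0)" by (intro eventually_nhds_in_open) auto
      then show "eventually (\<lambda>u. (\<lambda>m. fps_nth (Abs_fps (\<lambda>m. hcoeff f (m, n))) m * u ^ m) sums
          (\<Sum>j\<le>n. poly (coeff p j) u * g (n - j) u)) (nhds 0)"
      proof eventually_elim
        case (elim u)
        then have u: "cmod u < 1" by simp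
        have "frow f u n = (\<Sum>j\<le>n. poly (coeff p j) u * g (n - j) u)"
          using arg_cong[OF g_fps[OF u], of "\<lambda>F. fps_nth F n"]
          by (simp add: fps_mult_nth coeff_slice atLeast0AtMost)
        then show ?case using frow_sums[OF u, of f n] by simp
      qed
    qed
    ultimately have "Abs_fps (\<lambda>m. hcoeff f (m, n)) = (\<Sum>j\<le>n. fps_of_poly (coeff p j) * Abs_fps (\<lambda>m. b m (n - j)))"
      by (rule fps_expansion_unique_complex[rotated])
    from arg_cong[OF this, of "\<lambda>F. fps_nth F m"]
    show "hcoeff f (m, n) = (\<Sum>j\<le>n. \<Sum>i\<le>m. coeff (coeff p j) i * b (m - i) (n - j))"
      by (simp add: fps_sum_nth fps_mult_nth atLeast0AtMost)
  qed
qed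

section \<open>Dilations\<close>

definition dilate :: "real \<Rightarrow> complex fps \<Rightarrow> complex fps"
  where "dilate r h = Abs_fps (\<lambda>n. of_real r ^ n * fps_nth h n)"

lemma dilate_nth: "fps_nth (dilate r h) n = of_real r ^ n * fps_nth h n"
  by (simp add: dilate_def)

lemma dilate_1 [simp]: "dilate 1 h = h"
  by (intro fps_ext) (simp add: dilate_nth)

text \<open>A monic polynomial given by the list of its roots, so that an induction can move single
  factors; the leading coefficient scales out of every estimate.\<close>

definition rprod :: "complex list \<Rightarrow> complex fps"
  where "rprod as = prod_list (map (\<lambda>a. fps_X - fps_const a) as)"

lemma rprod_simps [simp]: "rprod [] = 1" "rprod (a # as) = (fps_X - fps_const a) * rprod as"
  by (simp_all add: rprod_def)

lemma linear_nth: "fps_nth ((fps_X - fps_const a) * h) n = (if n = 0 then 0 else fps_nth h (n - 1)) - a * fps_nth h n"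
  for a :: complex
  by (simp only: left_diff_distrib fps_sub_nth fps_X_mult_nth fps_mult_left_const_nth)

lemma subexp_linear:
  assumes "subexp (fps_nth h)"
  shows "subexp (fps_nth ((fps_X - fps_const a) * h))"
  unfolding subexp_def
proof (intro allI impI)
  fix \<rho> :: real assume \<rho>: "0 \<le> \<rho> \<and> \<rho> < 1"
  then obtain C where C: "\<And>n. cmod (fps_nth h n) * \<rho> ^ n \<le> C" using assms unfolding subexp_def by blast
  have C0: "0 \<le> C" by (rule order_trans[OF _ C[of 0]]) simp
  have "cmod (fps_nth ((fps_X - fps_const a) * h) n) * \<rho> ^ n \<le> C + cmod a * C" for n
  proof -
    have 1: "cmod (if n = 0 then 0 else fps_nth h (n - 1)) * \<rho> ^ n \<le> C"
    proof (cases n)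
      case (Suc m)
      have "\<rho> * (cmod (fps_nth h m) * \<rho> ^ m) \<le> 1 * C" using \<rho> C C0 by (intro mult_mono) auto
      then show ?thesis using Suc by (simp add: mult_ac)
    qed (use C0 in simp)
    have 2: "cmod (a * fps_nth h n) * \<rho> ^ n \<le> cmod a * C"
      using mult_left_mono[OF C[of n], of "cmod a"] by (simp add: norm_mult mult.assoc)
    have "cmod (fps_nth ((fps_X - fps_const a) * h) n) * \<rho> ^ n
        \<le> (cmod (if n = 0 then 0 else fps_nth h (n - 1)) + cmod (a * fps_nth h n)) * \<rho> ^ n"
      unfolding linear_nth using \<rho> by (intro mult_right_mono norm_triangle_ineq4) auto
    then show ?thesis using 1 2 by (simp only: distrib_right)
  qed
  then show "\<exists>C. \<forall>n. cmod (fps_nth ((fps_X - fps_const a) * h) n) * \<rho> ^ n \<le> C" by blast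
qed

lemma subexp_rprod: "subexp (fps_nth h) \<Longrightarrow> subexp (fps_nth (rprod as * h))"
  by (induct as) (auto simp: mult.assoc intro: subexp_linear)

lemma subexp_tendsto_0:
  assumes "subexp g" "0 \<le> \<rho>" "\<rho> < 1"
  shows "(\<lambda>n. cmod (g n) * \<rho> ^ n) \<longlonglongrightarrow> 0"
proof -
  define s where "s = (1 + \<rho>) / 2"
  have s: "\<rho> < s" "s < 1" "0 < s" using assms by (auto simp: s_def)
  obtain C where C: "\<And>n. cmod (g n) * s ^ n \<le> C" using assms(1) s unfolding subexp_def by (metis less_imp_le)
  show ?thesis
  proof (rule tendsto_sandwich[of "\<lambda>_. 0" _ _ "\<lambda>n. C * (\<rho> / s) ^ n"])
    show "(\<lambda>n. C * (\<rho> / s) ^ n) \<longlonglongrightarrow> 0"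
      using s assms(2) by (intro tendsto_mult_right_zero LIMSEQ_power_zero) simp
    have "cmod (g n) * \<rho> ^ n \<le> C * (\<rho> / s) ^ n" for n
    proof -
      have "cmod (g n) * \<rho> ^ n = (cmod (g n) * s ^ n) * (\<rho> / s) ^ n" using s by (simp add: power_divide)
      also have "\<dots> \<le> C * (\<rho> / s) ^ n" using C s assms(2) by (intro mult_right_mono) auto
      finally show ?thesis .
    qed
    then show "eventually (\<lambda>n. cmod (g n) * \<rho> ^ n \<le> C * (\<rho> / s) ^ n) sequentially" by simp
  qed (use assms(2) in auto)
qed

lemma l2b_dilate_mono:
  assumes "l2b (fps_nth (dilate R h)) B" "0 \<le> r" "r \<le> R"
  shows "l2b (fps_nth (dilate r h)) B"
proof -
  have "l2n (fps_nth (dilate r h)) N \<le> l2n (fps_nth (dilate R h)) N" for N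
    using assms(2,3) by (intro l2n_le) (simp add: dilate_nth norm_mult norm_power mult_right_mono power_mono)
  then show ?thesis using assms(1) unfolding l2b_def by (meson order_trans)
qed

lemma l2n_prev_le: "l2n (\<lambda>n. if n = 0 then 0 else y (n - 1)) N \<le> l2n y N"
proof (cases N)
  case (Suc M)
  have "l2n (\<lambda>n. if n = 0 then 0 else y (n - 1)) (Suc M) \<le> l2n y M"
    using l2n_Suc_shift[of "\<lambda>n. if n = 0 then 0 else y (n - 1)" M] by simp
  then show ?thesis using l2n_mono[of M "Suc M" y] Suc by simp
qed (simp add: l2n_def)

text \<open>Division by one factor at the cost of shrinking the radius from R to r. On a circle
  whose radius differs from |a| by at least \<delta> the factor is bounded below by \<delta>, and l2
  norms on circles increase with the radius.\<close>

lemma l2b_dilate_linear: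
  assumes h: "subexp (fps_nth h)" and r: "0 \<le> r" "r < R" "R \<le> 1"
    and B: "l2b (fps_nth (dilate R ((fps_X - fps_const a) * h))) B"
  shows "l2b (fps_nth (dilate r h)) (4 * B / (R - r))"
proof -
  \<comment> \<open>With a quarter of the gap, one of the two radii r and (R + r) / 2 = r + 2
    \<delta> has distance at least \<delta> from |a|.\<close>
  define \<delta> where "\<delta> = (R - r) / 4"
  have \<delta>: "\<delta> > 0" using r by (simp add: \<delta>_def)
  obtain \<rho> where \<rho>: "r \<le> \<rho>" "\<rho> < R" "\<rho> + \<delta> \<le> cmod a \<or> cmod a + \<delta> \<le> \<rho>"
  proof (cases "r + \<delta> \<le> cmod a")
    case True
    then show ?thesis using r by (intro that[of r]) auto
  next
    case False
    then show ?thesis using r by (intro that[of "(R + r) / 2"]) (auto simp: \<delta>_def field_simps)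
  qed
  define y where "y n = of_real \<rho> ^ n * fps_nth h n" for n
  define G where "G n = of_real \<rho> * (if n = 0 then 0 else y (n - 1)) - a * y n" for n
  have G_eq: "G = fps_nth (dilate \<rho> ((fps_X - fps_const a) * h))"
  proof
    fix n show "G n = fps_nth (dilate \<rho> ((fps_X - fps_const a) * h)) n"
      unfolding dilate_nth linear_nth G_def y_def by (cases n) (auto simp: algebra_simps)
  qed
  have GB: "l2b G B" unfolding G_eq using \<rho> r by (intro l2b_dilate_mono[OF B]) auto
  have \<rho>0: "0 \<le> \<rho>" using \<rho> r by simp
  have "l2n y N * \<delta> \<le> B" for N
    using \<rho>(3)
  proof
    assume a: "\<rho> + \<delta> \<le> cmod a"
    have "cmod a * l2n y N = l2n (\<lambda>n. of_real \<rho> * (if n = 0 then 0 else y (n - 1)) - G n) N"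
      unfolding l2n_cmult[symmetric] by (simp add: G_def)
    also have "\<dots> \<le> \<rho> * l2n y N + B"
    proof -
      have "l2n (\<lambda>n. of_real \<rho> * (if n = 0 then 0 else y (n - 1))) N \<le> \<rho> * l2n y N"
        unfolding l2n_cmult using \<rho>0 l2n_prev_le[of y N] by (simp add: mult_left_mono)
      then show ?thesis
        using l2n_diff[of "\<lambda>n. of_real \<rho> * (if n = 0 then 0 else y (n - 1))" G N] l2bD[OF GB, of N] by linarith
    qed
    finally have "(cmod a - \<rho>) * l2n y N \<le> B" by (simp add: algebra_simps)
    moreover have "\<delta> * l2n y N \<le> (cmod a - \<rho>) * l2n y N" using a by (intro mult_right_mono) auto
    ultimately show ?thesis by (simp add: mult.commute)
  next
    assume a: "cmod a + \<delta> \<le> \<rho>"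
    \<comment> \<open>When |a| is the smaller number, the truncated estimate leaves the boundary
      term \<open>y M\<close>. It tends to 0 because h grows subexponentially and \<rho> <
      1.\<close>
    have M: "l2n y N * \<delta> \<le> B + cmod a * cmod (y M)" if "M \<ge> N" for M
    proof -
      have "\<rho> * l2n y M = l2n (\<lambda>n. G (Suc n) + a * y (Suc n)) M"
        using l2n_cmult[of "of_real \<rho>" y M] \<rho>0 by (simp add: G_def)
      also have "\<dots> \<le> B + cmod a * l2n (\<lambda>n. y (Suc n)) M"
        using l2n_add[of "\<lambda>n. G (Suc n)" "\<lambda>n. a * y (Suc n)" M] l2bD[OF l2b_Suc[OF GB], of M]
        by (simp add: l2n_cmult)
      also have "\<dots> \<le> B + cmod a * (l2n y M + cmod (y M))"
        using l2n_shift_le[of y M] l2n_Suc[of y M] by (intro add_left_mono mult_left_mono) auto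
      finally have "(\<rho> - cmod a) * l2n y M \<le> B + cmod a * cmod (y M)" by (simp add: algebra_simps)
      moreover have "\<delta> * l2n y M \<le> (\<rho> - cmod a) * l2n y M" using a by (intro mult_right_mono) auto
      moreover have "\<delta> * l2n y N \<le> \<delta> * l2n y M" using that \<delta> by (intro mult_left_mono l2n_mono) auto
      ultimately show ?thesis by (simp add: mult.commute)
    qed
    have "(\<lambda>n. cmod (y n)) \<longlonglongrightarrow> 0"
      using subexp_tendsto_0[OF h \<rho>0] \<rho> r \<rho>0 by (simp add: y_def norm_mult norm_power mult.commute)
    then have "(\<lambda>M. B + cmod a * cmod (y M)) \<longlonglongrightarrow> B + cmod a * 0" by (intro tendsto_intros)
    then have "l2n y N * \<delta> \<le> B + cmod a * 0" by (rule LIMSEQ_le_const) (use M in blast)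
    then show ?thesis by simp
  qed
  then have "l2b y (4 * B / (R - r))"
    unfolding l2b_def \<delta>_def using r by (simp add: field_simps)
  moreover have "y = fps_nth (dilate \<rho> h)" by (simp add: y_def fun_eq_iff dilate_nth)
  ultimately have "l2b (fps_nth (dilate \<rho> h)) (4 * B / (R - r))" by simp
  then show ?thesis by (rule l2b_dilate_mono) (use r \<rho> in auto)
qed

text \<open>Each factor costs part of the gap between the radii. The constant depends on the number
  of roots and not on the roots themselves.\<close>

lemma l2b_dilate_rprod:
  "\<exists>c\<ge>0. \<forall>as h r R B. length as = k \<longrightarrow> subexp (fps_nth h) \<longrightarrow> 0 \<le> r \<longrightarrow> r < R \<longrightarrow> R \<le> 1 \<longrightarrow>
    l2b (fps_nth (dilate R (rprod as * h))) B \<longrightarrow> l2b (fps_nth (dilate r h)) (c * B / (R - r) ^ k)"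
proof (induct k)
  case 0
  show ?case by (intro exI[of _ 1]) (auto intro: l2b_dilate_mono)
next
  case (Suc k)
  then obtain c where c: "c \<ge> 0" "\<And>as h r R B. length as = k \<Longrightarrow> subexp (fps_nth h) \<Longrightarrow> 0 \<le> r \<Longrightarrow> r < R \<Longrightarrow> R \<le> 1 \<Longrightarrow>
    l2b (fps_nth (dilate R (rprod as * h))) B \<Longrightarrow> l2b (fps_nth (dilate r h)) (c * B / (R - r) ^ k)" by blast
  show ?case
  \<comment> \<open>With m halfway between r and R, the first factor costs 4 / (R - m) = 8 / (R -
    r), and the remaining k factors have half the gap, whence 2^k.\<close>
  proof (intro exI[of _ "c * 8 * 2 ^ k"] conjI allI impI)
    fix as :: "complex list" and h :: "complex fps" and r R B :: real
    assume as: "length as = Suc k" and h: "subexp (fps_nth h)" and r: "0 \<le> r" "r < R" "R \<le> 1"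
      and B: "l2b (fps_nth (dilate R (rprod as * h))) B"
    obtain a as' where a: "as = a # as'" "length as' = k" using as by (cases as) auto
    define m where "m = (R + r) / 2"
    have m: "r < m" "m < R" "R - m = (R - r) / 2" "m - r = (R - r) / 2" using r by (auto simp: m_def field_simps)
    have X: "l2b (fps_nth (dilate m (rprod as' * h))) (4 * B / (R - m))"
      by (rule l2b_dilate_linear[OF subexp_rprod[OF h]]) (use B a m r in \<open>auto simp: mult.assoc\<close>)
    have "m \<le> 1" using m r by simp
    have "l2b (fps_nth (dilate r h)) (c * (4 * B / (R - m)) / (m - r) ^ k)"
      by (rule c(2)[OF a(2) h r(1) m(1) \<open>m \<le> 1\<close> X])
    also have "c * (4 * B / (R - m)) / (m - r) ^ k = c * 8 * 2 ^ k * B / (R - r) ^ Suc k"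
      unfolding m(3,4) by (simp add: power_divide)
    finally show "l2b (fps_nth (dilate r h)) (c * 8 * 2 ^ k * B / (R - r) ^ Suc k)" .
  qed (use c in simp)
qed

text \<open>Induction on the factors that stay, with a second list \<open>bs\<close> of factors already lost: by
  \<open>(w - a) h(r w) = (r w - a) h(r w) + (1 - r) w h(r w)\<close> a factor either moves inside the
  dilation or is traded for \<open>1 - r\<close>.\<close>

lemma l2b_rprod_dilate:
  "\<exists>C\<ge>0. \<forall>as bs h r B. length as = n \<longrightarrow> length bs = k \<longrightarrow> subexp (fps_nth h) \<longrightarrow> 0 \<le> r \<longrightarrow> r < 1 \<longrightarrow>
    l2b (fps_nth (rprod as * (rprod bs * h))) B \<longrightarrow>
    l2b (fps_nth (rprod as * dilate r h)) (C * B / (1 - r) ^ k)"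
proof (induct n arbitrary: k)
  case 0
  obtain c where c: "c \<ge> 0" "\<And>as h r R B. length as = k \<Longrightarrow> subexp (fps_nth h) \<Longrightarrow> 0 \<le> r \<Longrightarrow> r < R \<Longrightarrow> R \<le> 1 \<Longrightarrow>
    l2b (fps_nth (dilate R (rprod as * h))) B \<Longrightarrow> l2b (fps_nth (dilate r h)) (c * B / (R - r) ^ k)"
    using l2b_dilate_rprod[of k] by blast
  show ?case using c(1) c(2)[where R = 1] by (intro exI[of _ c]) auto
next
  case (Suc n)
  obtain C1 where C1: "C1 \<ge> 0" "\<And>as bs h r B. length as = n \<Longrightarrow> length bs = k \<Longrightarrow> subexp (fps_nth h) \<Longrightarrow> 0 \<le> r \<Longrightarrow> r < 1 \<Longrightarrow>
    l2b (fps_nth (rprod as * (rprod bs * h))) B \<Longrightarrow> l2b (fps_nth (rprod as * dilate r h)) (C1 * B / (1 - r) ^ k)"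
    using Suc[of k] by blast
  obtain C2 where C2: "C2 \<ge> 0" "\<And>as bs h r B. length as = n \<Longrightarrow> length bs = Suc k \<Longrightarrow> subexp (fps_nth h) \<Longrightarrow> 0 \<le> r \<Longrightarrow> r < 1 \<Longrightarrow>
    l2b (fps_nth (rprod as * (rprod bs * h))) B \<Longrightarrow> l2b (fps_nth (rprod as * dilate r h)) (C2 * B / (1 - r) ^ Suc k)"
    using Suc[of "Suc k"] by blast
  show ?case
  proof (intro exI[of _ "C1 + C2"] conjI allI impI)
    fix as bs :: "complex list" and h :: "complex fps" and r B :: real
    assume as: "length as = Suc n" and bs: "length bs = k" and h: "subexp (fps_nth h)" and r: "0 \<le> r" "r < 1"
      and B: "l2b (fps_nth (rprod as * (rprod bs * h))) B"
    obtain a as' where a: "as = a # as'" "length as' = n" using as by (cases as) auto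
    let ?l = "fps_X - fps_const a"
    let ?h2 = "rprod as' * dilate r h"
    have 1: "l2b (fps_nth (rprod as' * dilate r (?l * h))) (C1 * B / (1 - r) ^ k)"
      using B a by (intro C1(2)[OF a(2) bs subexp_linear[OF h] r]) (simp add: mult_ac)
    have B': "l2b (fps_nth (rprod as' * (rprod (a # bs) * h))) B" using B a by (simp add: mult_ac)
    have bs': "length (a # bs) = Suc k" using bs by simp
    have 2: "l2b (fps_nth ?h2) (C2 * B / (1 - r) ^ Suc k)"
      by (rule C2(2)[OF a(2) bs' h r B'])
    have "l2b (\<lambda>i. of_real (1 - r) * (if i = 0 then 0 else fps_nth ?h2 (i - 1))) (cmod (of_real (1 - r)) * (C2 * B / (1 - r) ^ Suc k))"
      using l2n_prev_le[of "fps_nth ?h2"] 2 unfolding l2b_def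
      by (intro allI) (auto simp only: l2n_cmult intro!: mult_left_mono norm_ge_zero intro: order_trans)
    \<comment> \<open>The factor 1 - r cancels exactly the additional power in the denominator that
      losing one more factor has caused.\<close>
    moreover have "cmod (of_real (1 - r)) * (C2 * B / (1 - r) ^ Suc k) = C2 * B / (1 - r) ^ k"
      using r unfolding norm_of_real by simp
    ultimately have 3: "l2b (\<lambda>i. of_real (1 - r) * (if i = 0 then 0 else fps_nth ?h2 (i - 1))) (C2 * B / (1 - r) ^ k)"
      by simp
    have id: "?l * dilate r h = dilate r (?l * h) + fps_const (of_real (1 - r)) * (fps_X * dilate r h)"
    proof (rule fps_ext)
      fix i
      show "fps_nth (?l * dilate r h) i = fps_nth (dilate r (?l * h) + fps_const (of_real (1 - r)) * (fps_X * dilate r h)) i"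
        unfolding fps_add_nth dilate_nth linear_nth fps_mult_left_const_nth fps_X_mult_nth
        by (cases i) (auto simp: algebra_simps)
    qed
    have "rprod as * dilate r h = rprod as' * (?l * dilate r h)" by (simp add: a mult_ac)
    also have "\<dots> = rprod as' * dilate r (?l * h) + fps_const (of_real (1 - r)) * (fps_X * ?h2)"
      unfolding id by (simp add: distrib_left mult_ac)
    finally have "fps_nth (rprod as * dilate r h) =
        (\<lambda>i. fps_nth (rprod as' * dilate r (?l * h)) i + of_real (1 - r) * (if i = 0 then 0 else fps_nth ?h2 (i - 1)))"
      by (auto simp: fun_eq_iff simp del: of_real_diff)
    with l2b_add[OF 1 3] show "l2b (fps_nth (rprod as * dilate r h)) ((C1 + C2) * B / (1 - r) ^ k)"
      by (simp add: add_divide_distrib distrib_right)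
  qed (use C1 C2 in simp)
qed

lemma fps_of_poly_factorization:
  fixes q :: "complex poly"
  assumes "q \<noteq> 0"
  shows "\<exists>c as. length as = degree q \<and> c \<noteq> 0 \<and> fps_of_poly q = fps_const c * rprod as"
  using assms
proof (induct q rule: poly_linear_induct)
  case (const c)
  then show ?case by (intro exI[of _ c] exI[of _ "[]"]) (simp add: fps_of_poly_const)
next
  case (linear a q)
  then obtain c as where as: "length as = degree q" "c \<noteq> 0" "fps_of_poly q = fps_const c * rprod as" by blast
  have "fps_of_poly [:- a, 1:] = fps_X - fps_const a"
    by (intro fps_ext) (auto simp: coeff_pCons split: nat.split)
  then show ?case using linear(1) as
    by (intro exI[of _ c] exI[of _ "a # as"]) (simp add: degree_mult_eq fps_of_poly_mult mult_ac)
qed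

text \<open>The constant depends only on a bound for the degree. This uniformity is essential, since
  the lemma is applied to the restrictions of p to all lines at once.\<close>

lemma l2b_poly_dilate:
  "\<exists>C\<ge>0. \<forall>q h r B. degree q \<le> n \<longrightarrow> subexp (fps_nth h) \<longrightarrow> 0 \<le> r \<longrightarrow> r < 1 \<longrightarrow>
    l2b (fps_nth (fps_of_poly q * h)) B \<longrightarrow> l2b (fps_nth (fps_of_poly q * dilate r h)) (C * B)"
proof -
  have "\<forall>i. \<exists>C\<ge>0. \<forall>as h r B. length as = i \<longrightarrow> subexp (fps_nth h) \<longrightarrow> 0 \<le> r \<longrightarrow> r < 1 \<longrightarrow>
    l2b (fps_nth (rprod as * h)) B \<longrightarrow> l2b (fps_nth (rprod as * dilate r h)) (C * B)"
    using l2b_rprod_dilate[where k = 0] by simp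
  then obtain C where C: "\<And>i. C i \<ge> 0" "\<And>as h r B. subexp (fps_nth h) \<Longrightarrow> 0 \<le> r \<Longrightarrow> r < 1 \<Longrightarrow>
    l2b (fps_nth (rprod as * h)) B \<Longrightarrow> l2b (fps_nth (rprod as * dilate r h)) (C (length as) * B)" by metis
  show ?thesis
  proof (intro exI[of _ "\<Sum>i\<le>n. C i"] conjI allI impI)
    fix q :: "complex poly" and h :: "complex fps" and r B :: real
    assume q: "degree q \<le> n" and h: "subexp (fps_nth h)" and r: "0 \<le> r" "r < 1" and B: "l2b (fps_nth (fps_of_poly q * h)) B"
    note B0 = l2b_nonneg[OF B]
    show "l2b (fps_nth (fps_of_poly q * dilate r h)) ((\<Sum>i\<le>n. C i) * B)"
    proof (cases "q = 0")
      case True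
      have "0 \<le> (\<Sum>i\<le>n. C i) * B" using B0 C by (intro mult_nonneg_nonneg sum_nonneg) auto
      then show ?thesis using True by (simp add: l2b_def l2n_def L2_set_def)
    next
      case False
      then obtain c as where as: "length as = degree q" "c \<noteq> 0" "fps_of_poly q = fps_const c * rprod as"
        using fps_of_poly_factorization by blast
      have eq: "fps_nth (fps_of_poly q * g) = (\<lambda>i. c * fps_nth (rprod as * g) i)" for g
        by (auto simp: as(3) mult.assoc)
      have "l2b (\<lambda>i. 1 / c * (c * fps_nth (rprod as * h) i)) (cmod (1 / c) * B)"
        using B unfolding eq by (rule l2b_cmult)
      then have "l2b (fps_nth (rprod as * h)) (cmod (1 / c) * B)" using as(2) by simp
      from l2b_cmult[OF C(2)[OF h r this], of c]
      have X: "l2b (fps_nth (fps_of_poly q * dilate r h)) (C (degree q) * B)"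
        unfolding eq using as(1,2) by (simp add: norm_divide)
      have "C (degree q) \<le> (\<Sum>i\<le>n. C i)" using q C by (intro member_le_sum) auto
      then have "C (degree q) * B \<le> (\<Sum>i\<le>n. C i) * B" using B0 by (rule mult_right_mono)
      with X show ?thesis by (rule l2b_mono)
    qed
  qed (use C in \<open>auto intro: sum_nonneg\<close>)
qed

section \<open>Two variables through restriction to lines\<close>

definition conv2 :: "(nat \<Rightarrow> nat \<Rightarrow> complex) \<Rightarrow> (nat \<Rightarrow> nat \<Rightarrow> complex) \<Rightarrow> nat \<Rightarrow> nat \<Rightarrow> complex"
  where "conv2 A B m n = (\<Sum>j\<le>n. \<Sum>i\<le>m. A i j * B (m - i) (n - j))"

text \<open>The one-variable series \<open>A(s \<zeta>, s \<omega> \<zeta>)\<close> in \<open>\<zeta>\<close>.\<close>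

definition diag_slice :: "real \<Rightarrow> complex \<Rightarrow> (nat \<Rightarrow> nat \<Rightarrow> complex) \<Rightarrow> complex fps"
  where "diag_slice s \<omega> A = Abs_fps (\<lambda>k. of_real s ^ k * (\<Sum>n\<le>k. A (k - n) n * \<omega> ^ n))"

lemma diag_slice_nth: "fps_nth (diag_slice s \<omega> A) k = of_real s ^ k * (\<Sum>n\<le>k. A (k - n) n * \<omega> ^ n)"
  by (simp add: diag_slice_def)

text \<open>Restriction to a line is multiplicative, so one-variable estimates apply to p times its
  cofactor.\<close>

lemma diag_slice_conv2: "diag_slice s \<omega> (conv2 A B) = diag_slice s \<omega> A * diag_slice s \<omega> B"
proof (rule fps_ext)
  fix k
  let ?x = "of_real s :: complex"
  have "fps_nth (diag_slice s \<omega> (conv2 A B)) k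
      = (\<Sum>N\<le>k. \<Sum>j\<le>N. \<Sum>i\<le>k - N. ?x ^ k * (A i j * B (k - N - i) (N - j) * \<omega> ^ N))"
    by (simp add: diag_slice_nth conv2_def sum_distrib_left sum_distrib_right)
  also have "\<dots> = (\<Sum>(N, j, i)\<in>(SIGMA N:{..k}. {..N} \<times> {..k - N}). ?x ^ k * (A i j * B (k - N - i) (N - j) * \<omega> ^ N))"
    by (simp add: sum.Sigma sum.cartesian_product)
  \<comment> \<open>Reindexing: l is the total degree of the term taken from \<open>A\<close>, while
    n and n' are the exponents of the second variable in the two terms.\<close>
  also have "\<dots> = (\<Sum>(l, n, n')\<in>(SIGMA l:{..k}. {..l} \<times> {..k - l}).
      ?x ^ k * (A (l - n) n * B (k - l - n') n' * \<omega> ^ (n + n')))"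
    by (rule sum.reindex_bij_witness[where i = "\<lambda>(l, n, n'). (n + n', n, l - n)" and j = "\<lambda>(N, j, i). (i + j, j, N - j)"])
      (auto simp: diff_diff_eq add.commute)
  also have "\<dots> = (\<Sum>l\<le>k. \<Sum>n\<le>l. \<Sum>n'\<le>k - l. (?x ^ l * (A (l - n) n * \<omega> ^ n)) * (?x ^ (k - l) * (B (k - l - n') n' * \<omega> ^ n')))"
    unfolding sum.Sigma[OF finite_atMost ballI[OF finite_cartesian_product[OF finite_atMost finite_atMost]], symmetric]
      sum.cartesian_product[symmetric]
    by (intro sum.cong refl) (simp add: power_add mult_ac flip: power_add[of "?x"])
  also have "\<dots> = (\<Sum>l\<le>k. (?x ^ l * (\<Sum>n\<le>l. A (l - n) n * \<omega> ^ n)) * (?x ^ (k - l) * (\<Sum>n\<le>k - l. B (k - l - n) n * \<omega> ^ n)))"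
    by (simp only: sum_distrib_left[of "_ ^ _"] sum_product)
  also have "\<dots> = fps_nth (diag_slice s \<omega> A * diag_slice s \<omega> B) k"
    by (simp add: fps_mult_nth diag_slice_nth atLeast0AtMost)
  finally show "fps_nth (diag_slice s \<omega> (conv2 A B)) k = fps_nth (diag_slice s \<omega> A * diag_slice s \<omega> B) k" .
qed

definition dilate2 :: "real \<Rightarrow> (nat \<Rightarrow> nat \<Rightarrow> complex) \<Rightarrow> nat \<Rightarrow> nat \<Rightarrow> complex"
  where "dilate2 r b m n = of_real r ^ (m + n) * b m n"

lemma diag_slice_dilate2: "diag_slice s \<omega> (dilate2 r b) = dilate r (diag_slice s \<omega> b)"
  by (intro fps_ext) (simp add: diag_slice_nth dilate_nth dilate2_def sum_distrib_left mult_ac)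

definition subexp2 :: "(nat \<Rightarrow> nat \<Rightarrow> complex) \<Rightarrow> bool"
  where "subexp2 b \<longleftrightarrow> (\<forall>s. 0 < s \<and> s < 1 \<longrightarrow> (\<exists>C. \<forall>m n. cmod (b m n) * s ^ (m + n) \<le> C))"

lemma poly_times_geometric_bounded:
  fixes x :: real
  assumes "0 \<le> x" "x < 1"
  obtains D where "\<And>k. real (Suc k) * x ^ k \<le> D"
proof -
  have "(\<lambda>k. of_nat k * x ^ k + x ^ k) \<longlonglongrightarrow> 0 + 0"
    using assms by (intro tendsto_add powser_times_n_limit_0 LIMSEQ_power_zero) auto
  then have "Bseq (\<lambda>k. of_nat k * x ^ k + x ^ k)" by (intro convergent_imp_Bseq convergentI)
  then obtain D where D: "\<And>k. norm (of_nat k * x ^ k + x ^ k) \<le> D" unfolding Bseq_def by blast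
  have "real (Suc k) * x ^ k \<le> D" for k using D[of k] assms by (simp add: distrib_right)
  then show thesis by (rule that)
qed

lemma norm_diag_slice_le:
  assumes "\<And>m n. m + n = k \<Longrightarrow> cmod (A m n) \<le> D" and "cmod \<omega> = 1" and "0 \<le> s"
  shows "cmod (fps_nth (diag_slice s \<omega> A) k) \<le> s ^ k * (real (Suc k) * D)"
proof -
  have "cmod (\<Sum>n\<le>k. A (k - n) n * \<omega> ^ n) \<le> (\<Sum>n\<le>k. D)"
    using assms by (intro sum_norm_le) (simp add: norm_mult norm_power)
  then show ?thesis using assms(3) by (simp add: diag_slice_nth norm_mult norm_power mult_left_mono)
qed

text \<open>Degree k collects k + 1 coefficients. The factor k + 1 is absorbed by (s / t)^k for some
  t between s and 1.\<close>

lemma subexp_diag_slice: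
  assumes b: "subexp2 b" and \<omega>: "cmod \<omega> = 1" and s: "0 < s" "s < 1"
  shows "subexp (fps_nth (diag_slice s \<omega> b))"
  unfolding subexp_def
proof (intro allI impI)
  fix \<rho> :: real assume \<rho>: "0 \<le> \<rho> \<and> \<rho> < 1"
  define t where "t = (1 + s) / 2"
  have t: "s < t" "t < 1" "0 < t" using s by (auto simp: t_def)
  obtain C where C: "\<And>m n. cmod (b m n) * t ^ (m + n) \<le> C" using b t unfolding subexp2_def by blast
  have C0: "0 \<le> C" by (rule order_trans[OF _ C[of 0 0]]) simp
  obtain D where D: "\<And>k. real (Suc k) * (s / t) ^ k \<le> D"
    using poly_times_geometric_bounded[of "s / t"] s t by auto
  have "cmod (fps_nth (diag_slice s \<omega> b) k) * \<rho> ^ k \<le> D * C" for k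
  proof -
    have "cmod (b m n) \<le> C / t ^ k" if "m + n = k" for m n using C[of m n] t that by (simp add: field_simps)
    then have "cmod (fps_nth (diag_slice s \<omega> b) k) \<le> s ^ k * (real (Suc k) * (C / t ^ k))"
      using s \<omega> by (intro norm_diag_slice_le) auto
    also have "\<dots> = real (Suc k) * (s / t) ^ k * C" by (simp add: power_divide)
    also have "\<dots> \<le> D * C" using D C0 by (intro mult_right_mono) auto
    finally have "cmod (fps_nth (diag_slice s \<omega> b) k) \<le> D * C" .
    moreover have "cmod (fps_nth (diag_slice s \<omega> b) k) * \<rho> ^ k \<le> cmod (fps_nth (diag_slice s \<omega> b) k) * 1"
      using \<rho> by (intro mult_left_mono power_le_one) auto
    ultimately show ?thesis by simp
  qed
  then show "\<exists>C. \<forall>k. cmod (fps_nth (diag_slice s \<omega> b) k) * \<rho> ^ k \<le> C" by blast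
qed

lemma fps_of_poly_if_finite_support:
  assumes "\<And>k. k > N \<Longrightarrow> fps_nth F k = 0"
  shows "\<exists>q :: complex poly. degree q \<le> N \<and> F = fps_of_poly q"
proof (intro exI conjI)
  let ?q = "\<Sum>k\<le>N. monom (fps_nth F k) k"
  show "degree ?q \<le> N" by (intro degree_sum_le) (auto intro: order_trans[OF degree_monom_le])
  show "F = fps_of_poly ?q"
    by (rule fps_ext) (use assms in \<open>auto simp: coeff_sum not_le\<close>)
qed

lemma circ_1_conj: "cnj (circ 1 t) = circ 1 t powi (- 1)" and circ_1_nonzero: "circ 1 t \<noteq> 0"
  by (simp_all add: circ_def exp_cnj exp_minus power_int_minus)

lemma circle_parseval:
  "((\<lambda>t. (cmod (\<Sum>n\<le>k. c n * circ 1 t ^ n))\<^sup>2) has_integral (\<Sum>n\<le>k. (cmod (c n))\<^sup>2)) {0..1}"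
proof -
  have pw: "((\<lambda>t. circ 1 t powi j) has_integral (if j = 0 then 1 else 0)) {0..1}" for j
  proof -
    have "(\<lambda>t. circ 1 t powi j) integrable_on {0..1}"
      using circ_1_nonzero by (intro integrable_continuous_real continuous_intros) auto
    then show ?thesis using integral_circ_powi[of 1 j] by (metis has_integral_integral zero_less_one)
  qed
  have "((\<lambda>t. \<Sum>n\<le>k. \<Sum>m\<le>k. (c n * cnj (c m)) * circ 1 t powi (int n - int m)) has_integral
      (\<Sum>n\<le>k. \<Sum>m\<le>k. (c n * cnj (c m)) * (if int n - int m = 0 then 1 else 0))) {0..1}"
    by (intro has_integral_sum finite_atMost has_integral_mult_right pw)
  from has_integral_linear[OF this bounded_linear_Re]
  have 1: "((\<lambda>t. Re (\<Sum>n\<le>k. \<Sum>m\<le>k. (c n * cnj (c m)) * circ 1 t powi (int n - int m))) has_integral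
      Re (\<Sum>n\<le>k. \<Sum>m\<le>k. (c n * cnj (c m)) * (if int n - int m = 0 then 1 else 0))) {0..1}"
    by (simp add: o_def)
  have 2: "Re (\<Sum>n\<le>k. \<Sum>m\<le>k. (c n * cnj (c m)) * circ 1 t powi (int n - int m)) = (cmod (\<Sum>n\<le>k. c n * circ 1 t ^ n))\<^sup>2" for t
  proof -
    have "circ 1 t powi (int n - int m) = circ 1 t ^ n * cnj (circ 1 t) ^ m" for n m
      using circ_1_nonzero[of t] by (simp add: circ_1_conj power_int_diff power_int_minus field_simps)
    then have "(\<Sum>n\<le>k. \<Sum>m\<le>k. (c n * cnj (c m)) * circ 1 t powi (int n - int m))
        = (\<Sum>n\<le>k. c n * circ 1 t ^ n) * cnj (\<Sum>m\<le>k. c m * circ 1 t ^ m)"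
      by (simp add: sum_product mult_ac)
    also have "\<dots> = complex_of_real ((cmod (\<Sum>n\<le>k. c n * circ 1 t ^ n))\<^sup>2)"
      by (simp only: complex_norm_square)
    finally show ?thesis by simp
  qed
  have "(\<Sum>m\<le>k. (c n * cnj (c m)) * (if int n - int m = 0 then 1 else 0)) = complex_of_real ((cmod (c n))\<^sup>2)" if "n \<le> k" for n
  proof -
    have "(\<Sum>m\<le>k. (c n * cnj (c m)) * (if int n - int m = 0 then 1 else 0)) = (\<Sum>m\<le>k. if m = n then c n * cnj (c n) else 0)"
      by (intro sum.cong) auto
    then show ?thesis using that by (simp add: complex_norm_square del: of_real_power)
  qed
  then have 3: "Re (\<Sum>n\<le>k. \<Sum>m\<le>k. (c n * cnj (c m)) * (if int n - int m = 0 then 1 else 0)) = (\<Sum>n\<le>k. (cmod (c n))\<^sup>2)"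
    by simp
  show ?thesis using 1 unfolding 2 3 .
qed

text \<open>Averaging over the directions \<omega> of the lines recovers the square sum over the
  antidiagonal of total degree k, up to the weight of the radius.\<close>

lemma diag_slice_parseval:
  assumes "0 \<le> s"
  shows "((\<lambda>t. (cmod (fps_nth (diag_slice s (circ 1 t) A) k))\<^sup>2) has_integral
    (s ^ k)\<^sup>2 * (\<Sum>n\<le>k. (cmod (A (k - n) n))\<^sup>2)) {0..1}"
proof -
  have "((\<lambda>t. (s ^ k)\<^sup>2 * (cmod (\<Sum>n\<le>k. A (k - n) n * circ 1 t ^ n))\<^sup>2) has_integral
      (s ^ k)\<^sup>2 * (\<Sum>n\<le>k. (cmod (A (k - n) n))\<^sup>2)) {0..1}"
    by (intro has_integral_mult_right circle_parseval)
  then show ?thesis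
    using assms by (simp add: diag_slice_nth norm_mult norm_power power_mult_distrib)
qed

lemma sum_antidiagonals_le_norm: "(\<Sum>k<M. \<Sum>n\<le>k. (cmod (hcoeff f (k - n, n)))\<^sup>2) \<le> (norm f)\<^sup>2"
proof -
  let ?S = "SIGMA k:{..<M}. {..k}"
  have "(\<Sum>k<M. \<Sum>n\<le>k. (cmod (hcoeff f (k - n, n)))\<^sup>2) = (\<Sum>(k, n)\<in>?S. (cmod (hcoeff f (k - n, n)))\<^sup>2)"
    by (simp add: sum.Sigma)
  also have "\<dots> = (\<Sum>x\<in>(\<lambda>(k, n). (k - n, n)) ` ?S. (cmod (hcoeff f x))\<^sup>2)"
    by (subst sum.reindex) (auto simp: inj_on_def case_prod_unfold)
  also have "\<dots> \<le> (norm f)\<^sup>2" by (intro sum_le_norm_hardy2 finite_imageI finite_SigmaI) auto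
  finally show ?thesis .
qed

text \<open>Dilating the cofactor \<open>b\<close> of \<open>P\<close> is bounded in the norm of the product: apply the
  one-variable estimate to all diagonal slices and integrate over \<open>\<omega>\<close>. The auxiliary radius
  \<open>s < 1\<close> makes the slices square summable.\<close>

lemma conv2_dilate2_bound:
  assumes P: "\<And>i j. i + j > N \<Longrightarrow> P i j = 0"
  shows "\<exists>C\<ge>0. \<forall>f b r. subexp2 b \<longrightarrow> (\<forall>m n. hcoeff f (m, n) = conv2 P b m n) \<longrightarrow> 0 \<le> r \<longrightarrow> r < 1 \<longrightarrow>
    (\<forall>L. (\<Sum>k<L. \<Sum>n\<le>k. (cmod (conv2 P (dilate2 r b) (k - n) n))\<^sup>2) \<le> (C * norm f)\<^sup>2)"
proof -
  obtain C where C0: "C \<ge> 0" and C: "\<And>q h r B. degree q \<le> N \<Longrightarrow> subexp (fps_nth h) \<Longrightarrow> 0 \<le> r \<Longrightarrow> r < 1 \<Longrightarrow>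
    l2b (fps_nth (fps_of_poly q * h)) B \<Longrightarrow> l2b (fps_nth (fps_of_poly q * dilate r h)) (C * B)"
    using l2b_poly_dilate[of N] by blast
  have "(\<Sum>k<L. \<Sum>n\<le>k. (cmod (conv2 P (dilate2 r b) (k - n) n))\<^sup>2) \<le> (C * norm f)\<^sup>2"
    if b: "subexp2 b" and f: "\<And>m n. hcoeff f (m, n) = conv2 P b m n" and r: "0 \<le> r" "r < 1" for f b r L
  proof -
    define X where "X s = (\<Sum>k<L. (s ^ k)\<^sup>2 * (\<Sum>n\<le>k. (cmod (conv2 P (dilate2 r b) (k - n) n))\<^sup>2))" for s :: real
    have X_le: "X s \<le> (C * norm f)\<^sup>2" if s: "0 < s" "s < 1" for s
    proof -
      \<comment> \<open>Majorant for the squared k-th coefficient of a line restriction: k + 1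
        coefficients of f, each at most \<open>norm f\<close>, times s^k. It is summable because s <
        1.\<close>
      define a where "a k = (s ^ k * real (Suc k))\<^sup>2" for k
      have a0: "a k \<ge> 0" for k by (simp add: a_def)
      have sma: "summable a"
      proof -
        define x where "x = (1 + s) / 2"
        have x: "s < x" "x < 1" "0 < x" using s by (auto simp: x_def)
        obtain D where D: "\<And>k. real (Suc k) * x ^ k \<le> D" using poly_times_geometric_bounded[of x] x by auto
        show ?thesis
        proof (rule summable_comparison_test'[of "\<lambda>k. D\<^sup>2 * ((s / x)\<^sup>2) ^ k"])
          have "(s / x)\<^sup>2 < 1" using s x by (simp add: abs_square_less_1)
          then show "summable (\<lambda>k. D\<^sup>2 * ((s / x)\<^sup>2) ^ k)"
            by (intro summable_mult summable_geometric) simp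
          fix k
          have "a k = (real (Suc k) * x ^ k)\<^sup>2 * ((s / x) ^ k)\<^sup>2"
            using x by (simp add: a_def power_mult_distrib power_divide del: of_nat_Suc)
          also have "\<dots> \<le> D\<^sup>2 * ((s / x) ^ k)\<^sup>2"
            using D[of k] x by (intro mult_right_mono power_mono) auto
          finally show "norm (a k) \<le> D\<^sup>2 * ((s / x)\<^sup>2) ^ k"
            using a0 by (simp add: power_mult[symmetric] mult.commute)
        qed
      qed
      \<comment> \<open>The one-variable bound needs the full square sum over a line. Cutting at an
        index M whose tail is below \<open>e\<close> for all lines simultaneously leaves a finite
        sum, which can be integrated termwise over the directions.\<close>
      have "X s \<le> C\<^sup>2 * ((norm f)\<^sup>2 + e * (norm f)\<^sup>2)" if e: "e > 0" for e
      proof -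
        obtain M where M: "norm (\<Sum>i. a (i + M)) < e"
          using suminf_exist_split[OF e sma] by auto
        have tail: "(\<Sum>k\<in>{M..<K}. a k) \<le> e" for K
        proof (cases "M \<le> K")
          case True
          have "(\<Sum>k\<in>{M..<K}. a k) = (\<Sum>i<K - M. a (i + M))"
            using sum.shift_bounds_nat_ivl[of a 0 M "K - M"] True by (simp add: lessThan_atLeast0)
          also have "\<dots> \<le> (\<Sum>i. a (i + M))"
            using sma a0 by (intro sum_le_suminf) (auto simp: summable_iff_shift)
          also have "\<dots> \<le> e" using M by (simp add: abs_less_iff)
          finally show ?thesis .
        qed (use e in simp)
        define c where "c k t = (cmod (fps_nth (diag_slice s (circ 1 t) (conv2 P b)) k))\<^sup>2" for k t
        have c_le: "c k t \<le> a k * (norm f)\<^sup>2" for k t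
        proof -
          have "cmod (fps_nth (diag_slice s (circ 1 t) (conv2 P b)) k) \<le> s ^ k * (real (Suc k) * norm f)"
            by (rule norm_diag_slice_le) (use s in \<open>auto simp: hcoeff_le_norm norm_circ simp flip: f\<close>)
          then have "c k t \<le> (s ^ k * (real (Suc k) * norm f))\<^sup>2"
            unfolding c_def by (intro power_mono) auto
          then show ?thesis by (simp only: a_def power_mult_distrib mult.assoc)
        qed
        have pt: "(\<Sum>k<L. (cmod (fps_nth (diag_slice s (circ 1 t) (conv2 P (dilate2 r b))) k))\<^sup>2)
            \<le> C\<^sup>2 * ((\<Sum>k<M. c k t) + e * (norm f)\<^sup>2)" for t
        proof -
          let ?A = "(\<Sum>k<M. c k t) + e * (norm f)\<^sup>2"
          have w1: "cmod (circ 1 t) = 1" by (simp add: norm_circ)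
          have A0: "0 \<le> ?A" using e by (intro add_nonneg_nonneg sum_nonneg) (auto simp: c_def)
          obtain q where q: "degree q \<le> N" "diag_slice s (circ 1 t) P = fps_of_poly q"
            using fps_of_poly_if_finite_support[of N "diag_slice s (circ 1 t) P"] P
            by (auto simp: diag_slice_nth)
          let ?h = "diag_slice s (circ 1 t) b"
          have "l2b (fps_nth (fps_of_poly q * ?h)) (sqrt ?A)"
            unfolding l2b_def
          proof (intro allI real_le_rsqrt)
            fix K
            have "(l2n (fps_nth (fps_of_poly q * ?h)) K)\<^sup>2 = (\<Sum>k<K. c k t)"
              by (simp add: l2n_power2 c_def diag_slice_conv2 q(2))
            also have "\<dots> \<le> (\<Sum>k\<in>{..<M} \<union> {M..<K}. c k t)"
              by (intro sum_mono2) (auto simp: c_def)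
            also have "\<dots> = (\<Sum>k<M. c k t) + (\<Sum>k\<in>{M..<K}. c k t)"
              by (intro sum.union_disjoint) auto
            also have "(\<Sum>k\<in>{M..<K}. c k t) \<le> (\<Sum>k\<in>{M..<K}. a k) * (norm f)\<^sup>2"
              unfolding sum_distrib_right by (intro sum_mono c_le)
            also have "\<dots> \<le> e * (norm f)\<^sup>2" by (intro mult_right_mono tail) simp
            finally show "(l2n (fps_nth (fps_of_poly q * ?h)) K)\<^sup>2 \<le> ?A" by simp
          qed
          from C[OF q(1) subexp_diag_slice[OF b w1 s] r this]
          have "l2n (fps_nth (fps_of_poly q * dilate r ?h)) L \<le> C * sqrt ?A" by (rule l2bD)
          then have "(l2n (fps_nth (fps_of_poly q * dilate r ?h)) L)\<^sup>2 \<le> (C * sqrt ?A)\<^sup>2"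
            by (intro power_mono) auto
          then show ?thesis using A0
            by (simp add: l2n_power2 diag_slice_conv2 diag_slice_dilate2 q(2) power_mult_distrib)
        qed
        have "X s \<le> C\<^sup>2 * ((\<Sum>k<M. (s ^ k)\<^sup>2 * (\<Sum>n\<le>k. (cmod (conv2 P b (k - n) n))\<^sup>2)) + e * (norm f)\<^sup>2)"
        proof (rule has_integral_le[OF _ _ pt])
          show "((\<lambda>t. \<Sum>k<L. (cmod (fps_nth (diag_slice s (circ 1 t) (conv2 P (dilate2 r b))) k))\<^sup>2) has_integral X s) {0..1}"
            unfolding X_def using s by (intro has_integral_sum diag_slice_parseval) auto
          have "((\<lambda>t. (\<Sum>k<M. c k t) + e * (norm f)\<^sup>2) has_integral
              (\<Sum>k<M. (s ^ k)\<^sup>2 * (\<Sum>n\<le>k. (cmod (conv2 P b (k - n) n))\<^sup>2)) + e * (norm f)\<^sup>2) {0..1}"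
            unfolding c_def using s has_integral_const_real[of "e * (norm f)\<^sup>2" 0 1]
            by (intro has_integral_add has_integral_sum diag_slice_parseval) auto
          then show "((\<lambda>t. C\<^sup>2 * ((\<Sum>k<M. c k t) + e * (norm f)\<^sup>2)) has_integral
              C\<^sup>2 * ((\<Sum>k<M. (s ^ k)\<^sup>2 * (\<Sum>n\<le>k. (cmod (conv2 P b (k - n) n))\<^sup>2)) + e * (norm f)\<^sup>2)) {0..1}"
            by (rule has_integral_mult_right)
        qed
        also have "\<dots> \<le> C\<^sup>2 * ((norm f)\<^sup>2 + e * (norm f)\<^sup>2)"
        proof (intro mult_left_mono add_right_mono)
          have "(\<Sum>k<M. (s ^ k)\<^sup>2 * (\<Sum>n\<le>k. (cmod (conv2 P b (k - n) n))\<^sup>2))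
              \<le> (\<Sum>k<M. 1 * (\<Sum>n\<le>k. (cmod (conv2 P b (k - n) n))\<^sup>2))"
            using s by (intro sum_mono mult_right_mono sum_nonneg) (auto intro!: power_le_one)
          also have "\<dots> \<le> (norm f)\<^sup>2" using sum_antidiagonals_le_norm[where f = f] by (simp add: f)
          finally show "(\<Sum>k<M. (s ^ k)\<^sup>2 * (\<Sum>n\<le>k. (cmod (conv2 P b (k - n) n))\<^sup>2)) \<le> (norm f)\<^sup>2" .
        qed simp
        finally show ?thesis .
      qed
      then have *: "X s \<le> C\<^sup>2 * (norm f)\<^sup>2 + e * (C\<^sup>2 * (norm f)\<^sup>2)" if "e > 0" for e
        using that by (simp add: algebra_simps)
      have lim: "(\<lambda>i. C\<^sup>2 * (norm f)\<^sup>2 + inverse (real (Suc i)) * (C\<^sup>2 * (norm f)\<^sup>2)) \<longlonglongrightarrow> C\<^sup>2 * (norm f)\<^sup>2 + 0 * (C\<^sup>2 * (norm f)\<^sup>2)"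
        by (intro tendsto_intros LIMSEQ_inverse_real_of_nat)
      have "X s \<le> C\<^sup>2 * (norm f)\<^sup>2 + 0 * (C\<^sup>2 * (norm f)\<^sup>2)"
        by (rule LIMSEQ_le_const[OF lim]) (use * in simp)
      then show ?thesis by (simp add: power_mult_distrib)
    qed
    \<comment> \<open>Radii below 1 that tend to 1; \<open>X\<close> is a polynomial in s, so its
      bound passes to s = 1.\<close>
    define s where "s i = 1 - inverse (real (Suc (Suc i)))" for i
    have s: "0 < s i" "s i < 1" for i by (auto simp: s_def field_simps)
    have "s \<longlonglongrightarrow> 1 - 0"
      unfolding s_def[abs_def]
      by (intro tendsto_intros) (rule LIMSEQ_Suc[OF LIMSEQ_inverse_real_of_nat])
    then have "(\<lambda>i. X (s i)) \<longlonglongrightarrow> X 1" unfolding X_def by (intro tendsto_intros) simp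
    then have "X 1 \<le> (C * norm f)\<^sup>2" by (rule LIMSEQ_le_const2) (use X_le[OF s] in blast)
    then show ?thesis by (simp add: X_def)
  qed
  then show ?thesis using C0 by blast
qed

section \<open>Dilates as weak approximations\<close>

definition hardy_trunc :: "nat \<Rightarrow> hardy2 \<Rightarrow> hardy2"
  where "hardy_trunc N f = hardy_of (\<lambda>(m, n). if m < N \<and> n < N then hcoeff f (m, n) else 0)"

lemma hcoeff_hardy_trunc: "hcoeff (hardy_trunc N f) (m, n) = (if m < N \<and> n < N then hcoeff f (m, n) else 0)"
proof -
  have "square_summable (\<lambda>(m, n). if m < N \<and> n < N then hcoeff f (m, n) else 0)"
    unfolding square_summable_def
    by (rule summable_on_comparison_test[OF hcoeff[of f, unfolded square_summable_def]]) auto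
  then show ?thesis by (simp add: hardy_trunc_def hcoeff_hardy_of)
qed

lemma hardy_trunc_approx:
  assumes "e > 0"
  shows "\<exists>N. norm (f - hardy_trunc N f) \<le> e"
proof -
  define g where "g k = (cmod (hcoeff f k))\<^sup>2" for k
  have g: "g summable_on UNIV" using hcoeff[of f] by (simp add: square_summable_def g_def[abs_def])
  have "e\<^sup>2 > 0" using assms by simp
  then obtain F where F: "finite F" "dist (sum g F) (infsum g UNIV) \<le> e\<^sup>2"
    using infsum_finite_approximation[OF g] by blast
  obtain N1 where N1: "fst ` F \<subseteq> {..<N1}" using finite_nat_bounded[OF finite_imageI[OF F(1)]] by blast
  obtain N2 where N2: "snd ` F \<subseteq> {..<N2}" using finite_nat_bounded[OF finite_imageI[OF F(1)]] by blast
  define N where "N = max N1 N2"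
  define S where "S = {..<N} \<times> {..<N}"
  have FS: "F \<subseteq> S" using N1 N2 unfolding S_def N_def by fastforce
  have "norm (f - hardy_trunc N f) \<le> e"
  proof (rule norm_le_hardy2)
    fix A :: "(nat \<times> nat) set" assume A: "finite A"
    have "(\<Sum>k\<in>A. (cmod (hcoeff (f - hardy_trunc N f) k))\<^sup>2) = (\<Sum>k\<in>A - S. g k)"
      by (rule sum.mono_neutral_cong_right[OF A])
        (auto simp: hcoeff_diff hcoeff_hardy_trunc S_def g_def split: if_splits)
    also have "\<dots> \<le> infsum g UNIV - sum g F"
    proof -
      have "sum g (A - S) + sum g F = sum g ((A - S) \<union> F)"
        using A F(1) FS by (intro sum.union_disjoint[symmetric]) auto
      also have "\<dots> \<le> infsum g UNIV"
        using A F(1) by (intro finite_sum_le_infsum[OF g]) (auto simp: g_def)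
      finally show ?thesis by simp
    qed
    also have "\<dots> \<le> e\<^sup>2" using F(2) by (simp add: dist_real_def abs_le_iff)
    finally show "(\<Sum>k\<in>A. (cmod (hcoeff (f - hardy_trunc N f) k))\<^sup>2) \<le> e\<^sup>2" .
  qed (use assms in simp)
  then show ?thesis by blast
qed

lemma norm_hardy_of_poly_monom: "norm (hardy_of_poly (monom (monom 1 i) j * p)) = norm (hardy_of_poly p)"
proof -
  have "hshift i j (hardy_of_poly (monom (monom 1 i) j * p)) = hardy_of_poly p"
    by (rule hardy2_eqI) (simp add: hcoeff_hshift hcoeff_hardy_of_poly coeff_monom_mult)
  then have "complex_of_real ((norm (hardy_of_poly (monom (monom 1 i) j * p)))\<^sup>2) = complex_of_real ((norm (hardy_of_poly p))\<^sup>2)"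
    unfolding cinner_self[symmetric] cinner_hardy_of_poly_monom by simp
  then show ?thesis by (simp del: of_real_power)
qed

lemma hcoeff_hardy_of_poly_monom:
  "hcoeff (hardy_of_poly (monom (monom 1 i) j * p)) (m, n) =
    (if m < i \<or> n < j then 0 else coeff (coeff p (n - j)) (m - i))"
  by (simp add: hcoeff_hardy_of_poly coeff_monom_mult)

text \<open>p times the dilated cofactor is an absolutely convergent sum of monomial multiples of p,
  each orthogonal to the quotient module.\<close>

lemma dilated_in_submodule:
  assumes b: "subexp2 b" and r: "0 \<le> r" "r < 1" and f: "f \<in> quotient_module p"
  obtains F where "\<And>m n. hcoeff F (m, n) = conv2 (\<lambda>i j. coeff (coeff p j) i) (dilate2 r b) m n"
    "cinner F f = 0"
proof -
  define t where "t = (\<lambda>(i, j). dilate2 r b i j *\<^sub>C hardy_of_poly (monom (monom 1 i) j * p))"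
  define s where "s = (1 + r) / 2"
  have s: "r < s" "s < 1" "0 < s" using r by (auto simp: s_def)
  obtain C where C: "\<And>m n. cmod (b m n) * s ^ (m + n) \<le> C" using b s unfolding subexp2_def by blast
  \<comment> \<open>Chosen with |x|^2 = r / s, so that square summability of the monomials at (x, x)
    supplies the geometric majorant (r / s)^(m + n).\<close>
  define x where "x = complex_of_real (sqrt (r / s))"
  have x: "cmod x < 1" "(cmod x)\<^sup>2 = r / s" using r s by (auto simp: x_def)
  have "(\<lambda>k. (cmod (case k of (m, n) \<Rightarrow> x ^ m * x ^ n))\<^sup>2) summable_on UNIV"
    using square_summable_monomials[OF x(1) x(1)] by (simp add: square_summable_def)
  then have sm1: "(\<lambda>k. C * norm (hardy_of_poly p) * (cmod (case k of (m, n) \<Rightarrow> x ^ m * x ^ n))\<^sup>2) summable_on UNIV"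
    by (rule summable_on_cmult_right)
  have le: "norm (t k) \<le> C * norm (hardy_of_poly p) * (cmod (case k of (m, n) \<Rightarrow> x ^ m * x ^ n))\<^sup>2" for k
  proof (cases k)
    case (Pair m n)
    have "(cmod (x ^ m * x ^ n))\<^sup>2 = (r / s) ^ (m + n)"
      by (simp add: norm_mult norm_power power_add power_mult_distrib power_mult[symmetric] mult.commute flip: x(2))
    moreover have "r ^ (m + n) * cmod (b m n) \<le> C * (r / s) ^ (m + n)"
    proof -
      have "r ^ (m + n) * cmod (b m n) = (cmod (b m n) * s ^ (m + n)) * (r / s) ^ (m + n)"
        using s by (simp add: power_divide)
      also have "\<dots> \<le> C * (r / s) ^ (m + n)" using C r s by (intro mult_right_mono) auto
      finally show ?thesis .
    qed
    moreover have "norm (t k) = r ^ (m + n) * cmod (b m n) * norm (hardy_of_poly p)"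
      using r by (simp add: Pair t_def norm_scaleC norm_hardy_of_poly_monom dilate2_def norm_mult norm_power)
    ultimately show ?thesis
      using mult_right_mono[of "r ^ (m + n) * cmod (b m n)" "C * (r / s) ^ (m + n)" "norm (hardy_of_poly p)"]
      by (simp add: Pair mult.assoc mult.left_commute[of "norm (hardy_of_poly p)"] mult.commute[of _ "norm (hardy_of_poly p)"])
  qed
  have "(\<lambda>k. norm (t k)) summable_on UNIV"
    by (rule summable_on_comparison_test[OF sm1]) (use le in auto)
  then have t: "t summable_on UNIV" by (rule abs_summable_summable)
  show thesis
  proof (rule that[of "infsum t UNIV"])
    fix m n
    have "hcoeff (infsum t UNIV) (m, n) = (\<Sum>\<^sub>\<infinity>k. hcoeff (t k) (m, n))"
      using has_sum_bounded_linear[OF bounded_linear_hcoeff has_sum_infsum[OF t], of "(m, n)"]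
      by (simp add: infsumI)
    also have "\<dots> = (\<Sum>\<^sub>\<infinity>k\<in>{..m} \<times> {..n}. hcoeff (t k) (m, n))"
      by (rule infsum_cong_neutral) (auto simp: t_def hcoeff_scaleC hcoeff_hardy_of_poly_monom split: if_splits)
    also have "\<dots> = (\<Sum>k\<in>{..m} \<times> {..n}. hcoeff (t k) (m, n))" by (rule infsum_finite) simp
    also have "\<dots> = (\<Sum>i\<le>m. \<Sum>j\<le>n. dilate2 r b i j * coeff (coeff p (n - j)) (m - i))"
      unfolding sum.cartesian_product
      by (intro sum.cong) (auto simp: t_def hcoeff_scaleC hcoeff_hardy_of_poly_monom)
    also have "\<dots> = (\<Sum>j\<le>n. \<Sum>i\<le>m. dilate2 r b i j * coeff (coeff p (n - j)) (m - i))" by (rule sum.swap)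
    also have "\<dots> = (\<Sum>j\<le>n. \<Sum>i\<le>m. dilate2 r b (m - i) (n - j) * coeff (coeff p j) i)"
      by (rule sum.reindex_bij_witness[of _ "\<lambda>j. n - j" "\<lambda>j. n - j"]; (rule sum.reindex_bij_witness[of _ "\<lambda>i. m - i" "\<lambda>i. m - i"])?) auto
    finally show "hcoeff (infsum t UNIV) (m, n) = conv2 (\<lambda>i j. coeff (coeff p j) i) (dilate2 r b) m n"
      by (simp add: conv2_def mult.commute)
  next
    have "cinner (infsum t UNIV) f = (\<Sum>\<^sub>\<infinity>k. cinner (t k) f)"
      using has_sum_bounded_linear[OF bounded_bilinear.bounded_linear_left[OF bounded_bilinear_cinner]
          has_sum_infsum[OF t], of f]
      by (simp add: infsumI)
    also have "\<dots> = (\<Sum>\<^sub>\<infinity>k::nat \<times> nat. 0)"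
    proof (rule infsum_cong)
      fix k :: "nat \<times> nat"
      show "cinner (t k) f = 0"
        using f by (cases k) (simp add: t_def cinner_scaleC_left mem_quotient_iff flip: pcorr_eq_cinner)
    qed
    finally show "cinner (infsum t UNIV) f = 0" by simp
  qed
qed

lemma coeff2_support:
  fixes p :: "complex poly poly"
  obtains N where "\<And>i j. i + j > N \<Longrightarrow> coeff (coeff p j) i = 0"
proof -
  define d where "d = (MAX n\<in>{..degree p}. degree (coeff p n))"
  have "coeff (coeff p j) i = 0" if "i + j > d + degree p" for i j
  proof (cases "j \<le> degree p")
    case True
    have "degree (coeff p j) \<le> d" unfolding d_def using True by (intro Max_ge) auto
    then show ?thesis using that True by (simp add: coeff_eq_0)
  next
    case False
    then show ?thesis by (simp add: coeff_eq_0)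
  qed
  then show thesis by (rule that)
qed

text \<open>The dilated products \<open>F i\<close> are orthogonal to f, uniformly bounded, and
  converge to f coefficientwise. Bounded coefficientwise convergence is weak convergence, so the
  squared norm of f is a limit of zeros.\<close>

lemma quotient_multiple_eq_0:
  assumes f: "f \<in> quotient_module p" and b: "subexp2 b"
    and fb: "\<And>m n. hcoeff f (m, n) = conv2 (\<lambda>i j. coeff (coeff p j) i) b m n"
  shows "f = 0"
proof -
  let ?P = "\<lambda>i j. coeff (coeff p j) i"
  obtain N where N: "\<And>i j. i + j > N \<Longrightarrow> ?P i j = 0" using coeff2_support[of p] by blast
  obtain C where C0: "C \<ge> 0" and C: "\<And>r L. 0 \<le> r \<Longrightarrow> r < 1 \<Longrightarrow>
      (\<Sum>k<L. \<Sum>n\<le>k. (cmod (conv2 ?P (dilate2 r b) (k - n) n))\<^sup>2) \<le> (C * norm f)\<^sup>2"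
    using conv2_dilate2_bound[of N ?P, OF N] b fb by blast
  define r where "r i = 1 - inverse (real (Suc i))" for i
  have r: "0 \<le> r i" "r i < 1" for i by (auto simp: r_def field_simps)
  have "r \<longlonglongrightarrow> 1 - 0" unfolding r_def[abs_def] by (intro tendsto_intros LIMSEQ_inverse_real_of_nat)
  then have r1: "r \<longlonglongrightarrow> 1" by simp
  have "\<forall>i. \<exists>F. (\<forall>m n. hcoeff F (m, n) = conv2 ?P (dilate2 (r i) b) m n) \<and> cinner F f = 0"
    using dilated_in_submodule[OF b r f] by metis
  then obtain F where F: "\<And>i m n. hcoeff (F i) (m, n) = conv2 ?P (dilate2 (r i) b) m n"
    and Ff: "\<And>i. cinner (F i) f = 0" by metis
  have nF: "norm (F i) \<le> C * norm f" for i
  proof -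
    have "(\<Sum>m<M. \<Sum>n<M. (cmod (hcoeff (F i) (m, n)))\<^sup>2) \<le> (C * norm f)\<^sup>2" for M
    proof -
      let ?g = "\<lambda>m n. (cmod (conv2 ?P (dilate2 (r i) b) m n))\<^sup>2"
      have "(\<Sum>m<M. \<Sum>n<M. (cmod (hcoeff (F i) (m, n)))\<^sup>2) = (\<Sum>(m, n)\<in>{..<M} \<times> {..<M}. ?g m n)"
        by (simp add: F sum.cartesian_product)
      also have "\<dots> = (\<Sum>(k, n)\<in>(\<lambda>(m, n). (m + n, n)) ` ({..<M} \<times> {..<M}). ?g (k - n) n)"
        by (subst sum.reindex) (auto simp: inj_on_def case_prod_unfold)
      also have "\<dots> \<le> (\<Sum>(k, n)\<in>(SIGMA k:{..<2 * M}. {..k}). ?g (k - n) n)"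
        by (rule sum_mono2) auto
      also have "\<dots> = (\<Sum>k<2 * M. \<Sum>n\<le>k. ?g (k - n) n)" by (simp add: sum.Sigma)
      also have "\<dots> \<le> (C * norm f)\<^sup>2" by (rule C[OF r])
      finally show ?thesis .
    qed
    from hardy2_bound[of "hcoeff (F i)", OF this] C0
    have "norm (hardy_of (hcoeff (F i))) \<le> C * norm f" by simp
    moreover have "hardy_of (hcoeff (F i)) = F i"
      by (subst hcoeff_inject[symmetric]) (simp add: hcoeff_hardy_of hcoeff)
    ultimately show ?thesis by simp
  qed
  have lim: "(\<lambda>i. hcoeff (F i) (m, n)) \<longlonglongrightarrow> hcoeff f (m, n)" for m n
  proof -
    have "(\<lambda>i. conv2 ?P (dilate2 (r i) b) m n) \<longlonglongrightarrow> conv2 ?P (dilate2 1 b) m n"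
      unfolding conv2_def dilate2_def by (intro tendsto_intros r1)
    moreover have "dilate2 1 b = b" by (simp add: dilate2_def fun_eq_iff)
    ultimately show ?thesis by (simp add: F fb)
  qed
  \<comment> \<open>Weak convergence made explicit: against a truncation only finitely many
    coefficients matter, and orthogonality to f replaces the truncation by minus the remainder,
    which the uniform bound controls.\<close>
  have key: "(norm (hardy_trunc M f))\<^sup>2 \<le> C * norm f * norm (f - hardy_trunc M f)" for M
  proof -
    let ?S = "{..<M} \<times> {..<M}"
    have tr: "cinner g (hardy_trunc M f) = (\<Sum>k\<in>?S. hcoeff g k * cnj (hcoeff f k))" for g
    proof -
      have "cinner g (hardy_trunc M f) = (\<Sum>\<^sub>\<infinity>k\<in>?S. hcoeff g k * cnj (hcoeff f k))"
        unfolding cinner_hardy2 by (rule infsum_cong_neutral) (auto simp: hcoeff_hardy_trunc split: if_splits)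
      then show ?thesis by simp
    qed
    have "(\<lambda>i. cmod (cinner (F i) (hardy_trunc M f))) \<longlonglongrightarrow> cmod (cinner f (hardy_trunc M f))"
      unfolding tr by (intro tendsto_intros) (auto intro: lim)
    moreover have "cmod (cinner (F i) (hardy_trunc M f)) \<le> C * norm f * norm (f - hardy_trunc M f)" for i
    proof -
      have "cinner (F i) (hardy_trunc M f) = - cinner (F i) (f - hardy_trunc M f)"
        by (simp add: cinner_diff_right Ff)
      then have "cmod (cinner (F i) (hardy_trunc M f)) \<le> norm (F i) * norm (f - hardy_trunc M f)"
        using norm_cinner_le by simp
      also have "\<dots> \<le> C * norm f * norm (f - hardy_trunc M f)" by (intro mult_right_mono nF) simp
      finally show ?thesis .
    qed
    ultimately have le: "cmod (cinner f (hardy_trunc M f)) \<le> C * norm f * norm (f - hardy_trunc M f)"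
      by (intro LIMSEQ_le_const2) auto
    have "cinner f (hardy_trunc M f) = cinner (hardy_trunc M f) (hardy_trunc M f)"
      unfolding tr by (intro sum.cong) (auto simp: hcoeff_hardy_trunc)
    then have "cinner f (hardy_trunc M f) = complex_of_real ((norm (hardy_trunc M f))\<^sup>2)"
      by (simp only: cinner_self)
    with le show ?thesis by (simp add: norm_power)
  qed
  have "norm f \<le> 2 * sqrt e + e" if e: "e > 0" for e
  proof -
    \<comment> \<open>Small enough for the remainder itself and for its product with the uniform
      bound; the added 1 avoids division by 0.\<close>
    define e' where "e' = min (e / (C * norm f + 1)) e"
    have pos: "C * norm f + 1 > 0" using C0 by (simp add: add_nonneg_pos)
    have e': "e' > 0" "e' \<le> e" using e pos by (auto simp: e'_def)
    obtain M where M: "norm (f - hardy_trunc M f) \<le> e'" using hardy_trunc_approx[OF e'(1)] by blast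
    have "(norm (hardy_trunc M f))\<^sup>2 \<le> C * norm f * e'"
      using key[of M] mult_left_mono[OF M, of "C * norm f"] C0 by (simp add: order_trans)
    also have "\<dots> \<le> (C * norm f + 1) * (e / (C * norm f + 1))"
      using C0 e' pos by (intro mult_mono) (auto simp: e'_def)
    also have "\<dots> = e" using pos by simp
    finally have "norm (hardy_trunc M f) \<le> sqrt e" by (rule real_le_rsqrt)
    moreover have "norm f \<le> norm (hardy_trunc M f) + norm (f - hardy_trunc M f)"
      using norm_triangle_ineq[of "hardy_trunc M f" "f - hardy_trunc M f"] by simp
    moreover have "0 \<le> sqrt e" using e by simp
    ultimately show ?thesis using M e' by linarith
  qed
  then have "norm f \<le> 2 * sqrt (inverse (real (Suc i))) + inverse (real (Suc i))" for i by simp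
  moreover have "(\<lambda>i. 2 * sqrt (inverse (real (Suc i))) + inverse (real (Suc i))) \<longlonglongrightarrow> 2 * sqrt 0 + 0"
    by (intro tendsto_intros LIMSEQ_inverse_real_of_nat)
  ultimately have "norm f \<le> 2 * sqrt 0 + 0" by (intro LIMSEQ_le_const) auto
  then show ?thesis by simp
qed

section \<open>The generalized Cowen--Douglas property\<close>

abbreviation S_z_adj :: "complex poly poly \<Rightarrow> hardy2 \<Rightarrow> hardy2"
  where "S_z_adj p \<equiv> adjoint_on (quotient_module p) (S_z p)"

abbreviation eig :: "complex poly poly \<Rightarrow> complex \<Rightarrow> hardy2 set"
  where "eig p w \<equiv> eigenspace (quotient_module p) (S_z_adj p) w"

lemma eig_iff: "x \<in> eig p w \<longleftrightarrow> x \<in> quotient_module p \<and> zshift x = w *\<^sub>C x"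
  by (simp add: eigenspace_adjoint_S_z)

lemma csubspace_eig: "csubspace (eig p w)"
proof (rule csubspaceI)
  note sub = csubspaceD[OF csubspace_quotient[of p]]
  show "0 \<in> eig p w"
    using sub(1) zshift_diff[of 0 0] by (simp add: eig_iff)
  show "x + y \<in> eig p w" if "x \<in> eig p w" "y \<in> eig p w" for x y
    using that sub(2) by (simp add: eig_iff zshift_add scaleC_add_right)
  show "c *\<^sub>C x \<in> eig p w" if "x \<in> eig p w" for c x
    using that sub(3) by (simp add: eig_iff zshift_scaleC scaleC_scaleC mult.commute)
qed

lemma eig_basis:
  assumes p: "no_univariate_factors p" and w: "cmod w < 1"
  obtains B where "finite B" "card B = disk_zeros (slice p (cnj w))" "\<not> cdependent B" "cspan B = eig p w"
  using basis_eigvec_ker2[OF w slice_nonzero[OF p], of "cnj w"]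
  unfolding eigenspace_S_z[OF w] disk_zeros_eq_zcount by blast

lemma cdim_eig:
  assumes p: "no_univariate_factors p" and w: "cmod w < 1"
  shows "cdim (eig p w) = disk_zeros (slice p (cnj w))"
proof -
  obtain B where B: "finite B" "card B = disk_zeros (slice p (cnj w))" "\<not> cdependent B" "cspan B = eig p w"
    by (rule eig_basis[OF p w])
  have "cspan B = cspan (eig p w)" unfolding B(4)[symmetric] by (simp add: complex_vector.span_span)
  then show ?thesis using complex_vector.dim_eq_card[of B "eig p w"] B by simp
qed

lemma eig_total:
  assumes p: "no_univariate_factors p" and f: "f \<in> quotient_module p"
    and orth: "\<And>z x. z \<in> Omega p \<Longrightarrow> x \<in> eig p (cnj z) \<Longrightarrow> cinner f x = 0"
  shows "f = 0"
proof -
  have div: "\<exists>G. subexp G \<and> Abs_fps (frow f z) = fps_of_poly (slice p z) * Abs_fps G" if z: "z \<in> Omega p" for z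
  proof (rule orth_ker2_imp_dvd[OF slice_nonzero[OF p]])
    have z1: "cmod z < 1" using z Omega_subset by fastforce
    show "square_summable (frow f z)" by (rule square_summableI[OF l2b_frow[OF z1]])
    show "(\<Sum>n. frow f z n * h n) = 0" if "h \<in> ker2 (slice p z)" for h
    proof -
      have "eigvec (cnj z) h \<in> eig p (cnj z)" using that z1 by (subst eigenspace_S_z) auto
      then have "cinner f (eigvec (cnj z) h) = 0" by (rule orth[OF z])
      then show ?thesis using cinner_eigvec[of "cnj z" h f] z1 that by (simp add: ker2_def)
    qed
  qed
  obtain b :: "nat \<Rightarrow> nat \<Rightarrow> complex"
    where b: "\<And>m n. hcoeff f (m, n) = (\<Sum>j\<le>n. \<Sum>i\<le>m. coeff (coeff p j) i * b (m - i) (n - j))"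
      and bs: "\<And>s. 0 < s \<Longrightarrow> s < 1 \<Longrightarrow> \<exists>C. \<forall>m n. cmod (b m n) * s ^ (m + n) \<le> C"
    using global_quotient[OF p div] by blast
  show ?thesis
    by (rule quotient_multiple_eq_0[OF f, of b]) (use b bs in \<open>auto simp: subexp2_def conv2_def\<close>)
qed

section \<open>Passing to conjugate components\<close>

lemma connected_cnj_image: "connected S \<Longrightarrow> connected (cnj ` S)"
  by (intro connected_continuous_image continuous_intros)

lemma cnj_cnj_image [simp]: "cnj ` cnj ` S = S"
  by (simp add: image_image)

lemma components_cnj_image:
  assumes C: "C \<in> components S"
  shows "cnj ` C \<in> components (cnj ` S)"
  unfolding in_components_maximal
proof (intro conjI allI impI)
  show "cnj ` C \<noteq> {}" "cnj ` C \<subseteq> cnj ` S" "connected (cnj ` C)"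
    using C by (auto simp: in_components_maximal connected_cnj_image)
  fix D assume D: "D \<noteq> {} \<and> cnj ` C \<subseteq> D \<and> D \<subseteq> cnj ` S \<and> connected D"
  then have *: "cnj ` D \<noteq> {}" "C \<subseteq> cnj ` D" "cnj ` D \<subseteq> S" "connected (cnj ` D)"
    using connected_cnj_image image_mono[of "cnj ` C" D cnj] image_mono[of D "cnj ` S" cnj] by auto
  have max: "E = C" if "E \<noteq> {}" "C \<subseteq> E" "E \<subseteq> S" "connected E" for E
    using C that unfolding in_components_maximal by blast
  have "cnj ` D = C" by (rule max[OF *])
  then show "D = cnj ` C" using cnj_cnj_image by metis
qed

lemma components_cnj_imageD: "D \<in> components (cnj ` S) \<Longrightarrow> cnj ` D \<in> components S"
  using components_cnj_image[of D "cnj ` S"] by simp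

lemma disk_zeros_component:
  assumes p: "no_univariate_factors p" and C: "C \<in> components (Omega p)" and z: "z \<in> C" "v \<in> C"
  shows "disk_zeros (slice p z) = disk_zeros (slice p v)"
proof (rule connected_local_const[of C])
  show "connected C" using C by (rule in_components_connected)
  show "\<forall>a\<in>C. eventually (\<lambda>b. disk_zeros (slice p a) = disk_zeros (slice p b)) (at a within C)"
  proof
    fix a assume "a \<in> C"
    then have "a \<in> Omega p" using in_components_subset[OF C] by blast
    then obtain d where d: "d > 0" "\<And>v. v \<in> ball a d \<Longrightarrow> disk_zeros (slice p v) = disk_zeros (slice p a)"
      using Omega_locally_constant[OF p] by meson
    have "disk_zeros (slice p a) = disk_zeros (slice p b)" if "dist b a < d" for b
      using d(2)[of b] that by (simp add: dist_commute)
    then show "eventually (\<lambda>b. disk_zeros (slice p a) = disk_zeros (slice p b)) (at a within C)"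
      unfolding eventually_at using d(1) by blast
  qed
qed (use z in auto)

lemma hardy2_countable_dense: "\<exists>D :: hardy2 set. countable D \<and> (\<forall>f e. e > 0 \<longrightarrow> (\<exists>d\<in>D. norm (f - d) < e))"
proof -
  obtain Q :: "complex set" where Q: "countable Q" "\<And>X. open X \<Longrightarrow> X \<noteq> {} \<Longrightarrow> \<exists>d\<in>Q. d \<in> X"
    by (erule countable_dense_setE)
  define mon where "mon = (\<lambda>(m, n). hardy_of_poly (monom (monom 1 m) n))"
  have mon_coeff: "hcoeff (mon (i, j)) (m, n) = (if i = m \<and> j = n then 1 else 0)" for i j m n
    by (auto simp: mon_def hcoeff_hardy_of_poly)
  have nmon: "norm (mon k) = norm (mon (0, 0))" for k
    using norm_hardy_of_poly_monom[of "fst k" "snd k" 1] norm_hardy_of_poly_monom[of 0 0 1]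
    by (simp only: mon_def case_prod_unfold mult_1_right fst_conv snd_conv)
  let ?S = "\<lambda>N. {..<N::nat} \<times> {..<N::nat}"
  define D where "D = (\<Union>N. (\<lambda>c. \<Sum>k\<in>?S N. c k *\<^sub>C mon k) ` (Pi\<^sub>E (?S N) (\<lambda>_. Q)))"
  have "countable D" unfolding D_def using Q(1) by (intro countable_UN countable_image countable_PiE) auto
  moreover have "\<exists>d\<in>D. norm (f - d) < e" if e: "e > 0" for f e
  proof -
    obtain N where N: "norm (f - hardy_trunc N f) \<le> e / 2" using hardy_trunc_approx[of "e / 2" f] e by auto
    \<comment> \<open>There are N^2 coefficients, each in error by less than e / (2 K), on monomials
      of equal norm; the added 1 keeps K positive and the final inequality strict.\<close>
    define K where "K = (real N)\<^sup>2 * norm (mon (0, 0)) + 1"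
    have K: "K > 0" unfolding K_def by (intro add_nonneg_pos mult_nonneg_nonneg) auto
    have eK: "e / (2 * K) > 0" using e K by simp
    have "\<exists>q\<in>Q. cmod (hcoeff f k - q) < e / (2 * K)" for k
    proof -
      have "hcoeff f k \<in> ball (hcoeff f k) (e / (2 * K))" using eK by simp
      then have "\<exists>q\<in>Q. q \<in> ball (hcoeff f k) (e / (2 * K))" by (intro Q(2)) auto
      then show ?thesis by (simp add: dist_norm)
    qed
    then obtain q where q: "\<And>k. q k \<in> Q" "\<And>k. cmod (hcoeff f k - q k) < e / (2 * K)" by metis
    define c where "c = restrict q (?S N)"
    define d where "d = (\<Sum>k\<in>?S N. c k *\<^sub>C mon k)"
    have "c \<in> Pi\<^sub>E (?S N) (\<lambda>_. Q)" unfolding c_def restrict_PiE_iff using q(1) by blast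
    then have "d \<in> D" unfolding D_def d_def by blast
    have "hardy_trunc N f = (\<Sum>k\<in>?S N. hcoeff f k *\<^sub>C mon k)"
    proof (rule hardy2_eqI)
      fix m n
      have "hcoeff (\<Sum>k\<in>?S N. hcoeff f k *\<^sub>C mon k) (m, n) = (\<Sum>k\<in>?S N. if k = (m, n) then hcoeff f k else 0)"
        unfolding hcoeff_sum by (intro sum.cong) (auto simp: hcoeff_scaleC mon_coeff split: if_splits)
      also have "\<dots> = (if (m, n) \<in> ?S N then hcoeff f (m, n) else 0)" by (subst sum.delta) auto
      finally show "hcoeff (hardy_trunc N f) (m, n) = hcoeff (\<Sum>k\<in>?S N. hcoeff f k *\<^sub>C mon k) (m, n)"
        by (simp add: hcoeff_hardy_trunc)
    qed
    then have "hardy_trunc N f - d = (\<Sum>k\<in>?S N. (hcoeff f k - q k) *\<^sub>C mon k)"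
      by (simp add: d_def c_def complex_vector.scale_left_diff_distrib sum_subtractf)
    then have "norm (hardy_trunc N f - d) \<le> (\<Sum>k\<in>?S N. norm ((hcoeff f k - q k) *\<^sub>C mon k))"
      by (simp add: norm_sum)
    also have "\<dots> \<le> (\<Sum>k\<in>?S N. e / (2 * K) * norm (mon (0, 0)))"
    proof (rule sum_mono)
      fix k
      show "norm ((hcoeff f k - q k) *\<^sub>C mon k) \<le> e / (2 * K) * norm (mon (0, 0))"
        unfolding norm_scaleC nmon[of k] by (intro mult_right_mono less_imp_le[OF q(2)]) simp
    qed
    also have "\<dots> = e / (2 * K) * ((real N)\<^sup>2 * norm (mon (0, 0)))"
      by (simp add: power2_eq_square)
    also have "\<dots> < e / (2 * K) * K"
      using e K by (intro mult_strict_left_mono) (auto simp: K_def)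
    also have "\<dots> = e / 2" using K by simp
    finally have "norm (hardy_trunc N f - d) < e / 2" .
    moreover have "norm (f - d) \<le> norm (f - hardy_trunc N f) + norm (hardy_trunc N f - d)"
      using norm_triangle_ineq[of "f - hardy_trunc N f" "hardy_trunc N f - d"] by simp
    ultimately have "norm (f - d) < e" using N by linarith
    with \<open>d \<in> D\<close> show ?thesis by blast
  qed
  ultimately show ?thesis by blast
qed

text \<open>The projection onto \<open>K\<close> is contractive and fixes \<open>K\<close>, so it
  maps a countable dense set to one that is dense in \<open>K\<close>.\<close>

lemma separable_closed_csubspace:
  assumes K: "closed_csubspace (K :: hardy2 set)"
  shows "separable_space (top_of_set K)"
proof -
  obtain D :: "hardy2 set" where D: "countable D" "\<And>f e. e > 0 \<Longrightarrow> \<exists>d\<in>D. norm (f - d) < e"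
    using hardy2_countable_dense by blast
  let ?P = "orth_proj K"
  have PK: "?P ` D \<subseteq> K" using orth_proj_mem[OF K] by blast
  have "x \<in> top_of_set K closure_of (?P ` D)" if x: "x \<in> K" for x
    unfolding in_closure_of
  proof (intro conjI allI impI)
    show "x \<in> topspace (top_of_set K)" using x by simp
    fix T assume "x \<in> T \<and> openin (top_of_set K) T"
    then obtain U where U: "open U" "T = K \<inter> U" "x \<in> U" by (auto simp: openin_open)
    then obtain e where e: "e > 0" "ball x e \<subseteq> U" using open_contains_ball by blast
    obtain d where d: "d \<in> D" "norm (x - d) < e" using D(2)[OF e(1)] by blast
    have sub: "csubspace K" using K by (simp add: closed_csubspace_def)
    have "d = x + (- 1) *\<^sub>C (x - d)" by simp
    then have "?P d = ?P x + (- 1) *\<^sub>C ?P (x - d)"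
      using orth_proj_add[OF K, of x "(- 1) *\<^sub>C (x - d)"] orth_proj_scaleC[OF K, of "- 1" "x - d"] by simp
    then have "x - ?P d = ?P (x - d)" using orth_proj_id[OF sub x] by simp
    then have "norm (x - ?P d) < e" using norm_orth_proj_le[OF K, of "x - d"] d(2) by simp
    then have "?P d \<in> U" using e(2) by (auto simp: dist_norm)
    then show "\<exists>y. y \<in> ?P ` D \<and> y \<in> T" using d(1) orth_proj_mem[OF K] U(2) by blast
  qed
  then have "top_of_set K closure_of (?P ` D) = topspace (top_of_set K)"
    using closure_of_subset_topspace[of "top_of_set K"] by fastforce
  then show ?thesis
    unfolding separable_space_def using D(1) PK by (intro exI[of _ "?P ` D"]) auto
qed

lemma mem_cnj_image: "w \<in> cnj ` S \<longleftrightarrow> cnj w \<in> S"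
  by (metis complex_cnj_cnj image_iff)

lemma cnj_Omega:
  assumes p: "no_univariate_factors p" and w: "w \<in> cnj ` Omega p"
  shows "cmod w < 1" "cnj w \<in> Omega p" "\<And>v. cmod v = 1 \<Longrightarrow> poly (slice p (cnj w)) v \<noteq> 0"
proof -
  show w': "cnj w \<in> Omega p" using w by (simp add: mem_cnj_image)
  show "cmod w < 1" using w' Omega_subset by fastforce
  show "poly (slice p (cnj w)) v \<noteq> 0" if "cmod v = 1" for v
    using Omega_nonzero[OF p w' that] by (simp add: poly_slice)
qed

lemma open_cnj_Omega:
  assumes p: "no_univariate_factors p"
  shows "open (cnj ` Omega p)"
proof -
  have "cnj ` Omega p = cnj -` Omega p" using mem_cnj_image by blast
  then show ?thesis
    using open_vimage[OF open_Omega[OF p], of cnj] by (simp add: continuous_on_cnj continuous_on_id)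
qed

lemma eig_closed_cspan:
  assumes p: "no_univariate_factors p"
  shows "closed_cspan (\<Union>w\<in>cnj ` Omega p. eig p w) = quotient_module p"
proof (rule closed_cspan_eqI[OF closed_csubspace_quotient])
  show "(\<Union>w\<in>cnj ` Omega p. eig p w) \<subseteq> quotient_module p" by (auto simp: eig_iff)
  fix x assume "x \<in> quotient_module p" "x \<in> orth_compl (\<Union>w\<in>cnj ` Omega p. eig p w)"
  then show "x = 0" by (intro eig_total[OF p]) (auto simp: orth_compl_def)
qed

lemma cowen_douglas_S_z_adj:
  assumes p: "no_univariate_factors p"
  shows "\<exists>\<alpha>. (\<forall>C\<in>components (Omega p). \<forall>z\<in>C. \<alpha> (cnj ` C) = disk_zeros (slice p z)) \<and>
    cowen_douglas (quotient_module p) (cnj ` Omega p) \<alpha> (S_z_adj p)"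
proof -
  let ?K = "quotient_module p" and ?W = "cnj ` Omega p"
  \<comment> \<open>The zero count at an arbitrary point of the set. On a component it does not
    depend on the choice.\<close>
  define \<alpha> where "\<alpha> D = disk_zeros (slice p (cnj (SOME w. w \<in> D)))" for D
  have \<alpha>: "\<alpha> (cnj ` C) = disk_zeros (slice p z)" if C: "C \<in> components (Omega p)" and z: "z \<in> C" for C z
  proof -
    have "(SOME w. w \<in> cnj ` C) \<in> cnj ` C" by (rule someI_ex) (use z in blast)
    then have "cnj (SOME w. w \<in> cnj ` C) \<in> C" by (simp only: mem_cnj_image)
    then show ?thesis unfolding \<alpha>_def by (rule disk_zeros_component[OF p C _ z])
  qed
  have \<alpha>': "\<alpha> D = disk_zeros (slice p (cnj w))" if D: "D \<in> components ?W" and w: "w \<in> D" for D w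
    using \<alpha>[OF components_cnj_imageD[OF D], of "cnj w"] w by simp
  have "cowen_douglas ?K ?W \<alpha> (S_z_adj p)"
    unfolding cowen_douglas_def
  proof (intro conjI ballI)
    show "closed_csubspace ?K" by (rule closed_csubspace_quotient)
    show "separable_space (top_of_set ?K)" by (rule separable_closed_csubspace[OF closed_csubspace_quotient])
    show "open ?W" by (rule open_cnj_Omega[OF p])
    show "bounded ?W"
      using cnj_Omega(1)[OF p] by (intro boundedI[of _ 1] less_imp_le)
    note sub = csubspaceD[OF csubspace_quotient[of p]]
    show "bounded_op_on ?K (S_z_adj p)"
      unfolding bounded_op_on_def
    proof (intro conjI ballI allI exI[of _ 1])
      show "S_z_adj p ` ?K \<subseteq> ?K" by (auto simp: adjoint_S_z zshift_quotient)
    qed (auto simp: adjoint_S_z sub zshift_add zshift_scaleC norm_zshift_le)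
    show "(\<lambda>x. S_z_adj p x - w *\<^sub>C x) ` ?K = ?K" if w: "w \<in> ?W" for w
    proof
      show "(\<lambda>x. S_z_adj p x - w *\<^sub>C x) ` ?K \<subseteq> ?K"
        by (auto simp: adjoint_S_z zshift_quotient sub)
      obtain C where C: "\<And>y. y \<in> ?K \<Longrightarrow> \<exists>x\<in>?K. zshift x - w *\<^sub>C x = y \<and> norm x \<le> C * norm y"
        using zshift_lift[OF cnj_Omega(1)[OF p w] slice_nonzero[OF p] cnj_Omega(3)[OF p w]] by blast
      show "?K \<subseteq> (\<lambda>x. S_z_adj p x - w *\<^sub>C x) ` ?K"
      proof
        fix y assume "y \<in> ?K"
        then obtain x where "x \<in> ?K" "zshift x - w *\<^sub>C x = y" using C by blast
        then show "y \<in> (\<lambda>x. S_z_adj p x - w *\<^sub>C x) ` ?K"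
          by (intro image_eqI[of _ _ x]) (auto simp: adjoint_S_z)
      qed
    qed
    show "closed_cspan (\<Union>w\<in>?W. eig p w) = ?K" by (rule eig_closed_cspan[OF p])
    fix D assume D: "D \<in> components ?W"
    show "cdim (eig p w) = \<alpha> D" if "w \<in> D" for w
    proof -
      have "w \<in> ?W" using that in_components_subset[OF D] by blast
      then show ?thesis using cdim_eig[OF p cnj_Omega(1)[OF p]] \<alpha>'[OF D that] by simp
    qed
    obtain w where w: "w \<in> D" using in_components_nonempty[OF D] by blast
    then have "cnj w \<in> Omega p" using in_components_subset[OF D] cnj_Omega(2)[OF p] by blast
    then show "\<alpha> D > 0" using \<alpha>'[OF D w] by (simp add: Omega_eq[OF p])
  qed
  with \<alpha> show ?thesis by blast
qed

section \<open>Uniqueness from the eigenspaces over an open set\<close>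

lemma fsigma_ball: "fsigma (ball (0 :: complex) 1)"
proof -
  have "ball (0 :: complex) 1 = (\<Union>n. cball 0 (1 - inverse (real (Suc n))))"
  proof (intro equalityI subsetI)
    fix x :: complex assume "x \<in> ball 0 1"
    then obtain n where "inverse (real (Suc n)) < 1 - cmod x" using reals_Archimedean[of "1 - cmod x"] by auto
    then show "x \<in> (\<Union>n. cball 0 (1 - inverse (real (Suc n))))" by (intro UN_I[of n]) auto
  next
    fix x :: complex assume "x \<in> (\<Union>n. cball 0 (1 - inverse (real (Suc n))))"
    then obtain n where "cmod x \<le> 1 - inverse (real (Suc n))" by auto
    moreover have "inverse (real (Suc n)) > 0" by simp
    ultimately show "x \<in> ball 0 1" unfolding mem_ball dist_0_norm by linarith
  qed
  then show ?thesis by (simp add: fsigma.intros del: of_nat_Suc)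
qed

text \<open>The kernels over a nonempty open set generate the quotient module under \<open>S\<^sub>z\<close>: a vector
  orthogonal to everything generated has rows that vanish at the uncountably many zeros of the slices.\<close>

lemma zshift_invariant_orth_eig_eq_0:
  assumes p: "no_univariate_factors p" and U: "open U" "U \<noteq> {}" "U \<subseteq> Omega p"
    and inv: "\<And>f. f \<in> N \<Longrightarrow> zshift f \<in> N"
    and orth: "\<And>f z x. f \<in> N \<Longrightarrow> z \<in> U \<Longrightarrow> x \<in> eig p (cnj z) \<Longrightarrow> cinner f x = 0"
    and f: "f \<in> N"
  shows "f = 0"
proof -
  \<comment> \<open>Each a belongs to finitely many z, since p(., a) is a nonzero polynomial. As U
    is uncountable and every slice over it has a zero in the disk, A is uncountable.\<close>
  define A where "A = {a. cmod a < 1 \<and> (\<exists>z\<in>U. poly2 p (z, a) = 0)}"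
  have "uncountable A"
  proof
    assume "countable A"
    have "U \<subseteq> (\<Union>a\<in>A. {z. poly (poly p [:a:]) z = 0})"
      using Omega_root[OF p] U(3) by (fastforce simp: A_def poly_poly_const)
    moreover have "countable (\<Union>a\<in>A. {z. poly (poly p [:a:]) z = 0})"
      using \<open>countable A\<close> by (rule countable_UN) (simp add: countable_finite poly_roots_finite poly_const_nonzero[OF p])
    ultimately have "countable U" by (rule countable_subset)
    obtain x e where "e > 0" "ball x e \<subseteq> U" using U(1,2) open_contains_ball by blast
    then have "countable (ball x e)" using \<open>countable U\<close> countable_subset by blast
    then show False using uncountable_ball[OF \<open>e > 0\<close>] by blast
  qed
  have vanish: "(\<Sum>n. hcoeff g (0, n) * a ^ n) = 0" if g: "g \<in> N" and a: "a \<in> A" for g a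
  proof -
    obtain z where z: "z \<in> U" "poly2 p (z, a) = 0" and a1: "cmod a < 1" using a by (auto simp: A_def)
    have z1: "cmod z < 1" using z(1) U(3) Omega_subset by fastforce
    obtain q where q: "slice p z = [:- a, 1:] * q"
      using z(2) by (auto simp: poly_eq_0_iff_dvd dvd_def simp flip: poly_slice)
    have ker: "(\<lambda>n. a ^ n) \<in> ker2 (slice p z)"
      unfolding q ker2_linear_factor_inside[OF a1] by (simp add: ker2_def square_summable_zero)
    then have h2: "square_summable (\<lambda>n. a ^ n)" by (simp add: ker2_def)
    have zero: "(\<Sum>n. frow x z n * a ^ n) = 0" if "x \<in> N" for x
    proof -
      have "eigvec (cnj z) (\<lambda>n. a ^ n) \<in> eig p (cnj z)" using ker z1 by (subst eigenspace_S_z) auto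
      from orth[OF that z(1) this] show ?thesis using cinner_eigvec[of "cnj z" "\<lambda>n. a ^ n" x] z1 h2 by simp
    qed
    have sm: "summable (\<lambda>n. frow x z n * a ^ n)" for x
      by (rule summable_mult_square_summable[OF square_summableI[OF l2b_frow[OF z1]] h2])
    have row: "frow g z n = hcoeff g (0, n) + z * frow (zshift g) z n" for n
    proof -
      have "(\<lambda>m. hcoeff g (m, n) * z ^ m) sums frow g z n" by (rule frow_sums[OF z1])
      then have "(\<lambda>m. hcoeff g (Suc m, n) * z ^ Suc m) sums (frow g z n - hcoeff g (0, n))"
        by (subst sums_Suc_iff) simp
      moreover have "(\<lambda>m. z * (hcoeff (zshift g) (m, n) * z ^ m)) sums (z * frow (zshift g) z n)"
        by (rule sums_mult[OF frow_sums[OF z1]])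
      ultimately have "frow g z n - hcoeff g (0, n) = z * frow (zshift g) z n"
        by (simp add: hcoeff_hshift mult_ac sums_unique2)
      then show ?thesis by (simp add: algebra_simps)
    qed
    \<comment> \<open>This is g(0, a) = g(z, a) - z (zshift g)(z, a). Both terms on the right vanish
      because the powers of a lie in the kernel at z and \<open>N\<close> is invariant.\<close>
    have "(\<Sum>n. hcoeff g (0, n) * a ^ n) = (\<Sum>n. frow g z n * a ^ n - z * (frow (zshift g) z n * a ^ n))"
      by (simp add: row algebra_simps)
    also have "\<dots> = (\<Sum>n. frow g z n * a ^ n) - z * (\<Sum>n. frow (zshift g) z n * a ^ n)"
      using suminf_diff[OF sm[of g] summable_mult[OF sm[of "zshift g"], of z]] suminf_mult[OF sm[of "zshift g"], of z]
      by simp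
    also have "\<dots> = 0" using zero[OF g] zero[OF inv[OF g]] by simp
    finally show ?thesis .
  qed
  have row0: "hcoeff g (0, n) = 0" if g: "g \<in> N" for g n
  proof -
    define \<phi> where "\<phi> a = (\<Sum>n. hcoeff g (0, n) * a ^ n)" for a
    have sums: "(\<lambda>n. hcoeff g (0, n) * a ^ n) sums \<phi> a" if a: "cmod a < 1" for a
    proof -
      have "square_summable (\<lambda>n. a ^ n)"
        by (rule square_summableI[OF l2b_forward[of "\<lambda>_. 0" 0 a]])
          (use a in \<open>auto simp: l2b_def l2n_def L2_set_def\<close>)
      then have "summable (\<lambda>n. hcoeff g (0, n) * a ^ n)"
        by (rule summable_mult_square_summable[OF square_summableI[OF l2b_row]])
      then show ?thesis by (simp add: \<phi>_def summable_sums)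
    qed
    have hol: "\<phi> holomorphic_on ball 0 1"
      by (rule power_series_holomorphic[of _ _ "\<lambda>n. hcoeff g (0, n)"]) (use sums in auto)
    have A: "A \<subseteq> {a\<in>ball 0 1. \<phi> a = 0}" using vanish[OF g] by (auto simp: A_def \<phi>_def)
    have "\<phi> constant_on ball 0 1"
    proof (rule ccontr)
      assume "\<not> \<phi> constant_on ball 0 1"
      then have "countable {a\<in>ball 0 1. \<phi> a = 0}"
        using holomorphic_countable_zeros[OF hol open_ball connected_ball fsigma_ball] by blast
      then show False using A \<open>uncountable A\<close> countable_subset by blast
    qed
    moreover obtain a where "a \<in> A" using \<open>uncountable A\<close> by fastforce
    ultimately have "\<phi> v = 0" if "cmod v < 1" for v
      using A that unfolding constant_on_def by (metis (mono_tags, lifting) dist_0_norm mem_Collect_eq mem_ball subsetD)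
    then show ?thesis
      using sums by (intro powser_eq_0_imp_coeff_eq_0[of "\<lambda>n. hcoeff g (0, n)"]) metis
  qed
  \<comment> \<open>The m-th row of g is the initial row of g after m applications of
    \<open>zshift\<close>.\<close>
  have "hcoeff g (m, n) = 0" if "g \<in> N" for g m n
    using that
  proof (induct m arbitrary: g)
    case (Suc m)
    from Suc(1)[OF inv[OF Suc(2)]] show ?case by (simp add: hcoeff_hshift)
  qed (rule row0)
  then show ?thesis using f by (intro hardy2_eqI) (simp add: hcoeff_zero)
qed

section \<open>Reducibility\<close>

lemma closed_cspan_eig_invariant:
  assumes S: "\<And>y. y \<in> S \<Longrightarrow> \<exists>w. y \<in> eig p w" and f: "f \<in> closed_cspan S"
  shows "zshift f \<in> closed_cspan S"
proof -
  let ?M = "closed_cspan S"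
  have sM: "csubspace ?M" and cM: "closed ?M"
    using closed_csubspace_closed_cspan[of S] by (auto simp: closed_csubspace_def)
  have z0: "zshift 0 = 0" using zshift_diff[of 0 0] by simp
  have "csubspace (zshift -` ?M)"
    by (rule csubspaceI)
       (auto simp: z0 zshift_add zshift_scaleC intro: csubspace_0[OF sM] csubspace_add[OF sM] csubspace_scale[OF sM])
  moreover have "closed (zshift -` ?M)" by (rule closed_vimage[OF cM continuous_on_zshift])
  moreover have "S \<subseteq> zshift -` ?M"
  proof
    fix y assume y: "y \<in> S"
    then obtain w where "y \<in> eig p w" using S by blast
    then have "zshift y = w *\<^sub>C y" by (simp only: eig_iff)
    moreover have "w *\<^sub>C y \<in> ?M" using closed_cspan_superset[of S] y by (intro csubspace_scale[OF sM]) blast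
    ultimately show "y \<in> zshift -` ?M" by simp
  qed
  ultimately have "?M \<subseteq> zshift -` ?M" by (intro closed_cspan_minimal) (auto simp: closed_csubspace_def)
  then show ?thesis using f by blast
qed

text \<open>The source of strictness: eigenvectors, whatever their eigenvalues, span an invariant
  subspace, and an invariant subspace orthogonal to all kernels over one component is zero.\<close>

lemma eigenvectors_orth_component_eq_0:
  assumes p: "no_univariate_factors p" and C: "C \<in> components (cnj ` Omega p)"
    and S: "\<And>y. y \<in> S \<Longrightarrow> \<exists>w. y \<in> eig p w"
    and orth: "\<And>y w x. y \<in> S \<Longrightarrow> w \<in> C \<Longrightarrow> x \<in> eig p w \<Longrightarrow> cinner y x = 0"
    and y: "y \<in> S"
  shows "y = 0"
proof (rule zshift_invariant_orth_eig_eq_0[OF p, of "cnj ` C" "closed_cspan S"])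
  have "cnj ` C = cnj -` C"
  proof (intro set_eqI)
    fix w show "w \<in> cnj ` C \<longleftrightarrow> w \<in> cnj -` C" by (simp only: mem_cnj_image vimage_eq)
  qed
  moreover have "open (cnj -` C)"
    by (rule open_vimage[OF open_components[OF open_cnj_Omega[OF p] C]]) (intro continuous_intros)
  ultimately show "open (cnj ` C)" by simp
  show "cnj ` C \<noteq> {}" using in_components_nonempty[OF C] by simp
  show "cnj ` C \<subseteq> Omega p" using in_components_subset[OF components_cnj_imageD[OF C]] .
  show "zshift f \<in> closed_cspan S" if "f \<in> closed_cspan S" for f
    by (rule closed_cspan_eig_invariant[OF S that])
  show "cinner f x = 0" if f: "f \<in> closed_cspan S" and z: "z \<in> cnj ` C" and x: "x \<in> eig p (cnj z)" for f z x
  proof -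
    have "S \<subseteq> orth_compl {x}" using orth[OF _ _ x] z by (auto simp: orth_compl_def)
    then have "closed_cspan S \<subseteq> orth_compl {x}" by (intro closed_cspan_minimal closed_csubspace_orth_compl)
    then show ?thesis using f by (auto simp: orth_compl_def)
  qed
  show "y \<in> closed_cspan S" using y closed_cspan_superset by blast
qed

section \<open>From bundle decompositions to reducing subspaces\<close>

lemma fibre_kernel_bundle: "w \<in> C \<Longrightarrow> fibre (kernel_bundle K T C) w = eigenspace K T w"
  by (auto simp: kernel_bundle_def)

lemma bundle_decompositionD:
  assumes BD: "bundle_decomposition K T W E1 E2"
  shows "C \<in> components W \<Longrightarrow> E1 C \<subseteq> kernel_bundle K T C"
    and "C \<in> components W \<Longrightarrow> E2 C \<subseteq> kernel_bundle K T C"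
    and "\<exists>C\<in>components W. E1 C \<noteq> C \<times> {0}" and "\<exists>C\<in>components W. E2 C \<noteq> C \<times> {0}"
    and "C \<in> components W \<Longrightarrow> w \<in> C \<Longrightarrow> 0 \<in> fibre (E1 C) w \<and> 0 \<in> fibre (E2 C) w"
    and "C \<in> components W \<Longrightarrow> w \<in> C \<Longrightarrow> x \<in> eigenspace K T w \<Longrightarrow>
      \<exists>a\<in>fibre (E1 C) w. \<exists>b\<in>fibre (E2 C) w. x = a + b"
    and "C \<in> components W \<Longrightarrow> w \<in> C \<Longrightarrow> a \<in> fibre (E1 C) w \<Longrightarrow>
      C' \<in> components W \<Longrightarrow> w' \<in> C' \<Longrightarrow> b \<in> fibre (E2 C') w' \<Longrightarrow> cinner a b = 0"
proof -
  note BD' = BD[unfolded bundle_decomposition_def]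
  note A = BD'[THEN conjunct1] and B = BD'[THEN conjunct2, THEN conjunct1]
    and O = BD'[THEN conjunct2, THEN conjunct2]
  note A1 = bspec[OF A insertI1] and A2 = bspec[OF A insertI2[OF singletonI]]
  show "E1 C \<subseteq> kernel_bundle K T C" if "C \<in> components W"
    using bspec[OF A1[THEN conjunct1] that] unfolding holomorphic_subbundle_def by blast
  show "E2 C \<subseteq> kernel_bundle K T C" if "C \<in> components W"
    using bspec[OF A2[THEN conjunct1] that] unfolding holomorphic_subbundle_def by blast
  show "\<exists>C\<in>components W. E1 C \<noteq> C \<times> {0}" by (rule A1[THEN conjunct2, THEN conjunct1])
  show "\<exists>C\<in>components W. E2 C \<noteq> C \<times> {0}" by (rule A2[THEN conjunct2, THEN conjunct1])
  show "0 \<in> fibre (E1 C) w \<and> 0 \<in> fibre (E2 C) w" if "C \<in> components W" "w \<in> C"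
    using bspec[OF bspec[OF B that(1)] that(2)] by blast
  show "\<exists>a\<in>fibre (E1 C) w. \<exists>b\<in>fibre (E2 C) w. x = a + b"
    if "C \<in> components W" "w \<in> C" "x \<in> eigenspace K T w"
  proof -
    have "x \<in> {x + y | x y. x \<in> fibre (E1 C) w \<and> y \<in> fibre (E2 C) w}"
      unfolding bspec[OF bspec[OF B that(1)] that(2), THEN conjunct2] fibre_kernel_bundle[OF that(2)] by (rule that(3))
    then show ?thesis by blast
  qed
  show "cinner a b = 0" if *: "C \<in> components W" "w \<in> C" "a \<in> fibre (E1 C) w"
    "C' \<in> components W" "w' \<in> C'" "b \<in> fibre (E2 C') w'"
  proof -
    have "a \<in> (\<Union>w\<in>C. fibre (E1 C) w)" "b \<in> (\<Union>w\<in>C'. fibre (E2 C') w)" using * by blast+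
    note m = this[THEN subsetD[OF closed_cspan_superset]]
    show ?thesis by (rule bspec[OF bspec[OF bspec[OF bspec[OF O *(1)] *(4)] m(1)] m(2)])
  qed
qed

lemma subbundle_trivial_iff:
  assumes "E \<subseteq> kernel_bundle K T C" "\<And>w. w \<in> C \<Longrightarrow> 0 \<in> fibre E w"
  shows "E = C \<times> {0} \<longleftrightarrow> (\<forall>w\<in>C. \<forall>y\<in>fibre E w. y = 0)"
proof
  show "\<forall>w\<in>C. \<forall>y\<in>fibre E w. y = 0" if "E = C \<times> {0}" unfolding that by simp
  assume triv: "\<forall>w\<in>C. \<forall>y\<in>fibre E w. y = 0"
  show "E = C \<times> {0}"
  proof
    show "E \<subseteq> C \<times> {0}"
    proof
      fix v assume v: "v \<in> E"
      obtain w y where wy: "v = (w, y)" by (cases v)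
      have "w \<in> C" using assms(1) v unfolding kernel_bundle_def wy by (rule subsetD[THEN SigmaD1])
      then show "v \<in> C \<times> {0}" using triv v by (simp add: wy)
    qed
    show "C \<times> {0} \<subseteq> E" using assms(2) by auto
  qed
qed

definition all_fibres :: "complex set set \<Rightarrow> (complex set \<Rightarrow> (complex \<times> 'a) set) \<Rightarrow> 'a set"
  where "all_fibres \<C> E = (\<Union>C\<in>\<C>. \<Union>w\<in>C. fibre (E C) w)"

lemma all_fibres_iff: "y \<in> all_fibres \<C> E \<longleftrightarrow> (\<exists>C\<in>\<C>. \<exists>w\<in>C. y \<in> fibre (E C) w)"
  by (auto simp: all_fibres_def)

lemma all_fibres_eigenvector:
  assumes sub: "\<And>C. C \<in> \<C> \<Longrightarrow> E C \<subseteq> kernel_bundle K T C" and y: "y \<in> all_fibres \<C> E"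
  shows "\<exists>w. y \<in> eigenspace K T w"
proof -
  obtain C w where C: "C \<in> \<C>" "w \<in> C" "y \<in> fibre (E C) w" using y unfolding all_fibres_iff by blast
  then show ?thesis using sub[OF C(1)] unfolding kernel_bundle_def by blast
qed

lemma all_fibres_nonzero:
  assumes sub: "\<And>C. C \<in> \<C> \<Longrightarrow> E C \<subseteq> kernel_bundle K T C"
    and zero: "\<And>C w. C \<in> \<C> \<Longrightarrow> w \<in> C \<Longrightarrow> 0 \<in> fibre (E C) w"
    and ex: "\<exists>C\<in>\<C>. E C \<noteq> C \<times> {0}"
  shows "\<exists>y\<in>all_fibres \<C> E. y \<noteq> 0"
proof -
  obtain C where C: "C \<in> \<C>" "E C \<noteq> C \<times> {0}" using ex by blast
  then obtain w y where y: "w \<in> C" "y \<in> fibre (E C) w" "y \<noteq> 0"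
    using subbundle_trivial_iff[OF sub[OF C(1)] zero[OF C(1)]] by blast
  have "y \<in> all_fibres \<C> E" unfolding all_fibres_iff by (rule bexI[OF _ C(1)], rule bexI[OF _ y(1)], rule y(2))
  then show ?thesis by (intro bexI[of _ y] y(3))
qed

text \<open>If \<open>E1\<close> is zero over C, then \<open>E2\<close> fills the kernels there, so
  every fibre of \<open>E1\<close> is orthogonal to the kernels over C and \<open>E1\<close>
  vanishes everywhere. If \<open>E1\<close> fills the kernels over C, the same argument makes
  \<open>E2\<close> vanish.\<close>

lemma bundle_decomposition_strict:
  assumes p: "no_univariate_factors p"
    and BD: "bundle_decomposition (quotient_module p) (S_z_adj p) (cnj ` Omega p) E1 E2"
    and C: "C \<in> components (cnj ` Omega p)"
  shows "E1 C \<noteq> C \<times> {0} \<and> E1 C \<noteq> kernel_bundle (quotient_module p) (S_z_adj p) C"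
proof (intro conjI notI)
  note D = bundle_decompositionD[OF BD]
  let ?S = "all_fibres (components (cnj ` Omega p))"
  have S1: "\<exists>w. y \<in> eig p w" if "y \<in> ?S E1" for y by (rule all_fibres_eigenvector[OF D(1) that])
  have S2: "\<exists>w. y \<in> eig p w" if "y \<in> ?S E2" for y by (rule all_fibres_eigenvector[OF D(2) that])
  {
    assume eq: "E1 C = C \<times> {0}"
    have "cinner y x = 0" if y: "y \<in> ?S E1" and w: "w \<in> C" and x: "x \<in> eig p w" for y w x
    proof -
      obtain C' w' where y': "C' \<in> components (cnj ` Omega p)" "w' \<in> C'" "y \<in> fibre (E1 C') w'"
        using y unfolding all_fibres_iff by blast
      obtain a b where ab: "a \<in> fibre (E1 C) w" "b \<in> fibre (E2 C) w" "x = a + b" using D(6)[OF C w x] by blast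
      have "a = 0" using ab(1) by (simp add: eq)
      then show ?thesis using D(7)[OF y' C w ab(2)] ab(3) by simp
    qed
    then have "y = 0" if "y \<in> ?S E1" for y using eigenvectors_orth_component_eq_0[OF p C S1 _ that] by blast
    then show False using all_fibres_nonzero[OF D(1) D(5)[THEN conjunct1] D(3)] by blast
  next
    assume eq: "E1 C = kernel_bundle (quotient_module p) (S_z_adj p) C"
    have "cinner y x = 0" if y: "y \<in> ?S E2" and w: "w \<in> C" and x: "x \<in> eig p w" for y w x
    proof -
      obtain C' w' where y': "C' \<in> components (cnj ` Omega p)" "w' \<in> C'" "y \<in> fibre (E2 C') w'"
        using y unfolding all_fibres_iff by blast
      have "x \<in> fibre (E1 C) w" unfolding eq fibre_kernel_bundle[OF w] by (rule x)
      then have "cinner x y = 0" by (rule D(7)[OF C w _ y'])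
      then show ?thesis by (subst cinner_eq_0_commute)
    qed
    then have "y = 0" if "y \<in> ?S E2" for y using eigenvectors_orth_component_eq_0[OF p C S2 _ that] by blast
    then show False using all_fibres_nonzero[OF D(2) D(5)[THEN conjunct2] D(4)] by blast
  }
qed

text \<open>Invariance of \<open>M\<close> under S_z: the part u of \<open>S_z p x\<close>
  orthogonal to \<open>M\<close> is tested against an eigenvector a + b split along the
  decomposition. It is orthogonal to a by construction, and to b because the adjoint maps b to a
  multiple of b and b is orthogonal to \<open>M\<close>. Totality gives u = 0.\<close>

lemma bundle_decomposition_imp_reducible_op:
  assumes p: "no_univariate_factors p"
    and BD: "bundle_decomposition (quotient_module p) (S_z_adj p) (cnj ` Omega p) E1 E2"
  shows "reducible_op (quotient_module p) (S_z p)"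
proof -
  let ?K = "quotient_module p"
  note D = bundle_decompositionD[OF BD]
  define S1 where "S1 = all_fibres (components (cnj ` Omega p)) E1"
  define S2 where "S2 = all_fibres (components (cnj ` Omega p)) E2"
  define M where "M = closed_cspan S1"
  have S1: "\<exists>w. y \<in> eig p w" if "y \<in> S1" for y by (rule all_fibres_eigenvector[OF D(1) that[unfolded S1_def]])
  have S2: "\<exists>w. y \<in> eig p w" if "y \<in> S2" for y by (rule all_fibres_eigenvector[OF D(2) that[unfolded S2_def]])
  have S1K: "S1 \<subseteq> ?K"
  proof
    fix y assume "y \<in> S1"
    then obtain w where "y \<in> eig p w" using S1 by blast
    then show "y \<in> ?K" by (simp only: eig_iff)
  qed
  have S2K: "S2 \<subseteq> ?K"
  proof
    fix y assume "y \<in> S2"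
    then obtain w where "y \<in> eig p w" using S2 by blast
    then show "y \<in> ?K" by (simp only: eig_iff)
  qed
  have clM: "closed_csubspace M" unfolding M_def by (rule closed_csubspace_closed_cspan)
  have sM: "csubspace M" using clM by (simp add: closed_csubspace_def)
  have S1M: "S1 \<subseteq> M" unfolding M_def by (rule closed_cspan_superset)
  have MK: "M \<subseteq> ?K" unfolding M_def by (rule closed_cspan_minimal[OF closed_csubspace_quotient S1K])
  have "S1 \<subseteq> orth_compl S2"
    unfolding orth_compl_def S1_def S2_def all_fibres_def using D(7) by blast
  then have "M \<subseteq> orth_compl S2" unfolding M_def by (intro closed_cspan_minimal closed_csubspace_orth_compl)
  then have orth: "cinner x y = 0" if "x \<in> M" "y \<in> S2" for x y using that by (auto simp: orth_compl_def)
  have "adjoint_on ?K (S_z p) x \<in> M" if x: "x \<in> M" for x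
  proof -
    have "zshift x \<in> M" unfolding M_def by (rule closed_cspan_eig_invariant[OF S1 x[unfolded M_def]])
    moreover have "adjoint_on ?K (S_z p) x = zshift x" by (rule adjoint_S_z) (use x MK in blast)
    ultimately show ?thesis by simp
  qed
  moreover have "S_z p x \<in> M" if x: "x \<in> M" for x
  proof -
    define u where "u = S_z p x - orth_proj M (S_z p x)"
    have u: "u \<in> orth_compl M" unfolding u_def by (rule orth_proj_diff[OF clM])
    have "orth_proj M (S_z p x) \<in> M" by (rule orth_proj_mem[OF clM])
    then have "u \<in> ?K" unfolding u_def using MK by (intro csubspace_diff[OF csubspace_quotient] S_z_mem) blast
    moreover have "cinner u v = 0" if z: "z \<in> Omega p" and v: "v \<in> eig p (cnj z)" for z v
    proof -
      have "cnj z \<in> cnj ` Omega p" using z by blast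
      then obtain C where C: "C \<in> components (cnj ` Omega p)" "cnj z \<in> C"
        using Union_components[of "cnj ` Omega p"] by blast
      obtain a b where ab: "a \<in> fibre (E1 C) (cnj z)" "b \<in> fibre (E2 C) (cnj z)" "v = a + b"
        using D(6)[OF C v] by blast
      have "a \<in> M" using S1M ab(1) C unfolding S1_def all_fibres_def by blast
      then have "cinner u a = 0" using u by (auto simp: orth_compl_def)
      moreover have "cinner u b = 0"
      proof -
        have b: "b \<in> S2" using ab(2) C unfolding S2_def all_fibres_def by blast
        have "b \<in> fibre (kernel_bundle ?K (S_z_adj p) C) (cnj z)" using ab(2) D(2)[OF C(1)] by blast
        then have "b \<in> eig p (cnj z)" unfolding fibre_kernel_bundle[OF C(2)] .
        then have bK: "b \<in> ?K" and zb: "zshift b = cnj z *\<^sub>C b" by (simp_all only: eig_iff)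
        have "cinner u b = cinner x (zshift b) - cinner (orth_proj M (S_z p x)) b"
          unfolding u_def by (simp add: cinner_diff_left cinner_S_z[OF bK])
        also have "cinner (orth_proj M (S_z p x)) b = 0" by (rule orth[OF orth_proj_mem[OF clM] b])
        also have "cinner x (zshift b) = 0" unfolding zb using orth[OF x b] by (simp add: cinner_scaleC_right)
        finally show ?thesis by simp
      qed
      ultimately show ?thesis by (simp add: ab(3) cinner_add_right)
    qed
    ultimately have "u = 0" by (rule eig_total[OF p])
    then show ?thesis unfolding u_def using orth_proj_mem[OF clM, of "S_z p x"] by simp
  qed
  moreover have "M \<noteq> {0}"
    using all_fibres_nonzero[OF D(1) D(5)[THEN conjunct1] D(3)] S1M unfolding S1_def by blast
  moreover have "M \<noteq> ?K"
  proof
    assume "M = ?K"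
    obtain y where y: "y \<in> S2" "y \<noteq> 0"
      using all_fibres_nonzero[OF D(2) D(5)[THEN conjunct2] D(4)] unfolding S2_def by blast
    have "cinner y y = 0" by (rule orth[OF _ y(1)]) (use y(1) S2K \<open>M = ?K\<close> in blast)
    then show False using y(2) by simp
  qed
  ultimately show ?thesis unfolding reducible_op_def using clM MK by blast
qed

section \<open>From reducing subspaces to holomorphic subbundles\<close>

definition reducing_pair :: "complex poly poly \<Rightarrow> hardy2 set \<Rightarrow> hardy2 set \<Rightarrow> bool"
  where "reducing_pair p M N \<longleftrightarrow> closed_csubspace M \<and> closed_csubspace N \<and>
    M \<subseteq> quotient_module p \<and> N \<subseteq> quotient_module p \<and> (\<forall>x\<in>M. \<forall>y\<in>N. cinner x y = 0) \<and>
    zshift ` M \<subseteq> M \<and> zshift ` N \<subseteq> N \<and>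
    (\<forall>x\<in>quotient_module p. \<exists>a\<in>M. \<exists>b\<in>N. x = a + b \<and> norm a \<le> norm x \<and> norm b \<le> norm x)"

text \<open>Invariance of \<open>M\<close> under S_z is passed on as invariance of its complement
  \<open>N\<close> under the adjoint. A reducing pair thus mentions only \<open>zshift\<close> and
  is symmetric, so whatever is shown for \<open>M\<close> holds for \<open>N\<close>.\<close>

lemma reducible_op_imp_reducing_pair:
  assumes red: "reducible_op (quotient_module p) (S_z p)"
  shows "\<exists>M N. reducing_pair p M N \<and> M \<noteq> {0} \<and> N \<noteq> {0}"
proof -
  let ?K = "quotient_module p"
  obtain M where clM: "closed_csubspace M" and MK: "M \<subseteq> ?K" and M0: "M \<noteq> {0}" and M1: "M \<noteq> ?K"
    and inv: "S_z p ` M \<subseteq> M" and inv': "adjoint_on ?K (S_z p) ` M \<subseteq> M"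
    using red unfolding reducible_op_def by (elim exE conjE) (rule that)
  have sM: "csubspace M" using clM by (simp add: closed_csubspace_def)
  have sO: "csubspace (orth_compl M)" using closed_csubspace_orth_compl by (auto simp: closed_csubspace_def)
  define N where "N = ?K \<inter> orth_compl M"
  have split: "\<exists>a\<in>M. \<exists>b\<in>N. x = a + b \<and> norm a \<le> norm x \<and> norm b \<le> norm x" if x: "x \<in> ?K" for x
  proof -
    have a: "orth_proj M x \<in> M" "x - orth_proj M x \<in> orth_compl M" "norm (orth_proj M x) \<le> norm x"
      by (rule orth_proj_mem[OF clM] orth_proj_diff[OF clM] norm_orth_proj_le[OF clM])+
    \<comment> \<open>Identifies \<open>x - orth_proj M x\<close> as the projection onto the
      orthogonal complement, for the sake of its norm bound.\<close>
    have "x - (x - orth_proj M x) \<in> orth_compl (orth_compl M)"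
      using a(1) iffD2[OF subset_orth_compl_commute subset_refl, of M] by auto
    then have "orth_proj (orth_compl M) x = x - orth_proj M x" by (intro orth_proj_eqI[OF sO] a(2))
    then have "norm (x - orth_proj M x) \<le> norm x"
      using norm_orth_proj_le[OF closed_csubspace_orth_compl, of M x] by simp
    moreover have "x - orth_proj M x \<in> N"
      unfolding N_def using x a MK by (intro IntI csubspace_diff[OF csubspace_quotient]) auto
    moreover have "x = orth_proj M x + (x - orth_proj M x)" by simp
    ultimately show ?thesis using a(1,3) by (intro bexI[of _ "orth_proj M x"] bexI[of _ "x - orth_proj M x"] conjI)
  qed
  have "reducing_pair p M N"
    unfolding reducing_pair_def
  proof (intro conjI)
    show "closed_csubspace M" "M \<subseteq> ?K" by (rule clM MK)+
    show "N \<subseteq> ?K" by (simp add: N_def)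
    show "closed_csubspace N"
      using closed_csubspace_quotient[of p] closed_csubspace_orth_compl[of M]
      unfolding N_def closed_csubspace_def by (simp add: closed_Int complex_vector.subspace_inter)
    show "\<forall>x\<in>M. \<forall>y\<in>N. cinner x y = 0"
    proof (intro ballI)
      fix x y assume "x \<in> M" "y \<in> N"
      then have "cinner y x = 0" by (auto simp: N_def orth_compl_def)
      then show "cinner x y = 0" by (subst cinner_eq_0_commute)
    qed
    then have NM: "cinner x y = 0" if "x \<in> M" "y \<in> N" for x y using that by blast
    show "zshift ` M \<subseteq> M"
    proof
      fix f assume "f \<in> zshift ` M"
      then obtain x where x: "x \<in> M" "f = zshift x" by blast
      have "f = adjoint_on ?K (S_z p) x" unfolding x(2) by (rule adjoint_S_z[symmetric]) (use x MK in blast)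
      then show "f \<in> M" using inv' x(1) by blast
    qed
    show "zshift ` N \<subseteq> N"
    proof
      fix f assume "f \<in> zshift ` N"
      then obtain y where y: "y \<in> N" "f = zshift y" by blast
      have yK: "y \<in> ?K" using y(1) by (simp add: N_def)
      have "cinner f x = 0" if x: "x \<in> M" for x
      proof -
        have "S_z p x \<in> M" using x inv by blast
        then have "cinner x f = 0" using NM[OF _ y(1)] cinner_S_z[OF yK, of x] y(2) by simp
        then show ?thesis by (subst cinner_eq_0_commute)
      qed
      then show "f \<in> N" using zshift_quotient[OF yK] y(2) by (auto simp: N_def orth_compl_def)
    qed
    show "\<forall>x\<in>?K. \<exists>a\<in>M. \<exists>b\<in>N. x = a + b \<and> norm a \<le> norm x \<and> norm b \<le> norm x" by (intro ballI split)
  qed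
  moreover have "N \<noteq> {0}"
  proof
    assume N: "N = {0}"
    have "?K \<subseteq> M"
    proof
      fix x assume "x \<in> ?K"
      from split[OF this] obtain a b where "a \<in> M" "b \<in> N" "x = a + b" by blast
      then show "x \<in> M" using N by simp
    qed
    then show False using MK M1 by blast
  qed
  ultimately show ?thesis using M0 by blast
qed

text \<open>The disk has half the radius 1 / C, so that the differentiated series is dominated by a
  convergent one and the series may be differentiated termwise.\<close>

lemma vholomorphic_power_series:
  fixes x :: "nat \<Rightarrow> 'a::complex_hilbert"
  assumes C: "C > 0" and x: "\<And>k. norm (x k) \<le> B * C ^ k"
  shows "\<exists>s. (\<forall>w\<in>ball w0 (1 / (2 * C)). (\<lambda>k. (w - w0) ^ k *\<^sub>C x k) sums s w) \<and> vholomorphic_on s (ball w0 (1 / (2 * C)))"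
proof -
  let ?S = "ball w0 (1 / (2 * C))"
  define a where "a w n = (of_nat n * (w - w0) ^ (n - 1)) *\<^sub>C x n" for w n
  \<comment> \<open>Majorant of the n-th differentiated term: |w - w0| C < 1 / 2 contributes n - 1
    factors, and the remaining \<open>C\<close> stays in the constant.\<close>
  define M where "M n = real n * (1 / 2) ^ (n - 1) * (B * C)" for n
  have "summable (\<lambda>n. M (Suc n))"
    using geometric_deriv_sums[of "1 / 2 :: real"] unfolding M_def
    by (intro summable_mult2) (simp add: sums_iff del: of_nat_Suc)
  then have smM: "summable M" by (simp only: summable_Suc_iff)
  have a_le: "norm (a w n) \<le> M n" if w: "w \<in> ?S" for w n
  proof (cases n)
    case (Suc k)
    have "cmod (w - w0) \<le> 1 / (2 * C)" using w by (simp add: dist_norm norm_minus_commute)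
    then have pk: "cmod (w - w0) ^ k \<le> (1 / (2 * C)) ^ k" by (intro power_mono) auto
    have "norm (of_nat n * (w - w0) ^ (n - 1) :: complex) \<le> real n * (1 / (2 * C)) ^ k"
      unfolding norm_mult norm_power norm_of_nat using pk Suc by (intro mult_left_mono) auto
    then have "norm (a w n) \<le> real n * (1 / (2 * C)) ^ k * (B * C ^ n)"
      unfolding a_def norm_scaleC using C
      by (intro mult_mono x mult_nonneg_nonneg zero_le_power) auto
    also have "\<dots> = M n" using Suc C by (simp add: M_def power_divide power_mult_distrib)
    finally show ?thesis .
  qed (simp add: a_def M_def)
  have sma: "summable (\<lambda>n. norm (a w n))" if "w \<in> ?S" for w
    by (rule summable_comparison_test'[OF smM]) (use a_le[OF that] in auto)
  define d where "d w = (\<Sum>n. a w n)" for w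
  have "\<exists>g. \<forall>w\<in>?S. (\<lambda>n. (w - w0) ^ n *\<^sub>C x n) sums g w \<and> (g has_derivative (\<lambda>h. h *\<^sub>C d w)) (at w within ?S)"
  proof (rule has_derivative_series[where f' = "\<lambda>n w h. h *\<^sub>C a w n"])
    fix n w assume "w \<in> ?S"
    have "((\<lambda>w. (w - w0) ^ n) has_field_derivative of_nat n * (w - w0) ^ (n - 1)) (at w within ?S)"
      by (auto intro!: derivative_eq_intros)
    then have "((\<lambda>w. (w - w0) ^ n) has_derivative (\<lambda>h. (of_nat n * (w - w0) ^ (n - 1)) * h)) (at w within ?S)"
      by (simp add: has_field_derivative_def)
    from bounded_linear.has_derivative[OF bounded_bilinear.bounded_linear_left[OF bounded_bilinear_scaleC] this, of "x n"]
    show "((\<lambda>w. (w - w0) ^ n *\<^sub>C x n) has_derivative (\<lambda>h. h *\<^sub>C a w n)) (at w within ?S)"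
      by (simp add: a_def scaleC_scaleC mult.commute)
  next
    fix e :: real assume e: "e > 0"
    obtain N where N: "\<And>n. n \<ge> N \<Longrightarrow> norm (\<Sum>i. M (i + n)) < e" using suminf_exist_split[OF e smM] by blast
    have "norm ((\<Sum>i<n. h *\<^sub>C a w i) - h *\<^sub>C d w) \<le> e * norm h" if n: "n \<ge> N" and w: "w \<in> ?S" for n w h
    proof -
      have "(\<Sum>i<n. h *\<^sub>C a w i) - h *\<^sub>C d w = - (h *\<^sub>C (d w - (\<Sum>i<n. a w i)))"
        by (simp add: complex_vector.scale_right_diff_distrib complex_vector.scale_sum_right)
      also have "d w - (\<Sum>i<n. a w i) = (\<Sum>i. a w (i + n))"
        unfolding d_def using suminf_minus_initial_segment[OF summable_norm_cancel[OF sma[OF w]], of n] by simp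
      also have "norm (- (h *\<^sub>C (\<Sum>i. a w (i + n)))) \<le> norm h * (\<Sum>i. M (i + n))"
        unfolding norm_minus_cancel norm_scaleC
        using smM a_le[OF w] by (intro mult_left_mono norm_suminf_le) (auto simp: summable_iff_shift)
      also have "\<dots> \<le> norm h * e" using N[OF n] by (intro mult_left_mono) (auto simp: abs_less_iff)
      finally show ?thesis by (simp add: mult.commute)
    qed
    then show "\<forall>\<^sub>F n in sequentially. \<forall>w\<in>?S. \<forall>h. norm ((\<Sum>i<n. h *\<^sub>C a w i) - h *\<^sub>C d w) \<le> e * norm h"
      unfolding eventually_sequentially by blast
  next
    show "w0 \<in> ?S" using C by simp
    have "(\<lambda>n. (w0 - w0) ^ n *\<^sub>C x n) = (\<lambda>n. if n = 0 then x n else 0)" by (auto simp: fun_eq_iff)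
    then show "(\<lambda>n. (w0 - w0) ^ n *\<^sub>C x n) sums x 0" using sums_single[of 0 x] by simp
  qed simp
  then show ?thesis unfolding vholomorphic_on_def by blast
qed

lemma reducing_pairD:
  assumes "reducing_pair p M N"
  shows "closed_csubspace M" "closed_csubspace N" "M \<subseteq> quotient_module p" "N \<subseteq> quotient_module p"
    "x \<in> M \<Longrightarrow> y \<in> N \<Longrightarrow> cinner x y = 0" "zshift ` M \<subseteq> M" "zshift ` N \<subseteq> N"
    "u \<in> quotient_module p \<Longrightarrow> \<exists>a\<in>M. \<exists>b\<in>N. u = a + b \<and> norm a \<le> norm u \<and> norm b \<le> norm u"
proof -
  note D = assms[unfolded reducing_pair_def]
  note D' = D[THEN conjunct2, THEN conjunct2]
  note D'' = D'[THEN conjunct2, THEN conjunct2]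
  note D3 = D''[THEN conjunct2, THEN conjunct2]
  show "closed_csubspace M" "closed_csubspace N" "M \<subseteq> quotient_module p" "N \<subseteq> quotient_module p"
    "zshift ` M \<subseteq> M" "zshift ` N \<subseteq> N"
    by (rule D[THEN conjunct1] D[THEN conjunct2, THEN conjunct1] D'[THEN conjunct1]
      D'[THEN conjunct2, THEN conjunct1] D''[THEN conjunct2, THEN conjunct1] D3[THEN conjunct1])+
  show "cinner x y = 0" if "x \<in> M" "y \<in> N"
    using D''[THEN conjunct1] that by blast
  show "\<exists>a\<in>M. \<exists>b\<in>N. u = a + b \<and> norm a \<le> norm u \<and> norm b \<le> norm u" if "u \<in> quotient_module p"
    by (rule bspec[OF D3[THEN conjunct2] that])
qed

lemma reducing_pair_sym:
  assumes rp: "reducing_pair p M N"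
  shows "reducing_pair p N M"
  unfolding reducing_pair_def
proof (intro conjI)
  note D = reducing_pairD[OF rp]
  show "closed_csubspace N" "closed_csubspace M" "N \<subseteq> quotient_module p" "M \<subseteq> quotient_module p"
    "zshift ` N \<subseteq> N" "zshift ` M \<subseteq> M" by (rule D)+
  show "\<forall>x\<in>N. \<forall>y\<in>M. cinner x y = 0"
  proof (intro ballI)
    fix x y assume "x \<in> N" "y \<in> M"
    then have "cinner y x = 0" by (intro D(5))
    then show "cinner x y = 0" by (subst cinner_eq_0_commute)
  qed
  show "\<forall>x\<in>quotient_module p. \<exists>a\<in>N. \<exists>b\<in>M. x = a + b \<and> norm a \<le> norm x \<and> norm b \<le> norm x"
  proof
    fix x assume "x \<in> quotient_module p"
    from D(8)[OF this] obtain a b where ab: "a \<in> M" "b \<in> N" "x = a + b" "norm a \<le> norm x" "norm b \<le> norm x"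
      by blast
    moreover have "x = b + a" using ab(3) by (simp only: add.commute)
    ultimately show "\<exists>a\<in>N. \<exists>b\<in>M. x = a + b \<and> norm a \<le> norm x \<and> norm b \<le> norm x" by blast
  qed
qed

lemma reducing_pair_Int:
  assumes "reducing_pair p M N" "x \<in> M" "x \<in> N"
  shows "x = 0"
proof -
  have "cinner x x = 0" using reducing_pairD(5)[OF assms] by blast
  then show ?thesis by simp
qed

text \<open>Applying the adjoint minus w to a + b gives a vector of \<open>M\<close> and a vector of
  \<open>N\<close> with sum 0; since the two subspaces meet only in 0, both parts are
  eigenvectors.\<close>

lemma reducing_pair_split:
  assumes rp: "reducing_pair p M N" and x: "x \<in> eig p w"
  shows "\<exists>a\<in>M \<inter> eig p w. \<exists>b\<in>N \<inter> eig p w. x = a + b"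
proof -
  have xK: "x \<in> quotient_module p" and zx: "zshift x = w *\<^sub>C x" using x by (auto simp: eig_iff)
  obtain a b where ab: "a \<in> M" "b \<in> N" "x = a + b" using reducing_pairD(8)[OF rp xK] by blast
  have sM: "csubspace M" and sN: "csubspace N" using reducing_pairD(1-4)[OF rp] by (auto simp: closed_csubspace_def)
  have eq: "zshift a - w *\<^sub>C a = - (zshift b - w *\<^sub>C b)"
    using zx by (simp add: ab(3) zshift_add scaleC_add_right algebra_simps)
  have aM: "zshift a - w *\<^sub>C a \<in> M"
    using reducing_pairD(6)[OF rp] ab(1) by (intro csubspace_diff[OF sM] csubspace_scale[OF sM]) auto
  have bN: "zshift b - w *\<^sub>C b \<in> N"
    using reducing_pairD(7)[OF rp] ab(2) by (intro csubspace_diff[OF sN] csubspace_scale[OF sN]) auto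
  have "- (zshift b - w *\<^sub>C b) \<in> N" using csubspace_diff[OF sN csubspace_0[OF sN] bN] by simp
  then have "zshift a - w *\<^sub>C a = 0" using reducing_pair_Int[OF rp aM] eq by simp
  moreover from this eq have "zshift b - w *\<^sub>C b = 0" by simp
  moreover have "a \<in> quotient_module p" "b \<in> quotient_module p" using ab(1,2) reducing_pairD(3,4)[OF rp] by blast+
  ultimately have "a \<in> M \<inter> eig p w" "b \<in> N \<inter> eig p w" using ab(1,2) by (auto simp only: eig_iff Int_iff right_minus_eq)
  then show ?thesis using ab(3) by blast
qed

text \<open>The component in \<open>M\<close> of a solution in the whole module solves the same
  equation, because the defect lies in both \<open>M\<close> and \<open>N\<close>. The constant |C|
  + 1 is positive, as the radius 1 / (2 C) of the sections requires.\<close>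

lemma reducing_pair_lift:
  assumes p: "no_univariate_factors p" and rp: "reducing_pair p M N" and w: "w \<in> cnj ` Omega p"
  shows "\<exists>C>0. \<forall>y\<in>M. \<exists>x\<in>M. zshift x - w *\<^sub>C x = y \<and> norm x \<le> C * norm y"
proof -
  obtain C where C: "\<And>y. y \<in> quotient_module p \<Longrightarrow> \<exists>x\<in>quotient_module p. zshift x - w *\<^sub>C x = y \<and> norm x \<le> C * norm y"
    using zshift_lift[OF cnj_Omega(1)[OF p w] slice_nonzero[OF p] cnj_Omega(3)[OF p w]] by blast
  have sM: "csubspace M" and sN: "csubspace N" using reducing_pairD(1-4)[OF rp] by (auto simp: closed_csubspace_def)
  have "\<exists>x\<in>M. zshift x - w *\<^sub>C x = y \<and> norm x \<le> (\<bar>C\<bar> + 1) * norm y" if y: "y \<in> M" for y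
  proof -
    obtain x where x: "x \<in> quotient_module p" "zshift x - w *\<^sub>C x = y" "norm x \<le> C * norm y"
      using C[of y] y reducing_pairD(3)[OF rp] by blast
    obtain a b where ab: "a \<in> M" "b \<in> N" "x = a + b" "norm a \<le> norm x"
      using reducing_pairD(8)[OF rp x(1)] by blast
    have eq: "y - (zshift a - w *\<^sub>C a) = zshift b - w *\<^sub>C b"
      using x(2) by (simp add: ab(3) zshift_add scaleC_add_right algebra_simps)
    have "zshift a - w *\<^sub>C a \<in> M"
      using reducing_pairD(6)[OF rp] ab(1) by (intro csubspace_diff[OF sM] csubspace_scale[OF sM]) auto
    then have "y - (zshift a - w *\<^sub>C a) \<in> M" using y csubspace_diff[OF sM] by blast
    moreover have "y - (zshift a - w *\<^sub>C a) \<in> N"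
      unfolding eq using reducing_pairD(7)[OF rp] ab(2) by (intro csubspace_diff[OF sN] csubspace_scale[OF sN]) auto
    ultimately have "y - (zshift a - w *\<^sub>C a) = 0" by (rule reducing_pair_Int[OF rp])
    moreover have "C * norm y \<le> (\<bar>C\<bar> + 1) * norm y" by (intro mult_right_mono) auto
    ultimately show ?thesis using ab(1,4) x(3) by (intro bexI[of _ a]) auto
  qed
  then show ?thesis by (intro exI[of _ "\<bar>C\<bar> + 1"]) auto
qed

text \<open>An eigenvector at \<open>w\<^sub>0\<close> extends to the holomorphic section \<open>\<Sum> (w - w\<^sub>0)\<^sup>k R\<^sup>k x\<^sub>0\<close>, where \<open>R\<close>
  is a bounded right inverse of \<open>S\<^sub>z\<^sup>* - w\<^sub>0\<close>.\<close>

lemma holomorphic_section: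
  assumes M: "closed_csubspace M"
    and C: "C > 0" "\<And>y. y \<in> M \<Longrightarrow> \<exists>x\<in>M. zshift x - w0 *\<^sub>C x = y \<and> norm x \<le> C * norm y"
    and x0: "x0 \<in> M" "zshift x0 = w0 *\<^sub>C x0"
  shows "\<exists>s. vholomorphic_on s (ball w0 (1 / (2 * C))) \<and> s w0 = x0 \<and>
    (\<forall>w\<in>ball w0 (1 / (2 * C)). s w \<in> M \<and> zshift (s w) = w *\<^sub>C s w)"
proof -
  have sM: "csubspace M" and cM: "closed M" using M by (auto simp: closed_csubspace_def)
  obtain R where R: "\<And>y. y \<in> M \<Longrightarrow> R y \<in> M" "\<And>y. y \<in> M \<Longrightarrow> zshift (R y) - w0 *\<^sub>C R y = y"
    "\<And>y. y \<in> M \<Longrightarrow> norm (R y) \<le> C * norm y" using C(2) by metis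
  define x where "x k = (R ^^ k) x0" for k
  have xM: "x k \<in> M" for k by (induct k) (auto simp: x_def x0 R(1))
  have nx: "norm (x k) \<le> norm x0 * C ^ k" for k
  proof (induct k)
    case (Suc k)
    have "norm (x (Suc k)) \<le> C * norm (x k)" using R(3)[OF xM] by (simp add: x_def)
    also have "\<dots> \<le> C * (norm x0 * C ^ k)" using Suc C(1) by (intro mult_left_mono) auto
    finally show ?case by (simp add: mult_ac)
  qed (simp add: x_def)
  have xS: "zshift (x (Suc k)) = w0 *\<^sub>C x (Suc k) + x k" for k
    using R(2)[OF xM, of k] by (simp add: x_def algebra_simps)
  obtain s where s: "\<And>w. w \<in> ball w0 (1 / (2 * C)) \<Longrightarrow> (\<lambda>k. (w - w0) ^ k *\<^sub>C x k) sums s w"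
    and hol: "vholomorphic_on s (ball w0 (1 / (2 * C)))"
    using vholomorphic_power_series[OF C(1) nx, of w0] by blast
  have "s w0 = x0"
  proof -
    have "(\<lambda>n. (w0 - w0) ^ n *\<^sub>C x n) = (\<lambda>n. if n = 0 then x n else 0)" by (auto simp: fun_eq_iff)
    then have "(\<lambda>n. (w0 - w0) ^ n *\<^sub>C x n) sums x 0" using sums_single[of 0 x] by simp
    moreover have "x 0 = x0" by (simp add: x_def)
    ultimately show ?thesis using s[of w0] C(1) sums_unique2 by force
  qed
  moreover have "s w \<in> M \<and> zshift (s w) = w *\<^sub>C s w" if w: "w \<in> ball w0 (1 / (2 * C))" for w
  proof
    show "s w \<in> M"
    proof (rule closed_sequentially[OF cM])
      show "(\<lambda>n. \<Sum>k<n. (w - w0) ^ k *\<^sub>C x k) \<longlonglongrightarrow> s w" using s[OF w] by (simp add: sums_def)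
      show "(\<Sum>k<n. (w - w0) ^ k *\<^sub>C x k) \<in> M" for n
        by (induct n) (auto intro: csubspace_0[OF sM] csubspace_add[OF sM] csubspace_scale[OF sM] xM)
    qed
    have "(\<lambda>k. (w - w0) ^ Suc k *\<^sub>C x k) sums ((w - w0) *\<^sub>C s w)"
      using bounded_linear.sums[OF bounded_bilinear.bounded_linear_right[OF bounded_bilinear_scaleC] s[OF w], of "w - w0"]
      by (simp add: scaleC_scaleC)
    \<comment> \<open>The series of \<open>(w - w0) *\<^sub>C s w\<close> with indices moved up by
      one and 0 at index 0, so that it can be added termwise to the series of
      \<open>w0 *\<^sub>C s w\<close>.\<close>
    moreover define y where "y k = (if k = 0 then 0 else (w - w0) ^ k *\<^sub>C x (k - 1))" for k
    ultimately have "(\<lambda>k. y (Suc k)) sums ((w - w0) *\<^sub>C s w)" by simp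
    moreover have "y 0 = 0" by (simp add: y_def)
    ultimately have "y sums ((w - w0) *\<^sub>C s w)" using sums_Suc[of y "(w - w0) *\<^sub>C s w"] by simp
    moreover have "(\<lambda>k. w0 *\<^sub>C ((w - w0) ^ k *\<^sub>C x k)) sums (w0 *\<^sub>C s w)"
      by (rule bounded_linear.sums[OF bounded_bilinear.bounded_linear_right[OF bounded_bilinear_scaleC] s[OF w]])
    ultimately have "(\<lambda>k. w0 *\<^sub>C ((w - w0) ^ k *\<^sub>C x k) + y k) sums (w0 *\<^sub>C s w + (w - w0) *\<^sub>C s w)"
      by (rule sums_add[rotated])
    moreover have "w0 *\<^sub>C ((w - w0) ^ k *\<^sub>C x k) + y k = zshift ((w - w0) ^ k *\<^sub>C x k)" for k
    proof (cases k)
      case 0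
      then show ?thesis using x0 by (simp add: y_def x_def)
    next
      case (Suc j)
      then show ?thesis by (simp add: y_def zshift_scaleC xS scaleC_add_right scaleC_scaleC mult.commute)
    qed
    moreover have "w0 *\<^sub>C s w + (w - w0) *\<^sub>C s w = w *\<^sub>C s w" by (simp flip: scaleC_add_left)
    ultimately have "(\<lambda>k. zshift ((w - w0) ^ k *\<^sub>C x k)) sums (w *\<^sub>C s w)" by simp
    moreover have "(\<lambda>k. zshift ((w - w0) ^ k *\<^sub>C x k)) sums zshift (s w)"
      by (rule bounded_linear.sums[OF bounded_linear_zshift s[OF w]])
    ultimately show "zshift (s w) = w *\<^sub>C s w" using sums_unique2 by blast
  qed
  ultimately show ?thesis using hol by blast
qed

text \<open>An orthonormal basis of the fibre at w0 is extended to holomorphic sections. They stay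
  nearly orthonormal, hence independent, close to w0; that they span is known at w0 only and needs a
  count of dimensions elsewhere.\<close>

lemma reducing_pair_sections:
  assumes p: "no_univariate_factors p" and rp: "reducing_pair p M N" and w0: "w0 \<in> cnj ` Omega p"
  shows "\<exists>r :: nat. \<exists>s. \<exists>\<delta>>0. (\<forall>i<r. vholomorphic_on (s i) (ball w0 \<delta>)) \<and>
    cspan ((\<lambda>i. s i w0) ` {..<r}) = M \<inter> eig p w0 \<and>
    (\<forall>w\<in>ball w0 \<delta>. (\<lambda>i. s i w) ` {..<r} \<subseteq> M \<inter> eig p w \<and> inj_on (\<lambda>i. s i w) {..<r} \<and>
      \<not> cdependent ((\<lambda>i. s i w) ` {..<r}))"
proof -
  have M: "closed_csubspace M" and sM: "csubspace M" and MK: "M \<subseteq> quotient_module p"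
    using reducing_pairD(1-4)[OF rp] by (auto simp: closed_csubspace_def)
  obtain C where C: "C > 0" "\<And>y. y \<in> M \<Longrightarrow> \<exists>x\<in>M. zshift x - w0 *\<^sub>C x = y \<and> norm x \<le> C * norm y"
    using reducing_pair_lift[OF p rp w0] by blast
  let ?S = "ball w0 (1 / (2 * C))"
  obtain B where B: "finite B" "cspan B = eig p w0" using eig_basis[OF p cnj_Omega(1)[OF p w0]] by blast
  have V: "csubspace (M \<inter> eig p w0)" using sM csubspace_eig by (rule complex_vector.subspace_inter)
  obtain r :: nat and e where on: "\<And>i j. i < r \<Longrightarrow> j < r \<Longrightarrow> cinner (e i) (e j) = (if i = j then 1 else 0)"
    and e: "cspan (e ` {..<r}) = M \<inter> eig p w0"
  proof (rule orthonormal_basis_exists[OF V, of "card B"])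
    show "card S \<le> card B" if "S \<subseteq> M \<inter> eig p w0" "\<not> cdependent S" for S
      using complex_vector.independent_span_bound[OF B(1) that(2)] that(1) B(2) by blast
  qed blast
  have eV: "e i \<in> M \<inter> eig p w0" if "i < r" for i
    using complex_vector.span_superset[of "e ` {..<r}"] that e by blast
  have "\<exists>s. vholomorphic_on s ?S \<and> s w0 = e i \<and> (\<forall>w\<in>?S. s w \<in> M \<and> zshift (s w) = w *\<^sub>C s w)" if "i < r" for i
    by (rule holomorphic_section[OF M C]) (use eV[OF that] in \<open>auto simp: eig_iff\<close>)
  then obtain s where hol: "\<And>i. i < r \<Longrightarrow> vholomorphic_on (s i) ?S" and s0: "\<And>i. i < r \<Longrightarrow> s i w0 = e i"
    and sE: "\<And>i w. i < r \<Longrightarrow> w \<in> ?S \<Longrightarrow> s i w \<in> M \<and> zshift (s i w) = w *\<^sub>C s i w" by metis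
  have ev: "eventually (\<lambda>w. norm (s i w - e i) * r < 1) (nhds w0)" if i: "i < r" for i
  proof -
    have "w0 \<in> ?S" using C(1) by simp
    then obtain d where "(s i has_derivative (\<lambda>h. h *\<^sub>C d)) (at w0 within ?S)"
      using hol[OF i] unfolding vholomorphic_on_def by blast
    then have "continuous (at w0 within ?S) (s i)" by (rule has_derivative_continuous)
    then have "isCont (s i) w0" using \<open>w0 \<in> ?S\<close> by (simp add: at_within_open[OF _ open_ball])
    then have "isCont (\<lambda>w. norm (s i w - e i) * r) w0" by (intro continuous_intros)
    then have "((\<lambda>w. norm (s i w - e i) * r) \<longlongrightarrow> norm (s i w0 - e i) * r) (nhds w0)"
      unfolding isCont_def by (rule tendsto_at_iff_tendsto_nhds[THEN iffD1])
    then show ?thesis using s0[OF i] by (intro order_tendstoD(2)[of _ "norm (s i w0 - e i) * r"]) auto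
  qed
  have "eventually (\<lambda>w. \<forall>i\<in>{..<r}. norm (s i w - e i) * r < 1) (nhds w0)"
    by (intro eventually_ball_finite) (use ev in auto)
  then obtain d where d: "d > 0" "\<And>w i. dist w w0 < d \<Longrightarrow> i < r \<Longrightarrow> norm (s i w - e i) * r < 1"
    unfolding eventually_nhds_metric by auto
  let ?\<delta> = "min d (1 / (2 * C))"
  have "(\<lambda>i. s i w) ` {..<r} \<subseteq> M \<inter> eig p w \<and> inj_on (\<lambda>i. s i w) {..<r} \<and> \<not> cdependent ((\<lambda>i. s i w) ` {..<r})"
    if w: "w \<in> ball w0 ?\<delta>" for w
  proof
    show "(\<lambda>i. s i w) ` {..<r} \<subseteq> M \<inter> eig p w"
    proof
      fix x assume "x \<in> (\<lambda>i. s i w) ` {..<r}"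
      then obtain i where i: "i < r" "x = s i w" by blast
      have "w \<in> ?S" using w by simp
      then have "s i w \<in> M \<and> zshift (s i w) = w *\<^sub>C s i w" by (rule sE[OF i(1)])
      then show "x \<in> M \<inter> eig p w" using MK i(2) by (auto simp only: eig_iff)
    qed
    show "inj_on (\<lambda>i. s i w) {..<r} \<and> \<not> cdependent ((\<lambda>i. s i w) ` {..<r})"
      by (rule near_orthonormal_independent[OF on]) (use d(2)[of w] w in \<open>auto simp: dist_commute\<close>)
  qed
  moreover have "vholomorphic_on (s i) (ball w0 ?\<delta>)" if i: "i < r" for i
    unfolding vholomorphic_on_def
  proof
    fix w assume w: "w \<in> ball w0 ?\<delta>"
    then have "w \<in> ?S" by simp
    then obtain d where "(s i has_derivative (\<lambda>h. h *\<^sub>C d)) (at w within ?S)"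
      using hol[OF i] unfolding vholomorphic_on_def by blast
    then have "(s i has_derivative (\<lambda>h. h *\<^sub>C d)) (at w within ball w0 ?\<delta>)"
      by (rule has_derivative_subset) auto
    then show "\<exists>d. (s i has_derivative (\<lambda>h. h *\<^sub>C d)) (at w within ball w0 ?\<delta>)" by blast
  qed
  moreover have "(\<lambda>i. s i w0) ` {..<r} = e ` {..<r}" using s0 by (auto simp: image_iff)
  then have "cspan ((\<lambda>i. s i w0) ` {..<r}) = M \<inter> eig p w0" by (simp add: e)
  moreover have "?\<delta> > 0" using d(1) C(1) by simp
  ultimately show ?thesis by blast
qed

section \<open>Local frames of constant rank\<close>

lemma orth_union_independent:
  assumes rp: "reducing_pair p M N" and S: "S \<subseteq> M" "\<not> cdependent S" and S': "S' \<subseteq> N" "\<not> cdependent S'"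
  shows "\<not> cdependent (S \<union> S') \<and> S \<inter> S' = {}"
proof -
  have one: "a \<in> complex_vector.span (A - {a})"
    if rp: "reducing_pair p M N" and A: "A \<subseteq> M" "A' \<subseteq> N" and a: "a \<in> A" "a \<in> cspan (A \<union> A' - {a})"
    for M N A A' :: "hardy2 set" and a
  proof -
    have sM: "csubspace M" and sN: "csubspace N" using reducing_pairD(1-4)[OF rp] by (auto simp: closed_csubspace_def)
    have "a \<in> cspan ((A - {a}) \<union> A')"
      using a(2) complex_vector.span_mono[of "A \<union> A' - {a}" "(A - {a}) \<union> A'"] by blast
    then obtain u v where uv: "u \<in> cspan (A - {a})" "v \<in> cspan A'" "a = u + v"
      unfolding complex_vector.span_Un by blast
    have uM: "u \<in> M" using uv(1) complex_vector.span_minimal[of "A - {a}" M] A sM by blast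
    have vN: "v \<in> N" using uv(2) complex_vector.span_minimal[of A' N] A sN by blast
    have "a - u \<in> M" using a(1) A uM csubspace_diff[OF sM] by blast
    then have "v \<in> M" using uv(3) by simp
    then have "v = 0" using vN reducing_pair_Int[OF rp] by blast
    then show ?thesis using uv by simp
  qed
  have "S \<inter> S' = {}"
  proof (rule ccontr)
    assume "S \<inter> S' \<noteq> {}"
    then obtain x where "x \<in> S" "x \<in> S'" by blast
    then have "x = 0" using S S' reducing_pair_Int[OF rp] by blast
    then show False using \<open>x \<in> S\<close> S(2) complex_vector.dependent_zero by blast
  qed
  moreover have "\<not> cdependent (S \<union> S')"
  proof
    assume "cdependent (S \<union> S')"
    then obtain a where a: "a \<in> S \<union> S'" "a \<in> cspan (S \<union> S' - {a})" unfolding complex_vector.dependent_def by blast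
    show False
    proof (cases "a \<in> S")
      case True
      then have "a \<in> cspan (S - {a})" using one[OF rp S(1) S'(1) True a(2)] by blast
      then show False using S(2) True unfolding complex_vector.dependent_def by blast
    next
      case False
      then have aS': "a \<in> S'" using a(1) by blast
      have "a \<in> cspan (S' \<union> S - {a})" using a(2) by (simp add: Un_commute)
      then have "a \<in> cspan (S' - {a})" using one[OF reducing_pair_sym[OF rp] S'(1) S(1) aS'] by blast
      then show False using S'(2) aS' unfolding complex_vector.dependent_def by blast
    qed
  qed
  ultimately show ?thesis by blast
qed

text \<open>The sections in \<open>M\<close> and those in \<open>N\<close> are together r + r'
  independent eigenvectors. This number is the dimension of the eigenspace at w0, and the dimension
  is constant on the component, so they span each eigenspace nearby. Intersecting with
  \<open>M\<close> leaves the span of the first group.\<close>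

lemma local_frame:
  assumes p: "no_univariate_factors p" and rp: "reducing_pair p M N"
    and D: "D \<in> components (cnj ` Omega p)" and w0: "w0 \<in> D"
  shows "\<exists>r :: nat. \<exists>U s. open U \<and> w0 \<in> U \<and> U \<subseteq> D \<and> (\<forall>i<r. vholomorphic_on (s i) U) \<and>
    (\<forall>w\<in>U. inj_on (\<lambda>i. s i w) {..<r} \<and> \<not> cdependent ((\<lambda>i. s i w) ` {..<r}) \<and>
      cspan ((\<lambda>i. s i w) ` {..<r}) = M \<inter> eig p w)"
proof -
  have DW: "D \<subseteq> cnj ` Omega p" by (rule in_components_subset[OF D])
  have w0W: "w0 \<in> cnj ` Omega p" using w0 DW by blast
  have sM: "csubspace M" and sN: "csubspace N" using reducing_pairD(1-4)[OF rp] by (auto simp: closed_csubspace_def)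
  obtain r :: nat and s \<delta> where sec: "\<delta> > 0 \<and> (\<forall>i<r. vholomorphic_on (s i) (ball w0 \<delta>)) \<and>
    cspan ((\<lambda>i. s i w0) ` {..<r}) = M \<inter> eig p w0 \<and>
    (\<forall>w\<in>ball w0 \<delta>. (\<lambda>i. s i w) ` {..<r} \<subseteq> M \<inter> eig p w \<and> inj_on (\<lambda>i. s i w) {..<r} \<and>
      \<not> cdependent ((\<lambda>i. s i w) ` {..<r}))"
    using reducing_pair_sections[OF p rp w0W] by (elim exE) (rule that)
  obtain r' :: nat and s' \<delta>' where sec': "\<delta>' > 0 \<and> (\<forall>i<r'. vholomorphic_on (s' i) (ball w0 \<delta>')) \<and>
    cspan ((\<lambda>i. s' i w0) ` {..<r'}) = N \<inter> eig p w0 \<and>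
    (\<forall>w\<in>ball w0 \<delta>'. (\<lambda>i. s' i w) ` {..<r'} \<subseteq> N \<inter> eig p w \<and> inj_on (\<lambda>i. s' i w) {..<r'} \<and>
      \<not> cdependent ((\<lambda>i. s' i w) ` {..<r'}))"
    using reducing_pair_sections[OF p reducing_pair_sym[OF rp] w0W] by (elim exE) (rule that)
  note \<delta> = sec[THEN conjunct1] and sp = sec[THEN conjunct2, THEN conjunct2, THEN conjunct1]
    and s = sec[THEN conjunct2, THEN conjunct2, THEN conjunct2, THEN bspec]
    and hol = sec[THEN conjunct2, THEN conjunct1, rule_format]
  note \<delta>' = sec'[THEN conjunct1] and sp' = sec'[THEN conjunct2, THEN conjunct2, THEN conjunct1]
    and s' = sec'[THEN conjunct2, THEN conjunct2, THEN conjunct2, THEN bspec]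
  have "open D" using open_components[OF open_cnj_Omega[OF p] D] .
  then obtain \<epsilon> where \<epsilon>: "\<epsilon> > 0" "ball w0 \<epsilon> \<subseteq> D" using w0 open_contains_ball by blast
  define U where "U = ball w0 (min \<epsilon> (min \<delta> \<delta>'))"
  have U: "open U" "w0 \<in> U" "U \<subseteq> D" "U \<subseteq> ball w0 \<delta>" "U \<subseteq> ball w0 \<delta>'"
    using \<epsilon> \<delta> \<delta>' by (auto simp: U_def)
  let ?A = "\<lambda>w. (\<lambda>i. s i w) ` {..<r}" and ?A' = "\<lambda>w. (\<lambda>i. s' i w) ` {..<r'}"
  have A: "?A w \<subseteq> M \<inter> eig p w" "inj_on (\<lambda>i. s i w) {..<r}" "\<not> cdependent (?A w)" if "w \<in> U" for w
    using s[OF subsetD[OF U(4) that]] by (iprover)+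
  have A': "?A' w \<subseteq> N \<inter> eig p w" "inj_on (\<lambda>i. s' i w) {..<r'}" "\<not> cdependent (?A' w)" if "w \<in> U" for w
    using s'[OF subsetD[OF U(5) that]] by (iprover)+
  have ind: "\<not> cdependent (?A w \<union> ?A' w)" "card (?A w \<union> ?A' w) = r + r'" if w: "w \<in> U" for w
  proof -
    have *: "\<not> cdependent (?A w \<union> ?A' w) \<and> ?A w \<inter> ?A' w = {}"
      using A(1,3)[OF w] A'(1,3)[OF w] by (intro orth_union_independent[OF rp]) auto
    then show "\<not> cdependent (?A w \<union> ?A' w)" by blast
    have "card (?A w \<union> ?A' w) = card (?A w) + card (?A' w)" using * by (intro card_Un_disjoint) auto
    also have "\<dots> = r + r'" using A(2)[OF w] A'(2)[OF w] by (simp add: card_image)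
    finally show "card (?A w \<union> ?A' w) = r + r'" .
  qed
  have cdim: "cdim (eig p w) = r + r'" if w: "w \<in> U" for w
  proof -
    have "cspan (?A w0 \<union> ?A' w0) = eig p w0"
    proof
      show "cspan (?A w0 \<union> ?A' w0) \<subseteq> eig p w0"
        using A(1)[OF U(2)] A'(1)[OF U(2)] by (intro complex_vector.span_minimal csubspace_eig) auto
      show "eig p w0 \<subseteq> cspan (?A w0 \<union> ?A' w0)"
      proof
        fix x assume "x \<in> eig p w0"
        then obtain a b where "a \<in> M \<inter> eig p w0" "b \<in> N \<inter> eig p w0" "x = a + b"
          using reducing_pair_split[OF rp] by blast
        then show "x \<in> cspan (?A w0 \<union> ?A' w0)" unfolding complex_vector.span_Un sp sp' by blast
      qed
    qed
    then have "cspan (?A w0 \<union> ?A' w0) = cspan (eig p w0)" by (metis complex_vector.span_span)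
    then have "cdim (eig p w0) = r + r'"
      using complex_vector.dim_eq_card[OF _ ind(1)[OF U(2)]] ind(2)[OF U(2)] by simp
    moreover have "cdim (eig p w) = cdim (eig p w0)"
    proof -
      have wD: "w \<in> D" using w U(3) by blast
      have "disk_zeros (slice p (cnj w)) = disk_zeros (slice p (cnj w0))"
        by (rule disk_zeros_component[OF p components_cnj_imageD[OF D]]) (use wD w0 in auto)
      moreover have wW: "w \<in> cnj ` Omega p" using wD DW by blast
      ultimately show ?thesis
        using cdim_eig[OF p cnj_Omega(1)[OF p wW]] cdim_eig[OF p cnj_Omega(1)[OF p w0W]] by simp
    qed
    ultimately show ?thesis by simp
  qed
  have span: "cspan (?A w) = M \<inter> eig p w" if w: "w \<in> U" for w
  proof
    show "cspan (?A w) \<subseteq> M \<inter> eig p w"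
      by (intro complex_vector.span_minimal A(1)[OF w] complex_vector.subspace_inter sM csubspace_eig)
    show "M \<inter> eig p w \<subseteq> cspan (?A w)"
    proof
      fix x assume x: "x \<in> M \<inter> eig p w"
      have wW: "w \<in> cnj ` Omega p" using w U(3) DW by blast
      obtain B where B: "finite B" "card B = disk_zeros (slice p (cnj w))" "cspan B = eig p w"
        by (rule eig_basis[OF p cnj_Omega(1)[OF p wW]], rule that, assumption+)
      have cB: "card B = r + r'" using B(2) cdim[OF w] cdim_eig[OF p cnj_Omega(1)[OF p wW]] by simp
      have "x \<in> cspan (?A w \<union> ?A' w)"
      proof (rule ccontr)
        assume nx: "x \<notin> cspan (?A w \<union> ?A' w)"
        then have "\<not> cdependent (insert x (?A w \<union> ?A' w))"
          using complex_vector.independent_insertI ind(1)[OF w] by blast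
        moreover have "insert x (?A w \<union> ?A' w) \<subseteq> cspan B"
          unfolding B(3) using x A(1)[OF w] A'(1)[OF w] by auto
        ultimately have "card (insert x (?A w \<union> ?A' w)) \<le> card B"
          using complex_vector.independent_span_bound[OF B(1)] by blast
        moreover have "x \<notin> ?A w \<union> ?A' w" using nx complex_vector.span_base by (rule contrapos_nn)
        then have "card (insert x (?A w \<union> ?A' w)) = Suc (card (?A w \<union> ?A' w))"
          by (intro card_insert_disjoint) simp_all
        ultimately show False using ind(2)[OF w] cB by linarith
      qed
      then obtain a b where ab: "a \<in> cspan (?A w)" "b \<in> cspan (?A' w)" "x = a + b"
        unfolding complex_vector.span_Un by blast
      have "a \<in> M"
        by (rule subsetD[OF complex_vector.span_minimal[OF _ sM] ab(1)]) (use A(1)[OF w] in blast)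
      then have "x - a \<in> M" using x csubspace_diff[OF sM] by blast
      then have "b \<in> M" using ab(3) by simp
      moreover have "b \<in> N"
        by (rule subsetD[OF complex_vector.span_minimal[OF _ sN] ab(2)]) (use A'(1)[OF w] in blast)
      ultimately have "b = 0" by (rule reducing_pair_Int[OF rp])
      then show "x \<in> cspan (?A w)" using ab by simp
    qed
  qed
  have holU: "vholomorphic_on (s i) U" if i: "i < r" for i
    unfolding vholomorphic_on_def
  proof
    fix w assume "w \<in> U"
    then obtain d where "(s i has_derivative (\<lambda>h. h *\<^sub>C d)) (at w within ball w0 \<delta>)"
      using hol[OF i] U(4) unfolding vholomorphic_on_def by blast
    then have "(s i has_derivative (\<lambda>h. h *\<^sub>C d)) (at w within U)"
      by (rule has_derivative_subset) (rule U(4))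
    then show "\<exists>d. (s i has_derivative (\<lambda>h. h *\<^sub>C d)) (at w within U)" by blast
  qed
  show ?thesis
    by (rule exI[of _ r], rule exI[of _ U], rule exI[of _ s])
      (intro conjI allI impI ballI U(1-3) holU A(2,3) span)
qed

lemma fibre_Sigma: "w \<in> D \<Longrightarrow> fibre (Sigma D A) w = A w"
  by (rule set_eqI) (simp add: Image_singleton_iff)

text \<open>The local frames come with ranks of their own; each rank is the dimension of the fibre,
  which is locally constant and therefore constant on the connected component.\<close>

lemma reducing_pair_subbundle:
  assumes p: "no_univariate_factors p" and rp: "reducing_pair p M N" and D: "D \<in> components (cnj ` Omega p)"
  shows "holomorphic_subbundle D (SIGMA w:D. M \<inter> eig p w) (kernel_bundle (quotient_module p) (S_z_adj p) D)"
proof -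
  define fr where "fr r U s \<longleftrightarrow> (\<forall>i<r. vholomorphic_on (s i) U) \<and>
    (\<forall>w\<in>U. inj_on (\<lambda>i. s i w) {..<r} \<and> \<not> cdependent ((\<lambda>i. s i w) ` {..<r}) \<and>
      cspan ((\<lambda>i. s i w) ` {..<r}) = M \<inter> eig p w)" for r :: nat and U and s :: "nat \<Rightarrow> complex \<Rightarrow> hardy2"
  have ex: "\<exists>r U s. open U \<and> w0 \<in> U \<and> U \<subseteq> D \<and> fr r U s" if "w0 \<in> D" for w0
    unfolding fr_def by (rule local_frame[OF p rp D that])
  have rank: "cdim (M \<inter> eig p w) = r" if fr: "fr r U s" and w: "w \<in> U" for r U w s
  proof -
    let ?A = "(\<lambda>i. s i w) ` {..<r}"
    note A = bspec[OF fr[unfolded fr_def, THEN conjunct2] w]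
    have "cspan ?A = cspan (M \<inter> eig p w)"
      unfolding A[THEN conjunct2, THEN conjunct2, symmetric] by (simp only: complex_vector.span_span)
    then have "cdim (M \<inter> eig p w) = card ?A"
      by (rule complex_vector.dim_eq_card[OF _ A[THEN conjunct2, THEN conjunct1]])
    then show ?thesis using card_image[OF A[THEN conjunct1]] by simp
  qed
  obtain w1 where w1: "w1 \<in> D" using in_components_nonempty[OF D] by blast
  define r where "r = cdim (M \<inter> eig p w1)"
  have const: "cdim (M \<inter> eig p w) = r" if w: "w \<in> D" for w
    unfolding r_def
  proof (rule connected_local_const[OF in_components_connected[OF D] w w1])
    show "\<forall>a\<in>D. eventually (\<lambda>b. cdim (M \<inter> eig p a) = cdim (M \<inter> eig p b)) (at a within D)"
    proof
      fix a assume "a \<in> D"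
      then obtain r U s where U: "open U" "a \<in> U" and fr: "fr r U s" using ex by blast
      have "cdim (M \<inter> eig p a) = cdim (M \<inter> eig p b)" if "b \<in> U" for b
        by (simp only: rank[OF fr U(2)] rank[OF fr that])
      then show "eventually (\<lambda>b. cdim (M \<inter> eig p a) = cdim (M \<inter> eig p b)) (at a within D)"
        unfolding eventually_at_topological by (intro exI[of _ U]) (simp add: U)
    qed
  qed
  have "\<exists>U s. open U \<and> w0 \<in> U \<and> U \<subseteq> D \<and> (\<forall>i<r. vholomorphic_on (s i) U) \<and>
      (\<forall>w\<in>U. inj_on (\<lambda>i. s i w) {..<r} \<and> \<not> cdependent ((\<lambda>i. s i w) ` {..<r}) \<and>
        cspan ((\<lambda>i. s i w) ` {..<r}) = fibre (SIGMA w:D. M \<inter> eig p w) w)" if w0: "w0 \<in> D" for w0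
  proof -
    obtain r' U s where U: "open U" "w0 \<in> U" "U \<subseteq> D" and fr': "fr r' U s" using ex[OF w0] by blast
    have "r' = r" using rank[OF fr' U(2)] const[OF w0] by simp
    then have fr: "fr r U s" using fr' by simp
    note fr = fr[unfolded fr_def]
    have f: "fibre (SIGMA w:D. M \<inter> eig p w) w = M \<inter> eig p w" if "w \<in> U" for w
      by (rule fibre_Sigma) (rule subsetD[OF U(3) that])
    show ?thesis
    proof (rule exI[of _ U], rule exI[of _ s], intro conjI ballI U fr[THEN conjunct1])
      fix w assume w: "w \<in> U"
      note A = bspec[OF fr[THEN conjunct2] w]
      show "inj_on (\<lambda>i. s i w) {..<r}" by (rule A[THEN conjunct1])
      show "\<not> cdependent ((\<lambda>i. s i w) ` {..<r})" by (rule A[THEN conjunct2, THEN conjunct1])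
      show "cspan ((\<lambda>i. s i w) ` {..<r}) = fibre (SIGMA w:D. M \<inter> eig p w) w"
        unfolding f[OF w] by (rule A[THEN conjunct2, THEN conjunct2])
    qed
  qed
  then have "\<exists>r :: nat. \<forall>w0\<in>D. \<exists>U s. open U \<and> w0 \<in> U \<and> U \<subseteq> D \<and> (\<forall>i<r. vholomorphic_on (s i) U) \<and>
      (\<forall>w\<in>U. inj_on (\<lambda>i. s i w) {..<r} \<and> \<not> cdependent ((\<lambda>i. s i w) ` {..<r}) \<and>
        cspan ((\<lambda>i. s i w) ` {..<r}) = fibre (SIGMA w:D. M \<inter> eig p w) w)"
    by (intro exI[of _ r] ballI)
  moreover have "(SIGMA w:D. M \<inter> eig p w) \<subseteq> (SIGMA w:D. eig p w)" by (intro Sigma_mono Int_lower2 subset_refl)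
  ultimately show ?thesis unfolding holomorphic_subbundle_def kernel_bundle_def by (intro conjI)
qed

lemma reducing_pair_decomposition:
  assumes p: "no_univariate_factors p" and rp: "reducing_pair p M N" and nz: "M \<noteq> {0}" "N \<noteq> {0}"
  shows "bundle_decomposition (quotient_module p) (S_z_adj p) (cnj ` Omega p)
    (\<lambda>D. SIGMA w:D. M \<inter> eig p w) (\<lambda>D. SIGMA w:D. N \<inter> eig p w)"
proof -
  let ?W = "cnj ` Omega p" and ?KB = "kernel_bundle (quotient_module p) (S_z_adj p)"
  \<comment> \<open>If all eigenspaces lay in \<open>N\<close>, totality would put the whole module
    into \<open>N\<close> and leave nothing for \<open>M\<close>. This makes both bundles nonzero
    and proper.\<close>
  have sub: "\<exists>w\<in>?W. \<not> eig p w \<subseteq> N" if rp: "reducing_pair p M N" and nz: "M \<noteq> {0}" for M N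
  proof (rule ccontr)
    assume "\<not> ?thesis"
    then have "(\<Union>w\<in>?W. eig p w) \<subseteq> N" by blast
    then have "closed_cspan (\<Union>w\<in>?W. eig p w) \<subseteq> N" by (intro closed_cspan_minimal reducing_pairD(2)[OF rp])
    then have "quotient_module p \<subseteq> N" by (simp only: eig_closed_cspan[OF p])
    then have "M \<subseteq> {0}" using reducing_pair_Int[OF rp] reducing_pairD(3)[OF rp] by blast
    moreover have "0 \<in> M" using reducing_pairD(1)[OF rp] csubspace_0 by (auto simp: closed_csubspace_def)
    ultimately show False using nz by blast
  qed
  have comp: "\<exists>D\<in>components ?W. w \<in> D" if "w \<in> ?W" for w
    using that Union_components[of ?W] by blast
  have E: "(\<forall>D\<in>components ?W. holomorphic_subbundle D (SIGMA w:D. M \<inter> eig p w) (?KB D)) \<and>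
      (\<exists>D\<in>components ?W. (SIGMA w:D. M \<inter> eig p w) \<noteq> D \<times> {0}) \<and>
      (\<exists>D\<in>components ?W. (SIGMA w:D. M \<inter> eig p w) \<noteq> ?KB D)"
    if rp: "reducing_pair p M N" and M: "M \<noteq> {0}" and N: "N \<noteq> {0}" for M N
  proof (intro conjI ballI)
    show "holomorphic_subbundle D (SIGMA w:D. M \<inter> eig p w) (?KB D)" if "D \<in> components ?W" for D
      by (rule reducing_pair_subbundle[OF p rp that])
    obtain w x where x: "w \<in> ?W" "x \<in> eig p w" "x \<notin> N" using sub[OF rp M] by blast
    obtain a b where ab: "a \<in> M \<inter> eig p w" "b \<in> N \<inter> eig p w" "x = a + b" using reducing_pair_split[OF rp x(2)] by blast
    then have "a \<noteq> 0" using x(3) by auto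
    obtain D where D: "D \<in> components ?W" "w \<in> D" using comp[OF x(1)] by blast
    have "(w, a) \<in> (SIGMA w:D. M \<inter> eig p w)" by (intro SigmaI D(2) ab(1))
    moreover have "(w, a) \<notin> D \<times> {0}" using \<open>a \<noteq> 0\<close> by simp
    ultimately have "(SIGMA w:D. M \<inter> eig p w) \<noteq> D \<times> {0}" by metis
    then show "\<exists>D\<in>components ?W. (SIGMA w:D. M \<inter> eig p w) \<noteq> D \<times> {0}" by (rule bexI[OF _ D(1)])
    obtain w x where x: "w \<in> ?W" "x \<in> eig p w" "x \<notin> M" using sub[OF reducing_pair_sym[OF rp] N] by blast
    obtain D where D: "D \<in> components ?W" "w \<in> D" using comp[OF x(1)] by blast
    have "(w, x) \<in> ?KB D" unfolding kernel_bundle_def by (intro SigmaI D(2) x(2))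
    moreover have "(w, x) \<notin> (SIGMA w:D. M \<inter> eig p w)" using x(3) by blast
    ultimately have "(SIGMA w:D. M \<inter> eig p w) \<noteq> ?KB D" by metis
    then show "\<exists>D\<in>components ?W. (SIGMA w:D. M \<inter> eig p w) \<noteq> ?KB D" by (rule bexI[OF _ D(1)])
  qed
  have cl: "closed_cspan (\<Union>w\<in>D. fibre (SIGMA w:D. M \<inter> eig p w) w) \<subseteq> M" if rp: "reducing_pair p M N" for M N D
    by (intro closed_cspan_minimal reducing_pairD(1)[OF rp]) auto
  show ?thesis
    unfolding bundle_decomposition_def
  proof (intro conjI)
    show "\<forall>E\<in>{\<lambda>D. SIGMA w:D. M \<inter> eig p w, \<lambda>D. SIGMA w:D. N \<inter> eig p w}.
      (\<forall>C\<in>components ?W. holomorphic_subbundle C (E C) (?KB C)) \<and>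
      (\<exists>C\<in>components ?W. E C \<noteq> C \<times> {0}) \<and> (\<exists>C\<in>components ?W. E C \<noteq> ?KB C)"
      using E[OF rp nz] E[OF reducing_pair_sym[OF rp] nz(2,1)] by simp
    show "\<forall>C\<in>components ?W. \<forall>w\<in>C.
      fibre (SIGMA w:C. M \<inter> eig p w) w \<inter> fibre (SIGMA w:C. N \<inter> eig p w) w = {0} \<and>
      {x + y | x y. x \<in> fibre (SIGMA w:C. M \<inter> eig p w) w \<and> y \<in> fibre (SIGMA w:C. N \<inter> eig p w) w} = fibre (?KB C) w"
    proof (intro ballI conjI)
      fix C :: "complex set" and w assume w: "w \<in> C"
      have sM: "csubspace M" and sN: "csubspace N" using reducing_pairD(1-4)[OF rp] by (auto simp: closed_csubspace_def)
      note f = fibre_Sigma[OF w]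
      show "fibre (SIGMA w:C. M \<inter> eig p w) w \<inter> fibre (SIGMA w:C. N \<inter> eig p w) w = {0}"
        unfolding f using reducing_pair_Int[OF rp] csubspace_0[OF sM] csubspace_0[OF sN] csubspace_0[OF csubspace_eig] by blast
      show "{x + y | x y. x \<in> fibre (SIGMA w:C. M \<inter> eig p w) w \<and> y \<in> fibre (SIGMA w:C. N \<inter> eig p w) w} = fibre (?KB C) w"
        unfolding kernel_bundle_def f
      proof
        show "{x + y | x y. x \<in> M \<inter> eig p w \<and> y \<in> N \<inter> eig p w} \<subseteq> eig p w"
          using csubspace_add[OF csubspace_eig[of p w]] by blast
        show "eig p w \<subseteq> {x + y | x y. x \<in> M \<inter> eig p w \<and> y \<in> N \<inter> eig p w}"
          using reducing_pair_split[OF rp, of _ w] by blast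
      qed
    qed
    show "\<forall>C\<in>components ?W. \<forall>C'\<in>components ?W.
      \<forall>x\<in>closed_cspan (\<Union>w\<in>C. fibre (SIGMA w:C. M \<inter> eig p w) w).
      \<forall>y\<in>closed_cspan (\<Union>w\<in>C'. fibre (SIGMA w:C'. N \<inter> eig p w) w). cinner x y = 0"
    proof (intro ballI)
      fix C C' :: "complex set" and x y
      assume "x \<in> closed_cspan (\<Union>w\<in>C. fibre (SIGMA w:C. M \<inter> eig p w) w)"
        and "y \<in> closed_cspan (\<Union>w\<in>C'. fibre (SIGMA w:C'. N \<inter> eig p w) w)"
      then have "x \<in> M" "y \<in> N" using cl[OF rp] cl[OF reducing_pair_sym[OF rp]] by blast+
      then show "cinner x y = 0" by (rule reducing_pairD(5)[OF rp])
    qed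
  qed
qed

theorem theorem5p4:
  fixes p :: "complex poly poly"
  assumes "no_univariate_factors p"
    and "\<And>q. irreducible q \<Longrightarrow> q dvd p \<Longrightarrow> zero_set q \<inter> bidisk \<noteq> {}"
  shows "(\<exists>\<alpha>. (\<forall>C\<in>components (Omega p). \<forall>z\<in>C. \<alpha> (cnj ` C) = disk_zeros (slice p z)) \<and>
        cowen_douglas (quotient_module p) (cnj ` Omega p) \<alpha> (adjoint_on (quotient_module p) (S_z p)))
    \<and> (reducible_op (quotient_module p) (S_z p) \<longleftrightarrow>
        strictly_reducible_bundle (quotient_module p) (adjoint_on (quotient_module p) (S_z p))
          (cnj ` Omega p))"
proof (intro conjI iffI)
  note p = assms(1)
  show "\<exists>\<alpha>. (\<forall>C\<in>components (Omega p). \<forall>z\<in>C. \<alpha> (cnj ` C) = disk_zeros (slice p z)) \<and>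
      cowen_douglas (quotient_module p) (cnj ` Omega p) \<alpha> (S_z_adj p)"
    by (rule cowen_douglas_S_z_adj[OF p])
  show "strictly_reducible_bundle (quotient_module p) (S_z_adj p) (cnj ` Omega p)"
    if red: "reducible_op (quotient_module p) (S_z p)"
    unfolding strictly_reducible_bundle_def reducible_bundle_def
  proof (intro conjI allI impI ballI)
    obtain M N where MN: "reducing_pair p M N" "M \<noteq> {0}" "N \<noteq> {0}"
      using reducible_op_imp_reducing_pair[OF red] by blast
    show "\<exists>E1 E2. bundle_decomposition (quotient_module p) (S_z_adj p) (cnj ` Omega p) E1 E2"
      by (intro exI) (rule reducing_pair_decomposition[OF p MN])
    fix E1 E2 C
    assume "bundle_decomposition (quotient_module p) (S_z_adj p) (cnj ` Omega p) E1 E2"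
      and "C \<in> components (cnj ` Omega p)"
    note strict = bundle_decomposition_strict[OF p this]
    show "E1 C \<noteq> C \<times> {0}" "E1 C \<noteq> kernel_bundle (quotient_module p) (S_z_adj p) C"
      by (rule strict[THEN conjunct1], rule strict[THEN conjunct2])
  qed
  show "reducible_op (quotient_module p) (S_z p)"
    if "strictly_reducible_bundle (quotient_module p) (S_z_adj p) (cnj ` Omega p)"
    using that bundle_decomposition_imp_reducible_op[OF p]
    unfolding strictly_reducible_bundle_def reducible_bundle_def by (elim conjE exE)
qed

end
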